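(* Let $\Sigma$ be a sofic approximation to $G$. For any $G$-system $(X,\mu,T)$, $$\mathrm h^{\mathrm{dq}}_\Sigma(\mu^{\times k},T^{\times k})=k\cdot\mathrm h^{\mathrm{dq}}_\Sigma(\mu,T)\quad\text{for all } k\ge1.$$
   Context: $G$ is a countable discrete sofic group. A sofic approximation $\Sigma=(\sigma_n)_{n\ge1}$ to $G$ is a sequence of nonempty finite sets $V_n$ and maps $\sigma_n:G\to\mathrm{Sym}(V_n)$, $g\mapsto\sigma_n^g$ (not necessarily homomorphisms), such that for all $g,h\in G$ the proportion of $v\in V_n$ with $\sigma_n^g(\sigma_n^h(v))=\sigma_n^{gh}(v)$ tends to $1$, and for all $g\ne e$ the proportion of $v\in V_n$ with $\sigma_n^g(v)\neq v$ tends to $1$. A $G$-system $(X,\mu,T)$ is a standard probability space with a measurable $\mu$-preserving action $T$ of $G$; $(X^k,\mu^{\times k},T^{\times k})$ is its $k$-fold Cartesian power with diagonal action. A metric $G$-process $(\mathcal{X}^G,\mu,S,d)$ consists of a standard measurable space $\mathcal{X}$, a compact metric $d$ on $\mathcal X$ whose Borel $\sigma$-algebra is that of $\mathcal X$, the right-shift action $S^g((x_h)_{h})=(x_{hg})_{h}$, and an $S$-invariant probability measure $\mu$ on $\mathcal{X}^G$. $\mathcal{X}^G$ has the product topology from $d$, and $\mathrm{Prob}(\mathcal X^G)$ the resulting weak$^\ast$ topology. For a finite set $V$, a map $\sigma:G\to\mathrm{Sym}(V)$, $\mathbf{x}\in\mathcal{X}^V$, $v\in V$: $\Pi^\sigma_v(\mathbf{x})=(x_{\sigma^g(v)})_{g\in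 G}\in\mathcal{X}^G$; $P^\sigma_{\mathbf x}=\frac1{|V|}\sum_{v}\delta_{\Pi^\sigma_v(\mathbf x)}$; $\Omega(\mathcal O,\sigma)=\{\mathbf x\in\mathcal X^V: P^\sigma_{\mathbf x}\in\mathcal O\}$ for $\mathcal{O}\subseteq\mathrm{Prob}(\mathcal X^G)$; $d^{(V)}(\mathbf x,\mathbf x')=\frac1{|V|}\sum_v d(x_v,x'_v)$. For a Borel probability $\nu$ on a metric space $(Y,d_Y)$, $\mathrm{cov}_{\varepsilon,\delta}(\nu,d_Y)=\min\{|F|: F\subseteq Y,\ \nu(B_\delta(F))>1-\varepsilon\}$, with $B_\delta(F)$ the $\delta$-neighbourhood of $F$. A sequence $\mu_i\in\mathrm{Prob}(\mathcal X^{V_{n_i}})$ quenched converges to $\mu$ over $(\sigma_{n_i})_{i\ge1}$ if for every weak$^\ast$ neighbourhood $\mathcal O$ of $\mu$ the proportion of $v\in V_{n_i}$ with $(\Pi^{\sigma_{n_i}}_v)_\ast\mu_i\in\mathcal O$ tends to $1$ and $\mu_i(\Omega(\mathcal O,\sigma_{n_i}))\to1$. It doubly-quenched converges to $\mu$ if $\mu_i\times\mu_i\in\mathrm{Prob}((\mathcal X\times\mathcal X)^{V_{n_i}})$ quenched converges to $\mu\times\mu$ (on $(\mathcal X\times\mathcal X)^G$, with the average of the two copies of $d$). Then $$\mathrm h^{\mathrm{dq}}_\Sigma(\mu)=\sup\Big\{\sup_{\delta,\varepsilon>0}\limsup_{i\to\infty}\tfrac1{|V_{n_i}|}\log\mathrm{cov}_{\varepsilon,\delta}(\mu_i,d^{(V_{n_i})})\Big\},$$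 the outer supremum being over all subsequences $n_i\uparrow\infty$ and all sequences $(\mu_i)$ doubly-quenched converging to $\mu$ over $(\sigma_{n_i})_{i\ge1}$ (and $\sup\emptyset=-\infty$). This quantity does not depend on $d$ and is an isomorphism invariant of the underlying system. Every $G$-system is isomorphic to a $G$-process (via $x\mapsto(T^hx)_{h\in G}\in X^G$), and $\mathrm h^{\mathrm{dq}}_\Sigma(\mu,T)$ is defined as the value for any isomorphic metric $G$-process. *)

theory Defs
  imports "HOL-Probability.Probability" "HOL-Combinatorics.Permutations"
begin

text \<open>
  The countable discrete group is a type of class group_add and countable: it is written
  additively, but group_add does not assume commutativity, so \<open>g + h\<close> stands for the product
  \<open>gh\<close> (in this order), \<open>0\<close> for the identity.  A point of \<open>X\<^sup>V\<close> is an extensional function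
  in \<open>PiE V (\<lambda>_. X)\<close>.
\<close>

definition sofic_approximation ::
    "(nat \<Rightarrow> 'v set) \<Rightarrow> (nat \<Rightarrow> 'g::{group_add,countable} \<Rightarrow> 'v \<Rightarrow> 'v) \<Rightarrow> bool" where
  "sofic_approximation V \<sigma> \<longleftrightarrow>
     (\<forall>n. finite (V n) \<and> V n \<noteq> {} \<and> (\<forall>g. \<sigma> n g permutes V n)) \<and>
     (\<forall>g h. (\<lambda>n. real (card {v \<in> V n. \<sigma> n g (\<sigma> n h v) = \<sigma> n (g + h) v}) / real (card (V n)))
              \<longlonglongrightarrow> 1) \<and>
     (\<forall>g. g \<noteq> 0 \<longrightarrow>
        (\<lambda>n. real (card {v \<in> V n. \<sigma> n g v \<noteq> v}) / real (card (V n))) \<longlonglongrightarrow> 1)"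

definition topological_borel :: "'x topology \<Rightarrow> 'x measure" where
  "topological_borel \<tau> = sigma (topspace \<tau>) {U. openin \<tau> U}"

definition standard_measurable_space :: "'a measure \<Rightarrow> bool" where
  "standard_measurable_space M \<longleftrightarrow>
     (\<exists>\<tau>. completely_metrizable_space \<tau> \<and> second_countable \<tau> \<and>
          space M = topspace \<tau> \<and> sets M = sets (topological_borel \<tau>))"

definition G_action :: "'a measure \<Rightarrow> ('g::group_add \<Rightarrow> 'a \<Rightarrow> 'a) \<Rightarrow> bool" where
  "G_action M T \<longleftrightarrow>
     (\<forall>g. T g \<in> measurable M M \<and> distr M M (T g) = M) \<and>
     (\<forall>x\<in>space M. T 0 x = x) \<and>
     (\<forall>g h. \<forall>x\<in>space M. T (g + h) x = T g (T h x))"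

definition G_system :: "'a measure \<Rightarrow> ('g::{group_add,countable} \<Rightarrow> 'a \<Rightarrow> 'a) \<Rightarrow> bool" where
  "G_system M T \<longleftrightarrow> prob_space M \<and> standard_measurable_space M \<and> G_action M T"

text \<open>
  Isomorphism modulo null sets.  A map defined on a conull set may be extended measurably to the
  whole space, so \<open>\<phi>\<close> and its almost-everywhere inverse \<open>\<psi>\<close> are taken everywhere defined.
\<close>

definition system_isomorphic ::
    "'a measure \<Rightarrow> ('g \<Rightarrow> 'a \<Rightarrow> 'a) \<Rightarrow> 'b measure \<Rightarrow> ('g \<Rightarrow> 'b \<Rightarrow> 'b) \<Rightarrow> bool" where
  "system_isomorphic M T N S \<longleftrightarrow>
     (\<exists>\<phi> \<psi>. \<phi> \<in> measurable M N \<and> \<psi> \<in> measurable N M \<and>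
        distr M N \<phi> = N \<and> distr N M \<psi> = M \<and>
        (AE x in M. \<psi> (\<phi> x) = x) \<and> (AE y in N. \<phi> (\<psi> y) = y) \<and>
        (\<forall>g. AE x in M. \<phi> (T g x) = S g (\<phi> x)))"

definition power_measure :: "nat \<Rightarrow> 'a measure \<Rightarrow> (nat \<Rightarrow> 'a) measure" where
  "power_measure k M = PiM {..<k} (\<lambda>_. M)"

definition power_action :: "nat \<Rightarrow> ('g \<Rightarrow> 'a \<Rightarrow> 'a) \<Rightarrow> 'g \<Rightarrow> (nat \<Rightarrow> 'a) \<Rightarrow> (nat \<Rightarrow> 'a)" where
  "power_action k T g x = (\<lambda>i\<in>{..<k}. T g (x i))"

text \<open>
  The alphabet with its compact metric is an element \<open>D\<close> of the library type of metric spaces;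
  its measurable structure is determined by \<open>D\<close>.
\<close>

definition metric_borel :: "'x metric \<Rightarrow> 'x measure" where
  "metric_borel D = topological_borel (mtopology_of D)"

definition seq_space :: "'x metric \<Rightarrow> ('g \<Rightarrow> 'x) measure" where
  "seq_space D = PiM UNIV (\<lambda>_. metric_borel D)"

definition seq_topology :: "'x metric \<Rightarrow> ('g \<Rightarrow> 'x) topology" where
  "seq_topology D = product_topology (\<lambda>_. mtopology_of D) UNIV"

definition shift :: "'g::group_add \<Rightarrow> ('g \<Rightarrow> 'x) \<Rightarrow> ('g \<Rightarrow> 'x)" where
  "shift g x = (\<lambda>h. x (h + g))"

definition Prob :: "'a measure \<Rightarrow> 'a measure set" where
  "Prob M = {\<nu>. prob_space \<nu> \<and> sets \<nu> = sets M}"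

definition metric_process ::
    "'x metric \<Rightarrow> ('g::{group_add,countable} \<Rightarrow> 'x) measure \<Rightarrow> bool" where
  "metric_process D \<mu> \<longleftrightarrow>
     compact_space (mtopology_of D) \<and> \<mu> \<in> Prob (seq_space D) \<and>
     (\<forall>g. distr \<mu> \<mu> (shift g) = \<mu>)"

definition weak_star :: "'x metric \<Rightarrow> ('g::countable \<Rightarrow> 'x) measure topology" where
  "weak_star D = topology_generated_by
     {{\<nu> \<in> Prob (seq_space D). integral\<^sup>L \<nu> f \<in> U} | f U.
        continuous_map (seq_topology D) euclideanreal f \<and> open U}"

definition pullback_name :: "('g \<Rightarrow> 'v \<Rightarrow> 'v) \<Rightarrow> 'v \<Rightarrow> ('v \<Rightarrow> 'x) \<Rightarrow> ('g \<Rightarrow> 'x)" where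
  "pullback_name s v x = (\<lambda>g. x (s g v))"

definition empirical ::
    "'x metric \<Rightarrow> 'v set \<Rightarrow> ('g \<Rightarrow> 'v \<Rightarrow> 'v) \<Rightarrow> ('v \<Rightarrow> 'x) \<Rightarrow> ('g \<Rightarrow> 'x) measure" where
  "empirical D W s x =
     distr (uniform_count_measure W) (seq_space D) (\<lambda>v. pullback_name s v x)"

definition good_models ::
    "'x metric \<Rightarrow> 'v set \<Rightarrow> ('g \<Rightarrow> 'v \<Rightarrow> 'v) \<Rightarrow> ('g \<Rightarrow> 'x) measure set \<Rightarrow> ('v \<Rightarrow> 'x) set" where
  "good_models D W s U = {x \<in> PiE W (\<lambda>_. mspace D). empirical D W s x \<in> U}"

definition model_space :: "'x metric \<Rightarrow> 'v set \<Rightarrow> ('v \<Rightarrow> 'x) measure" where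
  "model_space D W = PiM W (\<lambda>_. metric_borel D)"

definition hamming :: "'x metric \<Rightarrow> 'v set \<Rightarrow> ('v \<Rightarrow> 'x) \<Rightarrow> ('v \<Rightarrow> 'x) \<Rightarrow> real" where
  "hamming D W x y = (\<Sum>v\<in>W. mdist D (x v) (y v)) / real (card W)"

text \<open>
  The value is \<open>\<infinity>\<close> if no finite set qualifies (impossible for totally bounded spaces), and 0 only
  if \<open>\<epsilon> > 1\<close>; the latter contributes \<open>-\<infinity>\<close> to the entropy and is irrelevant for the supremum.
\<close>

definition cov :: "real \<Rightarrow> real \<Rightarrow> 'y measure \<Rightarrow> ('y \<Rightarrow> 'y \<Rightarrow> real) \<Rightarrow> enat" where
  "cov \<epsilon> \<delta> \<nu> dY =
     Inf {enat (card F) | F. finite F \<and> F \<subseteq> space \<nu> \<and>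
            measure \<nu> {y \<in> space \<nu>. \<exists>x\<in>F. dY x y < \<delta>} > 1 - \<epsilon>}"

fun log_enat :: "enat \<Rightarrow> ereal" where
  "log_enat \<infinity> = \<infinity>"
| "log_enat (enat n) = (if n = 0 then -\<infinity> else ereal (ln (real n)))"

text \<open>
  Open neighbourhoods suffice (the conditions are monotone in the neighbourhood), and for them
  the set of good models is measurable.
\<close>

definition quenched_converges ::
    "'x metric \<Rightarrow> (nat \<Rightarrow> 'v set) \<Rightarrow> (nat \<Rightarrow> 'g::countable \<Rightarrow> 'v \<Rightarrow> 'v) \<Rightarrow>
     (nat \<Rightarrow> ('v \<Rightarrow> 'x) measure) \<Rightarrow> ('g \<Rightarrow> 'x) measure \<Rightarrow> bool" where
  "quenched_converges D V \<sigma> m \<mu> \<longleftrightarrow>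
     (\<forall>U. openin (weak_star D) U \<and> \<mu> \<in> U \<longrightarrow>
        (\<lambda>i. real (card {v \<in> V i. distr (m i) (seq_space D) (pullback_name (\<sigma> i) v) \<in> U})
               / real (card (V i))) \<longlonglongrightarrow> 1 \<and>
        (\<lambda>i. measure (m i) (good_models D (V i) (\<sigma> i) U)) \<longlonglongrightarrow> 1)"

definition avg_dist :: "'x metric \<Rightarrow> 'x \<times> 'x \<Rightarrow> 'x \<times> 'x \<Rightarrow> real" where
  "avg_dist D p q = (mdist D (fst p) (fst q) + mdist D (snd p) (snd q)) / 2"

definition avg_metric :: "'x metric \<Rightarrow> ('x \<times> 'x) metric" where
  "avg_metric D = metric (mspace D \<times> mspace D, avg_dist D)"

lemma Metric_space_avg_dist: "Metric_space (mspace D \<times> mspace D) (avg_dist D)"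
proof
  fix p q r :: "'a \<times> 'a"
  show "0 \<le> avg_dist D p q" by (simp add: avg_dist_def)
  show "avg_dist D p q = avg_dist D q p" by (simp add: avg_dist_def mdist_commute)
  assume p: "p \<in> mspace D \<times> mspace D" and q: "q \<in> mspace D \<times> mspace D"
  have "avg_dist D p q = 0 \<longleftrightarrow> mdist D (fst p) (fst q) = 0 \<and> mdist D (snd p) (snd q) = 0"
    by (simp add: avg_dist_def add_nonneg_eq_0_iff)
  with p q show "avg_dist D p q = 0 \<longleftrightarrow> p = q" by (auto simp: prod_eq_iff mem_Times_iff)
  assume r: "r \<in> mspace D \<times> mspace D"
  show "avg_dist D p r \<le> avg_dist D p q + avg_dist D q r"
    using mdist_triangle[of "fst p" D "fst q" "fst r"] mdist_triangle[of "snd p" D "snd q" "snd r"]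
      p q r by (simp add: avg_dist_def mem_Times_iff field_simps)
qed

lemma mspace_avg_metric [simp]: "mspace (avg_metric D) = mspace D \<times> mspace D"
  and mdist_avg_metric [simp]: "mdist (avg_metric D) = avg_dist D"
  by (simp_all add: avg_metric_def Metric_space.mspace_metric Metric_space.mdist_metric
      Metric_space_avg_dist)

text \<open>
  \<open>\<nu> \<times> \<nu>\<close>, transported along the identification of \<open>X\<^sup>I \<times> X\<^sup>I\<close> with \<open>(X \<times> X)\<^sup>I\<close>.
\<close>

definition self_product ::
    "'x metric \<Rightarrow> 'i set \<Rightarrow> ('i \<Rightarrow> 'x) measure \<Rightarrow> ('i \<Rightarrow> 'x \<times> 'x) measure" where
  "self_product D I \<nu> =
     distr (\<nu> \<Otimes>\<^sub>M \<nu>) (PiM I (\<lambda>_. metric_borel (avg_metric D))) (\<lambda>(x, y). \<lambda>i\<in>I. (x i, y i))"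

definition dq_converges ::
    "'x metric \<Rightarrow> (nat \<Rightarrow> 'v set) \<Rightarrow> (nat \<Rightarrow> 'g::countable \<Rightarrow> 'v \<Rightarrow> 'v) \<Rightarrow>
     (nat \<Rightarrow> ('v \<Rightarrow> 'x) measure) \<Rightarrow> ('g \<Rightarrow> 'x) measure \<Rightarrow> bool" where
  "dq_converges D V \<sigma> m \<mu> \<longleftrightarrow>
     quenched_converges (avg_metric D) V \<sigma> (\<lambda>i. self_product D (V i) (m i))
       (self_product D UNIV \<mu>)"

definition hdq_process ::
    "(nat \<Rightarrow> 'v set) \<Rightarrow> (nat \<Rightarrow> 'g::{group_add,countable} \<Rightarrow> 'v \<Rightarrow> 'v) \<Rightarrow>
     'x metric \<Rightarrow> ('g \<Rightarrow> 'x) measure \<Rightarrow> ereal" where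
  "hdq_process V \<sigma> D \<mu> =
     Sup {(SUP \<delta>\<in>{0<..}. SUP \<epsilon>\<in>{0<..}.
             limsup (\<lambda>i. log_enat (cov \<epsilon> \<delta> (m i) (hamming D (V (r i)))) / ereal (real (card (V (r i))))))
          | r m. strict_mono r \<and> (\<forall>i. m i \<in> Prob (model_space D (V (r i)))) \<and>
                 dq_converges D (V \<circ> r) (\<sigma> \<circ> r) m \<mu>}"

text \<open>
  The entropy of a system is the common value for all isomorphic metric processes.  HOL cannot
  quantify over the type of the alphabet inside a definition, so the alphabets range over all
  compact metrics on all subsets of \<open>nat \<Rightarrow> real\<close>.  This loses nothing: by the next lemma every
  compact metric space is isometric to one of these.
\<close>

lemma compact_metric_isometric_copy:
  fixes D :: "'x metric"
  assumes "compact_space (mtopology_of D)"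
  shows "\<exists>(D' :: (nat \<Rightarrow> real) metric) f. bij_betw f (mspace D) (mspace D') \<and>
           (\<forall>x\<in>mspace D. \<forall>y\<in>mspace D. mdist D' (f x) (f y) = mdist D x y)"
proof -
  interpret X: Metric_space "mspace D" "mdist D" by simp
  have "X.mtotally_bounded (mspace D)"
    using assms X.compact_space_eq_mcomplete_mtotally_bounded by (simp add: mtopology_of_def)
  then have "\<forall>n::nat. \<exists>K. finite K \<and> K \<subseteq> mspace D \<and>
      mspace D \<subseteq> (\<Union>x\<in>K. X.mball x (inverse (real (Suc n))))"
    unfolding X.mtotally_bounded_def by simp
  then obtain K where K: "\<And>n. finite (K n)" "\<And>n. K n \<subseteq> mspace D"
      "\<And>n. mspace D \<subseteq> (\<Union>x\<in>K n. X.mball x (inverse (real (Suc n))))"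
    by metis
  define C where "C = (\<Union>n. K n)"
  have C: "countable C" "C \<subseteq> mspace D"
    using K by (auto simp: C_def intro: countable_finite)
  define f where "f x = (\<lambda>n. mdist D x (from_nat_into C n))" for x
  have inj: "inj_on f (mspace D)"
  proof (rule inj_onI, rule ccontr)
    fix x y assume x: "x \<in> mspace D" and y: "y \<in> mspace D" and eq: "f x = f y" and "x \<noteq> y"
    then have "mdist D x y / 2 > 0" by simp
    then obtain n where n: "inverse (real (Suc n)) < mdist D x y / 2"
      using reals_Archimedean by blast
    obtain z where z: "z \<in> K n" "x \<in> X.mball z (inverse (real (Suc n)))"
      using K(3)[of n] x by auto
    then have "z \<in> C" by (auto simp: C_def)
    then obtain j where j: "from_nat_into C j = z"
      using C(1) from_nat_into_surj by metis
    have "mdist D x z = mdist D y z"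
      using fun_cong[OF eq, of j] j by (simp add: f_def)
    moreover have "mdist D x z < inverse (real (Suc n))"
      using z by (simp add: X.commute)
    moreover have "mdist D x y \<le> mdist D x z + mdist D y z"
      using X.triangle[of x z y] x y z K(2) by (auto simp: X.commute)
    ultimately show False using n by linarith
  qed
  define g where "g = inv_into (mspace D) f"
  define e where "e p q = mdist D (g p) (g q)" for p q
  have gf: "g (f x) = x" if "x \<in> mspace D" for x
    using that inj by (simp add: g_def)
  have "Metric_space (f ` mspace D) e"
    by standard (auto simp: e_def gf X.commute intro: X.triangle)
  then have "mspace (metric (f ` mspace D, e)) = f ` mspace D" "mdist (metric (f ` mspace D, e)) = e"
    by (simp_all add: Metric_space.mspace_metric Metric_space.mdist_metric)
  then show ?thesis
    using inj by (intro exI[of _ "metric (f ` mspace D, e)"] exI[of _ f])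
      (auto simp: bij_betw_def e_def gf)
qed

definition hdq_system ::
    "(nat \<Rightarrow> 'v set) \<Rightarrow> (nat \<Rightarrow> 'g::{group_add,countable} \<Rightarrow> 'v \<Rightarrow> 'v) \<Rightarrow>
     'a measure \<Rightarrow> ('g \<Rightarrow> 'a \<Rightarrow> 'a) \<Rightarrow> ereal" where
  "hdq_system V \<sigma> M T =
     (THE h. \<exists>(D :: (nat \<Rightarrow> real) metric) \<mu>.
        metric_process D \<mu> \<and> system_isomorphic M T \<mu> shift \<and> h = hdq_process V \<sigma> D \<mu>)"

end

theory Submission
  imports Defs
begin

text \<open>
  The theorem becomes elementary once doubly quenched convergence is expressed without topology.
  Give the alphabet countably many functions \<open>q\<^sub>n\<close> into \<open>[0,1]\<close> that generate its measurable
  structure, and describe a name \<open>x\<close> by the numbers \<open>q\<^sub>n (x\<^sub>g)\<close>.  By the Weierstrass theorem, laws of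
  names are close if the means of finitely many monomials in these numbers are close.  Models \<open>\<mu>\<^sub>i\<close>
  converge to \<open>\<mu>\<close> in the doubly quenched sense if and only if for most pairs \<open>(v, w)\<close> of points of
  the model the names seen at \<open>v\<close> and at \<open>w\<close> are nearly independent with law \<open>\<mu>\<close> each, as tested
  on monomials (\<open>dq_converges_of_coords\<close>, \<open>dq_coords_of_converges\<close>).  One direction is the second
  moment method for the doubled models.  For the other, square the correlation of centred monomials
  at \<open>v\<close> and \<open>w\<close>: the average of the squares over all pairs is an integral over two
  independent copies that factors into an average over \<open>v\<close> and an average over \<open>w\<close>.  In the same
  way the metric \<open>d\<^bsup>(V)\<^esup>\<close> may be replaced by the pseudometrics of finitely many coordinates, so
  that the entropy of a process depends on coordinates only (\<open>hdq_process_eq_hdq_coords\<close>).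

  Invariance under isomorphism (\<open>hdq_coords_le_of_isomorphic\<close>) is proved in this form.  Applied to
  the names of a model, a measurable map that is nearly a polynomial in the coordinates gives a code.
  Better and better codes, chosen by a diagonal argument, carry good models of one process to good
  models of the other (\<open>coded_models_exist\<close>).  In the limit the original process is a
  function of the coded one, hence nearly a polynomial in its coordinates, so that coded models which
  are close come from models which are close, off a set of small measure, and covering numbers do not
  drop (\<open>decoded_cov_le\<close>).  In particular all processes isomorphic to a system have the same value.

  For the power (\<open>hdq_coords_power\<close>) the upper bound comes from the marginals: they converge to \<open>\<mu>\<close>,
  and products of their covers are covers (\<open>rate_power_le\<close>).  For the lower bound take \<open>k\<close> independent
  copies of one model.  These product models converge, because the independence of the names at \<open>v\<close>
  and \<open>w\<close> is inherited by products; this is the point at which double quenching is stronger than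
  quenching.  Their covering numbers are bounded below since a measure that has no small cover has a
  part of definite mass which is spread out, and spread-out parts multiply (\<open>cov_power_ge\<close>).  All
  constants disappear in the growth rate if \<open>|V|\<close> tends to infinity.  If it does not, then the pairs
  \<open>v = w\<close> are a positive proportion of all pairs, so that the process is deterministic and the rate
  vanishes (\<open>rate_le_0_of_bounded\<close>).  Using one and the same sequence of models \<open>k\<close> times avoids any
  difference between upper and lower growth rates.

  Finally a standard space is a Borel subset of the Hilbert cube (\<open>standard_cube_retract\<close>), so that
  every system and its powers are isomorphic to metric processes over the cube.
\<close>

section \<open>Averages, monomials and polynomials in the coordinates\<close>

definition avg :: "'v set \<Rightarrow> ('v \<Rightarrow> real) \<Rightarrow> real" where
  "avg W f = (\<Sum>v\<in>W. f v) / real (card W)"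

lemma avg_mono: "(\<And>v. v \<in> W \<Longrightarrow> f v \<le> g v) \<Longrightarrow> avg W f \<le> avg W g"
  by (simp add: avg_def divide_right_mono sum_mono)

lemma avg_nonneg: "(\<And>v. v \<in> W \<Longrightarrow> 0 \<le> f v) \<Longrightarrow> 0 \<le> avg W f"
  by (simp add: avg_def sum_nonneg)

lemma avg_cong: "(\<And>v. v \<in> W \<Longrightarrow> f v = g v) \<Longrightarrow> avg W f = avg W g"
  by (simp add: avg_def)

lemma avg_add: "avg W (\<lambda>v. f v + g v) = avg W f + avg W g"
  by (simp add: avg_def sum.distrib add_divide_distrib)

lemma avg_diff: "avg W (\<lambda>v. f v - g v) = avg W f - avg W g"
  by (simp add: avg_def sum_subtractf diff_divide_distrib)

lemma avg_cmult: "avg W (\<lambda>v. c * f v) = c * avg W f"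
  by (simp add: avg_def sum_distrib_left [symmetric])

lemma avg_multc: "avg W (\<lambda>v. f v * c) = avg W f * c"
  by (simp add: avg_def sum_distrib_right [symmetric])

lemma avg_const: "finite W \<Longrightarrow> W \<noteq> {} \<Longrightarrow> avg W (\<lambda>v. c) = c"
  by (simp add: avg_def)

lemma avg_abs: "\<bar>avg W f\<bar> \<le> avg W (\<lambda>v. \<bar>f v\<bar>)"
  by (simp add: avg_def abs_divide divide_right_mono sum_abs)

lemma avg_sum: "avg W (\<lambda>v. \<Sum>j\<in>J. f j v) = (\<Sum>j\<in>J. avg W (f j))"
proof -
  have "(\<Sum>v\<in>W. \<Sum>j\<in>J. f j v) = (\<Sum>j\<in>J. \<Sum>v\<in>W. f j v)" by (rule sum.swap)
  then show ?thesis by (simp add: avg_def sum_divide_distrib)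
qed

lemma avg_le_const: "finite W \<Longrightarrow> W \<noteq> {} \<Longrightarrow> (\<And>v. v \<in> W \<Longrightarrow> f v \<le> c) \<Longrightarrow> avg W f \<le> c"
  using avg_mono [of W f "\<lambda>_. c"] by (simp add: avg_const)

lemma avg_permutes: "p permutes W \<Longrightarrow> avg W (\<lambda>v. f (p v)) = avg W f"
  unfolding avg_def using sum.permute [of p W f] by (simp add: o_def)

lemma integral_avg:
  "(\<And>v. v \<in> W \<Longrightarrow> integrable m (f v)) \<Longrightarrow>
    (\<integral>x. avg W (\<lambda>v. f v x) \<partial>m) = avg W (\<lambda>v. \<integral>x. f v x \<partial>m)"
  unfolding avg_def by (simp add: Bochner_Integration.integral_sum)

lemma avg_mult_avg: "avg W f * avg W' g = avg W (\<lambda>v. avg W' (\<lambda>w. f v * g w))"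
  by (simp add: avg_cmult avg_multc)

definition monomial :: "'j list \<Rightarrow> ('j \<Rightarrow> real) \<Rightarrow> real" where
  "monomial L z = prod_list (map z L)"

lemma monomial_Nil [simp]: "monomial [] z = 1"
  and monomial_Cons [simp]: "monomial (j # L) z = z j * monomial L z"
  and monomial_append [simp]: "monomial (L @ L') z = monomial L z * monomial L' z"
  by (simp_all add: monomial_def)

lemma monomial_map: "monomial (map f L) z = monomial L (\<lambda>j. z (f j))"
  by (induction L) auto

lemma monomial_unit_interval:
  "(\<And>j. j \<in> set L \<Longrightarrow> 0 \<le> z j \<and> z j \<le> 1) \<Longrightarrow> 0 \<le> monomial L z \<and> monomial L z \<le> 1"
  by (induction L) (auto intro: mult_le_one)

lemma monomial_bound:
  assumes "\<And>j. j \<in> set L \<Longrightarrow> \<bar>z j\<bar> \<le> C"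
  shows "\<bar>monomial L z\<bar> \<le> C ^ length L"
  using assms
proof (induction L)
  case (Cons j L)
  then have "\<bar>monomial L z\<bar> \<le> C ^ length L" "\<bar>z j\<bar> \<le> C" by auto
  then show ?case by (auto simp: abs_mult intro!: mult_mono)
qed simp

text \<open>
  Telescoping: replace one factor at a time, the others being bounded by \<open>C\<close>.
\<close>

lemma monomial_diff:
  assumes "\<And>j. j \<in> set L \<Longrightarrow> \<bar>z j\<bar> \<le> C" "\<And>j. j \<in> set L \<Longrightarrow> \<bar>y j\<bar> \<le> C" "1 \<le> C"
  shows "\<bar>monomial L z - monomial L y\<bar> \<le> C ^ length L * (\<Sum>j\<leftarrow>L. \<bar>z j - y j\<bar>)"
  using assms(1,2)
proof (induction L)
  case (Cons j L)
  have IH: "\<bar>monomial L z - monomial L y\<bar> \<le> C ^ length L * (\<Sum>j\<leftarrow>L. \<bar>z j - y j\<bar>)"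
    and bz: "\<bar>monomial L z\<bar> \<le> C ^ length L" and y: "\<bar>y j\<bar> \<le> C"
    using Cons monomial_bound [of L z C] by auto
  have le: "C ^ length L \<le> C * C ^ length L"
    using assms(3) by (simp add: mult_le_cancel_right1)
  have "monomial (j # L) z - monomial (j # L) y =
      (z j - y j) * monomial L z + y j * (monomial L z - monomial L y)"
    by (simp add: algebra_simps)
  also have "\<bar>\<dots>\<bar> \<le> \<bar>z j - y j\<bar> * \<bar>monomial L z\<bar> + \<bar>y j\<bar> * \<bar>monomial L z - monomial L y\<bar>"
    by (metis abs_mult abs_triangle_ineq)
  also have "\<dots> \<le> \<bar>z j - y j\<bar> * (C * C ^ length L) + C * (C ^ length L * (\<Sum>j\<leftarrow>L. \<bar>z j - y j\<bar>))"
    using IH y assms(3) order_trans [OF bz le] by (intro add_mono mult_mono) auto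
  also have "\<dots> = C ^ length (j # L) * (\<Sum>j\<leftarrow>j # L. \<bar>z j - y j\<bar>)"
    by (simp add: algebra_simps)
  finally show ?case .
qed simp

text \<open>
  Polynomials in infinitely many variables are lists of coefficients and words of variables.  There
  is no normal form: only values are compared.
\<close>

definition pev :: "(real \<times> 'j list) list \<Rightarrow> ('j \<Rightarrow> real) \<Rightarrow> real" where
  "pev p z = (\<Sum>(c, L)\<leftarrow>p. c * monomial L z)"

definition pnorm :: "(real \<times> 'j list) list \<Rightarrow> real" where
  "pnorm p = (\<Sum>(c, L)\<leftarrow>p. \<bar>c\<bar>)"

definition psupp :: "(real \<times> 'j list) list \<Rightarrow> 'j set" where
  "psupp p = (\<Union>(c, L)\<in>set p. set L)"

lemma finite_psupp [simp]: "finite (psupp p)"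
  by (auto simp: psupp_def)

lemma pev_Nil [simp]: "pev [] z = 0"
  and pev_Cons [simp]: "pev ((c, L) # p) z = c * monomial L z + pev p z"
  and pev_append [simp]: "pev (p @ p') z = pev p z + pev p' z"
  by (simp_all add: pev_def)

lemma pnorm_simps [simp]: "pnorm [] = 0" "pnorm ((c, L) # p) = \<bar>c\<bar> + pnorm p"
  by (simp_all add: pnorm_def)

lemma pnorm_nonneg [simp]: "0 \<le> pnorm p"
  by (induction p) auto

lemma psupp_simps [simp]: "psupp [] = {}" "psupp ((c, L) # p) = set L \<union> psupp p"
  by (simp_all add: psupp_def)

definition pmul :: "(real \<times> 'j list) list \<Rightarrow> (real \<times> 'j list) list \<Rightarrow> (real \<times> 'j list) list" where
  "pmul p p' = [(c * c', L @ L'). (c, L) \<leftarrow> p, (c', L') \<leftarrow> p']"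

lemma pev_pmul: "pev (pmul p p') z = pev p z * pev p' z"
proof -
  have 1: "pev (map (\<lambda>(c', L'). (c * c', L @ L')) p') z = c * monomial L z * pev p' z" for c L
    by (induction p') (auto simp: algebra_simps)
  show ?thesis
  proof (induction p)
    case Nil then show ?case by (simp add: pmul_def)
  next
    case (Cons a p)
    obtain c L where a: "a = (c, L)" by (cases a)
    have "pmul (a # p) p' = map (\<lambda>(c', L'). (c * c', L @ L')) p' @ pmul p p'"
      by (simp add: pmul_def a)
    then have "pev (pmul (a # p) p') z = c * monomial L z * pev p' z + pev (pmul p p') z"
      by (simp only: pev_append 1)
    then show ?case using Cons by (simp add: a algebra_simps)
  qed
qed

definition pmap :: "('i \<Rightarrow> 'j) \<Rightarrow> (real \<times> 'i list) list \<Rightarrow> (real \<times> 'j list) list" where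
  "pmap f p = map (\<lambda>(c, L). (c, map f L)) p"

lemma pev_pmap: "pev (pmap f p) z = pev p (\<lambda>j. z (f j))"
  by (induction p) (auto simp: pmap_def monomial_map)

definition pscale :: "real \<Rightarrow> (real \<times> 'j list) list \<Rightarrow> (real \<times> 'j list) list" where
  "pscale a p = map (\<lambda>(c, L). (a * c, L)) p"

lemma pev_pscale: "pev (pscale a p) z = a * pev p z"
  by (induction p) (auto simp: pscale_def algebra_simps)

lemma pev_cong: "(\<And>j. j \<in> psupp p \<Longrightarrow> z j = y j) \<Longrightarrow> pev p z = pev p y"
proof (induction p)
  case (Cons a p)
  obtain c L where a: "a = (c, L)" by (cases a)
  have "monomial L z = monomial L y"
    using Cons.prems a by (auto simp: monomial_def intro!: arg_cong[of _ _ prod_list])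
  then show ?case using Cons a by auto
qed simp

lemma pev_bound:
  assumes "\<And>j. j \<in> psupp p \<Longrightarrow> 0 \<le> z j \<and> z j \<le> 1"
  shows "\<bar>pev p z\<bar> \<le> pnorm p"
  using assms
proof (induction p)
  case (Cons a p)
  obtain c L where a: "a = (c, L)" by (cases a)
  have m: "0 \<le> monomial L z \<and> monomial L z \<le> 1"
    using Cons.prems a by (intro monomial_unit_interval) auto
  then have "\<bar>c * monomial L z\<bar> \<le> \<bar>c\<bar>" by (simp add: abs_mult mult_left_le)
  then show ?case using Cons a by (auto intro: order_trans[OF abs_triangle_ineq] add_mono)
qed simp

lemma continuous_on_monomial [continuous_intros]: "continuous_on S (monomial L)"
proof (induction L)
  case (Cons j L)
  have "continuous_on S (\<lambda>z::'a \<Rightarrow> real. z j)"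
    by (rule continuous_on_subset [OF continuous_on_product_coordinates]) simp
  then show ?case using Cons by (auto intro!: continuous_intros)
qed simp

lemma continuous_on_pev: "continuous_on S (pev p)"
proof (induction p)
  case Nil
  have "pev [] = (\<lambda>z. 0)" by (simp add: fun_eq_iff)
  then show ?case by simp
next
  case (Cons a p)
  obtain c L where a: "a = (c, L)" by (cases a)
  have "pev (a # p) = (\<lambda>z. c * monomial L z + pev p z)" by (simp add: fun_eq_iff a)
  then show ?case using Cons by (auto intro!: continuous_intros)
qed

text \<open>
  Polynomials in the coordinates are an algebra that separates the points of the product.
\<close>

lemma Stone_Weierstrass_pev:
  fixes f :: "('j::countable \<Rightarrow> real) \<Rightarrow> real"
  assumes "compact S" "continuous_on S f" "0 < e"
  obtains p where "\<And>z. z \<in> S \<Longrightarrow> \<bar>f z - pev p z\<bar> < e"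
proof -
  interpret function_ring_on "range pev" S
  proof
    show "compact S" by fact
    show "continuous_on S f" if "f \<in> range pev" for f using that continuous_on_pev by auto
    show "(\<lambda>x. f x + g x) \<in> range pev" if fg: "f \<in> range pev" "g \<in> range pev"
      for f g :: "('j \<Rightarrow> real) \<Rightarrow> real"
    proof -
      obtain p p' where "f = pev p" "g = pev p'" using fg by auto
      then have "(\<lambda>x. f x + g x) = pev (p @ p')" by (simp add: fun_eq_iff)
      then show ?thesis by blast
    qed
    show "(\<lambda>x. f x * g x) \<in> range pev" if fg: "f \<in> range pev" "g \<in> range pev"
      for f g :: "('j \<Rightarrow> real) \<Rightarrow> real"
    proof -
      obtain p p' where "f = pev p" "g = pev p'" using fg by auto
      then have "(\<lambda>x. f x * g x) = pev (pmul p p')" by (simp add: fun_eq_iff pev_pmul)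
      then show ?thesis by blast
    qed
    show "(\<lambda>_. c) \<in> range pev" for c
    proof -
      have "(\<lambda>_. c) = pev [(c, [])]" by (simp add: fun_eq_iff)
      then show ?thesis by blast
    qed
    show "\<exists>f\<in>range pev. f x \<noteq> f y" if "x \<noteq> y" for x y :: "'j \<Rightarrow> real"
    proof -
      obtain j where j: "x j \<noteq> y j" using \<open>x \<noteq> y\<close> by auto
      then have "pev [(1, [j])] x \<noteq> pev [(1, [j])] y" by simp
      then show ?thesis by blast
    qed
  qed
  show ?thesis using Stone_Weierstrass_basic [OF assms(2,3)] that by blast
qed

definition unit_cube :: "('j \<Rightarrow> real) set" where
  "unit_cube = {z. \<forall>j. 0 \<le> z j \<and> z j \<le> 1}"

lemma unit_cubeD: "z \<in> unit_cube \<Longrightarrow> 0 \<le> z j \<and> z j \<le> 1"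
  by (simp add: unit_cube_def)

lemma compact_unit_cube: "compact (unit_cube :: ('j \<Rightarrow> real) set)"
proof -
  have "compactin (product_topology (\<lambda>_. euclidean) UNIV) (PiE (UNIV::'j set) (\<lambda>_. {0..1::real}))"
    by (subst compactin_PiE) auto
  moreover have "PiE (UNIV::'j set) (\<lambda>_. {0..1::real}) = unit_cube"
    by (auto simp: unit_cube_def PiE_def)
  ultimately show ?thesis by (simp add: euclidean_product_topology)
qed

definition cube_field :: "'w measure \<Rightarrow> ('w \<Rightarrow> 'j \<Rightarrow> real) \<Rightarrow> bool" where
  "cube_field M z \<longleftrightarrow> (\<forall>j. (\<lambda>x. z x j) \<in> borel_measurable M) \<and> (\<forall>x\<in>space M. z x \<in> unit_cube)"

lemma cube_fieldI:
  "(\<And>j. (\<lambda>x. z x j) \<in> borel_measurable M) \<Longrightarrow>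
   (\<And>x j. x \<in> space M \<Longrightarrow> 0 \<le> z x j \<and> z x j \<le> 1) \<Longrightarrow> cube_field M z"
  by (simp add: cube_field_def unit_cube_def)

lemma cube_field_range: "cube_field M z \<Longrightarrow> x \<in> space M \<Longrightarrow> 0 \<le> z x j \<and> z x j \<le> 1"
  by (auto simp: cube_field_def unit_cube_def)

lemma cube_field_monomial:
  assumes "cube_field M z"
  shows "(\<lambda>x. monomial L (z x)) \<in> borel_measurable M"
    and "x \<in> space M \<Longrightarrow> 0 \<le> monomial L (z x) \<and> monomial L (z x) \<le> 1"
proof -
  have [measurable]: "(\<lambda>x. z x j) \<in> borel_measurable M" for j
    using assms by (simp add: cube_field_def)
  show "(\<lambda>x. monomial L (z x)) \<in> borel_measurable M"
    by (induction L) simp_all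
  show "x \<in> space M \<Longrightarrow> 0 \<le> monomial L (z x) \<and> monomial L (z x) \<le> 1"
    using cube_field_range [OF assms] by (intro monomial_unit_interval) auto
qed

lemma cube_field_pev:
  assumes "cube_field M z"
  shows "(\<lambda>x. pev p (z x)) \<in> borel_measurable M"
    and "x \<in> space M \<Longrightarrow> \<bar>pev p (z x)\<bar> \<le> pnorm p"
proof -
  have [measurable]: "(\<lambda>x. monomial L (z x)) \<in> borel_measurable M" for L
    by (rule cube_field_monomial [OF assms])
  show "(\<lambda>x. pev p (z x)) \<in> borel_measurable M"
    by (induction p) auto
  show "x \<in> space M \<Longrightarrow> \<bar>pev p (z x)\<bar> \<le> pnorm p"
    using cube_field_range [OF assms] by (intro pev_bound) auto
qed

lemma (in prob_space) integrable_bounded: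
  fixes f :: "'a \<Rightarrow> real"
  assumes "f \<in> borel_measurable M" "\<And>x. x \<in> space M \<Longrightarrow> \<bar>f x\<bar> \<le> C"
  shows "integrable M f"
  by (rule integrable_const_bound [of _ C]) (use assms in auto)

lemma (in prob_space) integral_bounded:
  fixes f :: "'a \<Rightarrow> real"
  assumes f: "f \<in> borel_measurable M" "\<And>x. x \<in> space M \<Longrightarrow> \<bar>f x\<bar> \<le> C"
  shows "\<bar>\<integral>x. f x \<partial>M\<bar> \<le> C"
proof -
  have "\<bar>\<integral>x. f x \<partial>M\<bar> \<le> (\<integral>x. \<bar>f x\<bar> \<partial>M)" by (rule integral_abs_bound)
  also have "\<dots> \<le> (\<integral>x. C \<partial>M)"
    using f by (intro integral_mono) (auto intro!: integrable_bounded [OF f] integrable_abs)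
  finally show ?thesis by (simp add: prob_space)
qed

section \<open>Pairwise asymptotic independence\<close>

text \<open>
  The field \<open>z i v\<close> is the random name seen at \<open>v\<close> in the \<open>i\<close>-th model.  At most pairs \<open>(v, w)\<close> the
  joint law of two names approaches the law of two independent copies of \<open>Z\<close>.
\<close>

definition pair_converges ::
    "(nat \<Rightarrow> 'v set) \<Rightarrow> (nat \<Rightarrow> 'w measure) \<Rightarrow> (nat \<Rightarrow> 'v \<Rightarrow> 'w \<Rightarrow> 'j \<Rightarrow> real) \<Rightarrow>
     'u measure \<Rightarrow> ('u \<Rightarrow> 'j \<Rightarrow> real) \<Rightarrow> bool" where
  "pair_converges W m z P Z \<longleftrightarrow> (\<forall>L L'.
     (\<lambda>i. avg (W i) (\<lambda>v. avg (W i) (\<lambda>w.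
        \<bar>(\<integral>x. monomial L (z i v x) * monomial L' (z i w x) \<partial>m i)
         - (\<integral>y. monomial L (Z y) \<partial>P) * (\<integral>y. monomial L' (Z y) \<partial>P)\<bar>))) \<longlonglongrightarrow> 0)"

locale field_sequence =
  fixes W :: "nat \<Rightarrow> 'v set" and m :: "nat \<Rightarrow> 'w measure" and z :: "nat \<Rightarrow> 'v \<Rightarrow> 'w \<Rightarrow> 'j \<Rightarrow> real"
    and P :: "'u measure" and Z :: "'u \<Rightarrow> 'j \<Rightarrow> real"
  assumes fin: "finite (W i)" and nonempty: "W i \<noteq> {}"
    and prob_m: "prob_space (m i)" and prob_P: "prob_space P"
    and field: "v \<in> W i \<Longrightarrow> cube_field (m i) (z i v)" and field_limit: "cube_field P Z"
begin

lemma card_pos: "0 < real (card (W i))"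
  using fin nonempty by (simp add: card_gt_0_iff)

lemma integrable_pev:
  assumes "v \<in> W i"
  shows "integrable (m i) (\<lambda>x. pev p (z i v x))"
  using cube_field_pev [OF field [OF assms]] by (rule prob_space.integrable_bounded [OF prob_m])

lemma integrable_pev_mult:
  assumes "v \<in> W i" "w \<in> W i"
  shows "integrable (m i) (\<lambda>x. pev p (z i v x) * pev p' (z i w x))"
  by (rule prob_space.integrable_bounded [OF prob_m, where C = "pnorm p * pnorm p'"])
    (use cube_field_pev [OF field [OF assms(1)]] cube_field_pev [OF field [OF assms(2)]]
      in \<open>auto simp: abs_mult intro!: mult_mono\<close>)

lemma integrable_pev_limit: "integrable P (\<lambda>y. pev p (Z y))"
  using cube_field_pev [OF field_limit] by (rule prob_space.integrable_bounded [OF prob_P])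

definition discrepancy :: "(real \<times> 'j list) list \<Rightarrow> (real \<times> 'j list) list \<Rightarrow> nat \<Rightarrow> real" where
  "discrepancy p p' i = avg (W i) (\<lambda>v. avg (W i) (\<lambda>w.
        \<bar>(\<integral>x. pev p (z i v x) * pev p' (z i w x) \<partial>m i)
         - (\<integral>y. pev p (Z y) \<partial>P) * (\<integral>y. pev p' (Z y) \<partial>P)\<bar>))"

lemma discrepancy_nonneg: "0 \<le> discrepancy p p' i"
  by (auto simp: discrepancy_def intro!: avg_nonneg)

lemma discrepancy_Cons_left:
  "discrepancy ((c, L) # p) p' i \<le> \<bar>c\<bar> * discrepancy [(1, L)] p' i + discrepancy p p' i"
proof -
  have "discrepancy ((c, L) # p) p' i \<le> avg (W i) (\<lambda>v. avg (W i) (\<lambda>w.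
     \<bar>c\<bar> * \<bar>(\<integral>x. pev [(1, L)] (z i v x) * pev p' (z i w x) \<partial>m i)
         - (\<integral>y. pev [(1, L)] (Z y) \<partial>P) * (\<integral>y. pev p' (Z y) \<partial>P)\<bar> +
     \<bar>(\<integral>x. pev p (z i v x) * pev p' (z i w x) \<partial>m i)
         - (\<integral>y. pev p (Z y) \<partial>P) * (\<integral>y. pev p' (Z y) \<partial>P)\<bar>))"
    unfolding discrepancy_def
  proof (intro avg_mono)
    fix v w assume v: "v \<in> W i" and w: "w \<in> W i"
    have tri: "a = c * x + y \<Longrightarrow> \<bar>a\<bar> \<le> \<bar>c\<bar> * \<bar>x\<bar> + \<bar>y\<bar>" for a x y :: real
      using abs_triangle_ineq [of "c * x" y] by (simp add: abs_mult)
    let ?I = "\<lambda>p. \<integral>x. pev p (z i v x) * pev p' (z i w x) \<partial>m i" and ?J = "\<lambda>p. \<integral>y. pev p (Z y) \<partial>P"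
    have e: "pev ((c, L) # p) y = c * pev [(1, L)] y + pev p y" for y by simp
    have 1: "?I ((c, L) # p) = c * ?I [(1, L)] + ?I p"
    proof -
      have "?I ((c, L) # p) = (\<integral>x. c * (pev [(1, L)] (z i v x) * pev p' (z i w x)) +
          pev p (z i v x) * pev p' (z i w x) \<partial>m i)"
        unfolding e by (simp only: distrib_right mult.assoc)
      then show ?thesis
        by (subst (asm) Bochner_Integration.integral_add)
          (use integrable_pev_mult [OF v w] in \<open>auto simp del: pev_Cons\<close>)
    qed
    have 2: "?J ((c, L) # p) = c * ?J [(1, L)] + ?J p"
      unfolding e
      by (subst Bochner_Integration.integral_add)
          (use integrable_pev_limit in \<open>auto simp del: pev_Cons\<close>)
    have "?I ((c, L) # p) - ?J ((c, L) # p) * ?J p' =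
        c * (?I [(1, L)] - ?J [(1, L)] * ?J p') + (?I p - ?J p * ?J p')"
      unfolding 1 2 by algebra
    then show "\<bar>?I ((c, L) # p) - ?J ((c, L) # p) * ?J p'\<bar> \<le>
        \<bar>c\<bar> * \<bar>?I [(1, L)] - ?J [(1, L)] * ?J p'\<bar> + \<bar>?I p - ?J p * ?J p'\<bar>"
      by (rule tri)
  qed
  then show ?thesis by (simp only: discrepancy_def avg_add avg_cmult)
qed

lemma discrepancy_commute: "discrepancy p p' i = discrepancy p' p i"
proof -
  have "discrepancy p p' i = avg (W i) (\<lambda>w. avg (W i) (\<lambda>v.
        \<bar>(\<integral>x. pev p (z i v x) * pev p' (z i w x) \<partial>m i)
         - (\<integral>y. pev p (Z y) \<partial>P) * (\<integral>y. pev p' (Z y) \<partial>P)\<bar>))"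
    unfolding discrepancy_def avg_def
    by (simp add: sum_divide_distrib [symmetric]) (subst sum.swap, simp)
  then show ?thesis by (simp add: discrepancy_def mult.commute)
qed

lemma pair_converges_iff_discrepancy:
  "pair_converges W m z P Z \<longleftrightarrow> (\<forall>L L'. discrepancy [(1, L)] [(1, L')] \<longlonglongrightarrow> 0)"
  by (simp add: pair_converges_def discrepancy_def [abs_def])

text \<open>
  The discrepancy is subadditive and homogeneous in each polynomial, so monomials suffice.
\<close>

lemma pair_converges_pev:
  assumes "pair_converges W m z P Z"
  shows "discrepancy p p' \<longlonglongrightarrow> 0"
proof -
  have 0: "discrepancy p p' \<longlonglongrightarrow> 0"
    if mon: "\<And>L. discrepancy [(1, L)] p' \<longlonglongrightarrow> 0" for p p'
  proof (induction p)
    case Nil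
    then show ?case by (simp add: discrepancy_def [abs_def] avg_def)
  next
    case (Cons a p)
    obtain c L where a: "a = (c, L)" by (cases a)
    have "(\<lambda>i. \<bar>c\<bar> * discrepancy [(1, L)] p' i + discrepancy p p' i) \<longlonglongrightarrow> \<bar>c\<bar> * 0 + 0"
      by (intro tendsto_intros mon Cons)
    then have "(\<lambda>i. \<bar>c\<bar> * discrepancy [(1, L)] p' i + discrepancy p p' i) \<longlonglongrightarrow> 0" by simp
    then show ?case unfolding a
      by (rule Lim_null_comparison [rotated])
        (use discrepancy_nonneg discrepancy_Cons_left in \<open>auto intro!: always_eventually\<close>)
  qed
  have 1: "discrepancy p' [(1, L)] \<longlonglongrightarrow> 0" for L p'
    by (rule 0) (use assms in \<open>auto simp: pair_converges_iff_discrepancy\<close>)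
  have 2: "discrepancy [(1, L)] p' = discrepancy p' [(1, L)]" for L p'
    by (rule ext) (rule discrepancy_commute)
  show ?thesis
    by (rule 0) (simp only: 1 2)
qed

lemma pair_converges_single:
  assumes "pair_converges W m z P Z"
  shows "(\<lambda>i. avg (W i) (\<lambda>v. \<bar>(\<integral>x. pev p (z i v x) \<partial>m i) - (\<integral>y. pev p (Z y) \<partial>P)\<bar>)) \<longlonglongrightarrow> 0"
proof -
  have "discrepancy p [(1, [])] =
      (\<lambda>i. avg (W i) (\<lambda>v. \<bar>(\<integral>x. pev p (z i v x) \<partial>m i) - (\<integral>y. pev p (Z y) \<partial>P)\<bar>))"
  proof (rule ext)
    fix i
    have 1: "(\<integral>y. 1 \<partial>P) = (1::real)"
      using prob_space.prob_space [OF prob_P] by simp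
    show "discrepancy p [(1, [])] i =
        avg (W i) (\<lambda>v. \<bar>(\<integral>x. pev p (z i v x) \<partial>m i) - (\<integral>y. pev p (Z y) \<partial>P)\<bar>)"
      unfolding discrepancy_def by (simp add: 1 avg_const [OF fin nonempty] del: lebesgue_integral_const)
  qed
  then show ?thesis using pair_converges_pev [OF assms, of p "[(1, [])]"] by simp
qed

lemma pair_converges_mean:
  assumes "pair_converges W m z P Z"
  shows "(\<lambda>i. avg (W i) (\<lambda>v. \<integral>x. pev p (z i v x) \<partial>m i)) \<longlonglongrightarrow> (\<integral>y. pev p (Z y) \<partial>P)"
proof (rule LIM_zero_cancel, rule Lim_null_comparison [OF _ pair_converges_single [OF assms]])
  show "\<forall>\<^sub>F i in sequentially. norm (avg (W i) (\<lambda>v. \<integral>x. pev p (z i v x) \<partial>m i) - (\<integral>y. pev p (Z y) \<partial>P))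
     \<le> avg (W i) (\<lambda>v. \<bar>(\<integral>x. pev p (z i v x) \<partial>m i) - (\<integral>y. pev p (Z y) \<partial>P)\<bar>)"
  proof (rule always_eventually, rule allI)
    fix i
    show "norm (avg (W i) (\<lambda>v. \<integral>x. pev p (z i v x) \<partial>m i) - (\<integral>y. pev p (Z y) \<partial>P))
     \<le> avg (W i) (\<lambda>v. \<bar>(\<integral>x. pev p (z i v x) \<partial>m i) - (\<integral>y. pev p (Z y) \<partial>P)\<bar>)"
      using avg_abs [of "W i" "\<lambda>v. (\<integral>x. pev p (z i v x) \<partial>m i) - (\<integral>y. pev p (Z y) \<partial>P)"]
      by (simp add: avg_diff avg_const fin nonempty)
  qed
qed

text \<open>
  The diagonal pairs \<open>v = w\<close> carry the proportion \<open>1 / |W|\<close> of all pairs, and on them independence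
  of a coordinate from itself is asserted.  So the limit has no variance unless \<open>|W| \<rightarrow> \<infinity>\<close>.
\<close>

lemma bounded_card_imp_variance_zero:
  assumes conv: "pair_converges W m z P Z" and bdd: "\<exists>\<^sub>F i in sequentially. card (W i) \<le> N"
  shows "(\<integral>y. (Z y j)\<^sup>2 \<partial>P) = (\<integral>y. Z y j \<partial>P)\<^sup>2"
proof -
  define c where "c = (\<integral>y. Z y j \<partial>P)"
  define d where "d i = avg (W i) (\<lambda>v. \<integral>x. (z i v x j)\<^sup>2 \<partial>m i) - c\<^sup>2" for i
  have "(\<lambda>i. avg (W i) (\<lambda>v. \<integral>x. pev [(1, [j, j])] (z i v x) \<partial>m i)) \<longlonglongrightarrow> (\<integral>y. pev [(1, [j, j])] (Z y) \<partial>P)"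
    by (rule pair_converges_mean [OF conv])
  then have lim: "d \<longlonglongrightarrow> (\<integral>y. (Z y j)\<^sup>2 \<partial>P) - c\<^sup>2"
    unfolding d_def by (intro tendsto_diff tendsto_const) (simp add: power2_eq_square)
  have le: "\<bar>d i\<bar> \<le> real (card (W i)) * discrepancy [(1, [j])] [(1, [j])] i" for i
  proof -
    let ?e = "\<lambda>v w. \<bar>(\<integral>x. z i v x j * z i w x j \<partial>m i) - c * c\<bar>"
    have "d i = avg (W i) (\<lambda>v. (\<integral>x. (z i v x j)\<^sup>2 \<partial>m i) - c\<^sup>2)"
      by (simp add: d_def avg_diff avg_const fin nonempty)
    also have "\<bar>\<dots>\<bar> \<le> avg (W i) (\<lambda>v. \<bar>(\<integral>x. (z i v x j)\<^sup>2 \<partial>m i) - c\<^sup>2\<bar>)"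
      by (rule avg_abs)
    also have "\<dots> \<le> avg (W i) (\<lambda>v. \<Sum>w\<in>W i. ?e v w)"
    proof (rule avg_mono)
      fix v assume v: "v \<in> W i"
      have "?e v v \<le> (\<Sum>w\<in>W i. ?e v w)"
        by (rule member_le_sum [OF v]) (auto simp: fin)
      then show "\<bar>(\<integral>x. (z i v x j)\<^sup>2 \<partial>m i) - c\<^sup>2\<bar> \<le> (\<Sum>w\<in>W i. ?e v w)"
        by (simp add: power2_eq_square)
    qed
    also have "\<dots> = avg (W i) (\<lambda>v. real (card (W i)) * avg (W i) (?e v))"
      using card_pos [of i] by (intro avg_cong) (simp add: avg_def)
    finally show ?thesis by (simp add: avg_cmult discrepancy_def c_def)
  qed
  have "(\<integral>y. (Z y j)\<^sup>2 \<partial>P) - c\<^sup>2 = 0"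
  proof (rule ccontr)
    assume "(\<integral>y. (Z y j)\<^sup>2 \<partial>P) - c\<^sup>2 \<noteq> 0"
    then have pos: "0 < \<bar>(\<integral>y. (Z y j)\<^sup>2 \<partial>P) - c\<^sup>2\<bar> / 2" (is "0 < ?a") by simp
    have "(\<lambda>i. \<bar>d i\<bar>) \<longlonglongrightarrow> \<bar>(\<integral>y. (Z y j)\<^sup>2 \<partial>P) - c\<^sup>2\<bar>" by (rule tendsto_rabs [OF lim])
    then have 1: "\<forall>\<^sub>F i in sequentially. ?a < \<bar>d i\<bar>"
      by (rule order_tendstoD) (use pos in auto)
    have "(\<lambda>i. real N * discrepancy [(1, [j])] [(1, [j])] i) \<longlonglongrightarrow> real N * 0"
      by (intro tendsto_intros pair_converges_pev [OF conv])
    then have 2: "\<forall>\<^sub>F i in sequentially. real N * discrepancy [(1, [j])] [(1, [j])] i < ?a"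
      by (rule order_tendstoD) (use pos in auto)
    obtain i where i: "card (W i) \<le> N" "?a < \<bar>d i\<bar>" "real N * discrepancy [(1, [j])] [(1, [j])] i < ?a"
      using frequently_ex [OF frequently_eventually_frequently [OF bdd eventually_conj [OF 1 2]]] by blast
    have "real (card (W i)) * discrepancy [(1, [j])] [(1, [j])] i \<le> real N * discrepancy [(1, [j])] [(1, [j])] i"
      using i discrepancy_nonneg by (intro mult_right_mono) auto
    then show False using le [of i] i by linarith
  qed
  then show ?thesis by (simp add: c_def)
qed

end

section \<open>Density of polynomials in the coordinates\<close>

lemma indicator_diff_le: "0 \<le> (c::real) \<and> c \<le> 1 \<Longrightarrow> \<bar>indicator A z - c\<bar> \<le> 1"
  by (auto simp: indicator_def)

text \<open>
  By inner regularity of \<open>S\<close> and of its complement, up to a small measure \<open>S\<close> and its complement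
  are compact, and the two compact sets are separated by a continuous function.
\<close>

lemma continuous_approx_indicator:
  fixes M :: "'a::polish_space measure"
  assumes M: "prob_space M" "sets M = sets borel" and S: "S \<in> sets borel" and e: "0 < e"
  shows "\<exists>F. continuous_on UNIV F \<and> (\<forall>z. 0 \<le> F z \<and> F z \<le> (1::real)) \<and>
            (\<integral>z. \<bar>indicator S z - F z\<bar> \<partial>M) \<le> e"
proof -
  interpret prob_space M by fact
  have sp: "space M = UNIV" using sets_eq_imp_space_eq [OF M(2)] by simp
  have inner: "\<exists>K. K \<subseteq> B \<and> compact K \<and> prob (B - K) < e / 2" if B: "B \<in> sets borel" for B
  proof (rule ccontr)
    assume none: "\<nexists>K. K \<subseteq> B \<and> compact K \<and> prob (B - K) < e / 2"
    have le: "prob K \<le> prob B - e / 2" if K: "K \<subseteq> B" "compact K" for K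
    proof -
      have "prob (B - K) = prob B - prob K"
        using K B M by (intro finite_measure_Diff) (auto intro: borel_closed compact_imp_closed)
      moreover have "\<not> prob (B - K) < e / 2" using none K by blast
      ultimately show ?thesis by linarith
    qed
    have "emeasure M B = (SUP K\<in>{K. K \<subseteq> B \<and> compact K}. emeasure M K)"
      by (rule inner_regular [OF M(2) _ B]) simp
    also have "\<dots> \<le> ennreal (prob B - e / 2)"
      using le by (intro SUP_least) (auto simp: emeasure_eq_measure intro: ennreal_leI)
    finally have "prob B \<le> prob B - e / 2"
      using le [of "{}"] by (simp add: emeasure_eq_measure)
    then show False using e by simp
  qed
  obtain K where K: "K \<subseteq> S" "compact K" "prob (S - K) < e / 2" using inner [OF S] by blast
  obtain K' where K': "K' \<subseteq> - S" "compact K'" "prob (- S - K') < e / 2" using inner [of "- S"] S by auto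
  have "normal_space (euclidean :: 'a topology)" by (simp add: metrizable_imp_normal_space metrizable_space_euclidean)
  then obtain F where F: "continuous_map euclidean (top_of_set {0..1::real}) F" "F ` K' \<subseteq> {0}" "F ` K \<subseteq> {1}"
    using Urysohn_lemma [of euclidean K' K 0 1] K K' by (auto simp: disjnt_def compact_imp_closed)
  then have c: "continuous_on UNIV F" and r: "\<And>z. 0 \<le> F z \<and> F z \<le> 1" by (auto simp: continuous_map_in_subtopology)
  have [measurable]: "F \<in> borel_measurable M" "S \<in> sets M" "K \<in> sets M" "K' \<in> sets M"
    using borel_measurable_continuous_onI [OF c] S K K' M(2)
    by (auto simp: measurable_cong_sets [OF M(2) refl] intro: borel_closed compact_imp_closed)
  have A: "S - K \<in> sets M" "- S - K' \<in> sets M"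
    using sets.compl_sets [of S M] by (auto simp: sp Compl_eq_Diff_UNIV)
  have i: "integrable M (indicator A :: 'a \<Rightarrow> real)" if "A \<in> sets M" for A
    using that by (simp add: emeasure_eq_measure)
  have "(\<integral>z. \<bar>indicator S z - F z\<bar> \<partial>M) \<le> (\<integral>z. indicator (S - K) z + indicator (- S - K') z \<partial>M)"
  proof (rule integral_mono)
    show "integrable M (\<lambda>z. \<bar>indicator S z - F z\<bar>)"
      by (rule integrable_bounded [where C = 1]) (use r in \<open>auto intro!: indicator_diff_le\<close>)
    show "integrable M (\<lambda>z. indicator (S - K) z + indicator (- S - K') z :: real)"
      by (rule Bochner_Integration.integrable_add [OF i [OF A(1)] i [OF A(2)]])
    fix z
    show "\<bar>indicator S z - F z\<bar> \<le> indicator (S - K) z + indicator (- S - K') z"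
      using F(2,3) r [of z] by (auto simp: indicator_def)
  qed
  also have "\<dots> = prob (S - K) + prob (- S - K')"
    using Bochner_Integration.integral_add [OF i [OF A(1)] i [OF A(2)]] by (simp add: sp)
  also have "\<dots> \<le> e" using K(3) K'(3) by linarith
  finally show ?thesis using c r by blast
qed

lemma cube_field_borel:
  fixes c :: "'w \<Rightarrow> 'j::countable \<Rightarrow> real"
  assumes "cube_field M c" shows "c \<in> borel_measurable M"
  using assms by (intro measurable_coordinatewise_then_product) (auto simp: cube_field_def)

text \<open>
  A function is a mean of indicators of its superlevel sets, up to a small uniform error; these are
  approximated by continuous functions on the cube, and the latter by polynomials.
\<close>

lemma pev_dense:
  fixes c :: "'w \<Rightarrow> 'j::countable \<Rightarrow> real"
  assumes M: "prob_space M" and c: "cube_field M c"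
    and gen: "\<And>S. S \<in> sets M \<Longrightarrow> \<exists>O'\<in>sets borel. S = c -` O' \<inter> space M"
    and f: "f \<in> borel_measurable M" "\<And>x. x \<in> space M \<Longrightarrow> 0 \<le> f x \<and> f x \<le> 1" and e: "0 < e"
  obtains p where "(\<integral>x. \<bar>f x - pev p (c x)\<bar> \<partial>M) \<le> e" "\<And>z. z \<in> unit_cube \<Longrightarrow> \<bar>pev p z\<bar> \<le> 2"
proof -
  interpret prob_space M by fact
  note [measurable] = cube_field_borel [OF c] f(1)
  define N where "N = Suc (nat \<lceil>3 / e\<rceil>)"
  have N: "1 / real N < e / 3" "0 < N"
  proof -
    have "3 / e < real N" unfolding N_def by linarith
    moreover have "0 < real N" by (simp add: N_def)
    ultimately show "1 / real N < e / 3" using e by (simp add: field_simps)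
  qed (simp add: N_def)
  define S where "S k = {x \<in> space M. real k \<le> real N * f x}" for k
  have [measurable]: "S k \<in> sets M" for k unfolding S_def by measurable
  let ?D = "distr M borel c"
  have "\<exists>F. continuous_on UNIV F \<and> (\<forall>z. 0 \<le> F z \<and> F z \<le> (1::real)) \<and>
            (\<integral>x. \<bar>indicator (S k) x - F (c x)\<bar> \<partial>M) \<le> e / 3" for k
  proof -
    obtain O' where O': "O' \<in> sets borel" "S k = c -` O' \<inter> space M"
      using gen [of "S k"] by auto
    have ex: "\<exists>F. continuous_on UNIV F \<and> (\<forall>z. 0 \<le> F z \<and> F z \<le> (1::real)) \<and>
            (\<integral>z. \<bar>indicator O' z - F z\<bar> \<partial>?D) \<le> e / 3"
      using O' e by (intro continuous_approx_indicator prob_space_distr) auto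
    obtain F where F: "continuous_on UNIV F" "\<forall>z. 0 \<le> F z \<and> F z \<le> (1::real)"
        "(\<integral>z. \<bar>indicator O' z - F z\<bar> \<partial>?D) \<le> e / 3"
      using ex by auto
    note [measurable] = borel_measurable_continuous_onI [OF F(1)] O'(1)
    have "(\<integral>z. \<bar>indicator O' z - F z\<bar> \<partial>?D) = (\<integral>x. \<bar>indicator O' (c x) - F (c x)\<bar> \<partial>M)"
      by (subst integral_distr) auto
    also have "\<dots> = (\<integral>x. \<bar>indicator (S k) x - F (c x)\<bar> \<partial>M)"
      by (rule Bochner_Integration.integral_cong) (auto simp: O' indicator_def)
    finally show ?thesis using F by auto
  qed
  then obtain F where F: "\<And>k. continuous_on UNIV (F k)" "\<And>k z. 0 \<le> F k z \<and> F k z \<le> (1::real)"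
      "\<And>k. (\<integral>x. \<bar>indicator (S k) x - F k (c x)\<bar> \<partial>M) \<le> e / 3"
    using choice [of "\<lambda>k F. continuous_on UNIV F \<and> (\<forall>z. 0 \<le> F z \<and> F z \<le> (1::real)) \<and>
            (\<integral>x. \<bar>indicator (S k) x - F (c x)\<bar> \<partial>M) \<le> e / 3"] by blast
  define H where "H z = (\<Sum>k=1..N. F k z) / real N" for z
  have H: "continuous_on UNIV H" unfolding H_def using F(1) by (intro continuous_intros) (simp_all add: N_def)
  have Hr: "0 \<le> H z \<and> H z \<le> 1" for z
  proof -
    have "(\<Sum>k=1..N. F k z) \<le> (\<Sum>k=1..N. 1)" by (intro sum_mono) (use F(2) in auto)
    then show ?thesis using F(2) N(2) by (auto simp: H_def intro!: divide_nonneg_nonneg sum_nonneg)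
  qed
  obtain p where p: "\<And>z. z \<in> unit_cube \<Longrightarrow> \<bar>H z - pev p z\<bar> < min 1 (e / 3)"
    using Stone_Weierstrass_pev [OF compact_unit_cube continuous_on_subset [OF H], of "min 1 (e / 3)"] e
    by auto
  note [measurable] = borel_measurable_continuous_onI [OF H] borel_measurable_continuous_onI [OF F(1)]
    cube_field_pev(1) [OF c]
  have cu: "c x \<in> unit_cube" if "x \<in> space M" for x using c that by (auto simp: cube_field_def)
  have floor: "\<bar>f x - (\<Sum>k=1..N. indicator (S k) x) / real N\<bar> \<le> 1 / real N" if x: "x \<in> space M" for x
  proof -
    have t: "0 \<le> real N * f x" "real N * f x \<le> real N"
      using f(2) [OF x] by (auto intro: mult_left_le)
    have eq: "{Suc 0..N} \<inter> {k. real k \<le> real N * f x} = {Suc 0..nat \<lfloor>real N * f x\<rfloor>}"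
      using t by (auto simp: le_nat_iff le_floor_iff)
    have "(\<Sum>k=1..N. indicator (S k) x) = real (nat \<lfloor>real N * f x\<rfloor>)"
      using x by (simp add: indicator_def S_def eq)
    moreover have "\<bar>real N * f x - real (nat \<lfloor>real N * f x\<rfloor>)\<bar> \<le> 1" using t by linarith
    moreover have "f x - (\<Sum>k=1..N. indicator (S k) x) / real N = (real N * f x - (\<Sum>k=1..N. indicator (S k) x)) / real N"
      using N by (simp add: field_simps)
    ultimately show ?thesis by (simp add: abs_divide divide_right_mono)
  qed
  have intF: "integrable M (\<lambda>x. \<bar>indicator (S k) x - F k (c x)\<bar>)" for k
    by (rule integrable_bounded [where C = 1]) (use F(2) in \<open>auto intro!: indicator_diff_le\<close>)
  show ?thesis
  proof
    have "(\<integral>x. \<bar>f x - pev p (c x)\<bar> \<partial>M) \<le>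
        (\<integral>x. 1 / real N + (\<Sum>k=1..N. \<bar>indicator (S k) x - F k (c x)\<bar>) / real N + e / 3 \<partial>M)"
    proof (rule integral_mono)
      show "integrable M (\<lambda>x. \<bar>f x - pev p (c x)\<bar>)"
        by (rule integrable_bounded [where C = "1 + pnorm p"])
          (use f(2) cube_field_pev(2) [OF c] in \<open>force intro!: order_trans [OF abs_triangle_ineq4] add_mono\<close>)+
      show "integrable M (\<lambda>x. 1 / real N + (\<Sum>k=1..N. \<bar>indicator (S k) x - F k (c x)\<bar>) / real N + e / 3)"
        using intF by auto
      fix x assume x: "x \<in> space M"
      have "\<bar>(\<Sum>k=1..N. indicator (S k) x) / real N - H (c x)\<bar> =
          \<bar>\<Sum>k=1..N. indicator (S k) x - F k (c x)\<bar> / real N"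
        by (simp add: H_def sum_subtractf diff_divide_distrib [symmetric])
      also have "\<dots> \<le> (\<Sum>k=1..N. \<bar>indicator (S k) x - F k (c x)\<bar>) / real N"
        by (intro divide_right_mono sum_abs) auto
      finally show "\<bar>f x - pev p (c x)\<bar> \<le>
          1 / real N + (\<Sum>k=1..N. \<bar>indicator (S k) x - F k (c x)\<bar>) / real N + e / 3"
        using floor [OF x] p [OF cu [OF x]] by linarith
    qed
    also have "\<dots> = 1 / real N + (\<Sum>k=1..N. \<integral>x. \<bar>indicator (S k) x - F k (c x)\<bar> \<partial>M) / real N + e / 3"
      using intF by (simp add: prob_space Bochner_Integration.integral_sum)
    also have "(\<Sum>k=1..N. \<integral>x. \<bar>indicator (S k) x - F k (c x)\<bar> \<partial>M) / real N \<le> (\<Sum>k=1..N. e / 3) / real N"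
      using F(3) by (intro divide_right_mono sum_mono) auto
    also have "(\<Sum>k=1..N. e / 3) / real N = e / 3" using N(2) by simp
    finally show "(\<integral>x. \<bar>f x - pev p (c x)\<bar> \<partial>M) \<le> e" using N(1) by linarith
    show "\<bar>pev p z\<bar> \<le> 2" if "z \<in> unit_cube" for z
      using p [OF that] Hr [of z] by linarith
  qed
qed

section \<open>Alphabets with coordinates\<close>

text \<open>
  The second clause says that the coordinates generate the measurable structure of \<open>A\<close>; it is stated
  for the embedding into the cube because sets are approximated there.
\<close>

definition coordinates :: "'a measure \<Rightarrow> ('n \<Rightarrow> 'a \<Rightarrow> real) \<Rightarrow> bool" where
  "coordinates A q \<longleftrightarrow> cube_field A (\<lambda>a n. q n a) \<and>
     (\<forall>S\<in>sets A. \<exists>O'\<in>sets borel. S = (\<lambda>a n. q n a) -` O' \<inter> space A)"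

lemma coordinates_measurable: "coordinates A q \<Longrightarrow> q n \<in> borel_measurable A"
  and coordinates_range: "coordinates A q \<Longrightarrow> a \<in> space A \<Longrightarrow> 0 \<le> q n a \<and> q n a \<le> 1"
  by (auto simp: coordinates_def cube_field_def unit_cube_def)

definition sequence_coords :: "('n \<Rightarrow> 'a \<Rightarrow> real) \<Rightarrow> ('g \<Rightarrow> 'a) \<Rightarrow> 'g \<times> 'n \<Rightarrow> real" where
  "sequence_coords q x = (\<lambda>(g, n). q n (x g))"

lemma sequence_coords_apply [simp]: "sequence_coords q x (g, n) = q n (x g)"
  by (simp add: sequence_coords_def)

lemma cube_field_sequence_coords:
  fixes q :: "'n \<Rightarrow> 'a \<Rightarrow> real" and X :: "'w \<Rightarrow> 'g \<Rightarrow> 'a"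
  assumes q: "coordinates A q" and X: "\<And>g. (\<lambda>w. X w g) \<in> measurable M A"
  shows "cube_field M (\<lambda>w. sequence_coords q (X w))"
proof (rule cube_fieldI)
  fix j :: "'g \<times> 'n"
  show "(\<lambda>w. sequence_coords q (X w) j) \<in> borel_measurable M"
    using measurable_compose [OF X coordinates_measurable [OF q]] by (cases j) simp
  fix w assume "w \<in> space M"
  then show "0 \<le> sequence_coords q (X w) j \<and> sequence_coords q (X w) j \<le> 1"
    using measurable_space [OF X] coordinates_range [OF q] by (cases j) auto
qed

lemma PiM_coords_generate:
  fixes q :: "'n::countable \<Rightarrow> 'a \<Rightarrow> real" and I :: "'g::countable set"
  assumes q: "coordinates A q" and S: "S \<in> sets (PiM I (\<lambda>_. A))"
  shows "\<exists>O'\<in>sets borel. S = (\<lambda>x (g, n). if g \<in> I then q n (x g) else 0) -` O' \<inter> space (PiM I (\<lambda>_. A))"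
proof -
  let ?P = "PiM I (\<lambda>_. A)"
  let ?c = "\<lambda>x (g, n). if g \<in> I then q n (x g) else 0"
  let ?V = "vimage_algebra (space ?P) ?c (borel :: ('g \<times> 'n \<Rightarrow> real) measure)"
  have "(\<lambda>x. x) \<in> measurable ?V ?P"
  proof (rule measurable_PiM_single')
    show "(\<lambda>x. x) \<in> space ?V \<rightarrow> (\<Pi>\<^sub>E i\<in>I. space A)" by (simp add: space_PiM)
    fix g :: 'g assume g: "g \<in> I"
    show "(\<lambda>x. x g) \<in> measurable ?V A"
    proof (rule measurableI)
      show "x \<in> space ?V \<Longrightarrow> x g \<in> space A" for x using g by (auto simp: space_PiM)
      fix T assume "T \<in> sets A"
      then obtain O' where O': "O' \<in> sets borel" "T = (\<lambda>a n. q n a) -` O' \<inter> space A"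
        using q unfolding coordinates_def by blast
      have "(\<lambda>z n. z (g, n)) \<in> measurable (borel :: ('g \<times> 'n \<Rightarrow> real) measure) borel"
        by (intro measurable_coordinatewise_then_product) (rule measurable_product_coordinates)
      then have B: "(\<lambda>z n. z (g, n)) -` O' \<in> sets (borel :: ('g \<times> 'n \<Rightarrow> real) measure)"
        using O'(1) measurable_sets [of "\<lambda>z n. z (g, n)" borel borel O'] by simp
      have "(\<lambda>x. x g) -` T \<inter> space ?V = ?c -` ((\<lambda>z n. z (g, n)) -` O') \<inter> space ?P"
        using g by (auto simp: O' space_PiM)
      then show "(\<lambda>x. x g) -` T \<inter> space ?V \<in> sets ?V"
        using in_vimage_algebra [OF B] by simp
    qed
  qed
  then have "S \<in> sets ?V"
    using measurable_sets [OF _ S, of "\<lambda>x. x" ?V] sets.sets_into_space [OF S] by (simp add: Int_absorb2)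
  then show ?thesis by (auto simp: sets_vimage_algebra2)
qed

lemma sequence_coords_generate:
  fixes q :: "'n::countable \<Rightarrow> 'a \<Rightarrow> real"
  assumes q: "coordinates A q" and S: "S \<in> sets (PiM (UNIV :: 'g::countable set) (\<lambda>_. A))"
  shows "\<exists>O'\<in>sets borel. S = sequence_coords q -` O' \<inter> space (PiM UNIV (\<lambda>_. A))"
  using PiM_coords_generate [OF q S] by (simp add: sequence_coords_def [abs_def])

text \<open>
  Only finitely many boxes of side \<open>e\<close> are met in the cube of the coordinates in \<open>F\<close>; choose a point
  in each.
\<close>

lemma coordinates_net:
  assumes q: "coordinates A q" and F: "finite F" and e: "0 < (e::real)"
  obtains R where "finite R" "R \<subseteq> space A" "\<And>a. a \<in> space A \<Longrightarrow> \<exists>r\<in>R. \<forall>n\<in>F. \<bar>q n r - q n a\<bar> \<le> e"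
proof -
  define h where "h a = (\<lambda>n\<in>F. nat \<lfloor>q n a / e\<rfloor>)" for a
  have "h a \<in> (\<Pi>\<^sub>E n\<in>F. {..nat \<lfloor>1 / e\<rfloor>})" if "a \<in> space A" for a
    using coordinates_range [OF q that] e
    by (auto simp: h_def intro!: nat_mono floor_mono divide_right_mono)
  then have fin: "finite (h ` space A)"
    by (intro finite_subset [OF _ finite_PiE [OF F, of "\<lambda>_. {..nat \<lfloor>1 / e\<rfloor>}"]]) auto
  define R where "R = inv_into (space A) h ` (h ` space A)"
  show ?thesis
  proof
    show "finite R" using fin by (simp add: R_def)
    show "R \<subseteq> space A" by (auto simp: R_def inv_into_into)
    fix a assume a: "a \<in> space A"
    define r where "r = inv_into (space A) h (h a)"
    have r: "r \<in> R" "r \<in> space A" "h r = h a"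
      using a by (auto simp: R_def r_def inv_into_into f_inv_into_f)
    have "\<bar>q n r - q n a\<bar> \<le> e" if n: "n \<in> F" for n
    proof -
      have "nat \<lfloor>q n r / e\<rfloor> = nat \<lfloor>q n a / e\<rfloor>" using fun_cong [OF r(3), of n] n by (simp add: h_def)
      moreover have "0 \<le> q n r / e" "0 \<le> q n a / e"
        using coordinates_range [OF q] a r e by auto
      ultimately have "\<lfloor>q n r / e\<rfloor> = \<lfloor>q n a / e\<rfloor>" by (metis eq_nat_nat_iff zero_le_floor)
      then have "\<bar>q n r / e - q n a / e\<bar> \<le> 1" by linarith
      then show ?thesis using e by (simp add: field_simps abs_le_iff)
    qed
    then show "\<exists>r\<in>R. \<forall>n\<in>F. \<bar>q n r - q n a\<bar> \<le> e" using r by auto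
  qed
qed

section \<open>Covering numbers\<close>

definition covered :: "'y measure \<Rightarrow> ('y \<Rightarrow> 'y \<Rightarrow> real) \<Rightarrow> real \<Rightarrow> 'y set \<Rightarrow> 'y set" where
  "covered \<nu> d \<delta> F = {y \<in> space \<nu>. \<exists>x\<in>F. d x y < \<delta>}"

definition is_cover :: "real \<Rightarrow> real \<Rightarrow> 'y measure \<Rightarrow> ('y \<Rightarrow> 'y \<Rightarrow> real) \<Rightarrow> 'y set \<Rightarrow> bool" where
  "is_cover \<epsilon> \<delta> \<nu> d F \<longleftrightarrow> finite F \<and> F \<subseteq> space \<nu> \<and> measure \<nu> (covered \<nu> d \<delta> F) > 1 - \<epsilon>"

lemma cov_eq: "cov \<epsilon> \<delta> \<nu> d = Inf {enat (card F) | F. is_cover \<epsilon> \<delta> \<nu> d F}"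
  by (simp add: cov_def is_cover_def covered_def)

lemma cov_le_card: "is_cover \<epsilon> \<delta> \<nu> d F \<Longrightarrow> cov \<epsilon> \<delta> \<nu> d \<le> enat (card F)"
  unfolding cov_eq by (intro Inf_lower) auto

lemma cov_mono_covers:
  assumes "\<And>F. is_cover \<epsilon>' \<delta>' \<nu>' d' F \<Longrightarrow> \<exists>F'. is_cover \<epsilon> \<delta> \<nu> d F' \<and> card F' \<le> card F"
  shows "cov \<epsilon> \<delta> \<nu> d \<le> cov \<epsilon>' \<delta>' \<nu>' d'"
  unfolding cov_eq [of \<epsilon>']
proof (rule Inf_greatest, clarify)
  fix F assume "is_cover \<epsilon>' \<delta>' \<nu>' d' F"
  then obtain F' where "is_cover \<epsilon> \<delta> \<nu> d F'" "card F' \<le> card F" using assms by blast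
  then show "cov \<epsilon> \<delta> \<nu> d \<le> enat (card F)"
    using cov_le_card order_trans by (metis enat_ord_simps(1))
qed

lemma cov_attained:
  assumes "is_cover \<epsilon> \<delta> \<nu> d F"
  obtains F' where "is_cover \<epsilon> \<delta> \<nu> d F'" "cov \<epsilon> \<delta> \<nu> d = enat (card F')"
proof -
  let ?A = "{enat (card F) | F. is_cover \<epsilon> \<delta> \<nu> d F}"
  have "Inf ?A \<in> ?A" by (rule wellorder_InfI [of "enat (card F)"]) (use assms in auto)
  then show ?thesis using that unfolding cov_eq by auto
qed

lemma covered_measurable:
  assumes "finite F" "\<And>x. x \<in> F \<Longrightarrow> d x \<in> borel_measurable \<nu>"
  shows "covered \<nu> d \<delta> F \<in> sets \<nu>"
proof -
  have "covered \<nu> d \<delta> F = (\<Union>x\<in>F. {y \<in> space \<nu>. d x y < \<delta>})" by (auto simp: covered_def)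
  also have "\<dots> \<in> sets \<nu>"
  proof (intro sets.finite_UN assms(1))
    fix x assume "x \<in> F"
    then have [measurable]: "d x \<in> borel_measurable \<nu>" by (rule assms)
    show "{y \<in> space \<nu>. d x y < \<delta>} \<in> sets \<nu>" by measurable
  qed
  finally show ?thesis .
qed

lemma cov_ge_1:
  assumes "\<epsilon> \<le> 1" shows "1 \<le> cov \<epsilon> \<delta> \<nu> d"
  unfolding cov_eq
proof (rule Inf_greatest, clarify)
  fix F assume F: "is_cover \<epsilon> \<delta> \<nu> d F"
  then have "F \<noteq> {}" using assms by (auto simp: is_cover_def covered_def)
  then have "1 \<le> card F" using F by (simp add: is_cover_def Suc_le_eq card_gt_0_iff)
  then show "1 \<le> enat (card F)" by (simp add: one_enat_def)
qed

text \<open>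
  A cover in the image is pulled back by choosing one preimage per ball.  The preimages are chosen
  in a large set \<open>E\<close> on which the fibres of the map are small.
\<close>

lemma cov_pullback:
  assumes \<nu>: "prob_space \<nu>" and f: "f \<in> measurable \<nu> N" and E: "E \<in> sets \<nu>" "measure \<nu> E \<ge> 1 - \<epsilon>2"
    and sep: "\<And>x y y'. x \<in> space N \<Longrightarrow> y \<in> E \<Longrightarrow> y' \<in> E \<Longrightarrow>
        d' x (f y) < \<delta>' \<Longrightarrow> d' x (f y') < \<delta>' \<Longrightarrow> d y y' < \<delta>"
    and d: "\<And>y. y \<in> space \<nu> \<Longrightarrow> d y \<in> borel_measurable \<nu>"
    and d': "\<And>x. x \<in> space N \<Longrightarrow> d' x \<in> borel_measurable N"
    and le: "\<epsilon>1 + \<epsilon>2 \<le> \<epsilon>"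
  shows "cov \<epsilon> \<delta> \<nu> d \<le> cov \<epsilon>1 \<delta>' (distr \<nu> N f) d'"
proof (rule cov_mono_covers)
  interpret prob_space \<nu> by fact
  fix F assume F: "is_cover \<epsilon>1 \<delta>' (distr \<nu> N f) d' F"
  then have FN: "finite F" "F \<subseteq> space N" by (auto simp: is_cover_def)
  define G where "G = {x \<in> F. \<exists>y\<in>E. d' x (f y) < \<delta>'}"
  define c where "c x = (SOME y. y \<in> E \<and> d' x (f y) < \<delta>')" for x
  have c: "c x \<in> E \<and> d' x (f (c x)) < \<delta>'" if "x \<in> G" for x
    unfolding c_def by (rule someI_ex) (use that in \<open>auto simp: G_def\<close>)
  have EN: "E \<subseteq> space \<nu>" using E sets.sets_into_space by blast
  have meas: "covered (distr \<nu> N f) d' \<delta>' F \<in> sets (distr \<nu> N f)"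
    using FN d' by (intro covered_measurable) auto
  have "1 - \<epsilon>1 < measure (distr \<nu> N f) (covered (distr \<nu> N f) d' \<delta>' F)"
    using F by (simp add: is_cover_def)
  also have "\<dots> = measure \<nu> (f -` covered (distr \<nu> N f) d' \<delta>' F \<inter> space \<nu>)"
    using meas f by (simp add: measure_distr)
  finally have 1: "1 - \<epsilon>1 < measure \<nu> (f -` covered (distr \<nu> N f) d' \<delta>' F \<inter> space \<nu>)" (is "_ < measure \<nu> ?B") .
  have B: "?B \<in> sets \<nu>" using meas f by (auto intro: measurable_sets)
  have cm: "covered \<nu> d \<delta> (c ` G) \<in> sets \<nu>"
    using FN c EN d by (intro covered_measurable) (auto simp: G_def)
  have "?B \<inter> E \<subseteq> covered \<nu> d \<delta> (c ` G)"
  proof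
    fix y assume y: "y \<in> ?B \<inter> E"
    then obtain x where x: "x \<in> F" "d' x (f y) < \<delta>'" by (auto simp: covered_def)
    then have G: "x \<in> G" using y by (auto simp: G_def)
    then have "d (c x) y < \<delta>" using sep [of x "c x" y] c [OF G] x y FN by auto
    then show "y \<in> covered \<nu> d \<delta> (c ` G)" using G y by (auto simp: covered_def)
  qed
  then have "measure \<nu> (?B \<inter> E) \<le> measure \<nu> (covered \<nu> d \<delta> (c ` G))"
    by (rule finite_measure_mono) (rule cm)
  moreover have "measure \<nu> ?B + measure \<nu> E \<le> 1 + measure \<nu> (?B \<inter> E)"
  proof -
    have "measure \<nu> (?B \<union> E) = measure \<nu> ?B + measure \<nu> E - measure \<nu> (?B \<inter> E)"
      by (rule measure_Un3) (use B E in \<open>auto simp: fmeasurable_eq_sets\<close>)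
    then show ?thesis using prob_le_1 [of "?B \<union> E"] by linarith
  qed
  ultimately have "1 - \<epsilon> < measure \<nu> (covered \<nu> d \<delta> (c ` G))"
    using 1 E(2) le by linarith
  moreover have "card (c ` G) \<le> card F"
    using FN by (intro order_trans [OF card_image_le card_mono]) (auto simp: G_def)
  ultimately show "\<exists>F'. is_cover \<epsilon> \<delta> \<nu> d F' \<and> card F' \<le> card F"
    using FN c EN by (intro exI [of _ "c ` G"]) (auto simp: is_cover_def G_def)
qed

text \<open>
  The measure \<open>\<nu>\<close> couples its images under the maps \<open>f j\<close>.  Products of covers of the images cover
  it up to the sum of the exceptional masses, because the distances add.
\<close>

lemma cov_prod_le:
  fixes k :: nat
  assumes \<nu>: "prob_space \<nu>" and k: "0 < k"
    and f: "\<And>j. j < k \<Longrightarrow> f j \<in> measurable \<nu> (N j)"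
    and g: "g \<in> (\<Pi>\<^sub>E j\<in>{..<k}. space (N j)) \<rightarrow> space \<nu>"
    and le: "\<And>x y. x \<in> (\<Pi>\<^sub>E j\<in>{..<k}. space (N j)) \<Longrightarrow> y \<in> space \<nu> \<Longrightarrow>
        d (g x) y \<le> (\<Sum>j<k. d' j (x j) (f j y))"
    and d: "\<And>y. y \<in> space \<nu> \<Longrightarrow> d y \<in> borel_measurable \<nu>"
    and d': "\<And>j x. j < k \<Longrightarrow> x \<in> space (N j) \<Longrightarrow> d' j x \<in> borel_measurable (N j)"
    and F: "\<And>j. j < k \<Longrightarrow> is_cover (\<epsilon> / real k) (\<delta> / real k) (distr \<nu> (N j) (f j)) (d' j) (F j)"
  shows "cov \<epsilon> \<delta> \<nu> d \<le> enat (\<Prod>j<k. card (F j))"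
proof -
  interpret prob_space \<nu> by fact
  define C where "C j = f j -` covered (distr \<nu> (N j) (f j)) (d' j) (\<delta> / real k) (F j) \<inter> space \<nu>" for j
  have fin: "finite (F j)" "F j \<subseteq> space (N j)" if "j < k" for j
    using F [OF that] by (auto simp: is_cover_def)
  have cmeas: "covered (distr \<nu> (N j) (f j)) (d' j) (\<delta> / real k) (F j) \<in> sets (N j)" if "j < k" for j
    using covered_measurable [of "F j" "d' j" "distr \<nu> (N j) (f j)"] fin [OF that] d' that by auto
  have C: "C j \<in> sets \<nu>" "measure \<nu> (C j) > 1 - \<epsilon> / real k" if "j < k" for j
    using cmeas [OF that] f [OF that] F [OF that]
    by (auto simp: C_def is_cover_def measure_distr intro: measurable_sets)
  let ?F = "g ` (\<Pi>\<^sub>E j\<in>{..<k}. F j)"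
  have Fsub: "(\<Pi>\<^sub>E j\<in>{..<k}. F j) \<subseteq> (\<Pi>\<^sub>E j\<in>{..<k}. space (N j))"
    using fin by (intro PiE_mono) auto
  have finF: "finite ?F" using fin by (intro finite_imageI finite_PiE) auto
  have "(\<Inter>j\<in>{..<k}. C j) \<subseteq> covered \<nu> d \<delta> ?F"
  proof
    fix y assume y: "y \<in> (\<Inter>j\<in>{..<k}. C j)"
    then have "y \<in> C 0" using k by auto
    then have ys: "y \<in> space \<nu>" by (simp add: C_def)
    have "\<exists>x\<in>F j. d' j x (f j y) < \<delta> / real k" if "j < k" for j
    proof -
      have "y \<in> C j" using y that by auto
      then show ?thesis by (auto simp: C_def covered_def)
    qed
    then obtain x where x: "\<And>j. j < k \<Longrightarrow> x j \<in> F j \<and> d' j (x j) (f j y) < \<delta> / real k" by metis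
    define x' where "x' = (\<lambda>j\<in>{..<k}. x j)"
    have x': "x' \<in> (\<Pi>\<^sub>E j\<in>{..<k}. F j)" using x by (auto simp: x'_def)
    have "d (g x') y \<le> (\<Sum>j<k. d' j (x' j) (f j y))"
      using x' Fsub ys by (intro le) auto
    also have "\<dots> < (\<Sum>j<k. \<delta> / real k)"
      using x k by (intro sum_strict_mono) (auto simp: x'_def)
    also have "\<dots> = \<delta>" using k by simp
    finally show "y \<in> covered \<nu> d \<delta> ?F" using x' ys by (auto simp: covered_def)
  qed
  moreover have "covered \<nu> d \<delta> ?F \<in> sets \<nu>"
  proof (rule covered_measurable [OF finF])
    fix y assume "y \<in> ?F"
    then obtain x where "x \<in> (\<Pi>\<^sub>E j\<in>{..<k}. F j)" "y = g x" by (rule imageE)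
    then have "y \<in> space \<nu>" using Fsub funcset_mem [OF g] by (simp add: subset_iff)
    then show "d y \<in> borel_measurable \<nu>" by (rule d)
  qed
  ultimately have "measure \<nu> (\<Inter>j\<in>{..<k}. C j) \<le> measure \<nu> (covered \<nu> d \<delta> ?F)"
    by (rule finite_measure_mono)
  moreover have "1 - \<epsilon> < measure \<nu> (\<Inter>j\<in>{..<k}. C j)"
  proof -
    have "measure \<nu> (space \<nu> - (\<Inter>j\<in>{..<k}. C j)) \<le> measure \<nu> (\<Union>j\<in>{..<k}. space \<nu> - C j)"
      using C k by (intro finite_measure_mono) auto
    also have "\<dots> \<le> (\<Sum>j<k. measure \<nu> (space \<nu> - C j))"
      using C by (intro finite_measure_subadditive_finite) auto
    also have "\<dots> < (\<Sum>j<k. \<epsilon> / real k)"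
    proof (rule sum_strict_mono)
      show "measure \<nu> (space \<nu> - C j) < \<epsilon> / real k" if "j \<in> {..<k}" for j
        using C [of j] that by (simp add: prob_compl)
    qed (use k in auto)
    also have "\<dots> = \<epsilon>" using k by simp
    finally show ?thesis
      using C(1) k by (subst (asm) prob_compl) auto
  qed
  moreover have "?F \<subseteq> space \<nu>"
  proof (rule image_subsetI)
    fix x assume "x \<in> (\<Pi>\<^sub>E j\<in>{..<k}. F j)"
    then show "g x \<in> space \<nu>" using Fsub funcset_mem [OF g] by (simp add: subset_iff)
  qed
  ultimately have "is_cover \<epsilon> \<delta> \<nu> d ?F"
    using finF by (simp add: is_cover_def)
  then have "cov \<epsilon> \<delta> \<nu> d \<le> enat (card ?F)" by (rule cov_le_card)
  also have "card ?F \<le> card (\<Pi>\<^sub>E j\<in>{..<k}. F j)"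
    using fin by (intro card_image_le finite_PiE) auto
  then have "enat (card ?F) \<le> enat (\<Prod>j<k. card (F j))" by (simp add: card_PiE)
  finally show ?thesis .
qed

text \<open>
  If \<open>N\<close> balls never suffice, then adding balls one by one, each carrying more than \<open>1/N\<close> of new
  mass, has to stop.  The mass that is still uncovered at that moment is at least \<open>\<epsilon>\<close>.
\<close>

lemma cov_imp_spread_out:
  assumes \<nu>: "prob_space \<nu>" and d: "\<And>x. x \<in> space \<nu> \<Longrightarrow> d x \<in> borel_measurable \<nu>"
    and N: "enat (Suc N) \<le> cov \<epsilon> \<delta> \<nu> d" and "0 < N" "0 < \<epsilon>"
  obtains R where "R \<in> sets \<nu>" "\<epsilon> \<le> measure \<nu> R"
    "\<And>x. x \<in> space \<nu> \<Longrightarrow> measure \<nu> (R \<inter> {y \<in> space \<nu>. d x y < \<delta>}) \<le> 1 / real N"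
proof (rule ccontr)
  interpret prob_space \<nu> by fact
  note goal = that
  assume no: "\<not> thesis"
  have "\<exists>F. finite F \<and> F \<subseteq> space \<nu> \<and> card F \<le> j \<and> real j / real N \<le> measure \<nu> (covered \<nu> d \<delta> F)"
    if "j \<le> N" for j
    using that
  proof (induction j)
    case 0
    show ?case by (intro exI [of _ "{}"]) auto
  next
    case (Suc j)
    then obtain F where F: "finite F" "F \<subseteq> space \<nu>" "card F \<le> j"
      "real j / real N \<le> measure \<nu> (covered \<nu> d \<delta> F)" by auto
    have small: "measure \<nu> (covered \<nu> d \<delta> F) \<le> 1 - \<epsilon>"
    proof (rule ccontr)
      assume "\<not> ?thesis"
      then have "is_cover \<epsilon> \<delta> \<nu> d F" using F by (simp add: is_cover_def)
      then have "cov \<epsilon> \<delta> \<nu> d \<le> enat (card F)" by (rule cov_le_card)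
      with N have "enat (Suc N) \<le> enat (card F)" by (rule order_trans)
      then show False using F Suc.prems by simp
    qed
    have cm: "covered \<nu> d \<delta> F \<in> sets \<nu>" using F d by (intro covered_measurable) auto
    let ?R = "space \<nu> - covered \<nu> d \<delta> F"
    have "\<epsilon> \<le> measure \<nu> ?R" using small cm by (simp add: prob_compl)
    then obtain x where x: "x \<in> space \<nu>" "1 / real N < measure \<nu> (?R \<inter> {y \<in> space \<nu>. d x y < \<delta>})"
      using no goal [of ?R] cm by (meson not_le sets.compl_sets)
    have [measurable]: "d x \<in> borel_measurable \<nu>" using d x by auto
    have eq: "covered \<nu> d \<delta> (insert x F) =
        covered \<nu> d \<delta> F \<union> (?R \<inter> {y \<in> space \<nu>. d x y < \<delta>})"
      by (auto simp: covered_def)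
    have "measure \<nu> (covered \<nu> d \<delta> (insert x F)) =
        measure \<nu> (covered \<nu> d \<delta> F) + measure \<nu> (?R \<inter> {y \<in> space \<nu>. d x y < \<delta>})"
      unfolding eq by (intro finite_measure_Union) (use cm in auto)
    then have "real (Suc j) / real N \<le> measure \<nu> (covered \<nu> d \<delta> (insert x F))"
      using x(2) F(4) by (simp add: add_divide_distrib)
    then show ?case
      using F x by (intro exI [of _ "insert x F"]) (auto simp: card_insert_if)
  qed
  from this [of N] obtain F where F: "finite F" "F \<subseteq> space \<nu>" "card F \<le> N"
      "1 \<le> measure \<nu> (covered \<nu> d \<delta> F)" using \<open>0 < N\<close> by auto
  then have "is_cover \<epsilon> \<delta> \<nu> d F" using \<open>0 < \<epsilon>\<close> by (simp add: is_cover_def)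
  then have "cov \<epsilon> \<delta> \<nu> d \<le> enat (card F)" by (rule cov_le_card)
  with N have "enat (Suc N) \<le> enat (card F)" by (rule order_trans)
  then show False using F by simp
qed

text \<open>
  The product of the spread-out parts has mass \<open>\<epsilon>\<^sup>k\<close> and meets each ball in mass at most
  \<open>N\<^sup>-\<^sup>k\<close>, because a ball of the product lies in a product of balls.
\<close>

lemma cov_power_ge:
  fixes k :: nat
  assumes \<nu>: "prob_space \<nu>" and k: "0 < k"
    and d: "\<And>x. x \<in> space \<nu> \<Longrightarrow> d x \<in> borel_measurable \<nu>"
    and N: "enat (Suc N) \<le> cov \<epsilon> \<delta> \<nu> d" "0 < N" and \<epsilon>: "0 < \<epsilon>"
    and g: "g \<in> measurable (PiM {..<k} (\<lambda>_. \<nu>)) Y"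
    and f: "\<And>j y. j < k \<Longrightarrow> y \<in> space Y \<Longrightarrow> f j y \<in> space \<nu>"
    and le: "\<And>j x y. j < k \<Longrightarrow> x \<in> space (PiM {..<k} (\<lambda>_. \<nu>)) \<Longrightarrow> y \<in> space Y \<Longrightarrow>
        d (f j y) (x j) \<le> d' y (g x)"
    and d': "\<And>y. y \<in> space Y \<Longrightarrow> d' y \<in> borel_measurable Y"
    and F: "is_cover (\<epsilon> ^ k / 2) \<delta> (distr (PiM {..<k} (\<lambda>_. \<nu>)) Y g) d' F"
  shows "\<epsilon> ^ k / 2 * real N ^ k \<le> real (card F)"
proof -
  obtain R where R: "R \<in> sets \<nu>" "\<epsilon> \<le> measure \<nu> R"
    "\<And>x. x \<in> space \<nu> \<Longrightarrow> measure \<nu> (R \<inter> {y \<in> space \<nu>. d x y < \<delta>}) \<le> 1 / real N"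
    using cov_imp_spread_out [OF \<nu> d N \<epsilon>] by blast
  interpret \<nu>: prob_space \<nu> by fact
  interpret P: prob_space "PiM {..<k} (\<lambda>_. \<nu>)" by (rule prob_space_PiM) (rule \<nu>)
  interpret pk: finite_product_prob_space "\<lambda>_. \<nu>" "{..<k}" by standard auto
  let ?P = "PiM {..<k} (\<lambda>_. \<nu>)"
  let ?D = "distr ?P Y g"
  have fin: "finite F" "F \<subseteq> space Y" using F by (auto simp: is_cover_def)
  define C where "C = g -` covered ?D d' \<delta> F \<inter> space ?P"
  have cm: "covered ?D d' \<delta> F \<in> sets Y"
    using covered_measurable [of F d' ?D] fin d' by auto
  have C: "C \<in> sets ?P" unfolding C_def using cm g by (auto intro: measurable_sets)
  have mC: "1 - \<epsilon> ^ k / 2 < measure ?P C"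
    using F cm g by (simp add: is_cover_def C_def measure_distr)
  define Rk where "Rk = (\<Pi>\<^sub>E j\<in>{..<k}. R)"
  have Rk: "Rk \<in> sets ?P" unfolding Rk_def using R by (intro sets_PiM_I_finite) auto
  have mRk: "\<epsilon> ^ k \<le> measure ?P Rk"
  proof -
    have "measure ?P Rk = (\<Prod>j<k. measure \<nu> R)" unfolding Rk_def
      using R by (intro pk.prob_times) auto
    then show ?thesis using R(2) \<epsilon> by (simp add: power_mono)
  qed
  define B where "B y = (\<Pi>\<^sub>E j\<in>{..<k}. R \<inter> {x \<in> space \<nu>. d (f j y) x < \<delta>})" for y
  have Bm: "R \<inter> {x \<in> space \<nu>. d (f j y) x < \<delta>} \<in> sets \<nu>" if "j < k" "y \<in> F" for j y
  proof -
    have [measurable]: "d (f j y) \<in> borel_measurable \<nu>" using d f that fin by auto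
    show ?thesis using R(1) by measurable
  qed
  have B: "B y \<in> sets ?P" "measure ?P (B y) \<le> (1 / real N) ^ k" if "y \<in> F" for y
  proof -
    show "B y \<in> sets ?P" unfolding B_def using Bm that by (intro sets_PiM_I_finite) auto
    have "measure ?P (B y) = (\<Prod>j<k. measure \<nu> (R \<inter> {x \<in> space \<nu>. d (f j y) x < \<delta>}))"
      unfolding B_def using Bm that by (intro pk.prob_times) auto
    also have "\<dots> \<le> (\<Prod>j<k. 1 / real N)"
      using R(3) f fin that by (intro prod_mono) auto
    finally show "measure ?P (B y) \<le> (1 / real N) ^ k" by simp
  qed
  have "Rk \<inter> C \<subseteq> (\<Union>y\<in>F. B y)"
  proof
    fix x assume x: "x \<in> Rk \<inter> C"
    then obtain y where y: "y \<in> F" "d' y (g x) < \<delta>" and xs: "x \<in> space ?P"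
      by (auto simp: C_def covered_def)
    have "d (f j y) (x j) < \<delta>" if "j < k" for j
      using le [OF that xs, of y] y fin by auto
    then have "x \<in> B y" using x xs by (auto simp: B_def Rk_def space_PiM PiE_iff)
    then show "x \<in> (\<Union>y\<in>F. B y)" using y by blast
  qed
  then have "measure ?P (Rk \<inter> C) \<le> measure ?P (\<Union>y\<in>F. B y)"
    using B fin by (intro P.finite_measure_mono) auto
  also have "\<dots> \<le> (\<Sum>y\<in>F. measure ?P (B y))"
    using B fin by (intro P.finite_measure_subadditive_finite) auto
  also have "\<dots> \<le> (\<Sum>y\<in>F. (1 / real N) ^ k)" using B by (intro sum_mono) auto
  finally have 1: "measure ?P (Rk \<inter> C) \<le> real (card F) * (1 / real N) ^ k" by simp
  have "measure ?P (Rk \<union> C) = measure ?P Rk + measure ?P C - measure ?P (Rk \<inter> C)"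
    by (rule measure_Un3) (use C Rk in \<open>auto simp: P.fmeasurable_eq_sets\<close>)
  then have "\<epsilon> ^ k / 2 \<le> measure ?P (Rk \<inter> C)"
    using P.prob_le_1 [of "Rk \<union> C"] mRk mC by linarith
  with 1 have "\<epsilon> ^ k / 2 \<le> real (card F) * (1 / real N) ^ k" by linarith
  then have "\<epsilon> ^ k / 2 * real N ^ k \<le> real (card F) * (1 / real N) ^ k * real N ^ k"
    by (intro mult_right_mono) auto
  then show ?thesis using N(2) by (simp add: power_divide)
qed

subsection \<open>The pseudometrics of finitely many coordinates\<close>

definition coord_dist :: "('n \<Rightarrow> 'a \<Rightarrow> real) \<Rightarrow> 'n set \<Rightarrow> 'v set \<Rightarrow> ('v \<Rightarrow> 'a) \<Rightarrow> ('v \<Rightarrow> 'a) \<Rightarrow> real" where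
  "coord_dist q F W x y = avg W (\<lambda>v. \<Sum>n\<in>F. \<bar>q n (x v) - q n (y v)\<bar>)"

lemma coord_dist_measurable:
  assumes q: "coordinates A q" and M: "sets M = sets (PiM W (\<lambda>_. A))"
  shows "coord_dist q F W x \<in> borel_measurable M"
proof -
  note [measurable] = coordinates_measurable [OF q]
  have [measurable]: "(\<lambda>y. q n (y v)) \<in> borel_measurable (PiM W (\<lambda>_. A))" if "v \<in> W" for v n
    using that by measurable
  have "(\<lambda>y. (\<Sum>v\<in>W. \<Sum>n\<in>F. \<bar>q n (x v) - q n (y v)\<bar>) / real (card W)) \<in> borel_measurable (PiM W (\<lambda>_. A))"
    by (intro borel_measurable_divide borel_measurable_sum) auto
  then show ?thesis unfolding coord_dist_def avg_def
    using measurable_cong_sets [OF M refl] by blast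
qed

text \<open>
  Words over a finite net of the alphabet, for the coordinates in \<open>F\<close>, form a cover.
\<close>

lemma coord_dist_cover:
  assumes q: "coordinates A q" and F: "finite F" and W: "finite W" "W \<noteq> {}"
    and m: "prob_space m" "sets m = sets (PiM W (\<lambda>_. A))" and e: "0 < \<epsilon>" "0 < \<delta>"
  shows "\<exists>C. is_cover \<epsilon> \<delta> m (coord_dist q F W) C"
proof -
  interpret prob_space m by fact
  have sp: "space m = (\<Pi>\<^sub>E v\<in>W. space A)" using sets_eq_imp_space_eq [OF m(2)] by (simp add: space_PiM)
  define \<eta> where "\<eta> = \<delta> / (real (card F) + 1)"
  have \<eta>: "0 < \<eta>" "real (card F) * \<eta> < \<delta>" using e by (auto simp: \<eta>_def field_simps)
  obtain R where R: "finite R" "R \<subseteq> space A" "\<And>a. a \<in> space A \<Longrightarrow> \<exists>r\<in>R. \<forall>n\<in>F. \<bar>q n r - q n a\<bar> \<le> \<eta>"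
    using coordinates_net [OF q F \<eta>(1)] by blast
  let ?C = "\<Pi>\<^sub>E v\<in>W. R"
  have "covered m (coord_dist q F W) \<delta> ?C = space m"
  proof (intro equalityI subsetI)
    fix y assume y: "y \<in> space m"
    then have "\<exists>r\<in>R. \<forall>n\<in>F. \<bar>q n r - q n (y v)\<bar> \<le> \<eta>" if "v \<in> W" for v
      using R(3) sp that by auto
    then obtain r where r: "\<And>v. v \<in> W \<Longrightarrow> r v \<in> R \<and> (\<forall>n\<in>F. \<bar>q n (r v) - q n (y v)\<bar> \<le> \<eta>)" by metis
    have "coord_dist q F W (restrict r W) y \<le> avg W (\<lambda>v. real (card F) * \<eta>)"
      unfolding coord_dist_def
    proof (intro avg_mono)
      fix v assume v: "v \<in> W"
      show "(\<Sum>n\<in>F. \<bar>q n (restrict r W v) - q n (y v)\<bar>) \<le> real (card F) * \<eta>"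
        using r [OF v] v sum_bounded_above [of F "\<lambda>n. \<bar>q n (restrict r W v) - q n (y v)\<bar>" \<eta>] by auto
    qed
    also have "\<dots> < \<delta>" using \<eta> W by (simp add: avg_const)
    finally show "y \<in> covered m (coord_dist q F W) \<delta> ?C"
      using y r by (auto simp: covered_def intro!: bexI [of _ "restrict r W"])
  qed (auto simp: covered_def)
  moreover have "finite ?C" using R W by (intro finite_PiE) auto
  moreover have "?C \<subseteq> space m" unfolding sp using R by (intro PiE_mono) auto
  ultimately show ?thesis using e by (intro exI [of _ ?C]) (auto simp: is_cover_def prob_space)
qed

section \<open>Coding by almost continuous maps\<close>

text \<open>
  Move on to the next \<open>j\<close> only after its requirement has become true for good.
\<close>

lemma diagonal_sequence:
  assumes "\<And>j. \<forall>\<^sub>F i in sequentially. R j i"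
  obtains s :: "nat \<Rightarrow> nat" where "filterlim s at_top sequentially" "\<forall>\<^sub>F i in sequentially. R (s i) i"
proof -
  obtain I where I: "\<And>j i. I j \<le> i \<Longrightarrow> R j i"
    using assms unfolding eventually_sequentially by metis
  define s where "s i = Max {j. j \<le> i \<and> (j = 0 \<or> I j \<le> i)}" for i
  have fin: "finite {j. j \<le> i \<and> (j = 0 \<or> I j \<le> i)}" for i by auto
  show ?thesis
  proof
    show "filterlim s at_top sequentially"
      unfolding filterlim_at_top eventually_sequentially
    proof
      fix Z
      have "Z \<le> s i" if "max Z (I Z) \<le> i" for i
        unfolding s_def by (rule Max_ge [OF fin]) (use that in auto)
      then show "\<exists>N. \<forall>i\<ge>N. Z \<le> s i" by blast
    qed
    have "R (s i) i" if "I 0 \<le> i" for i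
    proof -
      have "s i \<in> {j. j \<le> i \<and> (j = 0 \<or> I j \<le> i)}"
        unfolding s_def by (rule Max_in [OF fin]) auto
      then show ?thesis using that I by auto
    qed
    then show "\<forall>\<^sub>F i in sequentially. R (s i) i" unfolding eventually_sequentially by blast
  qed
qed

definition joint_coords ::
    "('n \<Rightarrow> 'a \<Rightarrow> real) \<Rightarrow> ('m \<Rightarrow> 'b \<Rightarrow> real) \<Rightarrow> ('g \<Rightarrow> 'a) \<Rightarrow> ('g \<Rightarrow> 'b) \<Rightarrow> 'g \<times> ('n + 'm) \<Rightarrow> real" where
  "joint_coords q p x y = (\<lambda>(g, k). case k of Inl n \<Rightarrow> q n (x g) | Inr n \<Rightarrow> p n (y g))"

lemma joint_coords_simps [simp]:
  "joint_coords q p x y (g, Inl n) = q n (x g)"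
  "joint_coords q p x y (g, Inr n') = p n' (y g)"
  by (simp_all add: joint_coords_def)

lemma cube_field_joint_coords:
  fixes X :: "'w \<Rightarrow> 'g \<Rightarrow> 'a" and Y :: "'w \<Rightarrow> 'g \<Rightarrow> 'b"
    and q :: "'n \<Rightarrow> 'a \<Rightarrow> real" and p :: "'m \<Rightarrow> 'b \<Rightarrow> real"
  assumes q: "coordinates A q" and X: "\<And>g. (\<lambda>w. X w g) \<in> measurable M A"
    and p: "coordinates B p" and Y: "\<And>g. (\<lambda>w. Y w g) \<in> measurable M B"
  shows "cube_field M (\<lambda>w. joint_coords q p (X w) (Y w))"
proof (rule cube_fieldI)
  fix j :: "'g \<times> ('n + 'm)"
  obtain g k where j: "j = (g, k)" by (cases j)
  show "(\<lambda>w. joint_coords q p (X w) (Y w) j) \<in> borel_measurable M"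
    using measurable_compose [OF X coordinates_measurable [OF q]]
      measurable_compose [OF Y coordinates_measurable [OF p]] by (cases k) (auto simp: j)
  fix w assume "w \<in> space M"
  then show "0 \<le> joint_coords q p (X w) (Y w) j \<and> joint_coords q p (X w) (Y w) j \<le> 1"
    using measurable_space [OF X] coordinates_range [OF q]
      measurable_space [OF Y] coordinates_range [OF p] by (cases k) (auto simp: j)
qed

text \<open>
  A measurable map \<open>\<phi>\<close> whose coordinates agree with polynomials up to a polynomial of small mean:
  round the polynomial approximations of the coordinates of \<open>f\<close> to the nearest element of a finite
  net.  The distance to the net is continuous, hence nearly a polynomial.
\<close>

lemma polynomial_approximation:
  fixes q :: "'n::countable \<Rightarrow> 'a \<Rightarrow> real" and p :: "'m \<Rightarrow> 'b \<Rightarrow> real"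
    and \<mu> :: "('g::countable \<Rightarrow> 'a) measure"
  assumes q: "coordinates A q" and p: "coordinates B p"
    and \<mu>: "prob_space \<mu>" "sets \<mu> = sets (PiM UNIV (\<lambda>_. A))"
    and f: "f \<in> measurable (PiM UNIV (\<lambda>_. A)) B" and F: "finite F" and e: "0 < e"
  obtains \<phi> a t where "\<phi> \<in> measurable (PiM UNIV (\<lambda>_. A)) B"
    "\<And>x n. x \<in> space (PiM UNIV (\<lambda>_. A)) \<Longrightarrow> n \<in> F \<Longrightarrow>
      \<bar>p n (\<phi> x) - pev (a n) (sequence_coords q x)\<bar> \<le> pev t (sequence_coords q x)"
    "\<And>n z. z \<in> unit_cube \<Longrightarrow> \<bar>pev (a n) z\<bar> \<le> 2"
    "(\<integral>x. pev t (sequence_coords q x) \<partial>\<mu>) \<le> e"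
    "\<And>n. n \<in> F \<Longrightarrow> (\<integral>x. \<bar>p n (f x) - pev (a n) (sequence_coords q x)\<bar> \<partial>\<mu>) \<le> e"
proof -
  interpret prob_space \<mu> by fact
  note [measurable_cong] = \<mu>(2)
  have sp: "space \<mu> = space (PiM UNIV (\<lambda>_. A))" by (rule sets_eq_imp_space_eq [OF \<mu>(2)])
  have f\<mu> [measurable]: "f \<in> measurable \<mu> B" using f by simp
  define \<eta> where "\<eta> = e / (2 * real (card F) + 2)"
  have \<eta>: "0 < \<eta>" "(2 * real (card F) + 2) * \<eta> = e" "\<eta> \<le> e"
  proof -
    show "0 < \<eta>" using e by (auto simp: \<eta>_def)
    show "(2 * real (card F) + 2) * \<eta> = e" by (simp add: \<eta>_def)
    moreover have "1 * \<eta> \<le> (2 * real (card F) + 2) * \<eta>"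
      using \<open>0 < \<eta>\<close> by (intro mult_right_mono) auto
    ultimately show "\<eta> \<le> e" by simp
  qed
  have comp_meas: "(\<lambda>x::'g \<Rightarrow> 'a. x g) \<in> measurable (PiM UNIV (\<lambda>_. A)) A" for g by simp
  have cf: "cube_field (PiM UNIV (\<lambda>_. A)) (\<lambda>x::'g \<Rightarrow> 'a. sequence_coords q x)"
    by (rule cube_field_sequence_coords [OF q comp_meas])
  have "(\<lambda>x::'g \<Rightarrow> 'a. x g) \<in> measurable \<mu> A" for g by measurable
  then have cf\<mu>: "cube_field \<mu> (\<lambda>x. sequence_coords q x)"
    by (rule cube_field_sequence_coords [OF q])
  have cu: "sequence_coords q x \<in> unit_cube" if "x \<in> space \<mu>" for x
    using cf\<mu> that by (auto simp: cube_field_def)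
  have gen: "\<exists>O'\<in>sets borel. S = (\<lambda>x. sequence_coords q x) -` O' \<inter> space \<mu>" if "S \<in> sets \<mu>" for S
    using sequence_coords_generate [OF q, of S] that \<mu>(2) sp by simp
  have "\<exists>a. (\<integral>x. \<bar>p n (f x) - pev a (sequence_coords q x)\<bar> \<partial>\<mu>) \<le> \<eta> \<and> (\<forall>z\<in>unit_cube. \<bar>pev a z\<bar> \<le> 2)" for n
  proof (rule pev_dense [OF \<mu>(1) cf\<mu> gen _ _ \<eta>(1), of "\<lambda>x. p n (f x)"])
    show "(\<lambda>x. p n (f x)) \<in> borel_measurable \<mu>"
      by (rule measurable_compose [OF f\<mu> coordinates_measurable [OF p]])
    show "x \<in> space \<mu> \<Longrightarrow> 0 \<le> p n (f x) \<and> p n (f x) \<le> 1" for x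
      using coordinates_range [OF p measurable_space [OF f\<mu>]] by blast
  qed blast+
  then obtain a where a: "\<And>n. (\<integral>x. \<bar>p n (f x) - pev (a n) (sequence_coords q x)\<bar> \<partial>\<mu>) \<le> \<eta>"
    "\<And>n z. z \<in> unit_cube \<Longrightarrow> \<bar>pev (a n) z\<bar> \<le> 2"
    by metis
  obtain R where R: "finite R" "R \<subseteq> space B" "\<And>b. b \<in> space B \<Longrightarrow> \<exists>r\<in>R. \<forall>n\<in>F. \<bar>p n r - p n b\<bar> \<le> \<eta>"
    using coordinates_net [OF p F \<eta>(1)] by blast
  have "R \<noteq> {}" using R(3) measurable_space [OF f\<mu>] not_empty by blast
  define D where "D r z = (\<Sum>n\<in>F. \<bar>p n r - pev (a n) z\<bar>)" for r and z :: "'g \<times> 'n \<Rightarrow> real"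
  define \<theta> where "\<theta> z = Min ((\<lambda>r. D r z) ` R)" for z
  have Dcont: "continuous_on S (D r)" for S r
    unfolding D_def by (intro continuous_intros continuous_on_pev)
  have \<theta>cont: "continuous_on S \<theta>" for S
    unfolding \<theta>_def using R(1) \<open>R \<noteq> {}\<close>
  proof (induction rule: finite_ne_induct)
    case (insert r R)
    then have "(\<lambda>z. Min ((\<lambda>r. D r z) ` insert r R)) = (\<lambda>z. min (D r z) (Min ((\<lambda>r. D r z) ` R)))"
      by (simp add: fun_eq_iff)
    then show ?case using insert Dcont by (auto intro!: continuous_intros)
  qed (simp add: Dcont)
  obtain t0 where t0: "\<And>z. z \<in> unit_cube \<Longrightarrow> \<bar>\<theta> z - pev t0 z\<bar> < \<eta>"
    using Stone_Weierstrass_pev [OF compact_unit_cube \<theta>cont \<eta>(1)] by blast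
  define t where "t = (\<eta>, []) # t0"
  have t: "\<theta> z \<le> pev t z" "pev t z \<le> \<theta> z + 2 * \<eta>" if "z \<in> unit_cube" for z
    using t0 [OF that] by (auto simp: t_def)
  obtain rs where rs: "set rs = R" using finite_list [OF R(1)] by blast
  have rs0: "rs \<noteq> []" using rs \<open>R \<noteq> {}\<close> by auto
  define ri where "ri k = (if k < length rs then rs ! k else hd rs)" for k
  have ri: "ri k \<in> R" for k using rs rs0 by (auto simp: ri_def)
  define \<phi> where "\<phi> x = ri (LEAST k. D (ri k) (sequence_coords q x) = \<theta> (sequence_coords q x))" for x :: "'g \<Rightarrow> 'a"
  have \<phi>: "D (\<phi> x) (sequence_coords q x) = \<theta> (sequence_coords q x)" for x
  proof -
    have "\<theta> (sequence_coords q x) \<in> (\<lambda>r. D r (sequence_coords q x)) ` R"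
      unfolding \<theta>_def by (rule Min_in) (use R(1) \<open>R \<noteq> {}\<close> in auto)
    then obtain r where r: "r \<in> R" "D r (sequence_coords q x) = \<theta> (sequence_coords q x)" by auto
    then obtain k where "k < length rs" "rs ! k = r" using rs by (metis in_set_conv_nth)
    then have "D (ri k) (sequence_coords q x) = \<theta> (sequence_coords q x)" using r by (simp add: ri_def)
    then show ?thesis unfolding \<phi>_def by (rule LeastI)
  qed
  have Dm: "(\<lambda>x. D r (sequence_coords q x)) \<in> borel_measurable (PiM UNIV (\<lambda>_. A))"
    and \<theta>m: "(\<lambda>x. \<theta> (sequence_coords q x)) \<in> borel_measurable (PiM UNIV (\<lambda>_. A))" for r
    by (rule measurable_compose [OF cube_field_borel [OF cf] borel_measurable_continuous_onI],
        rule Dcont \<theta>cont)+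
  have \<phi>m: "\<phi> \<in> measurable (PiM UNIV (\<lambda>_. A)) B"
  proof -
    have "(\<lambda>x. LEAST k. D (ri k) (sequence_coords q x) = \<theta> (sequence_coords q x))
        \<in> measurable (PiM UNIV (\<lambda>_. A)) (count_space UNIV)"
      by (rule measurable_Least) (unfold pred_def, rule borel_measurable_eq [OF Dm \<theta>m])
    moreover have "ri \<in> measurable (count_space UNIV) B" using ri R(2) by auto
    ultimately show ?thesis unfolding \<phi>_def by (rule measurable_compose)
  qed
  have bnd: "\<bar>p n (\<phi> x) - pev (a n) (sequence_coords q x)\<bar> \<le> pev t (sequence_coords q x)"
    if x: "x \<in> space (PiM UNIV (\<lambda>_. A))" and n: "n \<in> F" for x n
  proof -
    have "\<bar>p n (\<phi> x) - pev (a n) (sequence_coords q x)\<bar> \<le> D (\<phi> x) (sequence_coords q x)"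
      unfolding D_def by (rule member_le_sum [OF n]) (auto simp: F)
    then show ?thesis using \<phi> t(1) [OF cu] x sp by force
  qed
  have int_a: "integrable \<mu> (\<lambda>x. \<bar>p n (f x) - pev (a n) (sequence_coords q x)\<bar>)" for n
  proof (rule integrable_bounded [where C = "1 + 2"])
    show "(\<lambda>x. \<bar>p n (f x) - pev (a n) (sequence_coords q x)\<bar>) \<in> borel_measurable \<mu>"
      using measurable_compose [OF f\<mu> coordinates_measurable [OF p]] cube_field_pev(1) [OF cf\<mu>]
      by (intro borel_measurable_abs borel_measurable_diff) auto
    fix x assume x: "x \<in> space \<mu>"
    show "\<bar>\<bar>p n (f x) - pev (a n) (sequence_coords q x)\<bar>\<bar> \<le> 1 + 2"
      using a(2) [OF cu [OF x], of n] coordinates_range [OF p measurable_space [OF f\<mu> x], of n] by linarith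
  qed
  have "(\<integral>x. pev t (sequence_coords q x) \<partial>\<mu>) \<le>
      (\<integral>x. real (card F) * \<eta> + (\<Sum>n\<in>F. \<bar>p n (f x) - pev (a n) (sequence_coords q x)\<bar>) + 2 * \<eta> \<partial>\<mu>)"
  proof (rule integral_mono)
    show "integrable \<mu> (\<lambda>x. pev t (sequence_coords q x))"
      by (rule integrable_bounded) (rule cube_field_pev [OF cf\<mu>])+
    show "integrable \<mu> (\<lambda>x. real (card F) * \<eta> + (\<Sum>n\<in>F. \<bar>p n (f x) - pev (a n) (sequence_coords q x)\<bar>) + 2 * \<eta>)"
      using int_a by auto
    fix x assume x: "x \<in> space \<mu>"
    then obtain r where r: "r \<in> R" "\<forall>n\<in>F. \<bar>p n r - p n (f x)\<bar> \<le> \<eta>"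
      using R(3) measurable_space [OF f\<mu>] by blast
    have "\<theta> (sequence_coords q x) \<le> D r (sequence_coords q x)"
      unfolding \<theta>_def by (rule Min_le) (use R(1) r in auto)
    also have "\<dots> \<le> (\<Sum>n\<in>F. \<eta> + \<bar>p n (f x) - pev (a n) (sequence_coords q x)\<bar>)"
      unfolding D_def using r(2) by (intro sum_mono) force
    finally show "pev t (sequence_coords q x) \<le> real (card F) * \<eta> +
        (\<Sum>n\<in>F. \<bar>p n (f x) - pev (a n) (sequence_coords q x)\<bar>) + 2 * \<eta>"
      using t(2) [OF cu [OF x]] by (simp add: sum.distrib)
  qed
  also have "\<dots> = real (card F) * \<eta> + (\<Sum>n\<in>F. \<integral>x. \<bar>p n (f x) - pev (a n) (sequence_coords q x)\<bar> \<partial>\<mu>) + 2 * \<eta>"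
    using int_a by (simp add: prob_space Bochner_Integration.integral_sum)
  also have "\<dots> \<le> real (card F) * \<eta> + (\<Sum>n\<in>F. \<eta>) + 2 * \<eta>"
    using a(1) by (intro add_mono sum_mono) auto
  also have "\<dots> = e" using \<eta>(2) by (simp add: algebra_simps)
  finally have "(\<integral>x. pev t (sequence_coords q x) \<partial>\<mu>) \<le> e" .
  then show ?thesis
    using that [of \<phi> a t] \<phi>m bnd a \<eta>(3) order_trans by blast
qed

locale sofic_sequence =
  fixes W :: "nat \<Rightarrow> 'v set" and s :: "nat \<Rightarrow> 'g::{group_add,countable} \<Rightarrow> 'v \<Rightarrow> 'v"
  assumes fin: "finite (W i)" and nonempty: "W i \<noteq> {}" and perm: "s i g permutes W i"
    and approx: "(\<lambda>i. real (card {v \<in> W i. s i g (s i h v) = s i (g + h) v}) / real (card (W i))) \<longlonglongrightarrow> 1"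
begin

lemma map_in: "v \<in> W i \<Longrightarrow> s i g v \<in> W i"
  using permutes_in_image [OF perm] by blast

lemma defect_tendsto_0:
  "(\<lambda>i. avg (W i) (\<lambda>v. of_bool (s i g (s i h v) \<noteq> s i (g + h) v))) \<longlonglongrightarrow> 0"
proof -
  have "avg (W i) (\<lambda>v. of_bool (s i g (s i h v) \<noteq> s i (g + h) v)) =
      1 - real (card {v \<in> W i. s i g (s i h v) = s i (g + h) v}) / real (card (W i))" for i
  proof -
    have "avg (W i) (\<lambda>v. of_bool (s i g (s i h v) \<noteq> s i (g + h) v)) =
        avg (W i) (\<lambda>v. 1 - of_bool (s i g (s i h v) = s i (g + h) v))"
      by (rule avg_cong) auto
    also have "\<dots> = 1 - avg (W i) (\<lambda>v. of_bool (s i g (s i h v) = s i (g + h) v))"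
      by (simp add: avg_diff avg_const fin nonempty)
    also have "avg (W i) (\<lambda>v. of_bool (s i g (s i h v) = s i (g + h) v)) =
        real (card {v \<in> W i. s i g (s i h v) = s i (g + h) v}) / real (card (W i))"
      by (simp add: avg_def fin Int_def)
    finally show ?thesis .
  qed
  then show ?thesis using tendsto_diff [OF tendsto_const [of 1] approx [of g h]] by simp
qed

end

lemma (in prob_space) integral_mult_diff_le:
  fixes f g f' g' :: "'a \<Rightarrow> real"
  assumes meas: "f \<in> borel_measurable M" "g \<in> borel_measurable M" "f' \<in> borel_measurable M" "g' \<in> borel_measurable M"
    and bd: "\<And>x. x \<in> space M \<Longrightarrow> \<bar>f x\<bar> \<le> 1" "\<And>x. x \<in> space M \<Longrightarrow> \<bar>g x\<bar> \<le> 1"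
      "\<And>x. x \<in> space M \<Longrightarrow> \<bar>f' x\<bar> \<le> C" "\<And>x. x \<in> space M \<Longrightarrow> \<bar>g' x\<bar> \<le> C'"
  shows "\<bar>(\<integral>x. f x * g x \<partial>M) - (\<integral>x. f' x * g' x \<partial>M)\<bar> \<le>
      (\<integral>x. \<bar>f x - f' x\<bar> \<partial>M) + C * (\<integral>x. \<bar>g x - g' x\<bar> \<partial>M)"
proof -
  note [measurable] = meas
  have C: "0 \<le> C" "0 \<le> C'" using bd(3,4) not_empty abs_ge_zero order_trans by blast+
  have int1: "integrable M (\<lambda>x. f x * g x)"
    by (rule integrable_bounded [where C = "1 * 1"]) (use bd(1,2) in \<open>auto simp: abs_mult mult_le_one\<close>)
  have int2: "integrable M (\<lambda>x. f' x * g' x)"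
    by (rule integrable_bounded [where C = "C * C'"]) (use bd(3,4) C in \<open>auto simp: abs_mult intro!: mult_mono\<close>)
  have int3: "integrable M (\<lambda>x. \<bar>f x - f' x\<bar>)"
    by (rule integrable_bounded [where C = "1 + C"])
      (use bd(1,3) in \<open>auto intro!: order_trans [OF abs_triangle_ineq4] add_mono\<close>)
  have int4: "integrable M (\<lambda>x. \<bar>g x - g' x\<bar>)"
    by (rule integrable_bounded [where C = "1 + C'"])
      (use bd(2,4) in \<open>auto intro!: order_trans [OF abs_triangle_ineq4] add_mono\<close>)
  have "\<bar>(\<integral>x. f x * g x \<partial>M) - (\<integral>x. f' x * g' x \<partial>M)\<bar> = \<bar>\<integral>x. f x * g x - f' x * g' x \<partial>M\<bar>"
    using int1 int2 by simp
  also have "\<dots> \<le> (\<integral>x. \<bar>f x * g x - f' x * g' x\<bar> \<partial>M)" by (rule integral_abs_bound)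
  also have "\<dots> \<le> (\<integral>x. \<bar>f x - f' x\<bar> + C * \<bar>g x - g' x\<bar> \<partial>M)"
  proof (rule integral_mono)
    fix x assume x: "x \<in> space M"
    have "f x * g x - f' x * g' x = (f x - f' x) * g x + f' x * (g x - g' x)" by algebra
    also have "\<bar>\<dots>\<bar> \<le> \<bar>f x - f' x\<bar> * \<bar>g x\<bar> + \<bar>f' x\<bar> * \<bar>g x - g' x\<bar>"
      by (simp add: abs_mult [symmetric] abs_triangle_ineq)
    also have "\<dots> \<le> \<bar>f x - f' x\<bar> * 1 + C * \<bar>g x - g' x\<bar>"
      using bd(2,3) [OF x] by (intro add_mono mult_mono) auto
    finally show "\<bar>f x * g x - f' x * g' x\<bar> \<le> \<bar>f x - f' x\<bar> + C * \<bar>g x - g' x\<bar>" by simp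
  qed (use int1 int2 int3 int4 in auto)
  also have "\<dots> = (\<integral>x. \<bar>f x - f' x\<bar> \<partial>M) + C * (\<integral>x. \<bar>g x - g' x\<bar> \<partial>M)"
    using int3 int4 by simp
  finally show ?thesis .
qed

text \<open>
  Substituting polynomials for the variables of a monomial gives a polynomial.
\<close>

lemma pev_subst_monomial: "\<exists>p. \<forall>z. pev p z = monomial L (\<lambda>k. pev (u k) z)"
proof (induction L)
  case Nil
  show ?case by (rule exI [of _ "[(1, [])]"]) simp
next
  case (Cons k L)
  then obtain p where "\<forall>z. pev p z = monomial L (\<lambda>k. pev (u k) z)" by blast
  then show ?case by (intro exI [of _ "pmul (u k) p"]) (simp add: pev_pmul)
qed

locale coding = sofic_sequence W s
  for W :: "nat \<Rightarrow> 'v set" and s :: "nat \<Rightarrow> 'g::{group_add,countable} \<Rightarrow> 'v \<Rightarrow> 'v" +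
  fixes m :: "nat \<Rightarrow> ('v \<Rightarrow> 'a) measure"
    and A :: "'a measure" and q :: "'n::countable \<Rightarrow> 'a \<Rightarrow> real"
    and B :: "'b measure" and p :: "'m::countable \<Rightarrow> 'b \<Rightarrow> real"
    and P :: "'u measure" and X :: "'u \<Rightarrow> 'g \<Rightarrow> 'a" and Y :: "'u \<Rightarrow> 'g \<Rightarrow> 'b" and f :: "('g \<Rightarrow> 'a) \<Rightarrow> 'b"
  assumes q: "coordinates A q" and p: "coordinates B p"
    and prob_m: "prob_space (m i)" and sets_m: "sets (m i) = sets (PiM (W i) (\<lambda>_. A))"
    and prob_P: "prob_space P"
    and X: "\<And>g. (\<lambda>w. X w g) \<in> measurable P A" and Y: "\<And>g. (\<lambda>w. Y w g) \<in> measurable P B"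
    and f: "f \<in> measurable (PiM UNIV (\<lambda>_. A)) B"
    and code: "\<And>g. AE w in P. Y w g = f (shift g (X w))"
    and stationary: "\<And>g. distr P (PiM UNIV (\<lambda>_. A)) (\<lambda>w. shift g (X w)) = distr P (PiM UNIV (\<lambda>_. A)) X"
    and conv: "pair_converges W m (\<lambda>i v x. sequence_coords q (pullback_name (s i) v x)) P (\<lambda>w. sequence_coords q (X w))"
begin

abbreviation "Seq \<equiv> PiM (UNIV :: 'g set) (\<lambda>_. A)"

abbreviation "z \<equiv> \<lambda>i v x. sequence_coords q (pullback_name (s i) v x)"

lemma measurable_m: "h \<in> measurable (PiM (W i) (\<lambda>_. A)) N \<Longrightarrow> h \<in> measurable (m i) N"
  by (simp add: measurable_cong_sets [OF sets_m refl])

lemma component_m: "v \<in> W i \<Longrightarrow> (\<lambda>x. x v) \<in> measurable (m i) A"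
  using measurable_component_singleton [of v "W i" "\<lambda>_. A"] measurable_cong_sets [OF sets_m refl] by blast

lemma pullback_component: "v \<in> W i \<Longrightarrow> (\<lambda>x. pullback_name (s i) v x g) \<in> measurable (m i) A"
  using component_m [OF map_in] by (simp add: pullback_name_def)

lemma pullback_measurable: "v \<in> W i \<Longrightarrow> pullback_name (s i) v \<in> measurable (m i) Seq"
  using pullback_component by (intro measurable_PiM_single') (auto simp: space_PiM dest: measurable_space)

lemma X_measurable: "X \<in> measurable P Seq"
  using X by (intro measurable_PiM_single') (auto dest: measurable_space)

lemma shift_measurable: "shift g \<in> measurable Seq Seq"
  by (rule measurable_PiM_single') (auto simp: shift_def space_PiM PiE_iff)

lemma cube_field_z: "v \<in> W i \<Longrightarrow> cube_field (m i) (z i v)"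
  by (rule cube_field_sequence_coords [OF q pullback_component])

lemma cube_field_X: "cube_field P (\<lambda>w. sequence_coords q (X w))"
  by (rule cube_field_sequence_coords [OF q X])

sublocale field_sequence W m z P "\<lambda>w. sequence_coords q (X w)"
  by (rule field_sequence.intro)
    (rule fin nonempty prob_m prob_P cube_field_X | erule cube_field_z)+

definition block_code :: "(('g \<Rightarrow> 'a) \<Rightarrow> 'b) \<Rightarrow> nat \<Rightarrow> ('v \<Rightarrow> 'a) \<Rightarrow> 'v \<Rightarrow> 'b" where
  "block_code \<phi> i x = (\<lambda>v\<in>W i. \<phi> (pullback_name (s i) v x))"

lemma block_code_measurable:
  assumes "\<phi> \<in> measurable Seq B"
  shows "block_code \<phi> i \<in> measurable (PiM (W i) (\<lambda>_. A)) (PiM (W i) (\<lambda>_. B))"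
proof -
  have "(\<lambda>x. \<phi> (pullback_name (s i) v x)) \<in> measurable (PiM (W i) (\<lambda>_. A)) B" if "v \<in> W i" for v
    using measurable_compose [OF pullback_measurable [OF that] assms]
      measurable_cong_sets [OF sets_m refl] by blast
  then show ?thesis unfolding block_code_def by (intro measurable_restrict) auto
qed

definition joint_discrepancy where
  "joint_discrepancy \<Psi> L L' i = avg (W i) (\<lambda>v. avg (W i) (\<lambda>w.
     \<bar>(\<integral>x. monomial L (joint_coords q p (pullback_name (s i) v x) (pullback_name (s i) v (\<Psi> i x))) *
          monomial L' (joint_coords q p (pullback_name (s i) w x) (pullback_name (s i) w (\<Psi> i x))) \<partial>m i)
      - (\<integral>y. monomial L (joint_coords q p (X y) (Y y)) \<partial>P) * (\<integral>y. monomial L' (joint_coords q p (X y) (Y y)) \<partial>P)\<bar>))"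

text \<open>
  All coordinates of the first process, and those in \<open>F\<close> of the second.
\<close>

definition coded_index :: "'m set \<Rightarrow> 'g \<times> ('n + 'm) \<Rightarrow> bool" where
  "coded_index F j \<longleftrightarrow> (case snd j of Inl _ \<Rightarrow> True | Inr n \<Rightarrow> n \<in> F)"

text \<open>
  The factor by which errors in variables bounded by 2 are amplified in a monomial.
\<close>

definition loss :: "'j list \<Rightarrow> real" where
  "loss L = 2 ^ length L * real (length L)"

text \<open>
  The letter of the coded model at \<open>v\<close> is a nearly polynomial map \<open>\<phi>\<close>, applied to the name seen at
  \<open>v\<close>.  The name of the coded model at \<open>v\<close> involves the letters at \<open>\<sigma>\<^sup>g v\<close>, hence the names seen
  there, which are the shifted names for most \<open>v\<close> because \<open>\<sigma>\<close> is nearly an action.  So a monomial of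
  the joint name is close in mean to a polynomial in the name of the model, for which the pair
  convergence of the model applies, and the same substitution is valid in the limit.
\<close>

lemma code_step:
  assumes F: "finite F" and e: "0 < e"
  shows "\<exists>\<Psi>. (\<forall>i. \<Psi> i \<in> measurable (PiM (W i) (\<lambda>_. A)) (PiM (W i) (\<lambda>_. B))) \<and>
    (\<forall>L L'. (\<forall>j\<in>set L \<union> set L'. coded_index F j) \<longrightarrow>
      (\<forall>\<^sub>F i in sequentially. joint_discrepancy \<Psi> L L' i \<le> (3 * loss L + 3 * 2 ^ length L * loss L' + 1) * e))"
proof -
  let ?\<mu> = "distr P Seq X"
  interpret \<mu>: prob_space ?\<mu> by (rule prob_space.prob_space_distr [OF prob_P X_measurable])
  interpret P: prob_space P by (rule prob_P)
  interpret m: prob_space "m i" for i by (rule prob_m)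
  obtain \<phi> a t where \<phi>: "\<phi> \<in> measurable Seq B"
    and bnd: "\<And>x n. x \<in> space Seq \<Longrightarrow> n \<in> F \<Longrightarrow>
      \<bar>p n (\<phi> x) - pev (a n) (sequence_coords q x)\<bar> \<le> pev t (sequence_coords q x)"
    and a2: "\<And>n z. z \<in> unit_cube \<Longrightarrow> \<bar>pev (a n) z\<bar> \<le> 2"
    and t: "(\<integral>x. pev t (sequence_coords q x) \<partial>?\<mu>) \<le> e"
    and fa: "\<And>n. n \<in> F \<Longrightarrow> (\<integral>x. \<bar>p n (f x) - pev (a n) (sequence_coords q x)\<bar> \<partial>?\<mu>) \<le> e"
    using polynomial_approximation [OF q p \<mu>.prob_space_axioms sets_distr f F e] by blast
  define \<Psi> where "\<Psi> = block_code \<phi>"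
  define J where "J i v x = joint_coords q p (pullback_name (s i) v x) (pullback_name (s i) v (\<Psi> i x))" for i v x
  \<comment> \<open>The coordinates of the joint name, as polynomials in the coordinates of the first name.\<close>
  define u where "u = (\<lambda>(g::'g, k). case k of Inl n \<Rightarrow> [(1::real, [(g, n)])] | Inr n \<Rightarrow> pmap (\<lambda>(h, n'). (h + g, n')) (a n))"
  have u_Inl [simp]: "pev (u (g, Inl n)) y = y (g, n)" for g n y by (simp add: u_def)
  have u_Inr [simp]: "pev (u (g, Inr n)) y = pev (a n) (\<lambda>(h, n'). y (h + g, n'))" for g n y
    by (simp add: u_def pev_pmap case_prod_unfold)
  have shift_coords: "(\<lambda>(h, n'). sequence_coords q x (h + g, n')) = sequence_coords q (shift g x)" for x :: "'g \<Rightarrow> 'a" and g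
    by (auto simp: sequence_coords_def shift_def)
  have u2: "\<bar>pev (u j) y\<bar> \<le> 2" if "y \<in> unit_cube" for j y
  proof -
    obtain g k where j: "j = (g, k)" by (cases j)
    have c: "(\<lambda>(h, n'). y (h + g, n')) \<in> unit_cube" using that by (auto simp: unit_cube_def)
    show ?thesis
    proof (cases k)
      case (Inl n)
      have "\<bar>y (g, n)\<bar> \<le> 2" using unit_cubeD [OF that, of "(g, n)"] by linarith
      then show ?thesis by (simp add: j Inl)
    next
      case (Inr n)
      then show ?thesis using a2 [OF c, of n] by (simp add: j)
    qed
  qed
  obtain b where b: "\<And>L y. pev (b L) y = monomial L (\<lambda>j. pev (u j) y)"
    using pev_subst_monomial [where u = u] by metis
  have b2: "\<bar>pev (b L) y\<bar> \<le> 2 ^ length L" if "y \<in> unit_cube" for L y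
    unfolding b by (rule monomial_bound) (rule u2 [OF that])
  have \<Psi>m: "\<Psi> i \<in> measurable (PiM (W i) (\<lambda>_. A)) (PiM (W i) (\<lambda>_. B))" for i
    unfolding \<Psi>_def by (rule block_code_measurable [OF \<phi>])
  have \<Psi>m': "(\<lambda>x. pullback_name (s i) v (\<Psi> i x) g) \<in> measurable (m i) B" if "v \<in> W i" for i v g
  proof -
    have "(\<lambda>x. \<Psi> i x (s i g v)) \<in> measurable (PiM (W i) (\<lambda>_. A)) B"
      by (rule measurable_compose [OF \<Psi>m measurable_component_singleton]) (rule map_in [OF that])
    then show ?thesis unfolding pullback_name_def by (rule measurable_m)
  qed
  have cJ: "cube_field (m i) (J i v)" if "v \<in> W i" for i v
    unfolding J_def by (rule cube_field_joint_coords [OF q pullback_component [OF that] p \<Psi>m' [OF that]])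
  have cXY: "cube_field P (\<lambda>w. joint_coords q p (X w) (Y w))"
    by (rule cube_field_joint_coords [OF q X p Y])
  define err where "err i j v x = (case snd j of Inl _ \<Rightarrow> 0 | Inr n \<Rightarrow>
      pev t (z i (s i (fst j) v) x) +
      2 * pnorm (a n) * (\<Sum>h\<in>fst ` psupp (a n). of_bool (s i h (s i (fst j) v) \<noteq> s i (h + fst j) v)))"
    for i and j :: "'g \<times> ('n + 'm)" and v x
  have zc: "z i v x \<in> unit_cube" if "v \<in> W i" "x \<in> space (m i)" for i v x
    using cube_field_z [OF that(1)] that(2) by (simp add: cube_field_def)
  have shc: "sequence_coords q (shift g (pullback_name (s i) v x)) \<in> unit_cube"
    if "v \<in> W i" "x \<in> space (m i)" for i v x g
    using zc [OF that] by (auto simp: unit_cube_def sequence_coords_def shift_def)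
  have err: "\<bar>J i v x j - pev (u j) (z i v x)\<bar> \<le> err i j v x"
    if j: "coded_index F j" and v: "v \<in> W i" and x: "x \<in> space (m i)" for i v x j
  proof -
    obtain g k where jk: "j = (g, k)" by (cases j)
    show ?thesis
    proof (cases k)
      case (Inl n)
      then show ?thesis by (simp add: jk J_def err_def)
    next
      case (Inr n)
      have n: "n \<in> F" using j by (simp add: coded_index_def jk Inr)
      have v': "s i g v \<in> W i" by (rule map_in [OF v])
      have "J i v x j = p n (\<phi> (pullback_name (s i) (s i g v) x))"
        using v' by (simp add: jk Inr J_def \<Psi>_def block_code_def pullback_name_def)
      moreover have "pullback_name (s i) (s i g v) x \<in> space Seq"
        by (rule measurable_space [OF pullback_measurable [OF v'] x])
      ultimately have 1: "\<bar>J i v x j - pev (a n) (z i (s i g v) x)\<bar> \<le> pev t (z i (s i g v) x)"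
        using bnd n by simp
      have 2: "\<bar>pev (a n) (z i (s i g v) x) - pev (a n) (sequence_coords q (shift g (pullback_name (s i) v x)))\<bar>
        \<le> 2 * pnorm (a n) * (\<Sum>h\<in>fst ` psupp (a n). of_bool (s i h (s i g v) \<noteq> s i (h + g) v))"
      proof (cases "\<forall>h\<in>fst ` psupp (a n). s i h (s i g v) = s i (h + g) v")
        case True
        then have "pev (a n) (z i (s i g v) x) = pev (a n) (sequence_coords q (shift g (pullback_name (s i) v x)))"
          by (intro pev_cong) (force simp: sequence_coords_def shift_def pullback_name_def)
        then show ?thesis by (simp add: sum_nonneg)
      next
        case False
        then obtain h where h: "h \<in> fst ` psupp (a n)" "s i h (s i g v) \<noteq> s i (h + g) v" by blast
        have "(of_bool (s i h (s i g v) \<noteq> s i (h + g) v) :: real)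
            \<le> (\<Sum>h\<in>fst ` psupp (a n). of_bool (s i h (s i g v) \<noteq> s i (h + g) v))"
          by (rule member_le_sum [OF h(1)]) auto
        then have ge: "1 \<le> (\<Sum>h\<in>fst ` psupp (a n). of_bool (s i h (s i g v) \<noteq> s i (h + g) v) :: real)"
          using h(2) by simp
        have "\<bar>pev (a n) (z i (s i g v) x)\<bar> \<le> pnorm (a n)"
          "\<bar>pev (a n) (sequence_coords q (shift g (pullback_name (s i) v x)))\<bar> \<le> pnorm (a n)"
          by (rule pev_bound, rule unit_cubeD, rule zc [OF v' x],
              rule pev_bound, rule unit_cubeD, rule shc [OF v x])
        then have "\<bar>pev (a n) (z i (s i g v) x) - pev (a n) (sequence_coords q (shift g (pullback_name (s i) v x)))\<bar>
            \<le> 2 * pnorm (a n) * 1" by linarith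
        also have "\<dots> \<le> 2 * pnorm (a n) * (\<Sum>h\<in>fst ` psupp (a n). of_bool (s i h (s i g v) \<noteq> s i (h + g) v))"
          using ge by (intro mult_left_mono) auto
        finally show ?thesis .
      qed
      have "pev (u j) (z i v x) = pev (a n) (sequence_coords q (shift g (pullback_name (s i) v x)))"
        by (simp only: jk Inr u_Inr shift_coords)
      then show ?thesis using 1 2 by (simp add: err_def jk Inr)
    qed
  qed
  have err_int: "integrable (m i) (err i j v)" if v: "v \<in> W i" for i j v
    using integrable_pev [OF map_in [OF v], where p = t] by (cases "snd j") (auto simp: err_def [abs_def])
  have tP: "(\<integral>w. pev t (sequence_coords q (X w)) \<partial>P) \<le> e"
  proof -
    have "(\<lambda>x. pev t (sequence_coords q x)) \<in> borel_measurable Seq"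
      by (rule cube_field_pev) (rule cube_field_sequence_coords [OF q], simp)
    then show ?thesis using t by (subst (asm) integral_distr [OF X_measurable])
  qed
  have err_lim: "\<forall>\<^sub>F i in sequentially. avg (W i) (\<lambda>v. \<integral>x. err i j v x \<partial>m i) \<le> 2 * e" for j
  proof (cases "snd j")
    case (Inl n)
    then show ?thesis using e by (simp add: err_def [abs_def] avg_const fin nonempty)
  next
    case (Inr n)
    let ?g = "fst j"
    let ?E = "\<lambda>i. avg (W i) (\<lambda>v. \<integral>x. pev t (z i v x) \<partial>m i) +
        2 * pnorm (a n) * (\<Sum>h\<in>fst ` psupp (a n). avg (W i) (\<lambda>v. of_bool (s i h (s i ?g v) \<noteq> s i (h + ?g) v)))"
    have eq: "avg (W i) (\<lambda>v. \<integral>x. err i j v x \<partial>m i) = ?E i" for i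
    proof -
      have "avg (W i) (\<lambda>v. \<integral>x. err i j v x \<partial>m i) =
          avg (W i) (\<lambda>v. (\<integral>x. pev t (z i (s i ?g v) x) \<partial>m i) +
            2 * pnorm (a n) * (\<Sum>h\<in>fst ` psupp (a n). of_bool (s i h (s i ?g v) \<noteq> s i (h + ?g) v)))"
        using integrable_pev [OF map_in] m.prob_space
        by (intro avg_cong) (simp add: err_def Inr)
      also have "\<dots> = ?E i"
        using avg_permutes [OF perm [of i ?g], of "\<lambda>v. \<integral>x. pev t (z i v x) \<partial>m i"]
        by (simp only: avg_add avg_cmult avg_sum)
      finally show ?thesis .
    qed
    have "?E \<longlonglongrightarrow> (\<integral>w. pev t (sequence_coords q (X w)) \<partial>P) + 2 * pnorm (a n) * (\<Sum>h\<in>fst ` psupp (a n). 0)"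
      by (intro tendsto_add tendsto_mult tendsto_sum tendsto_const pair_converges_mean [OF conv] defect_tendsto_0)
    then have "\<forall>\<^sub>F i in sequentially. ?E i < 2 * e"
      by (rule order_tendstoD) (use tP e in simp)
    then show ?thesis unfolding eq by eventually_elim simp
  qed
  define M where "M i L = avg (W i) (\<lambda>v. \<integral>x. \<bar>monomial L (J i v x) - pev (b L) (z i v x)\<bar> \<partial>m i)" for i L
  have int_diff: "integrable (m i) (\<lambda>x. \<bar>monomial L (J i v x) - pev (b L) (z i v x)\<bar>)" if v: "v \<in> W i" for i L v
  proof (rule m.integrable_bounded [where C = "1 + pnorm (b L)"])
    show "(\<lambda>x. \<bar>monomial L (J i v x) - pev (b L) (z i v x)\<bar>) \<in> borel_measurable (m i)"
      using cube_field_monomial(1) [OF cJ [OF v]] cube_field_pev(1) [OF cube_field_z [OF v]] by auto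
    fix x assume x: "x \<in> space (m i)"
    show "\<bar>\<bar>monomial L (J i v x) - pev (b L) (z i v x)\<bar>\<bar> \<le> 1 + pnorm (b L)"
      using cube_field_monomial(2) [OF cJ [OF v] x, of L] cube_field_pev(2) [OF cube_field_z [OF v] x, of "b L"]
      by linarith
  qed
  have M: "\<forall>\<^sub>F i in sequentially. M i L \<le> 2 * loss L * e" if L: "\<forall>j\<in>set L. coded_index F j" for L
  proof -
    have le: "M i L \<le> 2 ^ length L * (\<Sum>j\<leftarrow>L. avg (W i) (\<lambda>v. \<integral>x. err i j v x \<partial>m i))" for i
    proof -
      have "M i L \<le> avg (W i) (\<lambda>v. 2 ^ length L * (\<Sum>j\<leftarrow>L. \<integral>x. err i j v x \<partial>m i))"
        unfolding M_def
      proof (rule avg_mono)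
        fix v assume v: "v \<in> W i"
        have ints: "integrable (m i) (\<lambda>x. \<Sum>j\<leftarrow>L. err i j v x)"
          and eqs: "(\<integral>x. (\<Sum>j\<leftarrow>L. err i j v x) \<partial>m i) = (\<Sum>j\<leftarrow>L. \<integral>x. err i j v x \<partial>m i)"
          using err_int [OF v] by (induction L) auto
        have "(\<integral>x. \<bar>monomial L (J i v x) - pev (b L) (z i v x)\<bar> \<partial>m i) \<le>
            (\<integral>x. 2 ^ length L * (\<Sum>j\<leftarrow>L. err i j v x) \<partial>m i)"
        proof (rule integral_mono [OF int_diff [OF v]])
          show "integrable (m i) (\<lambda>x. 2 ^ length L * (\<Sum>j\<leftarrow>L. err i j v x))" using ints by simp
          fix x assume x: "x \<in> space (m i)"
          have "\<bar>monomial L (J i v x) - pev (b L) (z i v x)\<bar> \<le> 2 ^ length L * (\<Sum>j\<leftarrow>L. \<bar>J i v x j - pev (u j) (z i v x)\<bar>)"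
            unfolding b
          proof (rule monomial_diff)
            show "\<bar>J i v x j\<bar> \<le> 2" for j using cube_field_range [OF cJ [OF v] x, of j] by linarith
            show "\<bar>pev (u j) (z i v x)\<bar> \<le> 2" for j by (rule u2 [OF zc [OF v x]])
          qed simp
          also have "\<dots> \<le> 2 ^ length L * (\<Sum>j\<leftarrow>L. err i j v x)"
            using err v x L by (intro mult_left_mono sum_list_mono) auto
          finally show "\<bar>monomial L (J i v x) - pev (b L) (z i v x)\<bar> \<le> 2 ^ length L * (\<Sum>j\<leftarrow>L. err i j v x)" .
        qed
        also have "\<dots> = 2 ^ length L * (\<Sum>j\<leftarrow>L. \<integral>x. err i j v x \<partial>m i)" by (simp add: eqs)
        finally show "(\<integral>x. \<bar>monomial L (J i v x) - pev (b L) (z i v x)\<bar> \<partial>m i) \<le>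
            2 ^ length L * (\<Sum>j\<leftarrow>L. \<integral>x. err i j v x \<partial>m i)" .
      qed
      also have "avg (W i) (\<lambda>v. (\<Sum>j\<leftarrow>L. \<integral>x. err i j v x \<partial>m i)) = (\<Sum>j\<leftarrow>L. avg (W i) (\<lambda>v. \<integral>x. err i j v x \<partial>m i))"
        by (induction L) (simp_all add: avg_add avg_const fin nonempty)
      then have "avg (W i) (\<lambda>v. 2 ^ length L * (\<Sum>j\<leftarrow>L. \<integral>x. err i j v x \<partial>m i)) =
          2 ^ length L * (\<Sum>j\<leftarrow>L. avg (W i) (\<lambda>v. \<integral>x. err i j v x \<partial>m i))"
        by (simp add: avg_cmult)
      finally show ?thesis .
    qed
    have "\<forall>\<^sub>F i in sequentially. \<forall>j\<in>set L. avg (W i) (\<lambda>v. \<integral>x. err i j v x \<partial>m i) \<le> 2 * e"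
      by (intro eventually_ball_finite) (auto intro: err_lim)
    then show ?thesis
    proof eventually_elim
      case (elim i)
      have "(\<Sum>j\<leftarrow>L. avg (W i) (\<lambda>v. \<integral>x. err i j v x \<partial>m i)) \<le> (\<Sum>j\<leftarrow>L. 2 * e)"
        using elim by (intro sum_list_mono) auto
      also have "\<dots> = real (length L) * (2 * e)" by (simp add: sum_list_triv)
      finally have "2 ^ length L * (\<Sum>j\<leftarrow>L. avg (W i) (\<lambda>v. \<integral>x. err i j v x \<partial>m i)) \<le> 2 ^ length L * (real (length L) * (2 * e))"
        by (intro mult_left_mono) auto
      moreover have "2 ^ length L * (real (length L) * (2 * e)) = 2 * loss L * e" by (simp add: loss_def)
      ultimately show ?case using le [of i] by linarith
    qed
  qed
  have lim: "(\<integral>w. \<bar>monomial L (joint_coords q p (X w) (Y w)) - pev (b L) (sequence_coords q (X w))\<bar> \<partial>P) \<le> loss L * e"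
    if L: "\<forall>j\<in>set L. coded_index F j" for L
  proof -
    let ?d = "\<lambda>j w. \<bar>joint_coords q p (X w) (Y w) j - pev (u j) (sequence_coords q (X w))\<bar>"
    have Xc: "sequence_coords q (X w) \<in> unit_cube" if "w \<in> space P" for w
      using cube_field_X that by (simp add: cube_field_def)
    have dm: "?d j \<in> borel_measurable P" for j
      by (intro borel_measurable_abs borel_measurable_diff cube_field_pev(1) [OF cube_field_X])
        (use cXY in \<open>auto simp only: cube_field_def\<close>)
    have dint: "integrable P (?d j)" for j
    proof (rule P.integrable_bounded [OF dm, where C = 3])
      fix w assume w: "w \<in> space P"
      show "\<bar>?d j w\<bar> \<le> 3"
        using cube_field_range [OF cXY w, of j] u2 [OF Xc [OF w], of j] by linarith
    qed
    have d1: "(\<integral>w. ?d j w \<partial>P) \<le> e" if j: "coded_index F j" for j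
    proof -
      obtain g k where jk: "j = (g, k)" by (cases j)
      show ?thesis
      proof (cases k)
        case (Inl n)
        then show ?thesis using e by (simp add: jk)
      next
        case (Inr n)
        have n: "n \<in> F" using j by (simp add: coded_index_def jk Inr)
        let ?h = "\<lambda>x. \<bar>p n (f x) - pev (a n) (sequence_coords q x)\<bar>"
        have hm: "?h \<in> borel_measurable Seq"
        proof -
          have "(\<lambda>x. pev (a n) (sequence_coords q x)) \<in> borel_measurable Seq"
            by (rule cube_field_pev) (rule cube_field_sequence_coords [OF q], simp)
          moreover have "(\<lambda>x. p n (f x)) \<in> borel_measurable Seq"
            by (rule measurable_compose [OF f coordinates_measurable [OF p]])
          ultimately show ?thesis by auto
        qed
        have sX: "(\<lambda>w. shift g (X w)) \<in> measurable P Seq"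
          by (rule measurable_compose [OF X_measurable shift_measurable])
        have "(\<integral>w. ?d j w \<partial>P) = (\<integral>w. ?h (shift g (X w)) \<partial>P)"
        proof (rule integral_cong_AE [OF dm])
          show "(\<lambda>w. ?h (shift g (X w))) \<in> borel_measurable P" by (rule measurable_compose [OF sX hm])
          show "AE w in P. ?d j w = ?h (shift g (X w))"
            using code [of g] by eventually_elim (simp add: jk Inr shift_coords del: sequence_coords_apply)
        qed
        also have "\<dots> = (\<integral>x. ?h x \<partial>distr P Seq (\<lambda>w. shift g (X w)))"
          by (rule integral_distr [OF sX hm, symmetric])
        also have "\<dots> \<le> e" unfolding stationary by (rule fa [OF n])
        finally show ?thesis .
      qed
    qed
    have ints: "integrable P (\<lambda>w. \<Sum>j\<leftarrow>L. ?d j w)"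
      and eqs: "(\<integral>w. (\<Sum>j\<leftarrow>L. ?d j w) \<partial>P) = (\<Sum>j\<leftarrow>L. \<integral>w. ?d j w \<partial>P)" for L
      by (induction L) (auto simp: dint)
    have "(\<integral>w. \<bar>monomial L (joint_coords q p (X w) (Y w)) - pev (b L) (sequence_coords q (X w))\<bar> \<partial>P)
        \<le> (\<integral>w. 2 ^ length L * (\<Sum>j\<leftarrow>L. ?d j w) \<partial>P)"
    proof (rule integral_mono)
      show "integrable P (\<lambda>w. \<bar>monomial L (joint_coords q p (X w) (Y w)) - pev (b L) (sequence_coords q (X w))\<bar>)"
      proof (rule P.integrable_bounded [where C = "1 + pnorm (b L)"])
        show "(\<lambda>w. \<bar>monomial L (joint_coords q p (X w) (Y w)) - pev (b L) (sequence_coords q (X w))\<bar>) \<in> borel_measurable P"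
          using cube_field_monomial(1) [OF cXY] cube_field_pev(1) [OF cube_field_X] by auto
        fix w assume w: "w \<in> space P"
        show "\<bar>\<bar>monomial L (joint_coords q p (X w) (Y w)) - pev (b L) (sequence_coords q (X w))\<bar>\<bar> \<le> 1 + pnorm (b L)"
          using cube_field_monomial(2) [OF cXY w, of L] cube_field_pev(2) [OF cube_field_X w, of "b L"] by linarith
      qed
      show "integrable P (\<lambda>w. 2 ^ length L * (\<Sum>j\<leftarrow>L. ?d j w))" using ints by simp
      fix w assume w: "w \<in> space P"
      show "\<bar>monomial L (joint_coords q p (X w) (Y w)) - pev (b L) (sequence_coords q (X w))\<bar> \<le> 2 ^ length L * (\<Sum>j\<leftarrow>L. ?d j w)"
        unfolding b
      proof (rule monomial_diff)
        show "\<bar>joint_coords q p (X w) (Y w) j\<bar> \<le> 2" for j using cube_field_range [OF cXY w, of j] by linarith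
        show "\<bar>pev (u j) (sequence_coords q (X w))\<bar> \<le> 2" for j by (rule u2 [OF Xc [OF w]])
      qed simp
    qed
    also have "\<dots> = 2 ^ length L * (\<Sum>j\<leftarrow>L. \<integral>w. ?d j w \<partial>P)" by (simp add: eqs)
    also have "\<dots> \<le> 2 ^ length L * (\<Sum>j\<leftarrow>L. e)"
      using d1 L by (intro mult_left_mono sum_list_mono) auto
    finally show ?thesis by (simp add: loss_def sum_list_triv)
  qed
  have main: "\<forall>\<^sub>F i in sequentially. joint_discrepancy \<Psi> L L' i \<le> (3 * loss L + 3 * 2 ^ length L * loss L' + 1) * e"
    if LL: "\<forall>j\<in>set L \<union> set L'. coded_index F j" for L L'
  proof -
    let ?I = "\<lambda>L. \<integral>y. monomial L (joint_coords q p (X y) (Y y)) \<partial>P"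
    let ?B = "\<lambda>L. \<integral>y. pev (b L) (sequence_coords q (X y)) \<partial>P"
    have bP: "\<bar>pev (b L) (sequence_coords q (X w))\<bar> \<le> 2 ^ length L" if "w \<in> space P" for w L
      using cube_field_X that by (intro b2) (simp add: cube_field_def)
    have I1: "\<bar>?I L\<bar> \<le> 1" for L
      using cube_field_monomial [OF cXY] by (intro P.integral_bounded) (auto simp: abs_le_iff intro: order_trans [of _ 0])
    have B1: "\<bar>?B L\<bar> \<le> 2 ^ length L" for L
      by (rule P.integral_bounded) (use cube_field_pev(1) [OF cube_field_X] bP in auto)
    have IB: "\<bar>?I L - ?B L\<bar> \<le> loss L * e" if "\<forall>j\<in>set L. coded_index F j" for L
    proof -
      have "integrable P (\<lambda>y. monomial L (joint_coords q p (X y) (Y y)))"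
        by (rule P.integrable_bounded [where C = 1])
          (use cube_field_monomial [OF cXY] in \<open>auto simp: abs_le_iff intro: order_trans [of _ 0]\<close>)
      then have "?I L - ?B L = (\<integral>w. monomial L (joint_coords q p (X w) (Y w)) - pev (b L) (sequence_coords q (X w)) \<partial>P)"
        using integrable_pev_limit by simp
      also have "\<bar>\<dots>\<bar> \<le> (\<integral>w. \<bar>monomial L (joint_coords q p (X w) (Y w)) - pev (b L) (sequence_coords q (X w))\<bar> \<partial>P)"
        by (rule integral_abs_bound)
      finally show ?thesis using lim [OF that] by linarith
    qed
    have lim2: "\<bar>?B L * ?B L' - ?I L * ?I L'\<bar> \<le> loss L * e + 2 ^ length L * (loss L' * e)"
    proof -
      have gen: "\<bar>b * b' - i * i'\<bar> \<le> l + c * l'"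
        if "\<bar>i - b\<bar> \<le> l" "\<bar>i' - b'\<bar> \<le> l'" "\<bar>i'\<bar> \<le> 1" "\<bar>b\<bar> \<le> c" for b b' i i' l l' c :: real
      proof -
        have "\<bar>b * b' - i * i'\<bar> = \<bar>(i - b) * i' + b * (i' - b')\<bar>"
          by (simp add: algebra_simps abs_minus_commute)
        also have "\<dots> \<le> \<bar>i - b\<bar> * \<bar>i'\<bar> + \<bar>b\<bar> * \<bar>i' - b'\<bar>"
          unfolding abs_mult [symmetric] by (rule abs_triangle_ineq)
        also have "\<dots> \<le> l * 1 + c * l'"
        proof (intro add_mono mult_mono abs_ge_zero that)
          show "0 \<le> l" using that(1) abs_ge_zero order_trans by blast
          show "0 \<le> c" using that(4) abs_ge_zero order_trans by blast
        qed
        finally show ?thesis by simp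
      qed
      show ?thesis by (rule gen [OF IB IB I1 B1]) (use LL in auto)
    qed
    have le: "joint_discrepancy \<Psi> L L' i \<le>
        M i L + 2 ^ length L * M i L' + discrepancy (b L) (b L') i + (loss L * e + 2 ^ length L * (loss L' * e))" for i
    proof -
      let ?K = "loss L * e + 2 ^ length L * (loss L' * e)"
      have "joint_discrepancy \<Psi> L L' i \<le> avg (W i) (\<lambda>v. avg (W i) (\<lambda>w.
          (\<integral>x. \<bar>monomial L (J i v x) - pev (b L) (z i v x)\<bar> \<partial>m i) +
          2 ^ length L * (\<integral>x. \<bar>monomial L' (J i w x) - pev (b L') (z i w x)\<bar> \<partial>m i) +
          \<bar>(\<integral>x. pev (b L) (z i v x) * pev (b L') (z i w x) \<partial>m i) - ?B L * ?B L'\<bar> + ?K))"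
        unfolding joint_discrepancy_def J_def [symmetric]
      proof (intro avg_mono)
        fix v w assume v: "v \<in> W i" and w: "w \<in> W i"
        have "\<bar>(\<integral>x. monomial L (J i v x) * monomial L' (J i w x) \<partial>m i) - (\<integral>x. pev (b L) (z i v x) * pev (b L') (z i w x) \<partial>m i)\<bar>
          \<le> (\<integral>x. \<bar>monomial L (J i v x) - pev (b L) (z i v x)\<bar> \<partial>m i) +
            2 ^ length L * (\<integral>x. \<bar>monomial L' (J i w x) - pev (b L') (z i w x)\<bar> \<partial>m i)"
        proof (rule m.integral_mult_diff_le)
          fix x assume x: "x \<in> space (m i)"
          show "\<bar>monomial L (J i v x)\<bar> \<le> 1" using cube_field_monomial(2) [OF cJ [OF v] x, of L] by linarith
          show "\<bar>monomial L' (J i w x)\<bar> \<le> 1" using cube_field_monomial(2) [OF cJ [OF w] x, of L'] by linarith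
          show "\<bar>pev (b L) (z i v x)\<bar> \<le> 2 ^ length L" by (rule b2 [OF zc [OF v x]])
          show "\<bar>pev (b L') (z i w x)\<bar> \<le> 2 ^ length L'" by (rule b2 [OF zc [OF w x]])
        qed (use cube_field_monomial(1) [OF cJ [OF v]] cube_field_monomial(1) [OF cJ [OF w]]
            cube_field_pev(1) [OF cube_field_z [OF v]] cube_field_pev(1) [OF cube_field_z [OF w]] in auto)
        then show "\<bar>(\<integral>x. monomial L (J i v x) * monomial L' (J i w x) \<partial>m i) - ?I L * ?I L'\<bar>
          \<le> (\<integral>x. \<bar>monomial L (J i v x) - pev (b L) (z i v x)\<bar> \<partial>m i) +
            2 ^ length L * (\<integral>x. \<bar>monomial L' (J i w x) - pev (b L') (z i w x)\<bar> \<partial>m i) +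
            \<bar>(\<integral>x. pev (b L) (z i v x) * pev (b L') (z i w x) \<partial>m i) - ?B L * ?B L'\<bar> + ?K"
          using lim2 by linarith
      qed
      also have "\<dots> = M i L + 2 ^ length L * M i L' + discrepancy (b L) (b L') i + ?K"
        by (simp add: avg_add avg_cmult avg_const fin nonempty M_def discrepancy_def)
      finally show ?thesis .
    qed
    have "\<forall>\<^sub>F i in sequentially. discrepancy (b L) (b L') i < e"
      using pair_converges_pev [OF conv] e by (rule order_tendstoD)
    moreover have "\<forall>\<^sub>F i in sequentially. M i L \<le> 2 * loss L * e" using LL by (intro M) auto
    moreover have "\<forall>\<^sub>F i in sequentially. M i L' \<le> 2 * loss L' * e" using LL by (intro M) auto
    ultimately show ?thesis
    proof eventually_elim
      case (elim i)
      have "2 ^ length L * M i L' \<le> 2 ^ length L * (2 * loss L' * e)"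
        using elim(3) by (intro mult_left_mono) auto
      moreover have "2 ^ length L * (2 * loss L' * e) = 2 * (2 ^ length L * (loss L' * e))"
        "(3 * loss L + 3 * 2 ^ length L * loss L' + 1) * e = 3 * (loss L * e) + 3 * (2 ^ length L * (loss L' * e)) + e"
        "2 * loss L * e = 2 * (loss L * e)"
        by (simp_all add: algebra_simps)
      ultimately show ?case using le [of i] elim(1,2) by linarith
    qed
  qed
  show ?thesis using \<Psi>m main by blast
qed

text \<open>
  Finitely many monomials are dealt with by one code up to a small error; the codes for more and more
  monomials are combined diagonally.
\<close>

lemma coded_models_exist:
  obtains \<Psi> where "\<And>i. \<Psi> i \<in> measurable (PiM (W i) (\<lambda>_. A)) (PiM (W i) (\<lambda>_. B))"
    "pair_converges W m (\<lambda>i v x. joint_coords q p (pullback_name (s i) v x) (pullback_name (s i) v (\<Psi> i x)))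
        P (\<lambda>w. joint_coords q p (X w) (Y w))"
proof -
  define F where "F j = {n::'m. to_nat n < j}" for j
  have finF: "finite (F j)" for j
    unfolding F_def by (rule finite_imageD [of to_nat]) (auto intro: finite_subset [of _ "{..<j}"] inj_on_subset [OF inj_to_nat])
  define K where "K L L' = 3 * loss L + 3 * 2 ^ length L * loss L' + 1" for L L' :: "('g \<times> ('n + 'm)) list"
  define e where "e j = 1 / real (Suc j)" for j
  have "\<exists>\<Psi>. (\<forall>i. \<Psi> i \<in> measurable (PiM (W i) (\<lambda>_. A)) (PiM (W i) (\<lambda>_. B))) \<and>
    (\<forall>L L'. (\<forall>k\<in>set L \<union> set L'. coded_index (F j) k) \<longrightarrow>
      (\<forall>\<^sub>F i in sequentially. joint_discrepancy \<Psi> L L' i \<le> K L L' * e j))" for j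
    unfolding K_def by (rule code_step [OF finF]) (simp add: e_def)
  then obtain \<Psi> where \<Psi>: "\<And>j i. \<Psi> j i \<in> measurable (PiM (W i) (\<lambda>_. A)) (PiM (W i) (\<lambda>_. B))"
    "\<And>j L L'. \<forall>k\<in>set L \<union> set L'. coded_index (F j) k \<Longrightarrow>
      (\<forall>\<^sub>F i in sequentially. joint_discrepancy (\<Psi> j) L L' i \<le> K L L' * e j)"
    by metis
  define Q where "Q j = {LL :: ('g \<times> ('n + 'm)) list \<times> ('g \<times> ('n + 'm)) list.
      to_nat LL < j \<and> (\<forall>k\<in>set (fst LL) \<union> set (snd LL). coded_index (F j) k)}" for j
  have finQ: "finite (Q j)" for j
    by (rule finite_imageD [of to_nat])
      (auto simp: Q_def intro: finite_subset [of _ "{..<j}"] inj_on_subset [OF inj_to_nat])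
  have "\<forall>\<^sub>F i in sequentially. \<forall>LL\<in>Q j. joint_discrepancy (\<Psi> j) (fst LL) (snd LL) i \<le> K (fst LL) (snd LL) * e j" for j
    by (rule eventually_ball_finite [OF finQ]) (auto simp: Q_def intro!: \<Psi>(2))
  then obtain \<tau> where \<tau>: "filterlim \<tau> at_top sequentially"
    "\<forall>\<^sub>F i in sequentially. \<forall>LL\<in>Q (\<tau> i). joint_discrepancy (\<Psi> (\<tau> i)) (fst LL) (snd LL) i \<le> K (fst LL) (snd LL) * e (\<tau> i)"
    by (rule diagonal_sequence)
  show ?thesis
  proof
    show "\<Psi> (\<tau> i) i \<in> measurable (PiM (W i) (\<lambda>_. A)) (PiM (W i) (\<lambda>_. B))" for i by (rule \<Psi>)
    show "pair_converges W m (\<lambda>i v x. joint_coords q p (pullback_name (s i) v x) (pullback_name (s i) v (\<Psi> (\<tau> i) i x)))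
        P (\<lambda>w. joint_coords q p (X w) (Y w))"
      unfolding pair_converges_def
    proof (intro allI)
      fix L L' :: "('g \<times> ('n + 'm)) list"
      define N where "N = Suc (to_nat (L, L')) + (\<Sum>k\<in>set L \<union> set L'. case snd k of Inl _ \<Rightarrow> 0 | Inr n \<Rightarrow> Suc (to_nat n))"
      have "coded_index (F j) k" if "k \<in> set L \<union> set L'" "N \<le> j" for j k
      proof (cases "snd k")
        case (Inr n)
        have "(case snd k of Inl _ \<Rightarrow> 0 | Inr n \<Rightarrow> Suc (to_nat n)) \<le>
            (\<Sum>k\<in>set L \<union> set L'. case snd k of Inl _ \<Rightarrow> 0 | Inr n \<Rightarrow> Suc (to_nat n))"
          by (rule member_le_sum [OF that(1)]) auto
        then show ?thesis using that(2) by (simp add: coded_index_def Inr F_def N_def)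
      qed (simp add: coded_index_def)
      then have inQ: "(L, L') \<in> Q j" if "N \<le> j" for j using that by (auto simp: Q_def N_def)
      have ev: "\<forall>\<^sub>F i in sequentially. N \<le> \<tau> i" using \<tau>(1) by (simp add: filterlim_at_top)
      have "\<forall>\<^sub>F i in sequentially. norm (joint_discrepancy (\<Psi> (\<tau> i)) L L' i) \<le> K L L' * e (\<tau> i)"
        using \<tau>(2) ev
      proof eventually_elim
        case (elim i)
        have "0 \<le> joint_discrepancy (\<Psi> (\<tau> i)) L L' i"
          by (auto simp: joint_discrepancy_def intro!: avg_nonneg)
        then show ?case using elim(1) inQ [OF elim(2)] by force
      qed
      moreover have "(\<lambda>i. K L L' * e (\<tau> i)) \<longlonglongrightarrow> K L L' * 0"
      proof (intro tendsto_mult tendsto_const)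
        have "e \<longlonglongrightarrow> 0" unfolding e_def by (rule LIMSEQ_Suc [OF lim_1_over_n])
        then show "(\<lambda>i. e (\<tau> i)) \<longlonglongrightarrow> 0" using \<tau>(1) by (rule filterlim_compose)
      qed
      ultimately have "(\<lambda>i. joint_discrepancy (\<Psi> (\<tau> i)) L L' i) \<longlonglongrightarrow> 0"
        by (intro Lim_null_comparison [of "\<lambda>i. joint_discrepancy (\<Psi> (\<tau> i)) L L' i" "\<lambda>i. K L L' * e (\<tau> i)"]) simp_all
      then show "(\<lambda>i. avg (W i) (\<lambda>v. avg (W i) (\<lambda>w.
          \<bar>(\<integral>x. monomial L (joint_coords q p (pullback_name (s i) v x) (pullback_name (s i) v (\<Psi> (\<tau> i) i x))) *
               monomial L' (joint_coords q p (pullback_name (s i) w x) (pullback_name (s i) w (\<Psi> (\<tau> i) i x))) \<partial>m i)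
           - (\<integral>y. monomial L (joint_coords q p (X y) (Y y)) \<partial>P) * (\<integral>y. monomial L' (joint_coords q p (X y) (Y y)) \<partial>P)\<bar>))) \<longlonglongrightarrow> 0"
        by (simp only: joint_discrepancy_def)
    qed
  qed
qed

end

section \<open>Decoding, and invariance of the entropy\<close>

text \<open>
  A Lipschitz constant of the polynomial on the cube, for the largest change of a variable.
\<close>

definition plip :: "(real \<times> 'j list) list \<Rightarrow> real" where
  "plip a = (\<Sum>(c, L)\<leftarrow>a. \<bar>c\<bar> * real (length L))"

lemma plip_simps [simp]: "plip [] = 0" "plip ((c, L) # a) = \<bar>c\<bar> * real (length L) + plip a"
  by (simp_all add: plip_def)

lemma plip_nonneg [simp]: "0 \<le> plip a"
  by (induction a) auto

lemma (in sofic_sequence) avg_monomial_diff: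
  assumes p: "coordinates B p" and y: "\<And>v. v \<in> W i \<Longrightarrow> y v \<in> space B" "\<And>v. v \<in> W i \<Longrightarrow> y' v \<in> space B"
    and D: "\<And>k. k \<in> snd ` set L \<Longrightarrow> avg (W i) (\<lambda>v. \<bar>p k (y v) - p k (y' v)\<bar>) \<le> D"
  shows "avg (W i) (\<lambda>v. \<bar>monomial L (sequence_coords p (pullback_name (s i) v y)) -
            monomial L (sequence_coords p (pullback_name (s i) v y'))\<bar>) \<le> real (length L) * D"
proof -
  let ?c = "\<lambda>y v. sequence_coords p (pullback_name (s i) v y)"
  have r: "0 \<le> ?c x v j \<and> ?c x v j \<le> 1" if "v \<in> W i" "\<And>v. v \<in> W i \<Longrightarrow> x v \<in> space B" for v x j
    using that map_in [OF that(1)] coordinates_range [OF p] by (cases j) (auto simp: pullback_name_def)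
  have "avg (W i) (\<lambda>v. \<bar>monomial L (?c y v) - monomial L (?c y' v)\<bar>) \<le>
      avg (W i) (\<lambda>v. \<Sum>j\<leftarrow>L. \<bar>?c y v j - ?c y' v j\<bar>)"
  proof (rule avg_mono)
    fix v assume v: "v \<in> W i"
    have "\<bar>monomial L (?c y v) - monomial L (?c y' v)\<bar> \<le> 1 ^ length L * (\<Sum>j\<leftarrow>L. \<bar>?c y v j - ?c y' v j\<bar>)"
    proof (rule monomial_diff)
      show "\<bar>?c y v j\<bar> \<le> 1" "\<bar>?c y' v j\<bar> \<le> 1" for j
        using r [OF v y(1), where j = j] r [OF v y(2), where j = j] by (auto simp: abs_le_iff)
    qed simp
    then show "\<bar>monomial L (?c y v) - monomial L (?c y' v)\<bar> \<le> (\<Sum>j\<leftarrow>L. \<bar>?c y v j - ?c y' v j\<bar>)" by simp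
  qed
  also have "\<dots> \<le> real (length L) * D"
    using D
  proof (induction L)
    case Nil
    show ?case by (simp add: avg_def)
  next
    case (Cons j L)
    obtain g k where j: "j = (g, k)" by (cases j)
    have "avg (W i) (\<lambda>v. \<bar>?c y v j - ?c y' v j\<bar>) = avg (W i) (\<lambda>v. \<bar>p k (y v) - p k (y' v)\<bar>)"
      using avg_permutes [OF perm [of i g], of "\<lambda>v. \<bar>p k (y v) - p k (y' v)\<bar>"]
      by (simp add: j pullback_name_def)
    also have "\<dots> \<le> D" using Cons.prems j by force
    finally show ?case
      using Cons.IH Cons.prems by (simp add: avg_add algebra_simps)
  qed
  finally show ?thesis .
qed

lemma (in sofic_sequence) avg_pev_diff:
  assumes p: "coordinates B p" and y: "\<And>v. v \<in> W i \<Longrightarrow> y v \<in> space B" "\<And>v. v \<in> W i \<Longrightarrow> y' v \<in> space B"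
    and D: "\<And>k. k \<in> snd ` psupp a \<Longrightarrow> avg (W i) (\<lambda>v. \<bar>p k (y v) - p k (y' v)\<bar>) \<le> D"
  shows "avg (W i) (\<lambda>v. \<bar>pev a (sequence_coords p (pullback_name (s i) v y)) -
            pev a (sequence_coords p (pullback_name (s i) v y'))\<bar>) \<le> plip a * D"
  using D
proof (induction a)
  case Nil
  show ?case by (simp add: avg_def)
next
  case (Cons cL a)
  obtain c L where cL: "cL = (c, L)" by (cases cL)
  let ?c = "\<lambda>y v. sequence_coords p (pullback_name (s i) v y)"
  have "avg (W i) (\<lambda>v. \<bar>pev (cL # a) (?c y v) - pev (cL # a) (?c y' v)\<bar>) \<le>
      avg (W i) (\<lambda>v. \<bar>c\<bar> * \<bar>monomial L (?c y v) - monomial L (?c y' v)\<bar> + \<bar>pev a (?c y v) - pev a (?c y' v)\<bar>)"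
  proof (rule avg_mono)
    fix v
    have "pev (cL # a) (?c y v) - pev (cL # a) (?c y' v) =
        c * (monomial L (?c y v) - monomial L (?c y' v)) + (pev a (?c y v) - pev a (?c y' v))"
      by (simp add: cL algebra_simps)
    then show "\<bar>pev (cL # a) (?c y v) - pev (cL # a) (?c y' v)\<bar> \<le>
        \<bar>c\<bar> * \<bar>monomial L (?c y v) - monomial L (?c y' v)\<bar> + \<bar>pev a (?c y v) - pev a (?c y' v)\<bar>"
      by (simp only: abs_mult [symmetric] abs_triangle_ineq)
  qed
  also have "\<dots> = \<bar>c\<bar> * avg (W i) (\<lambda>v. \<bar>monomial L (?c y v) - monomial L (?c y' v)\<bar>) +
      avg (W i) (\<lambda>v. \<bar>pev a (?c y v) - pev a (?c y' v)\<bar>)"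
    by (simp only: avg_add avg_cmult)
  also have "\<dots> \<le> \<bar>c\<bar> * (real (length L) * D) + plip a * D"
    using Cons.prems
    by (intro add_mono mult_left_mono avg_monomial_diff [OF p y] Cons.IH) (auto simp: cL)
  finally show ?case by (simp add: cL algebra_simps)
qed

text \<open>
  Mean absolute values are controlled by second moments, whose averages over \<open>v\<close> converge to the
  second moment of the limit; then Markov's inequality applies.  The constant in the hypothesis leaves
  room for both steps.
\<close>

lemma (in field_sequence) small_in_probability:
  assumes conv: "pair_converges W m z P Z" and F: "finite F" and pos: "0 < \<epsilon>" "0 < \<eta>"
    and small: "\<And>n. n \<in> F \<Longrightarrow> (\<integral>y. pev (pmul (d n) (d n)) (Z y) \<partial>P) \<le> 3 * (\<epsilon> * \<eta> / (5 * (real (card F) + 1)))\<^sup>2"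
  shows "\<forall>\<^sub>F i in sequentially. {x \<in> space (m i). (\<Sum>n\<in>F. avg (W i) (\<lambda>v. \<bar>pev (d n) (z i v x)\<bar>)) < \<eta>} \<in> sets (m i) \<and>
    1 - \<epsilon> \<le> measure (m i) {x \<in> space (m i). (\<Sum>n\<in>F. avg (W i) (\<lambda>v. \<bar>pev (d n) (z i v x)\<bar>)) < \<eta>}"
proof -
  interpret m: prob_space "m i" for i by (rule prob_m)
  define N where "N = real (card F) + 1"
  define c where "c = \<epsilon> * \<eta> / (5 * N)"
  have N: "1 \<le> N" by (simp add: N_def)
  have c: "0 < c" using pos N by (simp add: c_def)
  define G where "G i x = (\<Sum>n\<in>F. avg (W i) (\<lambda>v. \<bar>pev (d n) (z i v x)\<bar>))" for i x
  have G0: "0 \<le> G i x" for i x by (auto simp: G_def intro!: sum_nonneg avg_nonneg)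
  have absint: "integrable (m i) (\<lambda>x. \<bar>pev b (z i v x)\<bar>)" if "v \<in> W i" for i v b
    using integrable_pev [OF that] by simp
  have Gint: "integrable (m i) (G i)" for i
    unfolding G_def [abs_def] avg_def using absint by (auto intro!: Bochner_Integration.integrable_sum)
  have Gle: "(\<integral>x. G i x \<partial>m i) \<le> (\<Sum>n\<in>F. c + avg (W i) (\<lambda>v. \<integral>x. pev (pmul (d n) (d n)) (z i v x) \<partial>m i) / c)" for i
  proof -
    have "(\<integral>x. G i x \<partial>m i) = (\<Sum>n\<in>F. \<integral>x. avg (W i) (\<lambda>v. \<bar>pev (d n) (z i v x)\<bar>) \<partial>m i)"
      unfolding G_def by (rule Bochner_Integration.integral_sum)
        (use absint in \<open>auto simp: avg_def intro!: Bochner_Integration.integrable_sum\<close>)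
    also have "\<dots> = (\<Sum>n\<in>F. avg (W i) (\<lambda>v. \<integral>x. \<bar>pev (d n) (z i v x)\<bar> \<partial>m i))"
      by (intro sum.cong refl integral_avg absint)
    also have "\<dots> \<le> (\<Sum>n\<in>F. avg (W i) (\<lambda>v. c + (\<integral>x. pev (pmul (d n) (d n)) (z i v x) \<partial>m i) / c))"
    proof (intro sum_mono avg_mono)
      fix n v assume v: "v \<in> W i"
      have "(\<integral>x. \<bar>pev (d n) (z i v x)\<bar> \<partial>m i) \<le> (\<integral>x. c + pev (pmul (d n) (d n)) (z i v x) / c \<partial>m i)"
      proof (rule integral_mono [OF absint [OF v]])
        show "integrable (m i) (\<lambda>x. c + pev (pmul (d n) (d n)) (z i v x) / c)"
          using integrable_pev [OF v] by simp
        have sq: "\<bar>t\<bar> \<le> c + t * t / c" for t :: real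
        proof (cases "\<bar>t\<bar> \<le> c")
          case True
          then show ?thesis using c by (simp add: add_increasing2)
        next
          case False
          then have "c * \<bar>t\<bar> \<le> \<bar>t\<bar> * \<bar>t\<bar>" by (intro mult_right_mono) auto
          then have "\<bar>t\<bar> \<le> t * t / c" using c by (simp add: field_simps)
          then show ?thesis using c by simp
        qed
        show "\<bar>pev (d n) (z i v x)\<bar> \<le> c + pev (pmul (d n) (d n)) (z i v x) / c" for x
          using sq by (simp add: pev_pmul)
      qed
      also have "\<dots> = c + (\<integral>x. pev (pmul (d n) (d n)) (z i v x) \<partial>m i) / c"
        using integrable_pev [OF v] by (simp add: m.prob_space)
      finally show "(\<integral>x. \<bar>pev (d n) (z i v x)\<bar> \<partial>m i) \<le> c + (\<integral>x. pev (pmul (d n) (d n)) (z i v x) \<partial>m i) / c" .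
    qed
    also have "\<dots> = (\<Sum>n\<in>F. c + avg (W i) (\<lambda>v. \<integral>x. pev (pmul (d n) (d n)) (z i v x) \<partial>m i) / c)"
      using avg_multc [of "W i" _ "1 / c"] by (simp add: avg_add avg_const fin nonempty)
    finally show ?thesis .
  qed
  have ev: "\<forall>\<^sub>F i in sequentially. (\<integral>x. G i x \<partial>m i) \<le> 5 * N * c"
  proof -
    have "\<forall>\<^sub>F i in sequentially. \<forall>n\<in>F. avg (W i) (\<lambda>v. \<integral>x. pev (pmul (d n) (d n)) (z i v x) \<partial>m i) < 4 * c\<^sup>2"
    proof (rule eventually_ball_finite [OF F], rule ballI)
      fix n assume n: "n \<in> F"
      have "3 * c\<^sup>2 < 4 * c\<^sup>2" using c by simp
      then show "\<forall>\<^sub>F i in sequentially. avg (W i) (\<lambda>v. \<integral>x. pev (pmul (d n) (d n)) (z i v x) \<partial>m i) < 4 * c\<^sup>2"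
        by (intro order_tendstoD(2) [OF pair_converges_mean [OF conv]] le_less_trans [OF small [OF n, folded N_def, folded c_def]])
    qed
    then show ?thesis
    proof eventually_elim
      case (elim i)
      have "(\<integral>x. G i x \<partial>m i) \<le> (\<Sum>n\<in>F. c + 4 * c\<^sup>2 / c)"
        using elim c by (intro order_trans [OF Gle] sum_mono add_mono divide_right_mono) auto
      also have "\<dots> = real (card F) * (5 * c)" using c by (simp add: power2_eq_square)
      also have "\<dots> \<le> N * (5 * c)" using c by (intro mult_right_mono) (auto simp: N_def)
      finally show ?case by (simp add: mult.commute mult.left_commute)
    qed
  qed
  show ?thesis
    using ev unfolding G_def [symmetric]
  proof eventually_elim
    case (elim i)
    note [measurable] = borel_measurable_integrable [OF Gint]
    have "m.prob i {x \<in> space (m i). \<eta> \<le> G i x} \<le> (\<integral>x. G i x \<partial>m i) / \<eta>"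
      by (rule integral_Markov_inequality_measure [OF Gint sets.top]) (use G0 pos in auto)
    also have "\<dots> \<le> 5 * N * c / \<eta>" using elim pos by (intro divide_right_mono) auto
    also have "\<dots> = \<epsilon>" using pos N by (simp add: c_def)
    finally have "m.prob i {x \<in> space (m i). \<eta> \<le> G i x} \<le> \<epsilon>" .
    moreover have "{x \<in> space (m i). G i x < \<eta>} = space (m i) - {x \<in> space (m i). \<eta> \<le> G i x}" by auto
    ultimately show ?case by (simp add: m.prob_compl)
  qed
qed

text \<open>
  If \<open>x\<^sub>e\<close> is a function of \<open>y\<close> in the limit, then each coordinate of \<open>x\<close> is nearly a polynomial in
  the coordinates of \<open>y\<close>, hence nearly a Lipschitz function of \<open>y\<close>, off a set of small measure.
\<close>

lemma decoded_cov_le: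
  fixes q :: "'n::countable \<Rightarrow> 'a \<Rightarrow> real" and p :: "'m::countable \<Rightarrow> 'b \<Rightarrow> real"
    and s :: "nat \<Rightarrow> 'g::{group_add,countable} \<Rightarrow> 'v \<Rightarrow> 'v" and X :: "'u \<Rightarrow> 'g \<Rightarrow> 'a" and Y :: "'u \<Rightarrow> 'g \<Rightarrow> 'b"
  assumes sof: "sofic_sequence W s" and q: "coordinates A q" and p: "coordinates B p"
    and prob_m: "\<And>i. prob_space (m i)" and sets_m: "\<And>i. sets (m i) = sets (PiM (W i) (\<lambda>_. A))"
    and prob_P: "prob_space P"
    and X: "\<And>g. (\<lambda>w. X w g) \<in> measurable P A" and Y: "\<And>g. (\<lambda>w. Y w g) \<in> measurable P B"
    and f: "f \<in> measurable (PiM UNIV (\<lambda>_. B)) A"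
    and code: "AE w in P. X w 0 = f (Y w)"
    and \<Psi>: "\<And>i. \<Psi> i \<in> measurable (PiM (W i) (\<lambda>_. A)) (PiM (W i) (\<lambda>_. B))"
    and conv: "pair_converges W m (\<lambda>i v x. joint_coords q p (pullback_name (s i) v x) (pullback_name (s i) v (\<Psi> i x)))
        P (\<lambda>w. joint_coords q p (X w) (Y w))"
    and F: "finite F" and pos: "0 < \<epsilon>" "0 < \<delta>"
  shows "\<exists>F' \<delta>' \<epsilon>'. finite F' \<and> 0 < \<delta>' \<and> 0 < \<epsilon>' \<and>
    (\<forall>\<^sub>F i in sequentially. cov \<epsilon> \<delta> (m i) (coord_dist q F (W i)) \<le>
       cov \<epsilon>' \<delta>' (distr (m i) (PiM (W i) (\<lambda>_. B)) (\<Psi> i)) (coord_dist p F' (W i)))"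
proof -
  interpret sofic_sequence W s by fact
  interpret P: prob_space P by fact
  interpret m: prob_space "m i" for i by fact
  let ?Y = "PiM (UNIV :: 'g set) (\<lambda>_. B)"
  define J where "J i v x = joint_coords q p (pullback_name (s i) v x) (pullback_name (s i) v (\<Psi> i x))" for i v x
  have m_measA: "h \<in> measurable (PiM (W i) (\<lambda>_. A)) N \<Longrightarrow> h \<in> measurable (m i) N" for h i and N :: "'a measure"
    by (simp add: measurable_cong_sets [OF sets_m refl])
  have \<Psi>m: "\<Psi> i \<in> measurable (m i) (PiM (W i) (\<lambda>_. B))" for i
    using \<Psi> by (simp add: measurable_cong_sets [OF sets_m refl])
  have sp: "x v \<in> space A" if "x \<in> space (m i)" "v \<in> W i" for x i v
    using that sets_eq_imp_space_eq [OF sets_m [of i]] by (auto simp: space_PiM)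
  have spB: "y v \<in> space B" if "y \<in> space (PiM (W i) (\<lambda>_. B))" "v \<in> W i" for y i v
    using that by (auto simp: space_PiM)
  have c1: "(\<lambda>x. pullback_name (s i) v x g) \<in> measurable (m i) A" if "v \<in> W i" for i v g
    unfolding pullback_name_def by (rule m_measA) (rule measurable_component_singleton [OF map_in [OF that]])
  have c2: "(\<lambda>x. pullback_name (s i) v (\<Psi> i x) g) \<in> measurable (m i) B" if "v \<in> W i" for i v g
    unfolding pullback_name_def
    by (rule measurable_compose [OF \<Psi>m measurable_component_singleton]) (rule map_in [OF that])
  have cJ: "cube_field (m i) (J i v)" if "v \<in> W i" for i v
    unfolding J_def by (rule cube_field_joint_coords [OF q c1 [OF that] p c2 [OF that]])
  have cXY: "cube_field P (\<lambda>w. joint_coords q p (X w) (Y w))"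
    by (rule cube_field_joint_coords [OF q X p Y])
  interpret field_sequence W m J P "\<lambda>w. joint_coords q p (X w) (Y w)"
    by (rule field_sequence.intro) (rule fin nonempty prob_m prob_P cXY | erule cJ)+
  have conv': "pair_converges W m J P (\<lambda>w. joint_coords q p (X w) (Y w))"
    using conv by (simp only: J_def [abs_def])
  have Ym: "Y \<in> measurable P ?Y"
    using Y by (intro measurable_PiM_single') (auto dest: measurable_space)
  let ?\<nu> = "distr P ?Y Y"
  interpret \<nu>: prob_space ?\<nu> by (rule P.prob_space_distr [OF Ym])
  have cfY: "cube_field ?Y (\<lambda>y. sequence_coords p y)"
    by (rule cube_field_sequence_coords [OF p]) simp
  define N where "N = real (card F) + 1"
  define c where "c = \<epsilon> / 2 * (\<delta> / 4) / (5 * N)"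
  have N: "1 \<le> N" by (simp add: N_def)
  have c: "0 < c" using pos N by (simp add: c_def)
  have ex: "\<exists>a. (\<integral>y. \<bar>q n (f y) - pev a (sequence_coords p y)\<bar> \<partial>?\<nu>) \<le> c\<^sup>2 \<and> (\<forall>z\<in>unit_cube. \<bar>pev a z\<bar> \<le> 2)" for n
  proof (rule pev_dense [of ?\<nu> "\<lambda>y. sequence_coords p y" "\<lambda>y. q n (f y)" "c\<^sup>2"])
    show "prob_space ?\<nu>" by (rule \<nu>.prob_space_axioms)
    show "cube_field ?\<nu> (\<lambda>y. sequence_coords p y)" using cfY by (simp add: cube_field_def)
    show "S \<in> sets ?\<nu> \<Longrightarrow> \<exists>O'\<in>sets borel. S = sequence_coords p -` O' \<inter> space ?\<nu>" for S
      using sequence_coords_generate [OF p, of S] by simp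
    show "(\<lambda>y. q n (f y)) \<in> borel_measurable ?\<nu>"
      using measurable_compose [OF f coordinates_measurable [OF q]] by simp
    show "y \<in> space ?\<nu> \<Longrightarrow> 0 \<le> q n (f y) \<and> q n (f y) \<le> 1" for y
      using coordinates_range [OF q measurable_space [OF f]] by simp
    show "0 < c\<^sup>2" using c by simp
  qed blast+
  have ex': "\<forall>n. \<exists>a. (\<integral>y. \<bar>q n (f y) - pev a (sequence_coords p y)\<bar> \<partial>?\<nu>) \<le> c\<^sup>2 \<and> (\<forall>z\<in>unit_cube. \<bar>pev a z\<bar> \<le> 2)"
    by (rule allI) (rule ex)
  obtain a where "\<forall>n. (\<integral>y. \<bar>q n (f y) - pev (a n) (sequence_coords p y)\<bar> \<partial>?\<nu>) \<le> c\<^sup>2 \<and> (\<forall>z\<in>unit_cube. \<bar>pev (a n) z\<bar> \<le> 2)"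
    using choice [OF ex'] by blast
  then have a: "\<And>n. (\<integral>y. \<bar>q n (f y) - pev (a n) (sequence_coords p y)\<bar> \<partial>?\<nu>) \<le> c\<^sup>2"
    "\<And>n z. z \<in> unit_cube \<Longrightarrow> \<bar>pev (a n) z\<bar> \<le> 2" by blast+
  define d where "d n = [(1, [(0::'g, Inl n)])] @ pscale (- 1) (pmap (\<lambda>(g, k). (g, Inr k)) (a n))" for n
  have d: "pev (d n) (joint_coords q p x y) = q n (x 0) - pev (a n) (sequence_coords p y)" for n x y
  proof -
    have "(\<lambda>j. joint_coords q p x y ((\<lambda>(g, k). (g, Inr k)) j)) = sequence_coords p y"
      by (auto simp: fun_eq_iff)
    then show ?thesis by (simp add: d_def pev_pscale pev_pmap)
  qed
  have int_d: "(\<integral>w. pev (pmul (d n) (d n)) (joint_coords q p (X w) (Y w)) \<partial>P) \<le> 3 * c\<^sup>2" for n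
  proof -
    let ?h = "\<lambda>y. \<bar>q n (f y) - pev (a n) (sequence_coords p y)\<bar>"
    have hm: "?h \<in> borel_measurable ?Y"
      using measurable_compose [OF f coordinates_measurable [OF q], of n] cube_field_pev(1) [OF cfY, of "a n"] by auto
    have h3: "?h y \<le> 3" if "y \<in> space ?Y" for y
    proof -
      have "sequence_coords p y \<in> unit_cube" using cfY that by (simp add: cube_field_def)
      then show ?thesis using a(2) [of "sequence_coords p y" n]
          coordinates_range [OF q measurable_space [OF f that], of n] by linarith
    qed
    have hint: "integrable P (\<lambda>w. ?h (Y w))"
      by (rule P.integrable_bounded [OF measurable_compose [OF Ym hm], where C = 3])
        (use h3 measurable_space [OF Ym] in auto)
    have "(\<integral>w. pev (pmul (d n) (d n)) (joint_coords q p (X w) (Y w)) \<partial>P) \<le> (\<integral>w. 3 * ?h (Y w) \<partial>P)"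
    proof (rule integral_mono_AE)
      show "integrable P (\<lambda>w. pev (pmul (d n) (d n)) (joint_coords q p (X w) (Y w)))" by (rule integrable_pev_limit)
      show "integrable P (\<lambda>w. 3 * ?h (Y w))" using hint by simp
      show "AE w in P. pev (pmul (d n) (d n)) (joint_coords q p (X w) (Y w)) \<le> 3 * ?h (Y w)"
        using code AE_space
      proof eventually_elim
        case (elim w)
        have "pev (pmul (d n) (d n)) (joint_coords q p (X w) (Y w)) = ?h (Y w) * ?h (Y w)"
          using elim(1) by (simp add: pev_pmul d)
        also have "\<dots> \<le> 3 * ?h (Y w)"
          using h3 [OF measurable_space [OF Ym elim(2)]] by (intro mult_right_mono) auto
        finally show ?case .
      qed
    qed
    also have "\<dots> = 3 * (\<integral>y. ?h y \<partial>?\<nu>)" by (simp add: integral_distr [OF Ym hm])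
    also have "\<dots> \<le> 3 * c\<^sup>2" using a(1) by simp
    finally show ?thesis .
  qed
  define G where "G i x = (\<Sum>n\<in>F. avg (W i) (\<lambda>v. \<bar>pev (d n) (J i v x)\<bar>))" for i x
  have ev: "\<forall>\<^sub>F i in sequentially. {x \<in> space (m i). G i x < \<delta> / 4} \<in> sets (m i) \<and>
      1 - \<epsilon> / 2 \<le> m.prob i {x \<in> space (m i). G i x < \<delta> / 4}"
    unfolding G_def
    by (rule small_in_probability [OF conv' F]) (use pos int_d in \<open>simp_all add: c_def N_def\<close>)
  define F' where "F' = (\<Union>n\<in>F. snd ` psupp (a n))"
  have F': "finite F'" using F by (auto simp: F'_def)
  define C where "C = (\<Sum>n\<in>F. plip (a n))"
  have C: "0 \<le> C" by (auto simp: C_def intro: sum_nonneg)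
  define \<delta>' where "\<delta>' = \<delta> / (4 * (C + 1))"
  have \<delta>': "0 < \<delta>'" "2 * C * \<delta>' \<le> \<delta> / 2"
  proof -
    show "0 < \<delta>'" using pos C by (simp add: \<delta>'_def)
    have "2 * C * \<delta>' \<le> 2 * (C + 1) * \<delta>'" using \<open>0 < \<delta>'\<close> by (intro mult_right_mono) auto
    also have "2 * (C + 1) * \<delta>' = \<delta> / 2"
      using C by (simp add: \<delta>'_def field_simps add_nonneg_eq_0_iff)
    finally show "2 * C * \<delta>' \<le> \<delta> / 2" .
  qed
  have main: "cov \<epsilon> \<delta> (m i) (coord_dist q F (W i)) \<le>
       cov (\<epsilon> / 2) \<delta>' (distr (m i) (PiM (W i) (\<lambda>_. B)) (\<Psi> i)) (coord_dist p F' (W i))"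
    if Gi: "{x \<in> space (m i). G i x < \<delta> / 4} \<in> sets (m i) \<and>
      1 - \<epsilon> / 2 \<le> m.prob i {x \<in> space (m i). G i x < \<delta> / 4}" for i
  proof (rule cov_pullback [OF prob_m \<Psi>m, where E = "{x \<in> space (m i). G i x < \<delta> / 4}"])
    show "{x \<in> space (m i). G i x < \<delta> / 4} \<in> sets (m i)"
      "1 - \<epsilon> / 2 \<le> m.prob i {x \<in> space (m i). G i x < \<delta> / 4}" using Gi by blast+
    show "\<epsilon> / 2 + \<epsilon> / 2 \<le> \<epsilon>" by simp
    show "coord_dist q F (W i) x \<in> borel_measurable (m i)" for x
      by (rule coord_dist_measurable [OF q sets_m])
    show "coord_dist p F' (W i) x \<in> borel_measurable (PiM (W i) (\<lambda>_. B))" for x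
      by (rule coord_dist_measurable [OF p refl])
    fix y x x'
    assume y: "y \<in> space (PiM (W i) (\<lambda>_. B))"
      and x: "x \<in> {x \<in> space (m i). G i x < \<delta> / 4}" and x': "x' \<in> {x \<in> space (m i). G i x < \<delta> / 4}"
      and dx: "coord_dist p F' (W i) y (\<Psi> i x) < \<delta>'" and dx': "coord_dist p F' (W i) y (\<Psi> i x') < \<delta>'"
    let ?P = "\<lambda>n v y. pev (a n) (sequence_coords p (pullback_name (s i) v y))"
    have near: "avg (W i) (\<lambda>v. \<bar>?P n v y - ?P n v (\<Psi> i u)\<bar>) \<le> plip (a n) * \<delta>'"
      if n: "n \<in> F" and u: "u \<in> space (m i)" "coord_dist p F' (W i) y (\<Psi> i u) < \<delta>'" for n u
    proof (rule avg_pev_diff [OF p])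
      show "v \<in> W i \<Longrightarrow> y v \<in> space B" for v by (rule spB [OF y])
      show "v \<in> W i \<Longrightarrow> \<Psi> i u v \<in> space B" for v by (rule spB [OF measurable_space [OF \<Psi>m u(1)]])
      fix k assume "k \<in> snd ` psupp (a n)"
      then have k: "k \<in> F'" using n by (auto simp: F'_def)
      have "avg (W i) (\<lambda>v. \<bar>p k (y v) - p k (\<Psi> i u v)\<bar>) \<le> coord_dist p F' (W i) y (\<Psi> i u)"
        unfolding coord_dist_def
        by (rule avg_mono) (rule member_le_sum [OF k], auto simp: F')
      then show "avg (W i) (\<lambda>v. \<bar>p k (y v) - p k (\<Psi> i u v)\<bar>) \<le> \<delta>'" using u(2) by simp
    qed
    have one: "avg (W i) (\<lambda>v. \<bar>q n (x v) - q n (x' v)\<bar>) \<le>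
        avg (W i) (\<lambda>v. \<bar>pev (d n) (J i v x)\<bar>) + avg (W i) (\<lambda>v. \<bar>pev (d n) (J i v x')\<bar>) + 2 * (plip (a n) * \<delta>')"
      if n: "n \<in> F" for n
    proof -
      have "avg (W i) (\<lambda>v. \<bar>q n (x v) - q n (x' v)\<bar>) = avg (W i) (\<lambda>v. \<bar>q n (x (s i 0 v)) - q n (x' (s i 0 v))\<bar>)"
        using avg_permutes [OF perm [of i 0], of "\<lambda>v. \<bar>q n (x v) - q n (x' v)\<bar>"] by simp
      also have "\<dots> \<le> avg (W i) (\<lambda>v. \<bar>pev (d n) (J i v x)\<bar> + \<bar>pev (d n) (J i v x')\<bar> +
          (\<bar>?P n v y - ?P n v (\<Psi> i x)\<bar> + \<bar>?P n v y - ?P n v (\<Psi> i x')\<bar>))"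
      proof (rule avg_mono)
        fix v
        have e: "pev (d n) (J i v u) = q n (u (s i 0 v)) - ?P n v (\<Psi> i u)" for u
          unfolding J_def d by (simp add: pullback_name_def)
        show "\<bar>q n (x (s i 0 v)) - q n (x' (s i 0 v))\<bar> \<le> \<bar>pev (d n) (J i v x)\<bar> + \<bar>pev (d n) (J i v x')\<bar> +
          (\<bar>?P n v y - ?P n v (\<Psi> i x)\<bar> + \<bar>?P n v y - ?P n v (\<Psi> i x')\<bar>)" unfolding e by linarith
      qed
      finally show ?thesis
        using near [OF n _ dx] near [OF n _ dx'] x x' by (simp add: avg_add)
    qed
    have "coord_dist q F (W i) x x' = (\<Sum>n\<in>F. avg (W i) (\<lambda>v. \<bar>q n (x v) - q n (x' v)\<bar>))"
      by (simp add: coord_dist_def avg_sum)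
    also have "\<dots> \<le> (\<Sum>n\<in>F. avg (W i) (\<lambda>v. \<bar>pev (d n) (J i v x)\<bar>) + avg (W i) (\<lambda>v. \<bar>pev (d n) (J i v x')\<bar>) + 2 * (plip (a n) * \<delta>'))"
      by (rule sum_mono) (rule one)
    also have "\<dots> = G i x + G i x' + 2 * C * \<delta>'"
      by (simp add: sum.distrib G_def C_def sum_distrib_left sum_distrib_right mult.assoc)
    also have "\<dots> < \<delta>" using x x' \<delta>' by simp
    finally show "coord_dist q F (W i) x x' < \<delta>" .
  qed
  have "\<forall>\<^sub>F i in sequentially. cov \<epsilon> \<delta> (m i) (coord_dist q F (W i)) \<le>
       cov (\<epsilon> / 2) \<delta>' (distr (m i) (PiM (W i) (\<lambda>_. B)) (\<Psi> i)) (coord_dist p F' (W i))"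
    using ev by eventually_elim (rule main)
  then show ?thesis using F' \<delta>'(1) pos by (intro exI [of _ F'] exI [of _ \<delta>'] exI [of _ "\<epsilon> / 2"]) auto
qed

subsection \<open>The entropy in terms of coordinates\<close>

definition dq_coords ::
    "('n \<Rightarrow> 'a \<Rightarrow> real) \<Rightarrow> (nat \<Rightarrow> 'v set) \<Rightarrow> (nat \<Rightarrow> 'g \<Rightarrow> 'v \<Rightarrow> 'v) \<Rightarrow> (nat \<Rightarrow> ('v \<Rightarrow> 'a) measure) \<Rightarrow>
     ('g \<Rightarrow> 'a) measure \<Rightarrow> bool" where
  "dq_coords q W s m \<mu> \<longleftrightarrow>
     pair_converges W m (\<lambda>i v x. sequence_coords q (pullback_name (s i) v x)) \<mu> (\<lambda>x. sequence_coords q x)"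

definition growth :: "(nat \<Rightarrow> 'v set) \<Rightarrow> (nat \<Rightarrow> enat) \<Rightarrow> ereal" where
  "growth W c = limsup (\<lambda>i. log_enat (c i) / ereal (real (card (W i))))"

definition rate_coords ::
    "('n \<Rightarrow> 'a \<Rightarrow> real) \<Rightarrow> (nat \<Rightarrow> 'v set) \<Rightarrow> (nat \<Rightarrow> ('v \<Rightarrow> 'a) measure) \<Rightarrow> ereal" where
  "rate_coords q W m = (SUP F\<in>{F. finite F}. SUP \<delta>\<in>{0<..}. SUP \<epsilon>\<in>{0<..}.
     growth W (\<lambda>i. cov \<epsilon> \<delta> (m i) (coord_dist q F (W i))))"

definition hdq_coords ::
    "(nat \<Rightarrow> 'v set) \<Rightarrow> (nat \<Rightarrow> 'g \<Rightarrow> 'v \<Rightarrow> 'v) \<Rightarrow> 'a measure \<Rightarrow> ('n \<Rightarrow> 'a \<Rightarrow> real) \<Rightarrow>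
     ('g \<Rightarrow> 'a) measure \<Rightarrow> ereal" where
  "hdq_coords V \<sigma> A q \<mu> = Sup {rate_coords q (V \<circ> r) m | r m. strict_mono r \<and>
     (\<forall>i. m i \<in> Prob (PiM (V (r i)) (\<lambda>_. A))) \<and> dq_coords q (V \<circ> r) (\<sigma> \<circ> r) m \<mu>}"

lemma log_enat_mono: "a \<le> b \<Longrightarrow> log_enat a \<le> log_enat b"
  by (cases a; cases b) auto

lemma growth_mono:
  assumes "\<forall>\<^sub>F i in sequentially. c i \<le> c' i" "\<And>i. 0 < card (W i)"
  shows "growth W c \<le> growth W c'"
  unfolding growth_def
proof (rule Limsup_mono)
  show "\<forall>\<^sub>F i in sequentially. log_enat (c i) / ereal (real (card (W i))) \<le> log_enat (c' i) / ereal (real (card (W i)))"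
    using assms(1) by eventually_elim (use assms(2) in \<open>intro ereal_divide_right_mono log_enat_mono, auto\<close>)
qed

lemma sofic_approximation_sequence:
  assumes "sofic_approximation V \<sigma>" "strict_mono r"
  shows "sofic_sequence (V \<circ> r) (\<sigma> \<circ> r)"
proof
  show "finite ((V \<circ> r) i)" "(V \<circ> r) i \<noteq> {}" "(\<sigma> \<circ> r) i g permutes (V \<circ> r) i" for i g
    using assms(1) by (auto simp: sofic_approximation_def)
  fix g h
  have "(\<lambda>n. real (card {v \<in> V n. \<sigma> n g (\<sigma> n h v) = \<sigma> n (g + h) v}) / real (card (V n))) \<longlonglongrightarrow> 1"
    using assms(1) by (auto simp: sofic_approximation_def)
  from LIMSEQ_subseq_LIMSEQ [OF this assms(2)]
  show "(\<lambda>i. real (card {v \<in> (V \<circ> r) i. (\<sigma> \<circ> r) i g ((\<sigma> \<circ> r) i h v) = (\<sigma> \<circ> r) i (g + h) v}) /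
      real (card ((V \<circ> r) i))) \<longlonglongrightarrow> 1" by (simp add: o_def)
qed

lemma pair_converges_reindex:
  assumes conv: "pair_converges W m z P Z"
    and eq: "\<And>L L' i v w. v \<in> W i \<Longrightarrow> w \<in> W i \<Longrightarrow>
        (\<integral>x. monomial L (z' i v x) * monomial L' (z' i w x) \<partial>m' i) =
        (\<integral>x. monomial (map \<rho> L) (z i v x) * monomial (map \<rho> L') (z i w x) \<partial>m i)"
    and eq': "\<And>L. (\<integral>y. monomial L (Z' y) \<partial>P') = (\<integral>y. monomial (map \<rho> L) (Z y) \<partial>P)"
  shows "pair_converges W m' z' P' Z'"
  unfolding pair_converges_def
proof (intro allI)
  fix L L'
  have "(\<lambda>i. avg (W i) (\<lambda>v. avg (W i) (\<lambda>w. \<bar>(\<integral>x. monomial (map \<rho> L) (z i v x) * monomial (map \<rho> L') (z i w x) \<partial>m i)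
      - (\<integral>y. monomial (map \<rho> L) (Z y) \<partial>P) * (\<integral>y. monomial (map \<rho> L') (Z y) \<partial>P)\<bar>))) \<longlonglongrightarrow> 0"
    using conv unfolding pair_converges_def by blast
  moreover have "avg (W i) (\<lambda>v. avg (W i) (\<lambda>w. \<bar>(\<integral>x. monomial (map \<rho> L) (z i v x) * monomial (map \<rho> L') (z i w x) \<partial>m i)
      - (\<integral>y. monomial (map \<rho> L) (Z y) \<partial>P) * (\<integral>y. monomial (map \<rho> L') (Z y) \<partial>P)\<bar>)) =
    avg (W i) (\<lambda>v. avg (W i) (\<lambda>w. \<bar>(\<integral>x. monomial L (z' i v x) * monomial L' (z' i w x) \<partial>m' i)
      - (\<integral>y. monomial L (Z' y) \<partial>P') * (\<integral>y. monomial L' (Z' y) \<partial>P')\<bar>))" for i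
    by (intro avg_cong) (simp only: eq eq')
  ultimately show "(\<lambda>i. avg (W i) (\<lambda>v. avg (W i) (\<lambda>w. \<bar>(\<integral>x. monomial L (z' i v x) * monomial L' (z' i w x) \<partial>m' i)
      - (\<integral>y. monomial L (Z' y) \<partial>P') * (\<integral>y. monomial L' (Z' y) \<partial>P')\<bar>))) \<longlonglongrightarrow> 0" by simp
qed

lemma Prob_distr: "\<nu> \<in> Prob M \<Longrightarrow> f \<in> measurable M N \<Longrightarrow> distr \<nu> N f \<in> Prob N"
  using measurable_cong_sets [of \<nu> M N N] by (auto simp: Prob_def intro!: prob_space.prob_space_distr)

text \<open>
  Code good models of \<open>X\<close> to good models of \<open>Y\<close>.  The coded models have rates that are at least the
  given ones, since \<open>X\<close> can be decoded from \<open>Y\<close>.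
\<close>

theorem hdq_coords_le_of_coding:
  fixes q :: "'n::countable \<Rightarrow> 'a \<Rightarrow> real" and p :: "'m::countable \<Rightarrow> 'b \<Rightarrow> real"
    and \<sigma> :: "nat \<Rightarrow> 'g::{group_add,countable} \<Rightarrow> 'v \<Rightarrow> 'v" and X :: "'u \<Rightarrow> 'g \<Rightarrow> 'a" and Y :: "'u \<Rightarrow> 'g \<Rightarrow> 'b"
  assumes sof: "sofic_approximation V \<sigma>" and q: "coordinates A q" and p: "coordinates B p"
    and P: "prob_space P" and X: "X \<in> measurable P (PiM UNIV (\<lambda>_. A))" and Y: "Y \<in> measurable P (PiM UNIV (\<lambda>_. B))"
    and f: "f \<in> measurable (PiM UNIV (\<lambda>_. A)) B" and code: "\<And>g. AE w in P. Y w g = f (shift g (X w))"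
    and f': "f' \<in> measurable (PiM UNIV (\<lambda>_. B)) A" and code': "AE w in P. X w 0 = f' (Y w)"
    and stat: "\<And>g. distr P (PiM UNIV (\<lambda>_. A)) (\<lambda>w. shift g (X w)) = distr P (PiM UNIV (\<lambda>_. A)) X"
  shows "hdq_coords V \<sigma> A q (distr P (PiM UNIV (\<lambda>_. A)) X) \<le> hdq_coords V \<sigma> B p (distr P (PiM UNIV (\<lambda>_. B)) Y)"
  unfolding hdq_coords_def [of V \<sigma> A]
proof (rule Sup_least, clarify)
  let ?SA = "PiM (UNIV :: 'g set) (\<lambda>_. A)" and ?SB = "PiM (UNIV :: 'g set) (\<lambda>_. B)"
  fix r m assume r: "strict_mono (r :: nat \<Rightarrow> nat)" and m: "\<forall>i. m i \<in> Prob (PiM (V (r i)) (\<lambda>_. A))"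
    and dq: "dq_coords q (V \<circ> r) (\<sigma> \<circ> r) m (distr P ?SA X)"
  define W s where "W = V \<circ> r" and "s = \<sigma> \<circ> r"
  interpret S: sofic_sequence W s
    unfolding W_def s_def by (rule sofic_approximation_sequence [OF sof r])
  have Xg: "(\<lambda>w. X w g) \<in> measurable P A" for g
    using measurable_compose [OF X measurable_component_singleton] by simp
  have Yg: "(\<lambda>w. Y w g) \<in> measurable P B" for g
    using measurable_compose [OF Y measurable_component_singleton] by simp
  have sA: "cube_field ?SA (\<lambda>x. sequence_coords q x)" by (rule cube_field_sequence_coords [OF q]) simp
  have sB: "cube_field ?SB (\<lambda>x. sequence_coords p x)" by (rule cube_field_sequence_coords [OF p]) simp
  have mW: "prob_space (m i)" "sets (m i) = sets (PiM (W i) (\<lambda>_. A))" for i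
    using m by (auto simp: Prob_def W_def)
  have conv: "pair_converges W m (\<lambda>i v x. sequence_coords q (pullback_name (s i) v x)) P (\<lambda>w. sequence_coords q (X w))"
    by (rule pair_converges_reindex [OF dq [unfolded dq_coords_def, folded W_def s_def], where \<rho> = "\<lambda>j. j"])
      (simp_all add: integral_distr [OF X cube_field_monomial(1) [OF sA]])
  interpret C: coding W s m A q B p P X Y f
    by (rule coding.intro [OF S.sofic_sequence_axioms coding_axioms.intro])
      (rule q p mW P Xg Yg f code stat conv)+
  obtain \<Psi> where \<Psi>: "\<And>i. \<Psi> i \<in> measurable (PiM (W i) (\<lambda>_. A)) (PiM (W i) (\<lambda>_. B))"
    and joint: "pair_converges W m (\<lambda>i v x. joint_coords q p (pullback_name (s i) v x) (pullback_name (s i) v (\<Psi> i x)))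
        P (\<lambda>w. joint_coords q p (X w) (Y w))"
    by (rule C.coded_models_exist) blast
  define n where "n i = distr (m i) (PiM (W i) (\<lambda>_. B)) (\<Psi> i)" for i
  have \<Psi>m: "\<Psi> i \<in> measurable (m i) (PiM (W i) (\<lambda>_. B))" for i
    by (rule C.measurable_m [OF \<Psi>])
  have n: "n i \<in> Prob (PiM (V (r i)) (\<lambda>_. B))" for i
    using Prob_distr [OF m [rule_format] \<Psi> [unfolded W_def o_def]] by (simp add: n_def W_def)
  have mon: "monomial (map (\<lambda>(g, k). (g, Inr k)) L) (joint_coords q p x y) = monomial L (sequence_coords p y)" for L x y
    by (simp add: monomial_map) (rule arg_cong [of _ _ "monomial L"], auto simp: fun_eq_iff)
  have "dq_coords p W s n (distr P ?SB Y)"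
    unfolding dq_coords_def
  proof (rule pair_converges_reindex [OF joint, where \<rho> = "\<lambda>(g, k). (g, Inr k)"])
    fix L L' i v w assume v: "v \<in> W i" and w: "w \<in> W i"
    have c: "cube_field (PiM (W i) (\<lambda>_. B)) (\<lambda>y. sequence_coords p (pullback_name (s i) v y))" if "v \<in> W i" for v
      by (rule cube_field_sequence_coords [OF p])
        (unfold pullback_name_def, rule measurable_component_singleton [OF S.map_in [OF that]])
    show "(\<integral>y. monomial L (sequence_coords p (pullback_name (s i) v y)) *
          monomial L' (sequence_coords p (pullback_name (s i) w y)) \<partial>n i) =
        (\<integral>x. monomial (map (\<lambda>(g, k). (g, Inr k)) L) (joint_coords q p (pullback_name (s i) v x) (pullback_name (s i) v (\<Psi> i x))) *
          monomial (map (\<lambda>(g, k). (g, Inr k)) L') (joint_coords q p (pullback_name (s i) w x) (pullback_name (s i) w (\<Psi> i x))) \<partial>m i)"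
      unfolding mon n_def
      by (rule integral_distr [OF \<Psi>m borel_measurable_times]) (rule cube_field_monomial(1) [OF c [OF v]] cube_field_monomial(1) [OF c [OF w]])+
  next
    fix L
    show "(\<integral>y. monomial L (sequence_coords p y) \<partial>distr P ?SB Y) =
        (\<integral>w. monomial (map (\<lambda>(g, k). (g, Inr k)) L) (joint_coords q p (X w) (Y w)) \<partial>P)"
      unfolding mon by (rule integral_distr [OF Y cube_field_monomial(1) [OF sB]])
  qed
  then have "rate_coords p W n \<le> hdq_coords V \<sigma> B p (distr P ?SB Y)"
    unfolding hdq_coords_def using r n by (intro Sup_upper) (auto simp: W_def s_def)
  moreover have "rate_coords q W m \<le> rate_coords p W n"
    unfolding rate_coords_def [of q]
  proof (intro SUP_least)
    fix F :: "'n set" and \<delta> \<epsilon> :: real assume "F \<in> {F. finite F}" "\<delta> \<in> {0<..}" "\<epsilon> \<in> {0<..}"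
    then have F: "finite F" "0 < \<epsilon>" "0 < \<delta>" by auto
    obtain F' \<delta>' \<epsilon>' where F': "finite F'" "0 < \<delta>'" "0 < \<epsilon>'"
      and le: "\<forall>\<^sub>F i in sequentially. cov \<epsilon> \<delta> (m i) (coord_dist q F (W i)) \<le> cov \<epsilon>' \<delta>' (n i) (coord_dist p F' (W i))"
      using decoded_cov_le [OF S.sofic_sequence_axioms q p mW P Xg Yg f' code' \<Psi> joint F] unfolding n_def by blast
    have "growth W (\<lambda>i. cov \<epsilon> \<delta> (m i) (coord_dist q F (W i))) \<le> growth W (\<lambda>i. cov \<epsilon>' \<delta>' (n i) (coord_dist p F' (W i)))"
      by (rule growth_mono [OF le]) (simp add: card_gt_0_iff S.fin S.nonempty)
    also have "\<dots> \<le> rate_coords p W n"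
      unfolding rate_coords_def using F'
      by (intro SUP_upper2 [of F'] SUP_upper2 [of \<delta>'] SUP_upper2 [of \<epsilon>']) auto
    finally show "growth W (\<lambda>i. cov \<epsilon> \<delta> (m i) (coord_dist q F (W i))) \<le> rate_coords p W n" .
  qed
  ultimately show "rate_coords q (V \<circ> r) m \<le> hdq_coords V \<sigma> B p (distr P ?SB Y)"
    unfolding W_def by (rule order_trans [rotated])
qed

text \<open>
  Both processes are functions of a point of the system; by equivariance, a letter of one name is a
  function of the shifted other name.
\<close>

lemma hdq_coords_le_of_isomorphic:
  fixes q :: "'n::countable \<Rightarrow> 'a \<Rightarrow> real" and p :: "'m::countable \<Rightarrow> 'b \<Rightarrow> real"
    and \<sigma> :: "nat \<Rightarrow> 'g::{group_add,countable} \<Rightarrow> 'v \<Rightarrow> 'v" and M :: "'u measure"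
  assumes sof: "sofic_approximation V \<sigma>" and q: "coordinates A q" and p: "coordinates B p"
    and M: "prob_space M" and T: "\<And>g. T g \<in> measurable M M" "\<And>g. distr M M (T g) = M"
    and \<mu>: "sets \<mu> = sets (PiM UNIV (\<lambda>_. A))" "system_isomorphic M T \<mu> shift"
    and \<nu>: "sets \<nu> = sets (PiM UNIV (\<lambda>_. B))" "system_isomorphic M T \<nu> shift"
  shows "hdq_coords V \<sigma> A q \<mu> \<le> hdq_coords V \<sigma> B p \<nu>"
proof -
  let ?SA = "PiM (UNIV :: 'g set) (\<lambda>_. A)" and ?SB = "PiM (UNIV :: 'g set) (\<lambda>_. B)"
  obtain \<phi> \<psi> where \<phi>: "\<phi> \<in> measurable M \<mu>" "\<psi> \<in> measurable \<mu> M" "distr M \<mu> \<phi> = \<mu>"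
    "AE x in M. \<psi> (\<phi> x) = x" "\<And>g. AE x in M. \<phi> (T g x) = shift g (\<phi> x)"
    using \<mu>(2) unfolding system_isomorphic_def by blast
  obtain \<phi>' \<psi>' where \<phi>': "\<phi>' \<in> measurable M \<nu>" "\<psi>' \<in> measurable \<nu> M" "distr M \<nu> \<phi>' = \<nu>"
    "AE x in M. \<psi>' (\<phi>' x) = x" "\<And>g. AE x in M. \<phi>' (T g x) = shift g (\<phi>' x)"
    using \<nu>(2) unfolding system_isomorphic_def by blast
  have X: "\<phi> \<in> measurable M ?SA" and Y: "\<phi>' \<in> measurable M ?SB"
    and psi: "\<psi> \<in> measurable ?SA M" and psi': "\<psi>' \<in> measurable ?SB M"
    using \<phi>(1,2) \<phi>'(1,2)
    by (simp_all add: measurable_cong_sets [OF refl \<mu>(1)] measurable_cong_sets [OF refl \<nu>(1)]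
      measurable_cong_sets [OF \<mu>(1) refl] measurable_cong_sets [OF \<nu>(1) refl])
  have dX: "distr M ?SA \<phi> = \<mu>" using \<phi>(3) distr_cong [OF refl \<mu>(1), of M \<phi> \<phi>] by simp
  have dY: "distr M ?SB \<phi>' = \<nu>" using \<phi>'(3) distr_cong [OF refl \<nu>(1), of M \<phi>' \<phi>'] by simp
  have sh: "shift g \<in> measurable ?SA ?SA" for g
    by (rule measurable_PiM_single') (auto simp: shift_def space_PiM PiE_iff)
  have at: "AE x in M. \<psi> (\<phi> (T g x)) = T g x" for g
    by (rule AE_distrD [OF T(1)]) (unfold T(2), rule \<phi>(4))
  have f: "(\<lambda>x. \<phi>' (\<psi> x) 0) \<in> measurable ?SA B"
    using measurable_compose [OF measurable_compose [OF psi Y] measurable_component_singleton] by simp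
  have f': "(\<lambda>y. \<phi> (\<psi>' y) 0) \<in> measurable ?SB A"
    using measurable_compose [OF measurable_compose [OF psi' X] measurable_component_singleton] by simp
  have code: "AE w in M. \<phi>' w g = \<phi>' (\<psi> (shift g (\<phi> w))) 0" for g
    using \<phi>(5) [of g] \<phi>'(5) [of g] at [of g]
  proof eventually_elim
    case (elim w)
    have "\<phi>' (\<psi> (shift g (\<phi> w))) 0 = \<phi>' (T g w) 0" using elim(1,3) by simp
    also have "\<dots> = \<phi>' w g" by (simp add: elim(2) shift_def)
    finally show ?case by simp
  qed
  have code': "AE w in M. \<phi> w 0 = \<phi> (\<psi>' (\<phi>' w)) 0"
    using \<phi>'(4) by eventually_elim simp
  have stat: "distr M ?SA (\<lambda>w. shift g (\<phi> w)) = distr M ?SA \<phi>" for g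
  proof -
    have "distr M ?SA (\<lambda>w. shift g (\<phi> w)) = distr M ?SA (\<lambda>w. \<phi> (T g w))"
    proof (rule distr_cong_AE)
      show "AE w in M. shift g (\<phi> w) = \<phi> (T g w)" using \<phi>(5) [of g] by eventually_elim simp
      show "(\<lambda>w. shift g (\<phi> w)) \<in> measurable M ?SA" by (rule measurable_compose [OF X sh])
      show "(\<lambda>w. \<phi> (T g w)) \<in> measurable M ?SA" by (rule measurable_compose [OF T(1) X])
    qed auto
    also have "\<dots> = distr (distr M M (T g)) ?SA \<phi>"
      by (simp add: distr_distr [OF X T(1)] o_def)
    finally show ?thesis by (simp add: T(2))
  qed
  show ?thesis
    using hdq_coords_le_of_coding [OF sof q p M X Y f code f' code' stat] by (simp add: dX dY)
qed

section \<open>Powers\<close>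

definition power_coords :: "('n \<Rightarrow> 'a \<Rightarrow> real) \<Rightarrow> nat \<Rightarrow> nat \<times> 'n \<Rightarrow> (nat \<Rightarrow> 'a) \<Rightarrow> real" where
  "power_coords q k = (\<lambda>(j, n) a. if j < k then q n (a j) else 0)"

lemma power_coords_apply [simp]: "power_coords q k (j, n) a = (if j < k then q n (a j) else 0)"
  by (simp add: power_coords_def)

lemma coordinates_power:
  fixes q :: "'n::countable \<Rightarrow> 'a \<Rightarrow> real"
  assumes q: "coordinates A q"
  shows "coordinates (PiM {..<k} (\<lambda>_. A)) (power_coords q k)"
  unfolding coordinates_def
proof (intro conjI ballI)
  show "cube_field (PiM {..<k} (\<lambda>_. A)) (\<lambda>a n. power_coords q k n a)"
  proof (rule cube_fieldI)
    fix jn :: "nat \<times> 'n"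
    obtain j n where jn: "jn = (j, n)" by (cases jn)
    show "(\<lambda>a. power_coords q k jn a) \<in> borel_measurable (PiM {..<k} (\<lambda>_. A))"
      using measurable_compose [OF measurable_component_singleton [of j "{..<k}"] coordinates_measurable [OF q]]
      by (cases "j < k") (simp_all add: jn)
    fix a assume "a \<in> space (PiM {..<k} (\<lambda>_. A))"
    then show "0 \<le> power_coords q k jn a \<and> power_coords q k jn a \<le> 1"
      using coordinates_range [OF q] by (auto simp: jn space_PiM)
  qed
  fix S assume "S \<in> sets (PiM {..<k} (\<lambda>_. A))"
  from PiM_coords_generate [OF q this]
  show "\<exists>O'\<in>sets borel. S = (\<lambda>a n. power_coords q k n a) -` O' \<inter> space (PiM {..<k} (\<lambda>_. A))"
    by (simp add: power_coords_def case_prod_unfold)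
qed

text \<open>
  The identification of \<open>(A\<^sup>I)\<^sup>k\<close> with \<open>(A\<^sup>k)\<^sup>I\<close>.
\<close>

definition transpose_names :: "nat \<Rightarrow> 'i set \<Rightarrow> (nat \<Rightarrow> 'i \<Rightarrow> 'a) \<Rightarrow> 'i \<Rightarrow> nat \<Rightarrow> 'a" where
  "transpose_names k I x = (\<lambda>i\<in>I. \<lambda>j\<in>{..<k}. x j i)"

lemma transpose_names_measurable:
  "transpose_names k I \<in> measurable (PiM {..<k} (\<lambda>_. PiM I (\<lambda>_. A))) (PiM I (\<lambda>_. PiM {..<k} (\<lambda>_. A)))"
proof -
  have "(\<lambda>x. x j i) \<in> measurable (PiM {..<k} (\<lambda>_. PiM I (\<lambda>_. A))) A" if "j < k" "i \<in> I" for j i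
  proof -
    have "(\<lambda>x. x j) \<in> measurable (PiM {..<k} (\<lambda>_. PiM I (\<lambda>_. A))) (PiM I (\<lambda>_. A))"
      by (rule measurable_component_singleton) (use that in simp)
    moreover have "(\<lambda>y. y i) \<in> measurable (PiM I (\<lambda>_. A)) A"
      by (rule measurable_component_singleton) (use that in simp)
    ultimately show ?thesis by (rule measurable_compose)
  qed
  then show ?thesis unfolding transpose_names_def by (intro measurable_restrict) auto
qed

lemma transpose_names_measurable':
  assumes "sets m = sets (PiM I (\<lambda>_. A))"
  shows "transpose_names k I \<in> measurable (PiM {..<k} (\<lambda>_. m)) (PiM I (\<lambda>_. PiM {..<k} (\<lambda>_. A)))"
  using transpose_names_measurable measurable_cong_sets [OF sets_PiM_cong [OF refl assms] refl] by blast

definition power_process :: "nat \<Rightarrow> 'a measure \<Rightarrow> ('g \<Rightarrow> 'a) measure \<Rightarrow> ('g \<Rightarrow> nat \<Rightarrow> 'a) measure" where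
  "power_process k A \<mu> = distr (PiM {..<k} (\<lambda>_. \<mu>)) (PiM UNIV (\<lambda>_. PiM {..<k} (\<lambda>_. A))) (transpose_names k UNIV)"

definition comp_list :: "nat \<Rightarrow> ('g \<times> nat \<times> 'n) list \<Rightarrow> ('g \<times> 'n) list" where
  "comp_list j L = map (\<lambda>(g, j', n). (g, n)) (filter (\<lambda>(g, j', n). j' = j) L)"

text \<open>
  A monomial in the coordinates of the power is a product of monomials, one for each component.
\<close>

lemma monomial_power:
  assumes "\<And>g j n. (g, j, n) \<in> set L \<Longrightarrow> j < k"
  shows "monomial L (sequence_coords (power_coords q k) y) =
    (\<Prod>j<k. monomial (comp_list j L) (sequence_coords q (\<lambda>g. y g j)))"
  using assms
proof (induction L)
  case Nil
  show ?case by (simp add: comp_list_def)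
next
  case (Cons e L)
  obtain g i n where e: "e = (g, i, n)" by (cases e)
  have i: "i < k" using Cons.prems [of g i n] e by simp
  have IH: "monomial L (sequence_coords (power_coords q k) y) =
    (\<Prod>j<k. monomial (comp_list j L) (sequence_coords q (\<lambda>g. y g j)))"
    using Cons by auto
  have "(\<Prod>j<k. monomial (comp_list j (e # L)) (sequence_coords q (\<lambda>g. y g j))) =
     (\<Prod>j<k. (if j = i then q n (y g i) else 1) * monomial (comp_list j L) (sequence_coords q (\<lambda>g. y g j)))"
    by (intro prod.cong) (auto simp: comp_list_def e)
  also have "\<dots> = q n (y g i) * (\<Prod>j<k. monomial (comp_list j L) (sequence_coords q (\<lambda>g. y g j)))"
    using i by (simp add: prod.distrib)
  finally show ?case using i by (simp add: e IH)
qed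

lemma monomial_power_eq_0:
  assumes "(g, j, n) \<in> set L" "\<not> j < k"
  shows "monomial L (sequence_coords (power_coords q k) y) = 0"
  using assms by (induction L) auto

lemma monomial_power_pair_integral:
  fixes a b :: "'x \<Rightarrow> 'g \<Rightarrow> 'a" and q :: "'n \<Rightarrow> 'a \<Rightarrow> real" and k :: nat
  assumes m: "prob_space m" and q: "coordinates A q"
    and a: "\<And>g. (\<lambda>x. a x g) \<in> measurable m A" and b: "\<And>g. (\<lambda>x. b x g) \<in> measurable m A"
    and L: "\<And>g j n. (g, j, n) \<in> set L \<Longrightarrow> j < k" and L': "\<And>g j n. (g, j, n) \<in> set L' \<Longrightarrow> j < k"
  shows "(\<integral>x. monomial L (sequence_coords (power_coords q k) (\<lambda>g j. a (x j) g)) *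
        monomial L' (sequence_coords (power_coords q k) (\<lambda>g j. b (x j) g)) \<partial>PiM {..<k} (\<lambda>_. m)) =
    (\<Prod>j<k. \<integral>x. monomial (comp_list j L) (sequence_coords q (a x)) * monomial (comp_list j L') (sequence_coords q (b x)) \<partial>m)"
proof -
  interpret prob_space m by fact
  interpret product_sigma_finite "\<lambda>_::nat. m" by unfold_locales
  have ca: "cube_field m (\<lambda>x. sequence_coords q (a x))" by (rule cube_field_sequence_coords [OF q a])
  have cb: "cube_field m (\<lambda>x. sequence_coords q (b x))" by (rule cube_field_sequence_coords [OF q b])
  have "integrable m (\<lambda>x. monomial K (sequence_coords q (a x)) * monomial K' (sequence_coords q (b x)))" for K K'
  proof (rule integrable_bounded [where C = 1])
    show "(\<lambda>x. monomial K (sequence_coords q (a x)) * monomial K' (sequence_coords q (b x))) \<in> borel_measurable m"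
      using cube_field_monomial(1) [OF ca] cube_field_monomial(1) [OF cb] by auto
    fix x assume "x \<in> space m"
    then show "\<bar>monomial K (sequence_coords q (a x)) * monomial K' (sequence_coords q (b x))\<bar> \<le> 1"
      using cube_field_monomial(2) [OF ca, of x K] cube_field_monomial(2) [OF cb, of x K']
      by (auto simp: abs_mult intro!: mult_le_one)
  qed
  then have "(\<Prod>j<k. \<integral>x. monomial (comp_list j L) (sequence_coords q (a x)) * monomial (comp_list j L') (sequence_coords q (b x)) \<partial>m) =
    (\<integral>x. (\<Prod>j<k. monomial (comp_list j L) (sequence_coords q (a (x j))) * monomial (comp_list j L') (sequence_coords q (b (x j)))) \<partial>PiM {..<k} (\<lambda>_. m))"
    by (subst product_integral_prod) auto
  also have "\<dots> = (\<integral>x. monomial L (sequence_coords (power_coords q k) (\<lambda>g j. a (x j) g)) *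
        monomial L' (sequence_coords (power_coords q k) (\<lambda>g j. b (x j) g)) \<partial>PiM {..<k} (\<lambda>_. m))"
    using L L' by (intro Bochner_Integration.integral_cong refl) (simp add: monomial_power prod.distrib)
  finally show ?thesis by simp
qed

lemma sequence_power_coords_cong:
  "(\<And>g j. j < k \<Longrightarrow> y g j = y' g j) \<Longrightarrow>
    sequence_coords (power_coords q k) y = sequence_coords (power_coords q k) y'"
  by (auto simp: sequence_coords_def fun_eq_iff)

locale power_setting = sofic_sequence W s
  for W :: "nat \<Rightarrow> 'v set" and s :: "nat \<Rightarrow> 'g::{group_add,countable} \<Rightarrow> 'v \<Rightarrow> 'v" +
  fixes A :: "'a measure" and q :: "'n::countable \<Rightarrow> 'a \<Rightarrow> real" and \<mu> :: "('g \<Rightarrow> 'a) measure" and k :: nat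
  assumes q: "coordinates A q" and \<mu>: "\<mu> \<in> Prob (PiM UNIV (\<lambda>_. A))" and k: "0 < k"
begin

abbreviation "Ak \<equiv> PiM {..<k} (\<lambda>_. A)"
abbreviation "qk \<equiv> power_coords q k"

lemma prob_\<mu>: "prob_space \<mu>" and sets_\<mu>: "sets \<mu> = sets (PiM UNIV (\<lambda>_. A))"
  using \<mu> by (auto simp: Prob_def)

lemma \<mu>_component: "(\<lambda>x. x g) \<in> measurable \<mu> A"
  using measurable_component_singleton [of g UNIV "\<lambda>_. A"] measurable_cong_sets [OF sets_\<mu> refl] by blast

lemma qk: "coordinates Ak qk"
  by (rule coordinates_power [OF q])

lemma pullback_component:
  assumes "sets m = sets (PiM (W i) (\<lambda>_. B))" "v \<in> W i"
  shows "(\<lambda>x. pullback_name (s i) v x g) \<in> measurable m B"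
proof -
  have "(\<lambda>x. x (s i g v)) \<in> measurable (PiM (W i) (\<lambda>_. B)) B"
    by (rule measurable_component_singleton) (rule map_in [OF assms(2)])
  then show ?thesis by (simp add: pullback_name_def measurable_cong_sets [OF assms(1) refl])
qed

lemma pullback_transpose:
  assumes "v \<in> W i"
  shows "sequence_coords qk (pullback_name (s i) v (transpose_names k (W i) x)) =
     sequence_coords qk (\<lambda>g j. pullback_name (s i) v (x j) g)"
  using map_in [OF assms] by (intro sequence_power_coords_cong) (simp add: pullback_name_def transpose_names_def)

lemma seqk_measurable: "cube_field (PiM UNIV (\<lambda>_. Ak)) (\<lambda>y. sequence_coords qk y)"
  by (rule cube_field_sequence_coords [OF qk]) simp

lemma integral_power_process:
  "(\<integral>y. monomial L (sequence_coords qk y) \<partial>power_process k A \<mu>) =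
   (\<integral>x. monomial L (sequence_coords qk (\<lambda>g j. x j g)) \<partial>PiM {..<k} (\<lambda>_. \<mu>))"
proof -
  have eq: "sequence_coords qk (transpose_names k UNIV x) = sequence_coords qk (\<lambda>g j. x j g)" for x :: "nat \<Rightarrow> 'g \<Rightarrow> 'a"
    by (rule sequence_power_coords_cong) (simp add: transpose_names_def)
  have "(\<integral>y. monomial L (sequence_coords qk y) \<partial>power_process k A \<mu>) =
      (\<integral>x. monomial L (sequence_coords qk (transpose_names k UNIV x)) \<partial>PiM {..<k} (\<lambda>_. \<mu>))"
    unfolding power_process_def
    by (rule integral_distr [OF transpose_names_measurable' [OF sets_\<mu>] cube_field_monomial(1) [OF seqk_measurable]])
  then show ?thesis by (simp only: eq)
qed

subsection \<open>Marginals\<close>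

definition marginal :: "(nat \<Rightarrow> ('v \<Rightarrow> nat \<Rightarrow> 'a) measure) \<Rightarrow> nat \<Rightarrow> nat \<Rightarrow> ('v \<Rightarrow> 'a) measure" where
  "marginal n j i = distr (n i) (PiM (W i) (\<lambda>_. A)) (\<lambda>y. \<lambda>v\<in>W i. y v j)"

lemma marginal_map_measurable:
  assumes n: "n i \<in> Prob (PiM (W i) (\<lambda>_. Ak))" and j: "j < k"
  shows "(\<lambda>y. \<lambda>v\<in>W i. y v j) \<in> measurable (n i) (PiM (W i) (\<lambda>_. A))"
proof (rule measurable_restrict)
  fix v assume v: "v \<in> W i"
  have "(\<lambda>y. y v j) \<in> measurable (PiM (W i) (\<lambda>_. Ak)) A"
    by (rule measurable_compose [OF measurable_component_singleton [OF v] measurable_component_singleton]) (use j in simp)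
  then show "(\<lambda>y. y v j) \<in> measurable (n i) A"
    using n measurable_cong_sets [of "n i" "PiM (W i) (\<lambda>_. Ak)" A A] by (simp add: Prob_def)
qed

lemma marginal_Prob:
  assumes n: "n i \<in> Prob (PiM (W i) (\<lambda>_. Ak))" and j: "j < k"
  shows "marginal n j i \<in> Prob (PiM (W i) (\<lambda>_. A))"
  using n marginal_map_measurable [where n = n and i = i, OF assms]
  by (auto simp: Prob_def marginal_def intro: prob_space.prob_space_distr)

text \<open>
  A monomial of the \<open>j\<close>-th component is a monomial of the power with its indices renamed.
\<close>

lemma marginal_converges:
  assumes n: "\<And>i. n i \<in> Prob (PiM (W i) (\<lambda>_. Ak))" and j: "j < k"
    and conv: "dq_coords qk W s n (power_process k A \<mu>)"
  shows "dq_coords q W s (marginal n j) \<mu>"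
  unfolding dq_coords_def
proof (rule pair_converges_reindex [OF conv [unfolded dq_coords_def], where \<rho> = "\<lambda>(g, n). (g, j, n)"])
  have mon: "monomial (map (\<lambda>(g, n). (g, j, n)) L) (sequence_coords qk y) = monomial L (sequence_coords q (\<lambda>g. y g j))"
    for L y using j
    by (simp add: monomial_map) (rule arg_cong [of _ _ "monomial L"], auto simp: fun_eq_iff)
  fix L L' i v w assume v: "v \<in> W i" and w: "w \<in> W i"
  have c: "cube_field (PiM (W i) (\<lambda>_. A)) (\<lambda>y. sequence_coords q (pullback_name (s i) v y))" if "v \<in> W i" for v
    by (rule cube_field_sequence_coords [OF q pullback_component [OF refl that]])
  have eq: "sequence_coords q (pullback_name (s i) v (\<lambda>v\<in>W i. y v j)) = sequence_coords q (\<lambda>g. pullback_name (s i) v y g j)"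
    if "v \<in> W i" for v y
    using map_in [OF that] by (simp add: pullback_name_def)
  show "(\<integral>y. monomial L (sequence_coords q (pullback_name (s i) v y)) *
          monomial L' (sequence_coords q (pullback_name (s i) w y)) \<partial>marginal n j i) =
        (\<integral>y. monomial (map (\<lambda>(g, n). (g, j, n)) L) (sequence_coords qk (pullback_name (s i) v y)) *
          monomial (map (\<lambda>(g, n). (g, j, n)) L') (sequence_coords qk (pullback_name (s i) w y)) \<partial>n i)"
    unfolding mon marginal_def eq [OF v, symmetric] eq [OF w, symmetric]
    by (rule integral_distr [OF marginal_map_measurable [where n = n, OF n j] borel_measurable_times])
      (rule cube_field_monomial(1) [OF c [OF v]] cube_field_monomial(1) [OF c [OF w]])+
next
  have mon: "monomial (map (\<lambda>(g, n). (g, j, n)) L) (sequence_coords qk y) = monomial L (sequence_coords q (\<lambda>g. y g j))"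
    for L and y :: "'g \<Rightarrow> nat \<Rightarrow> 'a" using j
    by (simp add: monomial_map) (rule arg_cong [of _ _ "monomial L"], auto simp: fun_eq_iff)
  fix L
  have c: "cube_field \<mu> (\<lambda>x. sequence_coords q x)" by (rule cube_field_sequence_coords [OF q \<mu>_component])
  have comp: "(\<lambda>x. x j) \<in> measurable (PiM {..<k} (\<lambda>_. \<mu>)) \<mu>"
    by (rule measurable_component_singleton) (use j in simp)
  have "(\<integral>y. monomial (map (\<lambda>(g, n). (g, j, n)) L) (sequence_coords qk y) \<partial>power_process k A \<mu>) =
      (\<integral>x. monomial L (sequence_coords q (x j)) \<partial>PiM {..<k} (\<lambda>_. \<mu>))"
    unfolding integral_power_process by (simp only: mon)
  also have "\<dots> = (\<integral>x. monomial L (sequence_coords q x) \<partial>distr (PiM {..<k} (\<lambda>_. \<mu>)) \<mu> (\<lambda>x. x j))"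
    by (rule integral_distr [symmetric, OF comp cube_field_monomial(1) [OF c]])
  also have "distr (PiM {..<k} (\<lambda>_. \<mu>)) \<mu> (\<lambda>x. x j) = \<mu>"
    using j by (intro distr_PiM_component prob_\<mu>) simp
  finally show "(\<integral>y. monomial L (sequence_coords q y) \<partial>\<mu>) =
      (\<integral>y. monomial (map (\<lambda>(g, n). (g, j, n)) L) (sequence_coords qk y) \<partial>power_process k A \<mu>)" by simp
qed

lemma limsup_sum_le:
  fixes u :: "nat \<Rightarrow> nat \<Rightarrow> ereal"
  shows "limsup (\<lambda>i. \<Sum>j<K. u j i) \<le> (\<Sum>j<K. limsup (u j))"
proof (induction K)
  case 0
  show ?case by (simp add: Limsup_const)
next
  case (Suc K)
  have "limsup (\<lambda>i. (\<Sum>j<K. u j i) + u K i) \<le> limsup (\<lambda>i. \<Sum>j<K. u j i) + limsup (u K)"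
    by (rule ereal_limsup_add_mono)
  also have "\<dots> \<le> (\<Sum>j<K. limsup (u j)) + limsup (u K)" using Suc by (rule add_right_mono)
  finally show ?case by simp
qed

lemma cov_antimono_\<epsilon>: "\<epsilon>' \<le> \<epsilon> \<Longrightarrow> cov \<epsilon> \<delta> \<nu> d \<le> cov \<epsilon>' \<delta> \<nu> d"
  by (rule cov_mono_covers) (auto simp: is_cover_def)

lemma card_W_pos: "0 < card (W i)"
  using fin nonempty by (simp add: card_gt_0_iff)

lemma coord_dist_power_le:
  assumes F: "finite F"
  shows "coord_dist qk F (W i) (\<lambda>v\<in>W i. \<lambda>j\<in>{..<k}. x j v) y \<le> (\<Sum>j<k. coord_dist q (snd ` F) (W i) (x j) (\<lambda>v\<in>W i. y v j))"
proof -
  have "(\<Sum>j<k. coord_dist q (snd ` F) (W i) (x j) (\<lambda>v\<in>W i. y v j)) =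
      avg (W i) (\<lambda>v. \<Sum>j<k. \<Sum>n\<in>snd ` F. \<bar>q n (x j v) - q n ((\<lambda>v\<in>W i. y v j) v)\<bar>)"
    unfolding coord_dist_def by (rule avg_sum [symmetric])
  moreover have "coord_dist qk F (W i) (\<lambda>v\<in>W i. \<lambda>j\<in>{..<k}. x j v) y \<le> \<dots>"
    unfolding coord_dist_def
  proof (rule avg_mono)
    fix v assume v: "v \<in> W i"
    let ?h = "\<lambda>(j, n). \<bar>q n (x j v) - q n (y v j)\<bar>"
    have "(\<Sum>n\<in>F. \<bar>qk n ((\<lambda>v\<in>W i. \<lambda>j\<in>{..<k}. x j v) v) - qk n (y v)\<bar>) = (\<Sum>jn\<in>F. if fst jn < k then ?h jn else 0)"
      using v by (intro sum.cong) auto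
    also have "\<dots> = (\<Sum>jn\<in>{jn \<in> F. fst jn < k}. ?h jn)" by (rule sum.inter_filter [OF F, symmetric])
    also have "\<dots> \<le> (\<Sum>jn\<in>{..<k} \<times> snd ` F. ?h jn)"
      using F by (intro sum_mono2) (auto intro: image_eqI [rotated])
    also have "\<dots> = (\<Sum>j<k. \<Sum>n\<in>snd ` F. \<bar>q n (x j v) - q n ((\<lambda>v\<in>W i. y v j) v)\<bar>)"
      using v by (simp add: sum.cartesian_product)
    finally show "(\<Sum>n\<in>F. \<bar>qk n ((\<lambda>v\<in>W i. \<lambda>j\<in>{..<k}. x j v) v) - qk n (y v)\<bar>) \<le>
        (\<Sum>j<k. \<Sum>n\<in>snd ` F. \<bar>q n (x j v) - q n ((\<lambda>v\<in>W i. y v j) v)\<bar>)" .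
  qed
  ultimately show ?thesis by simp
qed

text \<open>
  The growth rates of the marginals add up, and the marginals converge to \<open>\<mu>\<close>.
\<close>

lemma rate_power_le:
  assumes n: "\<And>i. n i \<in> Prob (PiM (W i) (\<lambda>_. Ak))"
  shows "rate_coords qk W n \<le> (\<Sum>j<k. rate_coords q W (marginal n j))"
  unfolding rate_coords_def [of qk]
proof (intro SUP_least)
  fix F :: "(nat \<times> 'n) set" and \<delta> \<epsilon> :: real assume "F \<in> {F. finite F}" "\<delta> \<in> {0<..}" "\<epsilon> \<in> {0<..}"
  then have F: "finite F" and pos: "0 < \<epsilon>" "0 < \<delta>" by auto
  define e where "e = min \<epsilon> 1"
  have e: "0 < e" "e \<le> \<epsilon>" "e / real k \<le> 1" "0 < e / real k" "0 < \<delta> / real k"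
    using pos k by (auto simp: e_def divide_simps)
  let ?F = "snd ` F"
  have finF: "finite ?F" using F by simp
  let ?c = "\<lambda>j i. cov (e / real k) (\<delta> / real k) (marginal n j i) (coord_dist q ?F (W i))"
  have mP: "prob_space (marginal n j i)" "sets (marginal n j i) = sets (PiM (W i) (\<lambda>_. A))" if "j < k" for j i
    using marginal_Prob [where n = n, OF n that] by (auto simp: Prob_def)
  have nP: "prob_space (n i)" "sets (n i) = sets (PiM (W i) (\<lambda>_. Ak))" for i using n [of i] by (auto simp: Prob_def)
  have spn: "space (n i) = (\<Pi>\<^sub>E v\<in>W i. space Ak)" for i
    using sets_eq_imp_space_eq [OF nP(2)] by (simp add: space_PiM)
  have ex: "\<forall>j i. \<exists>C. j < k \<longrightarrow> is_cover (e / real k) (\<delta> / real k) (marginal n j i) (coord_dist q ?F (W i)) C \<and> ?c j i = enat (card C)"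
  proof (intro allI)
    fix j i
    show "\<exists>C. j < k \<longrightarrow> is_cover (e / real k) (\<delta> / real k) (marginal n j i) (coord_dist q ?F (W i)) C \<and> ?c j i = enat (card C)"
    proof (cases "j < k")
      case True
      then obtain C where "is_cover (e / real k) (\<delta> / real k) (marginal n j i) (coord_dist q ?F (W i)) C"
        using coord_dist_cover [OF q finF fin nonempty mP [OF True] e(4,5)] by blast
      then show ?thesis using cov_attained by metis
    qed auto
  qed
  then obtain C where C: "\<And>j i. j < k \<Longrightarrow> is_cover (e / real k) (\<delta> / real k) (marginal n j i) (coord_dist q ?F (W i)) (C j i)"
      "\<And>j i. j < k \<Longrightarrow> ?c j i = enat (card (C j i))"
    by metis
  have C1: "1 \<le> card (C j i)" if "j < k" for j i
    using cov_ge_1 [OF e(3), of "\<delta> / real k" "marginal n j i" "coord_dist q ?F (W i)"] C(2) [OF that, of i]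
    by (simp add: one_enat_def)
  have le: "cov \<epsilon> \<delta> (n i) (coord_dist qk F (W i)) \<le> enat (\<Prod>j<k. card (C j i))" for i
  proof (rule order_trans [OF cov_antimono_\<epsilon> [OF e(2)]])
    show "cov e \<delta> (n i) (coord_dist qk F (W i)) \<le> enat (\<Prod>j<k. card (C j i))"
    proof (rule cov_prod_le [OF nP(1) k, where f = "\<lambda>j y. \<lambda>v\<in>W i. y v j" and N = "\<lambda>j. PiM (W i) (\<lambda>_. A)"
          and g = "\<lambda>x. \<lambda>v\<in>W i. \<lambda>j\<in>{..<k}. x j v" and d' = "\<lambda>j. coord_dist q ?F (W i)"])
      show "j < k \<Longrightarrow> (\<lambda>y. \<lambda>v\<in>W i. y v j) \<in> measurable (n i) (PiM (W i) (\<lambda>_. A))" for j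
        by (rule marginal_map_measurable [where n = n, OF n])
      show "(\<lambda>x. \<lambda>v\<in>W i. \<lambda>j\<in>{..<k}. x j v) \<in> (\<Pi>\<^sub>E j\<in>{..<k}. space (PiM (W i) (\<lambda>_. A))) \<rightarrow> space (n i)"
        unfolding spn by (auto simp: space_PiM PiE_iff)
      show "coord_dist qk F (W i) (\<lambda>v\<in>W i. \<lambda>j\<in>{..<k}. x j v) y \<le> (\<Sum>j<k. coord_dist q ?F (W i) (x j) (\<lambda>v\<in>W i. y v j))" for x y
        by (rule coord_dist_power_le [OF F])
      show "coord_dist qk F (W i) y \<in> borel_measurable (n i)" for y
        by (rule coord_dist_measurable [OF qk nP(2)])
      show "coord_dist q ?F (W i) x \<in> borel_measurable (PiM (W i) (\<lambda>_. A))" for x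
        by (rule coord_dist_measurable [OF q refl])
      show "j < k \<Longrightarrow> is_cover (e / real k) (\<delta> / real k) (distr (n i) (PiM (W i) (\<lambda>_. A)) (\<lambda>y. \<lambda>v\<in>W i. y v j))
          (coord_dist q ?F (W i)) (C j i)" for j
        using C(1) by (simp add: marginal_def)
    qed
  qed
  have "growth W (\<lambda>i. cov \<epsilon> \<delta> (n i) (coord_dist qk F (W i))) \<le> growth W (\<lambda>i. enat (\<Prod>j<k. card (C j i)))"
    by (rule growth_mono [OF always_eventually card_W_pos]) (use le in blast)
  also have "\<dots> = limsup (\<lambda>i. \<Sum>j<k. log_enat (?c j i) / ereal (real (card (W i))))"
    unfolding growth_def
  proof (rule arg_cong [of _ _ limsup], rule ext)
    fix i
    have pos: "0 < real (card (C j i))" if "j < k" for j using C1 [OF that, of i] by linarith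
    have "log_enat (enat (\<Prod>j<k. card (C j i))) = ereal (\<Sum>j<k. ln (real (card (C j i))))"
    proof -
      have "(\<Prod>j<k. card (C j i)) \<noteq> 0" using pos by (auto simp: prod_zero_iff)
      moreover have "ln (real (\<Prod>j<k. card (C j i))) = (\<Sum>j<k. ln (real (card (C j i))))"
        unfolding of_nat_prod by (rule ln_prod) (use pos in auto)
      ultimately show ?thesis by simp
    qed
    moreover have "log_enat (?c j i) / ereal (real (card (W i))) = ereal (ln (real (card (C j i))) / real (card (W i)))" if "j < k" for j
      using pos [OF that] C(2) [OF that, of i] card_W_pos [of i] by simp
    ultimately show "log_enat (enat (\<Prod>j<k. card (C j i))) / ereal (real (card (W i))) =
        (\<Sum>j<k. log_enat (?c j i) / ereal (real (card (W i))))"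
      using card_W_pos [of i] by (simp add: sum_divide_distrib)
  qed
  also have "\<dots> \<le> (\<Sum>j<k. limsup (\<lambda>i. log_enat (?c j i) / ereal (real (card (W i)))))"
    by (rule limsup_sum_le)
  also have "\<dots> \<le> (\<Sum>j<k. rate_coords q W (marginal n j))"
  proof (rule sum_mono)
    fix j
    show "limsup (\<lambda>i. log_enat (?c j i) / ereal (real (card (W i)))) \<le> rate_coords q W (marginal n j)"
      unfolding growth_def [symmetric] rate_coords_def using finF e
      by (intro SUP_upper2 [of ?F] SUP_upper2 [of "\<delta> / real k"] SUP_upper2 [of "e / real k"]) auto
  qed
  finally show "growth W (\<lambda>i. cov \<epsilon> \<delta> (n i) (coord_dist qk F (W i))) \<le> (\<Sum>j<k. rate_coords q W (marginal n j))" .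
qed

subsection \<open>Product models\<close>

definition power_models :: "(nat \<Rightarrow> ('v \<Rightarrow> 'a) measure) \<Rightarrow> nat \<Rightarrow> ('v \<Rightarrow> nat \<Rightarrow> 'a) measure" where
  "power_models m i = distr (PiM {..<k} (\<lambda>_. m i)) (PiM (W i) (\<lambda>_. Ak)) (transpose_names k (W i))"

lemma power_models_Prob:
  assumes "m i \<in> Prob (PiM (W i) (\<lambda>_. A))"
  shows "power_models m i \<in> Prob (PiM (W i) (\<lambda>_. Ak))"
proof -
  have m: "prob_space (m i)" "sets (m i) = sets (PiM (W i) (\<lambda>_. A))" using assms by (auto simp: Prob_def)
  have "prob_space (PiM {..<k} (\<lambda>_. m i))" by (rule prob_space_PiM) (rule m)
  then show ?thesis
    unfolding power_models_def Prob_def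
    using prob_space.prob_space_distr [OF _ transpose_names_measurable' [OF m(2)]] by auto
qed

text \<open>
  A joint monomial of the product model at \<open>v\<close> and \<open>w\<close> is a product over the components, both before
  and in the limit, and the difference of two products of numbers in \<open>[0,1]\<close> is at most the sum of the
  differences of the factors.
\<close>

lemma power_models_converge:
  assumes m: "\<And>i. m i \<in> Prob (PiM (W i) (\<lambda>_. A))" and conv: "dq_coords q W s m \<mu>"
  shows "dq_coords qk W s (power_models m) (power_process k A \<mu>)"
  unfolding dq_coords_def pair_converges_def
proof (intro allI)
  fix L L' :: "('g \<times> nat \<times> 'n) list"
  have mP: "prob_space (m i)" "sets (m i) = sets (PiM (W i) (\<lambda>_. A))" for i using m [of i] by (auto simp: Prob_def)
  let ?E = "\<lambda>i v w. \<integral>y. monomial L (sequence_coords qk (pullback_name (s i) v y)) *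
      monomial L' (sequence_coords qk (pullback_name (s i) w y)) \<partial>power_models m i"
  let ?I = "\<lambda>L. \<integral>y. monomial L (sequence_coords qk y) \<partial>power_process k A \<mu>"
  let ?goal = "(\<lambda>i. avg (W i) (\<lambda>v. avg (W i) (\<lambda>w. \<bar>?E i v w - ?I L * ?I L'\<bar>))) \<longlonglongrightarrow> 0"
  show ?goal
  proof (cases "\<forall>(g, j, n)\<in>set L \<union> set L'. j < k")
    case False
    then obtain g j n where "(g, j, n) \<in> set L \<or> (g, j, n) \<in> set L'" "\<not> j < k" by auto
    then consider "\<And>y. monomial L (sequence_coords qk y) = 0" | "\<And>y. monomial L' (sequence_coords qk y) = 0"
      using monomial_power_eq_0 by metis
    then have "?E i v w - ?I L * ?I L' = 0" for i v w by cases simp_all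
    then show ?thesis by (simp add: avg_def)
  next
    case True
    then have L: "\<And>g j n. (g, j, n) \<in> set L \<Longrightarrow> j < k" and L': "\<And>g j n. (g, j, n) \<in> set L' \<Longrightarrow> j < k"
      by blast+
    define e where "e j i v w = (\<integral>x. monomial (comp_list j L) (sequence_coords q (pullback_name (s i) v x)) *
        monomial (comp_list j L') (sequence_coords q (pullback_name (s i) w x)) \<partial>m i)" for j i v w
    define c where "c L j = (\<integral>x. monomial (comp_list j L) (sequence_coords q x) \<partial>\<mu>)" for L j
    have E: "?E i v w = (\<Prod>j<k. e j i v w)" if v: "v \<in> W i" and w: "w \<in> W i" for i v w
    proof -
      have ck: "cube_field (PiM (W i) (\<lambda>_. Ak)) (\<lambda>y. sequence_coords qk (pullback_name (s i) v y))" if "v \<in> W i" for v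
        by (rule cube_field_sequence_coords [OF qk pullback_component [OF refl that]])
      have "?E i v w = (\<integral>x. monomial L (sequence_coords qk (pullback_name (s i) v (transpose_names k (W i) x))) *
          monomial L' (sequence_coords qk (pullback_name (s i) w (transpose_names k (W i) x))) \<partial>PiM {..<k} (\<lambda>_. m i))"
        unfolding power_models_def
        by (rule integral_distr [OF transpose_names_measurable' [OF mP(2)] borel_measurable_times])
          (rule cube_field_monomial(1) [OF ck [OF v]] cube_field_monomial(1) [OF ck [OF w]])+
      also have "\<dots> = (\<Prod>j<k. e j i v w)"
        unfolding pullback_transpose [OF v] pullback_transpose [OF w] e_def
        by (rule monomial_power_pair_integral [OF mP(1) q pullback_component [OF mP(2) v] pullback_component [OF mP(2) w] L L'])
      finally show ?thesis .
    qed
    have I: "?I K = (\<Prod>j<k. c K j)" if "\<And>g j n. (g, j, n) \<in> set K \<Longrightarrow> j < k" for K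
      using monomial_power_pair_integral [where a = "\<lambda>x. x" and b = "\<lambda>x. x" and L = K and L' = "[]" and k = k,
          OF prob_\<mu> q \<mu>_component \<mu>_component that]
      by (simp add: integral_power_process c_def comp_list_def)
    have bd: "\<bar>e j i v w\<bar> \<le> 1" if v: "v \<in> W i" and w: "w \<in> W i" for j i v w
      unfolding e_def
    proof (rule prob_space.integral_bounded [OF mP(1)])
      have cf: "cube_field (m i) (\<lambda>x. sequence_coords q (pullback_name (s i) v x))" if "v \<in> W i" for v
        by (rule cube_field_sequence_coords [OF q pullback_component [OF mP(2) that]])
      show "(\<lambda>x. monomial (comp_list j L) (sequence_coords q (pullback_name (s i) v x)) *
        monomial (comp_list j L') (sequence_coords q (pullback_name (s i) w x))) \<in> borel_measurable (m i)"
        using cube_field_monomial(1) [OF cf [OF v]] cube_field_monomial(1) [OF cf [OF w]] by auto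
      fix x assume x: "x \<in> space (m i)"
      show "\<bar>monomial (comp_list j L) (sequence_coords q (pullback_name (s i) v x)) *
        monomial (comp_list j L') (sequence_coords q (pullback_name (s i) w x))\<bar> \<le> 1"
        using cube_field_monomial(2) [OF cf [OF v] x, of "comp_list j L"] cube_field_monomial(2) [OF cf [OF w] x, of "comp_list j L'"]
        by (auto simp: abs_mult intro!: mult_le_one)
    qed
    have cb: "\<bar>c K j\<bar> \<le> 1" for K j
    proof -
      have cf: "cube_field \<mu> (\<lambda>x. sequence_coords q x)" by (rule cube_field_sequence_coords [OF q \<mu>_component])
      show ?thesis unfolding c_def
      proof (rule prob_space.integral_bounded [OF prob_\<mu> cube_field_monomial(1) [OF cf]])
        fix x assume "x \<in> space \<mu>"
        then show "\<bar>monomial (comp_list j K) (sequence_coords q x)\<bar> \<le> 1"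
          using cube_field_monomial(2) [OF cf, of x "comp_list j K"] by auto
      qed
    qed
    have le: "avg (W i) (\<lambda>v. avg (W i) (\<lambda>w. \<bar>?E i v w - ?I L * ?I L'\<bar>)) \<le>
        (\<Sum>j<k. avg (W i) (\<lambda>v. avg (W i) (\<lambda>w. \<bar>e j i v w - c L j * c L' j\<bar>)))" for i
    proof -
      have "avg (W i) (\<lambda>v. avg (W i) (\<lambda>w. \<bar>?E i v w - ?I L * ?I L'\<bar>)) \<le>
          avg (W i) (\<lambda>v. avg (W i) (\<lambda>w. \<Sum>j<k. \<bar>e j i v w - c L j * c L' j\<bar>))"
      proof (intro avg_mono)
        fix v w assume v: "v \<in> W i" and w: "w \<in> W i"
        have "?E i v w - ?I L * ?I L' = (\<Prod>j<k. e j i v w) - (\<Prod>j<k. c L j * c L' j)"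
          by (simp only: E [OF v w] I [OF L] I [OF L'] prod.distrib)
        moreover have "norm ((\<Prod>j<k. e j i v w) - (\<Prod>j<k. c L j * c L' j)) \<le> (\<Sum>j<k. norm (e j i v w - c L j * c L' j))"
          by (rule norm_prod_diff) (use bd [OF v w] cb in \<open>auto simp: abs_mult mult_le_one\<close>)
        ultimately show "\<bar>?E i v w - ?I L * ?I L'\<bar> \<le> (\<Sum>j<k. \<bar>e j i v w - c L j * c L' j\<bar>)" by simp
      qed
      then show ?thesis by (simp only: avg_sum)
    qed
    have "(\<lambda>i. \<Sum>j<k. avg (W i) (\<lambda>v. avg (W i) (\<lambda>w. \<bar>e j i v w - c L j * c L' j\<bar>))) \<longlonglongrightarrow> (\<Sum>j<k. 0)"
      using conv by (intro tendsto_sum) (auto simp: dq_coords_def pair_converges_def e_def c_def)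
    then have lim: "(\<lambda>i. \<Sum>j<k. avg (W i) (\<lambda>v. avg (W i) (\<lambda>w. \<bar>e j i v w - c L j * c L' j\<bar>))) \<longlonglongrightarrow> 0" by simp
    show ?thesis
    proof (rule Lim_null_comparison [OF always_eventually lim], rule allI)
      fix i
      have "0 \<le> avg (W i) (\<lambda>v. avg (W i) (\<lambda>w. \<bar>?E i v w - ?I L * ?I L'\<bar>))"
        by (intro avg_nonneg abs_ge_zero)
      then show "norm (avg (W i) (\<lambda>v. avg (W i) (\<lambda>w. \<bar>?E i v w - ?I L * ?I L'\<bar>))) \<le>
          (\<Sum>j<k. avg (W i) (\<lambda>v. avg (W i) (\<lambda>w. \<bar>e j i v w - c L j * c L' j\<bar>)))"
        using le [of i] by (simp only: real_norm_def abs_of_nonneg)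
    qed
  qed
qed

lemma coord_dist_power_ge:
  assumes j: "j < k" and x: "x \<in> space (PiM {..<k} (\<lambda>_. PiM (W i) (\<lambda>_. A)))" and F: "finite F"
  shows "coord_dist q F (W i) (\<lambda>v\<in>W i. y v j) (x j) \<le> coord_dist qk ({..<k} \<times> F) (W i) y (transpose_names k (W i) x)"
  unfolding coord_dist_def
proof (rule avg_mono)
  fix v assume v: "v \<in> W i"
  have "(\<Sum>n\<in>F. \<bar>q n ((\<lambda>v\<in>W i. y v j) v) - q n (x j v)\<bar>) = (\<Sum>jn\<in>{j} \<times> F. \<bar>qk jn (y v) - qk jn (transpose_names k (W i) x v)\<bar>)"
  proof -
    have "{j} \<times> F = Pair j ` F" by auto
    then show ?thesis using v j by (simp add: sum.reindex inj_on_def transpose_names_def)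
  qed
  also have "\<dots> \<le> (\<Sum>jn\<in>{..<k} \<times> F. \<bar>qk jn (y v) - qk jn (transpose_names k (W i) x v)\<bar>)"
    using F j by (intro sum_mono2) auto
  finally show "(\<Sum>n\<in>F. \<bar>q n ((\<lambda>v\<in>W i. y v j) v) - q n (x j v)\<bar>) \<le>
      (\<Sum>jn\<in>{..<k} \<times> F. \<bar>qk jn (y v) - qk jn (transpose_names k (W i) x v)\<bar>)" .
qed

text \<open>
  Up to a constant factor, the covering number of the product model is at least the \<open>k\<close>-th power of
  that of the model, and the logarithm of a constant is negligible against \<open>|W|\<close>.
\<close>

lemma growth_power_ge:
  assumes m: "\<And>i. m i \<in> Prob (PiM (W i) (\<lambda>_. A))"
    and card: "filterlim (\<lambda>i. card (W i)) at_top sequentially"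
    and F: "finite F" and pos: "0 < \<epsilon>" "\<epsilon> \<le> 1" "0 < \<delta>"
  shows "ereal (real k) * growth W (\<lambda>i. cov \<epsilon> \<delta> (m i) (coord_dist q F (W i))) \<le>
    growth W (\<lambda>i. cov (\<epsilon> ^ k / 2) \<delta> (power_models m i) (coord_dist qk ({..<k} \<times> F) (W i)))"
proof -
  let ?d = "\<lambda>i. coord_dist q F (W i)" and ?dk = "\<lambda>i. coord_dist qk ({..<k} \<times> F) (W i)"
  have mP: "prob_space (m i)" "sets (m i) = sets (PiM (W i) (\<lambda>_. A))" for i using m [of i] by (auto simp: Prob_def)
  have nP: "prob_space (power_models m i)" "sets (power_models m i) = sets (PiM (W i) (\<lambda>_. Ak))" for i
    using power_models_Prob [where m = m and i = i, OF m] by (auto simp: Prob_def)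
  have ek: "0 < \<epsilon> ^ k / 2" "\<epsilon> ^ k / 2 \<le> 1" using pos power_le_one [of \<epsilon> k] by auto
  have "\<forall>i. \<exists>N. cov \<epsilon> \<delta> (m i) (?d i) = enat N"
    using coord_dist_cover [OF q F fin nonempty mP pos(1,3)] cov_attained by metis
  then obtain N where N: "\<And>i. cov \<epsilon> \<delta> (m i) (?d i) = enat (N i)" by metis
  have "\<forall>i. \<exists>C. is_cover (\<epsilon> ^ k / 2) \<delta> (power_models m i) (?dk i) C \<and> cov (\<epsilon> ^ k / 2) \<delta> (power_models m i) (?dk i) = enat (card C)"
    using coord_dist_cover [OF qk _ fin nonempty nP ek(1) pos(3), of "{..<k} \<times> F"] F cov_attained
    by (metis finite_SigmaI finite_lessThan)
  then obtain C where C: "\<And>i. is_cover (\<epsilon> ^ k / 2) \<delta> (power_models m i) (?dk i) (C i)"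
    "\<And>i. cov (\<epsilon> ^ k / 2) \<delta> (power_models m i) (?dk i) = enat (card (C i))" by metis
  have N1: "1 \<le> N i" for i
    using cov_ge_1 [OF pos(2), of \<delta> "m i" "?d i"] N [of i] by (simp add: one_enat_def)
  have C1: "1 \<le> card (C i)" for i
    using cov_ge_1 [OF ek(2), of \<delta> "power_models m i" "?dk i"] C(2) [of i] by (simp add: one_enat_def)
  have main: "\<epsilon> ^ k / 2 * (real (N i) / 2) ^ k \<le> real (card (C i))" for i
  proof (cases "2 \<le> N i")
    case True
    define M where "M = N i - 1"
    have M: "N i = Suc M" "0 < M" using True by (auto simp: M_def)
    have "\<epsilon> ^ k / 2 * (real (N i) / 2) ^ k \<le> \<epsilon> ^ k / 2 * real M ^ k"
      using M ek by (intro mult_left_mono power_mono) auto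
    also have "\<dots> \<le> real (card (C i))"
    proof (rule cov_power_ge [OF mP(1) k, where d = "?d i" and \<delta> = \<delta> and Y = "PiM (W i) (\<lambda>_. Ak)"
          and g = "transpose_names k (W i)" and d' = "?dk i" and f = "\<lambda>j y. \<lambda>v\<in>W i. y v j"])
      have spm: "space (m i) = space (PiM (W i) (\<lambda>_. A))" by (rule sets_eq_imp_space_eq [OF mP(2)])
      show "?d i x \<in> borel_measurable (m i)" for x by (rule coord_dist_measurable [OF q mP(2)])
      show "enat (Suc M) \<le> cov \<epsilon> \<delta> (m i) (?d i)" using N [of i] M by simp
      show "0 < M" "0 < \<epsilon>" using M pos by auto
      show "transpose_names k (W i) \<in> measurable (PiM {..<k} (\<lambda>_. m i)) (PiM (W i) (\<lambda>_. Ak))"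
        by (rule transpose_names_measurable' [OF mP(2)])
      show "(\<lambda>v\<in>W i. y v j) \<in> space (m i)" if "j < k" "y \<in> space (PiM (W i) (\<lambda>_. Ak))" for j y
        using that unfolding spm by (auto simp: space_PiM PiE_iff)
      show "?d i (\<lambda>v\<in>W i. y v j) (x j) \<le> ?dk i y (transpose_names k (W i) x)"
        if "j < k" "x \<in> space (PiM {..<k} (\<lambda>_. m i))" for j x y
        using that spm by (intro coord_dist_power_ge F) (simp_all add: space_PiM)
      show "?dk i y \<in> borel_measurable (PiM (W i) (\<lambda>_. Ak))" for y by (rule coord_dist_measurable [OF qk refl])
      show "is_cover (\<epsilon> ^ k / 2) \<delta> (distr (PiM {..<k} (\<lambda>_. m i)) (PiM (W i) (\<lambda>_. Ak)) (transpose_names k (W i))) (?dk i) (C i)"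
        using C(1) [of i] by (simp add: power_models_def)
    qed
    finally show ?thesis .
  next
    case False
    then have "real (N i) = 1" using N1 [of i] by simp
    then have "\<epsilon> ^ k / 2 * (real (N i) / 2) ^ k \<le> 1 * 1"
      using ek by (intro mult_mono) (auto simp: power_le_one)
    also have "\<dots> \<le> real (card (C i))" using C1 [of i] by simp
    finally show ?thesis .
  qed
  define K where "K = - ln (\<epsilon> ^ k / 2) + real k * ln 2"
  have ln_le: "real k * ln (real (N i)) \<le> ln (real (card (C i))) + K" for i
  proof -
    have Np: "0 < real (N i)" using N1 [of i] by simp
    have "ln (\<epsilon> ^ k / 2 * (real (N i) / 2) ^ k) \<le> ln (real (card (C i)))"
      using main [of i] C1 [of i] ek Np by (subst ln_le_cancel_iff) auto
    moreover have "ln (\<epsilon> ^ k / 2 * (real (N i) / 2) ^ k) = ln (\<epsilon> ^ k / 2) + real k * (ln (real (N i)) - ln 2)"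
      using ek Np pos by (subst ln_mult) (auto simp: ln_realpow ln_div)
    ultimately show ?thesis by (simp add: K_def algebra_simps)
  qed
  have cardR: "filterlim (\<lambda>i. real (card (W i))) at_top sequentially"
    using filterlim_compose [OF filterlim_real_sequentially card] .
  have K0: "(\<lambda>i. ereal (K / real (card (W i)))) \<longlonglongrightarrow> ereal 0"
    by (intro tendsto_ereal tendsto_divide_0 [OF tendsto_const] filterlim_at_top_imp_at_infinity cardR)
  have "ereal (real k) * growth W (\<lambda>i. cov \<epsilon> \<delta> (m i) (?d i)) =
      limsup (\<lambda>i. ereal (real k) * (log_enat (cov \<epsilon> \<delta> (m i) (?d i)) / ereal (real (card (W i)))))"
    unfolding growth_def by (rule limsup_ereal_mult_left [symmetric]) simp
  also have "\<dots> \<le> limsup (\<lambda>i. ereal (K / real (card (W i))) +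
      log_enat (cov (\<epsilon> ^ k / 2) \<delta> (power_models m i) (?dk i)) / ereal (real (card (W i))))"
  proof (rule Limsup_mono [OF always_eventually], rule allI)
    fix i
    have "real k * ln (real (N i)) / real (card (W i)) \<le> (ln (real (card (C i))) + K) / real (card (W i))"
      by (rule divide_right_mono [OF ln_le]) simp
    then show "ereal (real k) * (log_enat (cov \<epsilon> \<delta> (m i) (?d i)) / ereal (real (card (W i)))) \<le>
      ereal (K / real (card (W i))) + log_enat (cov (\<epsilon> ^ k / 2) \<delta> (power_models m i) (?dk i)) / ereal (real (card (W i)))"
      using N1 [of i] C1 [of i] card_W_pos [of i] by (simp add: N C add_divide_distrib)
  qed
  also have "\<dots> = ereal 0 + limsup (\<lambda>i. log_enat (cov (\<epsilon> ^ k / 2) \<delta> (power_models m i) (?dk i)) / ereal (real (card (W i))))"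
    by (rule ereal_limsup_lim_add [OF K0]) simp
  finally show ?thesis by (simp add: growth_def)
qed

lemma rate_nonneg: "0 \<le> rate_coords q' W m'"
proof -
  have "0 \<le> growth W (\<lambda>i. cov 1 1 (m' i) (coord_dist q' {} (W i)))"
    unfolding growth_def
  proof (rule le_Limsup [OF _ always_eventually], simp, rule allI)
    fix i
    have "log_enat 1 \<le> log_enat (cov 1 1 (m' i) (coord_dist q' {} (W i)))"
      by (rule log_enat_mono) (rule cov_ge_1, simp)
    then show "0 \<le> log_enat (cov 1 1 (m' i) (coord_dist q' {} (W i))) / ereal (real (card (W i)))"
      using card_W_pos [of i] by (intro zero_le_divide_ereal) (auto simp: one_enat_def zero_ereal_def)
  qed
  also have "\<dots> \<le> rate_coords q' W m'"
    unfolding rate_coords_def by (intro SUP_upper2 [of "{}"] SUP_upper2 [of 1]) auto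
  finally show ?thesis .
qed

text \<open>
  Along a sequence of bounded sizes only deterministic coordinates are possible, and then one point
  of a typical model covers all other typical models.
\<close>

lemma rate_le_0_of_bounded:
  assumes m: "\<And>i. m i \<in> Prob (PiM (W i) (\<lambda>_. A))" and conv: "dq_coords q W s m \<mu>"
    and bdd: "\<exists>\<^sub>F i in sequentially. card (W i) \<le> N"
  shows "rate_coords q W m \<le> 0"
  unfolding rate_coords_def
proof (intro SUP_least)
  fix F :: "'n set" and \<delta> \<epsilon> :: real assume "F \<in> {F. finite F}" "\<delta> \<in> {0<..}" "\<epsilon> \<in> {0<..}"
  then have F: "finite F" and pos: "0 < \<epsilon>" "0 < \<delta>" by auto
  have mP: "prob_space (m i)" "sets (m i) = sets (PiM (W i) (\<lambda>_. A))" for i using m [of i] by (auto simp: Prob_def)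
  let ?z = "\<lambda>i v x. sequence_coords q (pullback_name (s i) v x)"
  interpret \<mu>: prob_space \<mu> by (rule prob_\<mu>)
  have cf: "cube_field \<mu> (\<lambda>x. sequence_coords q x)" by (rule cube_field_sequence_coords [OF q \<mu>_component])
  interpret fs: field_sequence W m ?z \<mu> "\<lambda>x. sequence_coords q x"
    by (rule field_sequence.intro)
      (rule fin nonempty mP prob_\<mu> cf | rule cube_field_sequence_coords [OF q pullback_component [OF mP(2)]], assumption)+
  have pc: "pair_converges W m ?z \<mu> (\<lambda>x. sequence_coords q x)" using conv by (simp add: dq_coords_def)
  define c where "c n = (\<integral>x. q n (x 0) \<partial>\<mu>)" for n
  define d where "d n = [(1, [(0::'g, n)]), (- c n, [])]" for n
  have var: "(\<integral>x. (q n (x 0))\<^sup>2 \<partial>\<mu>) = (c n)\<^sup>2" for n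
    using fs.bounded_card_imp_variance_zero [OF pc bdd, of "(0, n)"] by (simp add: c_def)
  have int: "integrable \<mu> (\<lambda>x. q n (x 0))" "integrable \<mu> (\<lambda>x. (q n (x 0))\<^sup>2)" for n
    using fs.integrable_pev_limit [of "[(1, [(0, n)])]"] fs.integrable_pev_limit [of "[(1, [(0, n), (0, n)])]"]
    by (simp_all add: power2_eq_square)
  have small: "(\<integral>x. pev (pmul (d n) (d n)) (sequence_coords q x) \<partial>\<mu>) = 0" for n
  proof -
    have "pev (pmul (d n) (d n)) (sequence_coords q x) = (q n (x 0))\<^sup>2 - 2 * c n * q n (x 0) + (c n)\<^sup>2" for x
      by (simp add: pev_pmul d_def power2_eq_square algebra_simps)
    then have "(\<integral>x. pev (pmul (d n) (d n)) (sequence_coords q x) \<partial>\<mu>) = (\<integral>x. (q n (x 0))\<^sup>2 - 2 * c n * q n (x 0) + (c n)\<^sup>2 \<partial>\<mu>)"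
      by simp
    also have "\<dots> = (\<integral>x. (q n (x 0))\<^sup>2 \<partial>\<mu>) - 2 * c n * (\<integral>x. q n (x 0) \<partial>\<mu>) + (c n)\<^sup>2"
      using int [of n] by (simp add: \<mu>.prob_space)
    also have "\<dots> = 0" by (simp only: var c_def [symmetric]) (simp add: power2_eq_square)
    finally show ?thesis .
  qed
  let ?G = "\<lambda>i x. \<Sum>n\<in>F. avg (W i) (\<lambda>v. \<bar>pev (d n) (?z i v x)\<bar>)"
  let ?e = "min (\<epsilon> / 2) (1 / 2)"
  have ev: "\<forall>\<^sub>F i in sequentially. {x \<in> space (m i). ?G i x < \<delta> / 2} \<in> sets (m i) \<and>
      1 - ?e \<le> measure (m i) {x \<in> space (m i). ?G i x < \<delta> / 2}"
    by (rule fs.small_in_probability [OF pc F]) (use pos small in auto)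
  have G: "?G i x = (\<Sum>n\<in>F. avg (W i) (\<lambda>v. \<bar>q n (x v) - c n\<bar>))" for i x
  proof (rule sum.cong [OF refl])
    fix n
    show "avg (W i) (\<lambda>v. \<bar>pev (d n) (?z i v x)\<bar>) = avg (W i) (\<lambda>v. \<bar>q n (x v) - c n\<bar>)"
      using avg_permutes [OF perm [of i 0], of "\<lambda>v. \<bar>q n (x v) - c n\<bar>"] by (simp add: d_def pullback_name_def)
  qed
  have "\<forall>\<^sub>F i in sequentially. cov \<epsilon> \<delta> (m i) (coord_dist q F (W i)) \<le> 1"
    using ev
  proof eventually_elim
    case (elim i)
    interpret mi: prob_space "m i" by (rule mP)
    let ?S = "{x \<in> space (m i). ?G i x < \<delta> / 2}"
    have "?S \<noteq> {}"
    proof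
      assume e: "?S = {}"
      have "1 - ?e \<le> 0" using elim unfolding e by simp
      then show False by (simp add: min_def split: if_splits)
    qed
    then obtain x0 where x0: "x0 \<in> ?S" by blast
    have sub: "?S \<subseteq> covered (m i) (coord_dist q F (W i)) \<delta> {x0}"
    proof
      fix x assume x: "x \<in> ?S"
      have "coord_dist q F (W i) x0 x = (\<Sum>n\<in>F. avg (W i) (\<lambda>v. \<bar>q n (x0 v) - q n (x v)\<bar>))"
        by (simp add: coord_dist_def avg_sum)
      also have "\<dots> \<le> (\<Sum>n\<in>F. avg (W i) (\<lambda>v. \<bar>q n (x0 v) - c n\<bar> + \<bar>q n (x v) - c n\<bar>))"
        by (intro sum_mono avg_mono) linarith
      also have "\<dots> = ?G i x0 + ?G i x" unfolding G by (simp add: avg_add sum.distrib)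
      also have "\<dots> < \<delta>" using x0 x by simp
      finally show "x \<in> covered (m i) (coord_dist q F (W i)) \<delta> {x0}" using x by (simp add: covered_def)
    qed
    have "covered (m i) (coord_dist q F (W i)) \<delta> {x0} \<in> sets (m i)"
      by (rule covered_measurable) (auto intro: coord_dist_measurable [OF q mP(2)])
    then have "measure (m i) ?S \<le> measure (m i) (covered (m i) (coord_dist q F (W i)) \<delta> {x0})"
      by (rule mi.finite_measure_mono [OF sub])
    moreover have "1 - \<epsilon> < 1 - ?e" using pos by (simp add: min_def)
    ultimately have "is_cover \<epsilon> \<delta> (m i) (coord_dist q F (W i)) {x0}"
      using x0 elim by (simp add: is_cover_def)
    then show ?case using cov_le_card [of \<epsilon> \<delta> "m i" "coord_dist q F (W i)" "{x0}"] by (simp add: one_enat_def)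
  qed
  then have "growth W (\<lambda>i. cov \<epsilon> \<delta> (m i) (coord_dist q F (W i))) \<le> growth W (\<lambda>i. 1)"
    by (rule growth_mono) (rule card_W_pos)
  also have "\<dots> = 0" by (simp add: growth_def one_enat_def Limsup_const zero_ereal_def [symmetric])
  finally show "growth W (\<lambda>i. cov \<epsilon> \<delta> (m i) (coord_dist q F (W i))) \<le> 0" .
qed

lemma rate_power_ge:
  assumes m: "\<And>i. m i \<in> Prob (PiM (W i) (\<lambda>_. A))" and conv: "dq_coords q W s m \<mu>"
  shows "ereal (real k) * rate_coords q W m \<le> rate_coords qk W (power_models m)"
proof (cases "filterlim (\<lambda>i. card (W i)) at_top sequentially")
  case True
  have kp: "0 < ereal (real k)" "ereal (real k) \<noteq> \<infinity>" using k by auto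
  have "rate_coords q W m \<le> rate_coords qk W (power_models m) / ereal (real k)"
    unfolding rate_coords_def [of q]
  proof (intro SUP_least)
    fix F :: "'n set" and \<delta> \<epsilon> :: real assume "F \<in> {F. finite F}" "\<delta> \<in> {0<..}" "\<epsilon> \<in> {0<..}"
    then have F: "finite F" and pos: "0 < \<epsilon>" "0 < \<delta>" by auto
    define e where "e = min \<epsilon> 1"
    have e: "0 < e" "e \<le> 1" "e \<le> \<epsilon>" using pos by (auto simp: e_def)
    have "growth W (\<lambda>i. cov \<epsilon> \<delta> (m i) (coord_dist q F (W i))) \<le> growth W (\<lambda>i. cov e \<delta> (m i) (coord_dist q F (W i)))"
      by (rule growth_mono [OF always_eventually card_W_pos]) (use cov_antimono_\<epsilon> [OF e(3)] in blast)
    also have "\<dots> \<le> rate_coords qk W (power_models m) / ereal (real k)"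
      unfolding ereal_le_divide_pos [OF kp]
    proof (rule order_trans [OF growth_power_ge [OF m True F e(1,2) pos(2)]])
      show "growth W (\<lambda>i. cov (e ^ k / 2) \<delta> (power_models m i) (coord_dist qk ({..<k} \<times> F) (W i))) \<le> rate_coords qk W (power_models m)"
        unfolding rate_coords_def using F e pos
        by (intro SUP_upper2 [of "{..<k} \<times> F"] SUP_upper2 [of \<delta>] SUP_upper2 [of "e ^ k / 2"]) auto
    qed
    finally show "growth W (\<lambda>i. cov \<epsilon> \<delta> (m i) (coord_dist q F (W i))) \<le> rate_coords qk W (power_models m) / ereal (real k)" .
  qed
  then show ?thesis unfolding ereal_le_divide_pos [OF kp] .
next
  case False
  then obtain N where "\<not> (\<forall>\<^sub>F i in sequentially. N \<le> card (W i))" by (auto simp: filterlim_at_top)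
  then have "\<exists>\<^sub>F i in sequentially. card (W i) \<le> N"
    by (auto simp: not_eventually elim: frequently_elim1)
  then have "rate_coords q W m \<le> 0" by (rule rate_le_0_of_bounded [OF m conv])
  then have "ereal (real k) * rate_coords q W m \<le> 0" by (simp add: ereal_mult_le_0_iff)
  then show ?thesis using rate_nonneg order_trans by blast
qed

end

theorem hdq_coords_power:
  fixes q :: "'n::countable \<Rightarrow> 'a \<Rightarrow> real" and \<mu> :: "('g::{group_add,countable} \<Rightarrow> 'a) measure"
    and V :: "nat \<Rightarrow> 'v set"
  assumes sof: "sofic_approximation V \<sigma>" and q: "coordinates A q" and \<mu>: "\<mu> \<in> Prob (PiM UNIV (\<lambda>_. A))" and k: "0 < k"
  shows "hdq_coords V \<sigma> (PiM {..<k} (\<lambda>_. A)) (power_coords q k) (power_process k A \<mu>) = ereal (real k) * hdq_coords V \<sigma> A q \<mu>"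
proof (rule antisym)
  have setting: "power_setting (V \<circ> r) (\<sigma> \<circ> r) A q \<mu> k" if "strict_mono r" for r
    by (rule power_setting.intro [OF sofic_approximation_sequence [OF sof that] power_setting_axioms.intro [OF q \<mu> k]])
  show "hdq_coords V \<sigma> (PiM {..<k} (\<lambda>_. A)) (power_coords q k) (power_process k A \<mu>) \<le> ereal (real k) * hdq_coords V \<sigma> A q \<mu>"
    unfolding hdq_coords_def [of V \<sigma> "PiM {..<k} (\<lambda>_. A)"]
  proof (rule Sup_least, clarify)
    fix r n assume r: "strict_mono (r :: nat \<Rightarrow> nat)" and n: "\<forall>i. n i \<in> Prob (PiM (V (r i)) (\<lambda>_. PiM {..<k} (\<lambda>_. A)))"
      and conv: "dq_coords (power_coords q k) (V \<circ> r) (\<sigma> \<circ> r) n (power_process k A \<mu>)"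
    interpret power_setting "V \<circ> r" "\<sigma> \<circ> r" A q \<mu> k by (rule setting [OF r])
    have n': "n i \<in> Prob (PiM ((V \<circ> r) i) (\<lambda>_. PiM {..<k} (\<lambda>_. A)))" for i using n by simp
    let ?h = "hdq_coords V \<sigma> A q \<mu>"
    have le: "rate_coords q (V \<circ> r) (marginal n j) \<le> ?h" if "j < k" for j
      unfolding hdq_coords_def
      using r marginal_Prob [where n = n, OF n' that] marginal_converges [where n = n, OF n' that conv]
      by (intro Sup_upper) auto
    have sum: "(\<Sum>j<K. ?h) = ereal (real K) * ?h" for K :: nat
    proof (induction K)
      case (Suc K)
      have "ereal (real (Suc K)) * ?h = (ereal (real K) + 1) * ?h" by (simp add: one_ereal_def add.commute)
      also have "\<dots> = ereal (real K) * ?h + 1 * ?h" by (rule ereal_left_distrib) auto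
      finally show ?case using Suc by simp
    qed (simp add: zero_ereal_def [symmetric])
    have "rate_coords (power_coords q k) (V \<circ> r) n \<le> (\<Sum>j<k. rate_coords q (V \<circ> r) (marginal n j))"
      by (rule rate_power_le [OF n'])
    also have "\<dots> \<le> (\<Sum>j<k. ?h)" by (rule sum_mono) (use le in auto)
    finally show "rate_coords (power_coords q k) (V \<circ> r) n \<le> ereal (real k) * ?h" unfolding sum .
  qed
  have kp: "0 < ereal (real k)" "ereal (real k) \<noteq> \<infinity>" using k by auto
  let ?hk = "hdq_coords V \<sigma> (PiM {..<k} (\<lambda>_. A)) (power_coords q k) (power_process k A \<mu>)"
  have "hdq_coords V \<sigma> A q \<mu> \<le> ?hk / ereal (real k)"
    unfolding hdq_coords_def [of V \<sigma> A]
  proof (rule Sup_least, clarify)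
    fix r m assume r: "strict_mono (r :: nat \<Rightarrow> nat)" and m: "\<forall>i. m i \<in> Prob (PiM (V (r i)) (\<lambda>_. A))"
      and conv: "dq_coords q (V \<circ> r) (\<sigma> \<circ> r) m \<mu>"
    interpret power_setting "V \<circ> r" "\<sigma> \<circ> r" A q \<mu> k by (rule setting [OF r])
    have m': "m i \<in> Prob (PiM ((V \<circ> r) i) (\<lambda>_. A))" for i using m by simp
    have "ereal (real k) * rate_coords q (V \<circ> r) m \<le> rate_coords qk (V \<circ> r) (power_models m)"
      by (rule rate_power_ge [OF m' conv])
    also have "\<dots> \<le> ?hk"
      unfolding hdq_coords_def using r power_models_Prob [where m = m, OF m'] power_models_converge [OF m' conv]
      by (intro Sup_upper) auto
    finally show "rate_coords q (V \<circ> r) m \<le> ?hk / ereal (real k)" unfolding ereal_le_divide_pos [OF kp] .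
  qed
  then show "ereal (real k) * hdq_coords V \<sigma> A q \<mu> \<le> ?hk" unfolding ereal_le_divide_pos [OF kp] .
qed

section \<open>Compact metric alphabets\<close>

subsection \<open>Embedding by countably many functions\<close>

lemma compact_embedding_closed:
  fixes e :: "'j::countable \<Rightarrow> 't \<Rightarrow> real"
  assumes T: "compact_space T" and e: "\<And>j. continuous_map T euclideanreal (e j)" and C: "closedin T C"
  shows "compact ((\<lambda>x j. e j x) ` C)"
proof -
  have "continuous_map T (product_topology (\<lambda>_. euclideanreal) UNIV) (\<lambda>x j. e j x)"
    using e by (simp add: continuous_map_componentwise_UNIV)
  then have c: "continuous_map T euclidean (\<lambda>x j. e j x)" by (simp add: euclidean_product_topology)
  have "compactin T C" using closedin_compact_space [OF T C] .
  then have "compactin euclidean ((\<lambda>x j. e j x) ` C)" by (rule image_compactin [OF _ c])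
  then show ?thesis by simp
qed

text \<open>
  A continuous injection of a compact space into a Hausdorff space is an embedding.
\<close>

lemma compact_embedding_open:
  fixes e :: "'j::countable \<Rightarrow> 't \<Rightarrow> real"
  assumes T: "compact_space T" and e: "\<And>j. continuous_map T euclideanreal (e j)"
    and sep: "\<And>x y. x \<in> topspace T \<Longrightarrow> y \<in> topspace T \<Longrightarrow> (\<And>j. e j x = e j y) \<Longrightarrow> x = y"
    and U: "openin T U"
  obtains O' where "open O'" "U = {x \<in> topspace T. (\<lambda>j. e j x) \<in> O'}"
proof
  let ?K = "(\<lambda>x j. e j x) ` (topspace T - U)"
  have "compact ?K" by (rule compact_embedding_closed [OF T e]) (use U in auto)
  then show "open (- ?K)" by (simp add: compact_imp_closed open_Compl)
  show "U = {x \<in> topspace T. (\<lambda>j. e j x) \<in> - ?K}"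
  proof (intro equalityI subsetI)
    fix x assume x: "x \<in> U"
    then have xT: "x \<in> topspace T" using U openin_subset by blast
    have "(\<lambda>j. e j x) \<noteq> (\<lambda>j. e j y)" if "y \<in> topspace T - U" for y
    proof
      assume "(\<lambda>j. e j x) = (\<lambda>j. e j y)"
      then have "e j x = e j y" for j by (rule fun_cong)
      then have "x = y" using xT that by (intro sep) auto
      then show False using x that by auto
    qed
    then show "x \<in> {x \<in> topspace T. (\<lambda>j. e j x) \<in> - ?K}" using xT by auto
  qed auto
qed

lemma compact_embedding_pev:
  fixes e :: "'j::countable \<Rightarrow> 't \<Rightarrow> real"
  assumes T: "compact_space T" and e: "\<And>j. continuous_map T euclideanreal (e j)"
    and sep: "\<And>x y. x \<in> topspace T \<Longrightarrow> y \<in> topspace T \<Longrightarrow> (\<And>j. e j x = e j y) \<Longrightarrow> x = y"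
    and f: "continuous_map T euclideanreal f" and \<eta>: "0 < \<eta>"
  obtains p where "\<And>x. x \<in> topspace T \<Longrightarrow> \<bar>f x - pev p (\<lambda>j. e j x)\<bar> < \<eta>"
proof -
  let ?E = "\<lambda>x j. e j x" and ?S = "(\<lambda>x j. e j x) ` topspace T"
  have inj: "inj_on ?E (topspace T)"
    by (rule inj_onI) (rule sep, auto dest: fun_cong)
  define f' where "f' = f \<circ> inv_into (topspace T) ?E"
  have f': "f' (?E x) = f x" if "x \<in> topspace T" for x
    by (simp add: f'_def inv_into_f_f [OF inj that])
  have "compact ?S" by (rule compact_embedding_closed [OF T e]) simp
  moreover have "continuous_on ?S f'"
    unfolding continuous_closedin_preimage_eq
  proof (intro allI impI)
    fix C :: "real set" assume C: "closed C"
    have "closedin T {x \<in> topspace T. f x \<in> C}"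
      using closedin_continuous_map_preimage [OF f, of C] C by simp
    then have "compact (?E ` {x \<in> topspace T. f x \<in> C})" by (rule compact_embedding_closed [OF T e])
    moreover have "?S \<inter> f' -` C = ?E ` {x \<in> topspace T. f x \<in> C}" using f' by auto
    ultimately show "closedin (top_of_set ?S) (?S \<inter> f' -` C)"
      by (metis closed_subset compact_imp_closed Int_lower1)
  qed
  ultimately obtain p where "\<And>z. z \<in> ?S \<Longrightarrow> \<bar>f' z - pev p z\<bar> < \<eta>"
    using Stone_Weierstrass_pev [OF _ _ \<eta>] by metis
  then show ?thesis using f' that [of p] by force
qed

lemma compact_open_measurable:
  fixes e :: "'j::countable \<Rightarrow> 't \<Rightarrow> real"
  assumes T: "compact_space T" and e: "\<And>j. continuous_map T euclideanreal (e j)"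
    and sep: "\<And>x y. x \<in> topspace T \<Longrightarrow> y \<in> topspace T \<Longrightarrow> (\<And>j. e j x = e j y) \<Longrightarrow> x = y"
    and h: "h \<in> space M \<rightarrow> topspace T" "\<And>j. (\<lambda>w. e j (h w)) \<in> borel_measurable M"
    and U: "openin T U"
  shows "{w \<in> space M. h w \<in> U} \<in> sets M"
proof -
  obtain O' where O': "open O'" "U = {x \<in> topspace T. (\<lambda>j. e j x) \<in> O'}"
    by (rule compact_embedding_open [OF T e sep U])
  have "(\<lambda>w j. e j (h w)) \<in> borel_measurable M"
    by (rule measurable_coordinatewise_then_product) (rule h)
  then have "(\<lambda>w j. e j (h w)) -` O' \<inter> space M \<in> sets M"
    using O'(1) by (auto intro: measurable_sets)
  moreover have "{w \<in> space M. h w \<in> U} = (\<lambda>w j. e j (h w)) -` O' \<inter> space M"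
    using h(1) by (auto simp: O')
  ultimately show ?thesis by simp
qed

lemma compact_continuous_measurable:
  fixes e :: "'j::countable \<Rightarrow> 't \<Rightarrow> real"
  assumes T: "compact_space T" and e: "\<And>j. continuous_map T euclideanreal (e j)"
    and sep: "\<And>x y. x \<in> topspace T \<Longrightarrow> y \<in> topspace T \<Longrightarrow> (\<And>j. e j x = e j y) \<Longrightarrow> x = y"
    and h: "h \<in> space M \<rightarrow> topspace T" "\<And>j. (\<lambda>w. e j (h w)) \<in> borel_measurable M"
    and f: "continuous_map T euclideanreal f"
  shows "(\<lambda>w. f (h w)) \<in> borel_measurable M"
proof (rule borel_measurableI)
  fix S :: "real set" assume S: "open S"
  have "openin T {x \<in> topspace T. f x \<in> S}"
    using openin_continuous_map_preimage [OF f, of S] S by simp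
  from compact_open_measurable [where e = e and h = h, OF T e sep h this]
  have "{w \<in> space M. h w \<in> {x \<in> topspace T. f x \<in> S}} \<in> sets M" .
  moreover have "{w \<in> space M. h w \<in> {x \<in> topspace T. f x \<in> S}} = (\<lambda>w. f (h w)) -` S \<inter> space M"
    using h(1) by auto
  ultimately show "(\<lambda>w. f (h w)) -` S \<inter> space M \<in> sets M" by simp
qed

subsection \<open>Coordinates of a compact metric space\<close>

lemma space_metric_borel [simp]: "space (metric_borel D) = mspace D"
  by (simp add: metric_borel_def topological_borel_def space_measure_of_conv)

lemma sets_metric_borel: "sets (metric_borel D) = sigma_sets (mspace D) {U. openin (mtopology_of D) U}"
proof -
  have "{U. openin (mtopology_of D) U} \<subseteq> Pow (mspace D)"
    using openin_subset [of "mtopology_of D"] by auto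
  then show ?thesis by (simp add: metric_borel_def topological_borel_def)
qed

lemma open_metric_borel: "openin (mtopology_of D) U \<Longrightarrow> U \<in> sets (metric_borel D)"
  unfolding sets_metric_borel by (rule sigma_sets.Basic) simp

lemma continuous_metric_borel:
  assumes f: "continuous_map (mtopology_of D) euclideanreal f"
  shows "f \<in> borel_measurable (metric_borel D)"
proof (rule borel_measurableI)
  fix S :: "real set" assume S: "open S"
  have "openin (mtopology_of D) {x \<in> mspace D. f x \<in> S}"
    using openin_continuous_map_preimage [OF f, of S] S by simp
  moreover have "f -` S \<inter> space (metric_borel D) = {x \<in> mspace D. f x \<in> S}" by auto
  ultimately show "f -` S \<inter> space (metric_borel D) \<in> sets (metric_borel D)"
    by (simp add: open_metric_borel)
qed

text \<open>
  The last clause, uniform separation, compares the metric with finitely many coordinates up to a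
  prescribed error.
\<close>

definition metric_coords :: "'x metric \<Rightarrow> (nat \<Rightarrow> 'x \<Rightarrow> real) \<Rightarrow> bool" where
  "metric_coords D q \<longleftrightarrow>
     (\<forall>n. \<forall>x\<in>mspace D. 0 \<le> q n x \<and> q n x \<le> 1) \<and>
     (\<forall>n. \<forall>x\<in>mspace D. \<forall>y\<in>mspace D. \<bar>q n x - q n y\<bar> \<le> mdist D x y) \<and>
     (\<forall>\<eta>>0. \<exists>N C. 0 \<le> C \<and> (\<forall>x\<in>mspace D. \<forall>y\<in>mspace D. mdist D x y \<le> \<eta> + C * (\<Sum>n<N. \<bar>q n x - q n y\<bar>)))"

text \<open>
  Scaled distances to the points of finite nets; a net of mesh below \<open>\<eta> / 2\<close> determines distances up to
  \<open>\<eta>\<close>.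
\<close>

lemma metric_coords_exist:
  assumes "compact_space (mtopology_of D)"
  obtains q where "metric_coords D q"
proof -
  interpret X: Metric_space "mspace D" "mdist D" by simp
  have tb: "X.mtotally_bounded (mspace D)"
    using assms X.compact_space_eq_mcomplete_mtotally_bounded by (simp add: mtopology_of_def)
  then have bdd: "X.mbounded (mspace D)" by (rule X.mtotally_bounded_imp_mbounded)
  have "\<exists>B\<ge>1. \<forall>x\<in>mspace D. \<forall>y\<in>mspace D. mdist D x y \<le> B"
  proof -
    obtain B where "\<forall>x\<in>mspace D. \<forall>y\<in>mspace D. mdist D x y \<le> B"
      using bdd unfolding X.mbounded_alt by blast
    then show ?thesis by (intro exI [of _ "max 1 B"]) (auto simp: le_max_iff_disj)
  qed
  then obtain B where B: "1 \<le> B" "\<And>x y. x \<in> mspace D \<Longrightarrow> y \<in> mspace D \<Longrightarrow> mdist D x y \<le> B" by blast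
  have "\<forall>n::nat. \<exists>K. finite K \<and> K \<subseteq> mspace D \<and> mspace D \<subseteq> (\<Union>x\<in>K. X.mball x (inverse (real (Suc n))))"
    using tb unfolding X.mtotally_bounded_def by simp
  then obtain K where K: "\<And>n. finite (K n)" "\<And>n. K n \<subseteq> mspace D"
      "\<And>n. mspace D \<subseteq> (\<Union>x\<in>K n. X.mball x (inverse (real (Suc n))))"
    by metis
  define C where "C = (\<Union>n. K n)"
  have C: "countable C" "C \<subseteq> mspace D" using K by (auto simp: C_def intro: countable_finite)
  define c where "c = from_nat_into C"
  define q where "q n x = mdist D x (c n) / B" for n x
  have cin: "c n \<in> mspace D" if "x \<in> mspace D" for n x
  proof -
    have "C \<noteq> {}" using K(3) [of 0] that unfolding C_def by blast
    then show ?thesis using C from_nat_into [of C n] by (auto simp: c_def)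
  qed
  show ?thesis
  proof
    show "metric_coords D q" unfolding metric_coords_def
    proof (intro conjI allI ballI impI)
      fix n x assume x: "x \<in> mspace D"
      show "0 \<le> q n x" using B(1) by (simp add: q_def)
      show "q n x \<le> 1" using B(1) B(2) [OF x cin [OF x], of n] by (simp add: q_def)
    next
      fix n x y assume x: "x \<in> mspace D" and y: "y \<in> mspace D"
      have "\<bar>mdist D x (c n) - mdist D y (c n)\<bar> \<le> mdist D x y"
        using mdist_triangle [OF x y cin [OF x], of n] mdist_triangle [OF y x cin [OF x], of n]
        by (simp add: mdist_commute abs_le_iff)
      then have "\<bar>mdist D x (c n) - mdist D y (c n)\<bar> / B \<le> mdist D x y / 1"
        using B(1) by (intro frac_le) auto
      then show "\<bar>q n x - q n y\<bar> \<le> mdist D x y"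
        using B(1) by (simp add: q_def diff_divide_distrib [symmetric] abs_divide)
    next
      fix \<eta> :: real assume "0 < \<eta>"
      then obtain j where j: "inverse (real (Suc j)) < \<eta> / 2" using reals_Archimedean half_gt_zero by blast
      have "\<exists>n. c n = k" if "k \<in> K j" for k
        using from_nat_into_surj [OF C(1), of k] that by (auto simp: C_def c_def)
      then obtain idx where idx: "\<And>k. k \<in> K j \<Longrightarrow> c (idx k) = k" by metis
      define N where "N = Suc (\<Sum>k\<in>K j. idx k)"
      have "mdist D x y \<le> \<eta> + B * (\<Sum>n<N. \<bar>q n x - q n y\<bar>)" if x: "x \<in> mspace D" and y: "y \<in> mspace D" for x y
      proof -
        obtain k where k: "k \<in> K j" "x \<in> X.mball k (inverse (real (Suc j)))" using K(3) [of j] x by auto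
        have kD: "k \<in> mspace D" using k K(2) by auto
        have dk: "mdist D x k < \<eta> / 2" using k j by (simp add: mdist_commute)
        have "idx k < N"
          unfolding N_def using member_le_sum [OF k(1), of idx] K(1) by (simp add: le_imp_less_Suc)
        then have "\<bar>q (idx k) x - q (idx k) y\<bar> \<le> (\<Sum>n<N. \<bar>q n x - q n y\<bar>)"
          by (intro member_le_sum) auto
        then have "B * \<bar>q (idx k) x - q (idx k) y\<bar> \<le> B * (\<Sum>n<N. \<bar>q n x - q n y\<bar>)"
          using B(1) by (intro mult_left_mono) auto
        moreover have "B * \<bar>q (idx k) x - q (idx k) y\<bar> = \<bar>mdist D x k - mdist D y k\<bar>"
          using B(1) idx [OF k(1)] by (simp add: q_def diff_divide_distrib [symmetric] abs_divide)
        moreover have "mdist D x y \<le> mdist D x k + mdist D y k"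
          using mdist_triangle [OF x kD y] by (simp add: mdist_commute)
        ultimately show ?thesis using dk by linarith
      qed
      then show "\<exists>N C. 0 \<le> C \<and> (\<forall>x\<in>mspace D. \<forall>y\<in>mspace D. mdist D x y \<le> \<eta> + C * (\<Sum>n<N. \<bar>q n x - q n y\<bar>))"
        using B(1) by (intro exI [of _ N] exI [of _ B]) auto
    qed
  qed
qed

lemma metric_coords_range: "metric_coords D q \<Longrightarrow> x \<in> mspace D \<Longrightarrow> 0 \<le> q n x \<and> q n x \<le> 1"
  and metric_coords_lipschitz: "metric_coords D q \<Longrightarrow> x \<in> mspace D \<Longrightarrow> y \<in> mspace D \<Longrightarrow> \<bar>q n x - q n y\<bar> \<le> mdist D x y"
  by (simp_all add: metric_coords_def)

lemma metric_coords_continuous: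
  assumes q: "metric_coords D q"
  shows "continuous_map (mtopology_of D) euclideanreal (q n)"
proof -
  have "Lipschitz_continuous_map D euclidean_metric (q n)"
    unfolding Lipschitz_continuous_map_def
    using metric_coords_lipschitz [OF q] by (auto simp: dist_real_def intro!: exI [of _ 1])
  then show ?thesis using Lipschitz_continuous_imp_continuous_map by fastforce
qed

lemma metric_coords_separate:
  assumes q: "metric_coords D q" and x: "x \<in> mspace D" and y: "y \<in> mspace D" and eq: "\<And>n. q n x = q n y"
  shows "x = y"
proof (rule ccontr)
  assume "x \<noteq> y"
  then have pos: "0 < mdist D x y / 2"
    using Metric_space.mdist_pos_less [OF Metric_space_mspace_mdist] x y by fastforce
  then obtain N C where "mdist D x y \<le> mdist D x y / 2 + C * (\<Sum>n<N. \<bar>q n x - q n y\<bar>)"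
    using q x y unfolding metric_coords_def by blast
  then show False using pos by (simp add: eq)
qed

lemma metric_coords_separate_top:
  assumes "metric_coords D q" "x \<in> topspace (mtopology_of D)" "y \<in> topspace (mtopology_of D)" "\<And>n. q n x = q n y"
  shows "x = y"
  using metric_coords_separate [where q = q, OF assms(1) _ _ assms(4)] assms(2,3) by simp

lemma coordinates_metric:
  assumes D: "compact_space (mtopology_of D)" and q: "metric_coords D q"
  shows "coordinates (metric_borel D) q"
  unfolding coordinates_def
proof
  show cf: "cube_field (metric_borel D) (\<lambda>a n. q n a)"
    using continuous_metric_borel [OF metric_coords_continuous [OF q]] metric_coords_range [OF q]
    by (intro cube_fieldI) auto
  let ?V = "vimage_algebra (mspace D) (\<lambda>a n. q n a) (borel :: (nat \<Rightarrow> real) measure)"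
  show "\<forall>S\<in>sets (metric_borel D). \<exists>O'\<in>sets borel. S = (\<lambda>a n. q n a) -` O' \<inter> space (metric_borel D)"
  proof
    fix S assume "S \<in> sets (metric_borel D)"
    then have "S \<in> sigma_sets (mspace D) {U. openin (mtopology_of D) U}" by (simp add: sets_metric_borel)
    also have "\<dots> \<subseteq> sets ?V"
    proof (rule sets.sigma_sets_subset', clarify)
      fix U assume U: "openin (mtopology_of D) U"
      obtain O' where "open O'" "U = {x \<in> topspace (mtopology_of D). (\<lambda>n. q n x) \<in> O'}"
        by (rule compact_embedding_open [where e = q, OF D metric_coords_continuous [OF q] metric_coords_separate_top [OF q] U])
      then show "U \<in> sets ?V"
        by (auto simp: sets_vimage_algebra2 intro!: exI [of _ O'])
    qed (use sets.top [of ?V] in simp)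
    finally show "\<exists>O'\<in>sets borel. S = (\<lambda>a n. q n a) -` O' \<inter> space (metric_borel D)"
      by (auto simp: sets_vimage_algebra2)
  qed
qed

lemma measurable_metric_borel:
  fixes e :: "'j::countable \<Rightarrow> 'x \<Rightarrow> real"
  assumes D: "compact_space (mtopology_of D)" and e: "\<And>j. continuous_map (mtopology_of D) euclideanreal (e j)"
    and sep: "\<And>x y. x \<in> mspace D \<Longrightarrow> y \<in> mspace D \<Longrightarrow> (\<And>j. e j x = e j y) \<Longrightarrow> x = y"
    and h: "h \<in> space M \<rightarrow> mspace D" "\<And>j. (\<lambda>w. e j (h w)) \<in> borel_measurable M"
  shows "h \<in> measurable M (metric_borel D)"
  unfolding metric_borel_def topological_borel_def
proof (rule measurable_measure_of)
  show "{U. openin (mtopology_of D) U} \<subseteq> Pow (topspace (mtopology_of D))" by (auto dest!: openin_subset)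
  show hT: "h \<in> space M \<rightarrow> topspace (mtopology_of D)" using h(1) by simp
  fix U assume "U \<in> {U. openin (mtopology_of D) U}"
  then have U: "openin (mtopology_of D) U" by simp
  have sep': "x = y" if "x \<in> topspace (mtopology_of D)" "y \<in> topspace (mtopology_of D)" "\<And>j. e j x = e j y" for x y
    using sep [OF _ _ that(3)] that(1,2) by simp
  have "{w \<in> space M. h w \<in> U} \<in> sets M"
    by (rule compact_open_measurable [where e = e and h = h, OF D e sep' hT h(2) U])
  moreover have "h -` U \<inter> space M = {w \<in> space M. h w \<in> U}" by auto
  ultimately show "h -` U \<inter> space M \<in> sets M" by simp
qed

subsection \<open>Weak star neighbourhoods and polynomials\<close>

lemma space_seq_space: "space (seq_space D) = topspace (seq_topology D)"
  by (simp add: seq_space_def seq_topology_def space_PiM)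

lemma compact_seq_topology: "compact_space (mtopology_of D) \<Longrightarrow> compact_space (seq_topology D)"
  by (simp add: seq_topology_def compact_space_product_topology)

lemma sequence_coords_continuous:
  assumes q: "metric_coords D q"
  shows "continuous_map (seq_topology D) euclideanreal (\<lambda>x. sequence_coords q x j)"
proof -
  obtain g n where j: "j = (g, n)" by (cases j)
  have "continuous_map (seq_topology D) (mtopology_of D) (\<lambda>x. x g)"
    unfolding seq_topology_def using continuous_map_product_coordinates [of g UNIV "\<lambda>_. mtopology_of D"] by simp
  from continuous_map_compose [OF this metric_coords_continuous [OF q, of n]]
  show ?thesis by (simp add: j o_def)
qed

lemma sequence_coords_separate:
  assumes q: "metric_coords D q" and x: "x \<in> topspace (seq_topology D)" "y \<in> topspace (seq_topology D)"
    and eq: "\<And>j. sequence_coords q x j = sequence_coords q y j"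
  shows "x = y"
proof
  fix g
  show "x g = y g"
  proof (rule metric_coords_separate [OF q])
    show "x g \<in> mspace D" "y g \<in> mspace D" using x by (auto simp: seq_topology_def)
    show "q n (x g) = q n (y g)" for n using eq [of "(g, n)"] by simp
  qed
qed

lemma continuous_seq_measurable:
  fixes f :: "('g::countable \<Rightarrow> 'x) \<Rightarrow> real"
  assumes D: "compact_space (mtopology_of D)" and f: "continuous_map (seq_topology D) euclideanreal f"
  shows "f \<in> borel_measurable (seq_space D)"
proof -
  obtain q where q: "metric_coords D q" using metric_coords_exist [OF D] by blast
  have "cube_field (seq_space D :: ('g \<Rightarrow> 'x) measure) (\<lambda>x. sequence_coords q x)"
    unfolding seq_space_def by (rule cube_field_sequence_coords [OF coordinates_metric [OF D q]]) simp
  then have m: "(\<lambda>x. sequence_coords q x j) \<in> borel_measurable (seq_space D :: ('g \<Rightarrow> 'x) measure)" for j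
    unfolding cube_field_def by blast
  have "(\<lambda>x. f ((\<lambda>x. x) x)) \<in> borel_measurable (seq_space D)"
    by (rule compact_continuous_measurable [where h = "\<lambda>x. x" and M = "seq_space D" and e = "\<lambda>j x. sequence_coords q x j",
        OF compact_seq_topology [OF D] sequence_coords_continuous [OF q] sequence_coords_separate [OF q] _ m f])
      (auto simp: space_seq_space)
  then show ?thesis by simp
qed

lemma continuous_seq_bounded:
  assumes D: "compact_space (mtopology_of D)" and f: "continuous_map (seq_topology D) euclideanreal f"
  obtains C where "0 \<le> C" "\<And>x. x \<in> topspace (seq_topology D) \<Longrightarrow> \<bar>f x\<bar> \<le> C"
proof -
  have "compactin euclideanreal (f ` topspace (seq_topology D))"
    using compact_seq_topology [OF D] f by (intro image_compactin [OF _ f]) (simp add: compact_space_def)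
  then have "bounded (f ` topspace (seq_topology D))" by (simp add: compact_imp_bounded)
  then obtain C where "0 < C" "\<forall>y\<in>f ` topspace (seq_topology D). norm y \<le> C" by (auto simp: bounded_pos)
  then show ?thesis using that [of C] by auto
qed

lemma pullback_continuous:
  assumes s: "\<And>g. s g permutes W" and v: "v \<in> W"
  shows "continuous_map (product_topology (\<lambda>_. mtopology_of D) W) (seq_topology D) (pullback_name s v)"
  unfolding seq_topology_def continuous_map_componentwise_UNIV pullback_name_def
proof
  fix g
  have "s g v \<in> W" using permutes_in_image [OF s] v by blast
  then show "continuous_map (product_topology (\<lambda>_. mtopology_of D) W) (mtopology_of D) (\<lambda>x. x (s g v))"
    by (rule continuous_map_product_coordinates [where T = "\<lambda>_. mtopology_of D"])
qed

lemma pullback_measurable_seq: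
  assumes s: "\<And>g. s g permutes W" and v: "v \<in> W"
  shows "pullback_name s v \<in> measurable (model_space D W) (seq_space D)"
  unfolding seq_space_def model_space_def
proof (rule measurable_PiM_single')
  fix g
  have "s g v \<in> W" using permutes_in_image [OF s] v by blast
  then show "(\<lambda>x. pullback_name s v x g) \<in> measurable (PiM W (\<lambda>_. metric_borel D)) (metric_borel D)"
    by (simp add: pullback_name_def)
next
  show "pullback_name s v \<in> space (PiM W (\<lambda>_. metric_borel D)) \<rightarrow> (\<Pi>\<^sub>E i\<in>UNIV. space (metric_borel D))"
    using permutes_in_image [OF s] v by (auto simp: space_PiM pullback_name_def)
qed

lemma empirical_Prob:
  assumes W: "finite W" "W \<noteq> {}" and s: "\<And>g. s g permutes W" and x: "x \<in> PiE W (\<lambda>_. mspace D)"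
  shows "empirical D W s x \<in> Prob (seq_space D)"
    and "f \<in> borel_measurable (seq_space D) \<Longrightarrow> (\<integral>y. f y \<partial>empirical D W s x) = avg W (\<lambda>v. f (pullback_name s v x))"
proof -
  have m: "(\<lambda>v. pullback_name s v x) \<in> measurable (uniform_count_measure W) (seq_space D)"
  proof -
    have "pullback_name s v x \<in> space (seq_space D)" if "v \<in> W" for v
      using measurable_space [OF pullback_measurable_seq [OF s that], of x D] x by (simp add: model_space_def space_PiM)
    then show ?thesis by (simp add: measurable_def sets_uniform_count_measure space_uniform_count_measure)
  qed
  show "empirical D W s x \<in> Prob (seq_space D)"
    unfolding empirical_def Prob_def
    using prob_space.prob_space_distr [OF prob_space_uniform_count_measure [OF W] m] by simp
  show "(\<integral>y. f y \<partial>empirical D W s x) = avg W (\<lambda>v. f (pullback_name s v x))" if "f \<in> borel_measurable (seq_space D)"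
    unfolding empirical_def by (simp add: integral_distr [OF m that] integral_uniform_count_measure W avg_def)
qed

text \<open>
  The empirical measure depends continuously on the model, so this is an open set of a product of
  finitely many compact metric spaces.
\<close>

lemma good_models_measurable:
  assumes D: "compact_space (mtopology_of D)" and W: "finite W" "W \<noteq> {}" and s: "\<And>g. s g permutes W"
    and U: "openin (weak_star D) U"
  shows "good_models D W s U \<in> sets (model_space D W)"
proof -
  obtain q where q: "metric_coords D q" using metric_coords_exist [OF D] by blast
  let ?T = "product_topology (\<lambda>_. mtopology_of D) W"
  have T: "compact_space ?T" using D by (simp add: compact_space_product_topology)
  have top: "topspace ?T = PiE W (\<lambda>_. mspace D)" by simp
  have e1: "empirical D W s x \<in> Prob (seq_space D)" if "x \<in> PiE W (\<lambda>_. mspace D)" for x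
    by (rule empirical_Prob(1) [where s = s, OF W s that])
  have e2: "(\<integral>y. f y \<partial>empirical D W s x) = avg W (\<lambda>v. f (pullback_name s v x))"
    if "x \<in> PiE W (\<lambda>_. mspace D)" "f \<in> borel_measurable (seq_space D)" for x f
    by (rule empirical_Prob(2) [where s = s, OF W s that])
  have "continuous_map ?T (weak_star D) (empirical D W s)"
    unfolding weak_star_def
  proof (rule continuous_on_generated_topo, goal_cases)
    case (1 B)
    then obtain f O' where B: "B = {\<nu> \<in> Prob (seq_space D). integral\<^sup>L \<nu> f \<in> O'}"
      and f: "continuous_map (seq_topology D) euclideanreal f" and O': "open O'" by blast
    have "continuous_map ?T euclideanreal (\<lambda>x. avg W (\<lambda>v. f (pullback_name s v x)))"
      unfolding avg_def divide_inverse
      using continuous_map_compose [OF pullback_continuous [where s = s, OF s] f] W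
      by (intro continuous_map_real_mult_right continuous_map_sum) (auto simp: o_def)
    then have "openin ?T {x \<in> topspace ?T. avg W (\<lambda>v. f (pullback_name s v x)) \<in> O'}"
      using openin_continuous_map_preimage O' by fastforce
    moreover have "empirical D W s -` B \<inter> topspace ?T = {x \<in> topspace ?T. avg W (\<lambda>v. f (pullback_name s v x)) \<in> O'}"
      using e1 e2 [OF _ continuous_seq_measurable [OF D f]] unfolding B top by auto
    ultimately show ?case by simp
  next
    case 2
    have "Prob (seq_space D) = {\<nu> \<in> Prob (seq_space D). integral\<^sup>L \<nu> (\<lambda>_. 0) \<in> (UNIV :: real set)}" by simp
    moreover have "continuous_map (seq_topology D) euclideanreal (\<lambda>_. 0)" by simp
    ultimately have "Prob (seq_space D) \<in> {{\<nu> \<in> Prob (seq_space D). integral\<^sup>L \<nu> f \<in> U} | f U.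
        continuous_map (seq_topology D) euclideanreal f \<and> open U}" by blast
    then show ?case using e1 top by blast
  qed
  then have oU: "openin ?T {x \<in> topspace ?T. empirical D W s x \<in> U}"
    using openin_continuous_map_preimage U by fastforce
  define e where "e j x = q (snd (prod_decode j)) (x (from_nat_into W (fst (prod_decode j))))" for j x
  have fW: "from_nat_into W a \<in> W" for a using W(2) by (rule from_nat_into)
  have qm: "q n \<in> borel_measurable (metric_borel D)" for n
    by (rule coordinates_measurable [OF coordinates_metric [OF D q]])
  have "{x \<in> space (model_space D W). x \<in> {x \<in> topspace ?T. empirical D W s x \<in> U}} \<in> sets (model_space D W)"
  proof (rule compact_open_measurable [OF T, where e = e and h = "\<lambda>x. x"])
    show "continuous_map ?T euclideanreal (e j)" for j
      unfolding e_def using continuous_map_compose [OF continuous_map_product_coordinates [OF fW] metric_coords_continuous [OF q]]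
      by (simp add: o_def)
    show "x = y" if "x \<in> topspace ?T" "y \<in> topspace ?T" "\<And>j. e j x = e j y" for x y
    proof (rule PiE_ext)
      show "x \<in> PiE W (\<lambda>_. mspace D)" "y \<in> PiE W (\<lambda>_. mspace D)" using that top by auto
      fix v assume v: "v \<in> W"
      obtain a where a: "from_nat_into W a = v" using from_nat_into_surj [OF countable_finite [OF W(1)] v] by blast
      show "x v = y v"
      proof (rule metric_coords_separate [OF q])
        show "x v \<in> mspace D" "y v \<in> mspace D" using that v top by auto
        show "q n (x v) = q n (y v)" for n using that(3) [of "prod_encode (a, n)"] by (simp add: e_def a)
      qed
    qed
    show "(\<lambda>x. x) \<in> space (model_space D W) \<rightarrow> topspace ?T" by (simp add: model_space_def space_PiM)
    show "(\<lambda>x. e j x) \<in> borel_measurable (model_space D W)" for j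
      unfolding e_def model_space_def by (rule measurable_compose [OF measurable_component_singleton [OF fW] qm])
    show "openin ?T {x \<in> topspace ?T. empirical D W s x \<in> U}" by (rule oU)
  qed
  moreover have "{x \<in> space (model_space D W). x \<in> {x \<in> topspace ?T. empirical D W s x \<in> U}} = good_models D W s U"
    by (auto simp: good_models_def model_space_def space_PiM)
  ultimately show ?thesis by simp
qed

section \<open>Doubly quenched convergence in coordinates\<close>

lemma abs_le_square: "0 < \<eta> \<Longrightarrow> \<bar>t\<bar> \<le> \<eta> + t\<^sup>2 / (\<eta>::real)"
proof (cases "\<bar>t\<bar> \<le> \<eta>")
  case False
  assume \<eta>: "0 < \<eta>"
  have "\<eta> * \<bar>t\<bar> \<le> \<bar>t\<bar> * \<bar>t\<bar>" using False by (intro mult_right_mono) auto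
  then have "\<bar>t\<bar> \<le> t\<^sup>2 / \<eta>" using \<eta> by (simp add: field_simps power2_eq_square)
  then show ?thesis using \<eta> by simp
qed (simp add: add_increasing2)

lemma tendsto_0_of_square_bound:
  fixes u v :: "nat \<Rightarrow> real"
  assumes v: "v \<longlonglongrightarrow> 0" and u: "\<And>i. 0 \<le> u i" "\<And>i \<eta>. 0 < \<eta> \<Longrightarrow> u i \<le> K * \<eta> + v i / \<eta>" and K: "0 \<le> K"
  shows "u \<longlonglongrightarrow> 0"
proof (rule LIMSEQ_I)
  fix e :: real assume e: "0 < e"
  define \<eta> where "\<eta> = e / (2 * (K + 1))"
  have \<eta>: "0 < \<eta>" "K * \<eta> \<le> e / 2"
    using e K by (auto simp: \<eta>_def field_simps add_nonneg_pos)
  have "\<forall>\<^sub>F i in sequentially. v i < \<eta> * (e / 2)"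
    using v e \<eta> by (intro order_tendstoD(2)) auto
  then obtain N where N: "\<And>i. N \<le> i \<Longrightarrow> v i < \<eta> * (e / 2)" unfolding eventually_sequentially by blast
  have "norm (u i - 0) < e" if "N \<le> i" for i
  proof -
    have "v i / \<eta> < e / 2" using N [OF that] \<eta>(1) by (simp add: field_simps)
    then have "u i < e" using u(2) [OF \<eta>(1), of i] \<eta>(2) by linarith
    then show ?thesis using u(1) [of i] by simp
  qed
  then show "\<exists>N. \<forall>i\<ge>N. norm (u i - 0) < e" by blast
qed

text \<open>
  The second moment method: the variance of an average over \<open>v\<close> is an average of correlations over the
  pairs \<open>(v, w)\<close>.
\<close>

lemma (in field_sequence) pair_converges_in_mean:
  assumes conv: "pair_converges W m z P Z"
  shows "(\<lambda>i. \<integral>x. \<bar>avg (W i) (\<lambda>v. pev p (z i v x)) - (\<integral>y. pev p (Z y) \<partial>P)\<bar> \<partial>m i) \<longlonglongrightarrow> 0"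
proof -
  define c where "c = (\<integral>y. pev p (Z y) \<partial>P)"
  define Y where "Y i x = avg (W i) (\<lambda>v. pev p (z i v x)) - c" for i x
  interpret m: prob_space "m i" for i by (rule prob_m)
  have Ym: "Y i \<in> borel_measurable (m i)" for i
    unfolding Y_def [abs_def] avg_def using cube_field_pev(1) [OF field] by auto
  have Yb: "\<bar>Y i x\<bar> \<le> pnorm p + \<bar>c\<bar>" if "x \<in> space (m i)" for i x
  proof -
    have "\<bar>avg (W i) (\<lambda>v. pev p (z i v x))\<bar> \<le> avg (W i) (\<lambda>v. \<bar>pev p (z i v x)\<bar>)" by (rule avg_abs)
    also have "\<dots> \<le> pnorm p" by (rule avg_le_const [OF fin nonempty]) (use cube_field_pev(2) [OF field] that in auto)
    finally show ?thesis unfolding Y_def by linarith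
  qed
  have intY: "integrable (m i) (\<lambda>x. \<bar>Y i x\<bar>)" for i
    by (rule m.integrable_bounded [where C = "pnorm p + \<bar>c\<bar>"]) (use Ym Yb in auto)
  have intY2: "integrable (m i) (\<lambda>x. (Y i x)\<^sup>2)" for i
    by (rule m.integrable_bounded [where C = "(pnorm p + \<bar>c\<bar>)\<^sup>2"]) (use Ym Yb in \<open>auto intro!: power2_le_iff_abs_le [THEN iffD2]\<close>)
  define v where "v i = discrepancy p p i + 2 * \<bar>c\<bar> * avg (W i) (\<lambda>v. \<bar>(\<integral>x. pev p (z i v x) \<partial>m i) - c\<bar>)" for i
  have sq: "(\<integral>x. (Y i x)\<^sup>2 \<partial>m i) \<le> v i" for i
  proof -
    have "(\<integral>x. (Y i x)\<^sup>2 \<partial>m i) = (\<integral>x. avg (W i) (\<lambda>v. avg (W i) (\<lambda>w. pev p (z i v x) * pev p (z i w x)))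
        - 2 * c * avg (W i) (\<lambda>v. pev p (z i v x)) + c\<^sup>2 \<partial>m i)"
      by (intro Bochner_Integration.integral_cong refl)
        (simp add: Y_def power2_eq_square avg_mult_avg [symmetric] algebra_simps)
    also have "\<dots> = avg (W i) (\<lambda>v. avg (W i) (\<lambda>w. \<integral>x. pev p (z i v x) * pev p (z i w x) \<partial>m i))
        - 2 * c * avg (W i) (\<lambda>v. \<integral>x. pev p (z i v x) \<partial>m i) + c\<^sup>2"
    proof -
      have i1: "integrable (m i) (\<lambda>x. avg (W i) (\<lambda>w. pev p (z i v x) * pev p (z i w x)))" if "v \<in> W i" for v
        unfolding avg_def using integrable_pev_mult [OF that] by auto
      have i2: "integrable (m i) (\<lambda>x. avg (W i) (\<lambda>v. avg (W i) (\<lambda>w. pev p (z i v x) * pev p (z i w x))))"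
        unfolding avg_def [of _ "\<lambda>v. avg _ (_ v)"] using i1 by auto
      have i3: "integrable (m i) (\<lambda>x. avg (W i) (\<lambda>v. pev p (z i v x)))"
        unfolding avg_def using integrable_pev by auto
      have "(\<integral>x. avg (W i) (\<lambda>v. avg (W i) (\<lambda>w. pev p (z i v x) * pev p (z i w x))) \<partial>m i) =
          avg (W i) (\<lambda>v. avg (W i) (\<lambda>w. \<integral>x. pev p (z i v x) * pev p (z i w x) \<partial>m i))"
        by (subst integral_avg [OF i1]) (auto intro!: avg_cong integral_avg integrable_pev_mult)
      moreover have "(\<integral>x. avg (W i) (\<lambda>v. pev p (z i v x)) \<partial>m i) = avg (W i) (\<lambda>v. \<integral>x. pev p (z i v x) \<partial>m i)"
        by (rule integral_avg [OF integrable_pev])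
      ultimately show ?thesis using i2 i3 by (simp add: m.prob_space)
    qed
    also have "\<dots> = avg (W i) (\<lambda>v. avg (W i) (\<lambda>w. (\<integral>x. pev p (z i v x) * pev p (z i w x) \<partial>m i) - c * c))
        - 2 * c * avg (W i) (\<lambda>v. (\<integral>x. pev p (z i v x) \<partial>m i) - c)"
      by (simp add: avg_diff avg_const fin nonempty power2_eq_square algebra_simps)
    also have "\<dots> \<le> v i"
    proof -
      have "avg (W i) (\<lambda>v. avg (W i) (\<lambda>w. (\<integral>x. pev p (z i v x) * pev p (z i w x) \<partial>m i) - c * c)) \<le> discrepancy p p i"
        unfolding discrepancy_def c_def by (intro avg_mono) simp
      moreover have "- (2 * c * avg (W i) (\<lambda>v. (\<integral>x. pev p (z i v x) \<partial>m i) - c)) \<le>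
          2 * \<bar>c\<bar> * avg (W i) (\<lambda>v. \<bar>(\<integral>x. pev p (z i v x) \<partial>m i) - c\<bar>)"
      proof -
        have "- (2 * c * avg (W i) (\<lambda>v. (\<integral>x. pev p (z i v x) \<partial>m i) - c)) \<le>
            \<bar>2 * c * avg (W i) (\<lambda>v. (\<integral>x. pev p (z i v x) \<partial>m i) - c)\<bar>" by simp
        also have "\<dots> = 2 * \<bar>c\<bar> * \<bar>avg (W i) (\<lambda>v. (\<integral>x. pev p (z i v x) \<partial>m i) - c)\<bar>" by (simp add: abs_mult)
        also have "\<dots> \<le> 2 * \<bar>c\<bar> * avg (W i) (\<lambda>v. \<bar>(\<integral>x. pev p (z i v x) \<partial>m i) - c\<bar>)"
          by (intro mult_left_mono avg_abs) simp
        finally show ?thesis .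
      qed
      ultimately show ?thesis unfolding v_def by linarith
    qed
    finally show ?thesis .
  qed
  have "v \<longlonglongrightarrow> 0 + 2 * \<bar>c\<bar> * 0"
    unfolding v_def c_def by (intro tendsto_add tendsto_mult tendsto_const pair_converges_pev [OF conv] pair_converges_single [OF conv])
  then have v: "v \<longlonglongrightarrow> 0" by simp
  have "(\<lambda>i. \<integral>x. \<bar>Y i x\<bar> \<partial>m i) \<longlonglongrightarrow> 0"
  proof (rule tendsto_0_of_square_bound [OF v, where K = 1])
    fix i and \<eta> :: real assume \<eta>: "0 < \<eta>"
    have "(\<integral>x. \<bar>Y i x\<bar> \<partial>m i) \<le> (\<integral>x. \<eta> + (Y i x)\<^sup>2 / \<eta> \<partial>m i)"
      by (rule integral_mono [OF intY]) (use intY2 abs_le_square [OF \<eta>] in auto)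
    also have "\<dots> = \<eta> + (\<integral>x. (Y i x)\<^sup>2 \<partial>m i) / \<eta>" using intY2 by (simp add: m.prob_space)
    also have "\<dots> \<le> \<eta> + v i / \<eta>" using sq \<eta> by (intro add_left_mono divide_right_mono) auto
    finally show "(\<integral>x. \<bar>Y i x\<bar> \<partial>m i) \<le> 1 * \<eta> + v i / \<eta>" by simp
  qed auto
  then show ?thesis by (simp add: Y_def c_def)
qed

subsection \<open>Quenched convergence\<close>

locale quenched_setting =
  fixes E :: "'y metric" and W :: "nat \<Rightarrow> 'v set" and s :: "nat \<Rightarrow> 'g::countable \<Rightarrow> 'v \<Rightarrow> 'v"
    and n :: "nat \<Rightarrow> ('v \<Rightarrow> 'y) measure" and \<nu> :: "('g \<Rightarrow> 'y) measure"
  assumes E: "compact_space (mtopology_of E)"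
    and fin: "finite (W i)" and nonempty: "W i \<noteq> {}" and perm: "s i g permutes W i"
    and n: "n i \<in> Prob (model_space E (W i))" and \<nu>: "\<nu> \<in> Prob (seq_space E)"
begin

lemma prob_n: "prob_space (n i)" and sets_n: "sets (n i) = sets (model_space E (W i))"
  using n [of i] by (auto simp: Prob_def)

lemma space_n: "space (n i) = (\<Pi>\<^sub>E v\<in>W i. mspace E)"
  using sets_eq_imp_space_eq [OF sets_n] by (simp add: model_space_def space_PiM)

lemma pullback_n: "v \<in> W i \<Longrightarrow> pullback_name (s i) v \<in> measurable (n i) (seq_space E)"
  using pullback_measurable_seq [where s = "s i", OF perm] by (simp add: measurable_cong_sets [OF sets_n refl])

definition deviation :: "(('g \<Rightarrow> 'y) \<Rightarrow> real) \<Rightarrow> nat \<Rightarrow> ('v \<Rightarrow> 'y) \<Rightarrow> real" where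
  "deviation f i y = \<bar>avg (W i) (\<lambda>v. f (pullback_name (s i) v y)) - (\<integral>x. f x \<partial>\<nu>)\<bar>"

lemma deviation_measurable:
  assumes f: "continuous_map (seq_topology E) euclideanreal f"
  shows "deviation f i \<in> borel_measurable (n i)"
  unfolding deviation_def [abs_def] avg_def
  using measurable_compose [OF pullback_n continuous_seq_measurable [OF E f]] by auto

lemma deviation_bounded:
  assumes f: "continuous_map (seq_topology E) euclideanreal f"
  obtains C where "0 \<le> C" "\<And>i y. y \<in> space (n i) \<Longrightarrow> deviation f i y \<le> C"
proof -
  obtain C where C: "0 \<le> C" "\<And>x. x \<in> topspace (seq_topology E) \<Longrightarrow> \<bar>f x\<bar> \<le> C"
    using continuous_seq_bounded [OF E f] by blast
  show ?thesis
  proof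
    show "0 \<le> C + \<bar>\<integral>x. f x \<partial>\<nu>\<bar>" using C by simp
    fix i y assume y: "y \<in> space (n i)"
    have "\<bar>avg (W i) (\<lambda>v. f (pullback_name (s i) v y))\<bar> \<le> avg (W i) (\<lambda>v. \<bar>f (pullback_name (s i) v y)\<bar>)" by (rule avg_abs)
    also have "\<dots> \<le> C"
      using measurable_space [OF pullback_n y] C(2) by (intro avg_le_const fin nonempty) (simp add: space_seq_space)
    finally show "deviation f i y \<le> C + \<bar>\<integral>x. f x \<partial>\<nu>\<bar>" unfolding deviation_def by linarith
  qed
qed

lemma integrable_deviation:
  assumes f: "continuous_map (seq_topology E) euclideanreal f"
  shows "integrable (n i) (deviation f i)"
proof -
  obtain C where C: "0 \<le> C" "\<And>i y. y \<in> space (n i) \<Longrightarrow> deviation f i y \<le> C" using deviation_bounded [OF f] by blast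
  show ?thesis
    by (rule prob_space.integrable_bounded [OF prob_n deviation_measurable [OF f], where C = C])
      (use C(2) in \<open>auto simp: deviation_def\<close>)
qed

definition basic_nhd :: "(('g \<Rightarrow> 'y) \<Rightarrow> real) \<Rightarrow> real \<Rightarrow> ('g \<Rightarrow> 'y) measure set" where
  "basic_nhd f \<eta> = {\<nu>' \<in> Prob (seq_space E). integral\<^sup>L \<nu>' f \<in> ball (integral\<^sup>L \<nu> f) \<eta>}"

lemma good_basic:
  assumes f: "continuous_map (seq_topology E) euclideanreal f"
  shows "good_models E (W i) (s i) (basic_nhd f \<eta>) = {y \<in> space (n i). deviation f i y < \<eta>}"
proof -
  have fm: "f \<in> borel_measurable (seq_space E)" by (rule continuous_seq_measurable [OF E f])
  have e1: "empirical E (W i) (s i) y \<in> Prob (seq_space E)" if "y \<in> PiE (W i) (\<lambda>_. mspace E)" for y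
    by (rule empirical_Prob(1) [where s = "s i", OF fin nonempty perm that])
  have e2: "(\<integral>x. f x \<partial>empirical E (W i) (s i) y) = avg (W i) (\<lambda>v. f (pullback_name (s i) v y))"
    if "y \<in> PiE (W i) (\<lambda>_. mspace E)" for y
    by (rule empirical_Prob(2) [where s = "s i", OF fin nonempty perm that fm])
  show ?thesis
    using e1 e2 by (auto simp: good_models_def space_n basic_nhd_def deviation_def dist_real_def abs_minus_commute)
qed

lemma open_basic:
  assumes f: "continuous_map (seq_topology E) euclideanreal f"
  shows "openin (weak_star E) (basic_nhd f \<eta>)"
  unfolding weak_star_def basic_nhd_def
  by (rule topology_generated_by_Basis) (use f open_ball in blast)

lemma quenched_imp_deviation:
  assumes q: "quenched_converges E W s n \<nu>" and f: "continuous_map (seq_topology E) euclideanreal f"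
  shows "(\<lambda>i. \<integral>y. deviation f i y \<partial>n i) \<longlonglongrightarrow> 0"
proof -
  interpret n: prob_space "n i" for i by (rule prob_n)
  obtain C where C: "0 \<le> C" "\<And>i y. y \<in> space (n i) \<Longrightarrow> deviation f i y \<le> C" using deviation_bounded [OF f] by blast
  have le: "(\<integral>y. deviation f i y \<partial>n i) \<le> \<eta> + C * (1 - measure (n i) (good_models E (W i) (s i) (basic_nhd f \<eta>)))"
    if \<eta>: "0 < \<eta>" for i \<eta>
  proof -
    let ?G = "{y \<in> space (n i). deviation f i y < \<eta>}"
    note [measurable] = deviation_measurable [OF f]
    have G: "?G \<in> sets (n i)" by measurable
    have "(\<integral>y. deviation f i y \<partial>n i) \<le> (\<integral>y. \<eta> + C * indicator (space (n i) - ?G) y \<partial>n i)"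
    proof (rule integral_mono [OF integrable_deviation [OF f]])
      show "integrable (n i) (\<lambda>y. \<eta> + C * indicator (space (n i) - ?G) y)" using G by (auto simp: n.emeasure_eq_measure)
      fix y assume y: "y \<in> space (n i)"
      show "deviation f i y \<le> \<eta> + C * indicator (space (n i) - ?G) y"
        using C(2) [OF y] \<eta> y by (auto simp: indicator_def)
    qed
    also have "\<dots> = \<eta> + C * measure (n i) (space (n i) - ?G)"
      using G by (simp add: n.prob_space n.emeasure_eq_measure)
    also have "\<dots> = \<eta> + C * (1 - measure (n i) ?G)" using G by (simp add: n.prob_compl)
    finally show ?thesis unfolding good_basic [OF f] .
  qed
  have mem: "\<nu> \<in> basic_nhd f \<eta>" if "0 < \<eta>" for \<eta> using \<nu> that by (simp add: basic_nhd_def)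
  show ?thesis
  proof (rule LIMSEQ_I)
    fix e :: real assume e: "0 < e"
    have "(\<lambda>i. measure (n i) (good_models E (W i) (s i) (basic_nhd f (e / 2)))) \<longlonglongrightarrow> 1"
      using q open_basic [OF f] mem [of "e / 2"] e unfolding quenched_converges_def by simp
    then have "(\<lambda>i. C * (1 - measure (n i) (good_models E (W i) (s i) (basic_nhd f (e / 2))))) \<longlonglongrightarrow> C * (1 - 1)"
      by (intro tendsto_intros)
    then have "\<forall>\<^sub>F i in sequentially. C * (1 - measure (n i) (good_models E (W i) (s i) (basic_nhd f (e / 2)))) < e / 2"
      by (rule order_tendstoD) (use e in simp)
    then obtain N where N: "\<And>i. N \<le> i \<Longrightarrow> C * (1 - measure (n i) (good_models E (W i) (s i) (basic_nhd f (e / 2)))) < e / 2"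
      unfolding eventually_sequentially by blast
    have "norm ((\<integral>y. deviation f i y \<partial>n i) - 0) < e" if "N \<le> i" for i
    proof -
      have "0 \<le> (\<integral>y. deviation f i y \<partial>n i)" by (rule Bochner_Integration.integral_nonneg) (simp add: deviation_def)
      moreover have "(\<integral>y. deviation f i y \<partial>n i) \<le> e / 2 + C * (1 - measure (n i) (good_models E (W i) (s i) (basic_nhd f (e / 2))))"
        by (rule le) (use e in simp)
      ultimately show ?thesis using N [OF that] by simp
    qed
    then show "\<exists>N. \<forall>i\<ge>N. norm ((\<integral>y. deviation f i y \<partial>n i) - 0) < e" by blast
  qed
qed

definition share :: "('g \<Rightarrow> 'y) measure set \<Rightarrow> nat \<Rightarrow> real" where
  "share U i = real (card {v \<in> W i. distr (n i) (seq_space E) (pullback_name (s i) v) \<in> U}) / real (card (W i))"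

lemma share_avg: "share U i = avg (W i) (\<lambda>v. of_bool (distr (n i) (seq_space E) (pullback_name (s i) v) \<in> U))"
  by (simp add: share_def avg_def fin Int_def)

lemma share_le_1: "share U i \<le> 1"
  unfolding share_avg by (rule avg_le_const [OF fin nonempty]) simp

text \<open>
  Both clauses of quenched convergence pass to finite intersections and to larger neighbourhoods.
  Measurability of the sets of good models is what makes their measure monotone.
\<close>

lemma quenched_if_deviation:
  assumes a: "\<And>f. continuous_map (seq_topology E) euclideanreal f \<Longrightarrow>
      (\<lambda>i. avg (W i) (\<lambda>v. \<bar>(\<integral>y. f (pullback_name (s i) v y) \<partial>n i) - (\<integral>x. f x \<partial>\<nu>)\<bar>)) \<longlonglongrightarrow> 0"
    and b: "\<And>f. continuous_map (seq_topology E) euclideanreal f \<Longrightarrow> (\<lambda>i. \<integral>y. deviation f i y \<partial>n i) \<longlonglongrightarrow> 0"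
  shows "quenched_converges E W s n \<nu>"
proof -
  interpret n: prob_space "n i" for i by (rule prob_n)
  let ?ok = "\<lambda>U. share U \<longlonglongrightarrow> 1 \<and> (\<lambda>i. measure (n i) (good_models E (W i) (s i) U)) \<longlonglongrightarrow> 1"
  let ?B = "{{\<nu> \<in> Prob (seq_space E). integral\<^sup>L \<nu> f \<in> U} | f U.
        continuous_map (seq_topology E) euclideanreal f \<and> open U} :: ('g \<Rightarrow> 'y) measure set set"
  have gm: "good_models E (W i) (s i) U \<in> sets (n i)" if "generate_topology_on ?B U" for i U
    using good_models_measurable [where s = "s i", OF E fin nonempty perm] that
    by (simp add: sets_n weak_star_def openin_topology_generated_by_iff)
  have mono: "?ok U'" if U: "?ok U" "U \<subseteq> U'" "generate_topology_on ?B U'" for U U'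
  proof
    have "share U i \<le> share U' i" for i
      unfolding share_avg using U(2) by (intro avg_mono) auto
    then show "share U' \<longlonglongrightarrow> 1"
      using U(1) share_le_1 by (intro tendsto_sandwich [of "share U" "share U'" sequentially "\<lambda>_. 1"]) auto
    have "measure (n i) (good_models E (W i) (s i) U) \<le> measure (n i) (good_models E (W i) (s i) U')" for i
      using U(2) by (intro n.finite_measure_mono gm [OF U(3)]) (auto simp: good_models_def)
    then show "(\<lambda>i. measure (n i) (good_models E (W i) (s i) U')) \<longlonglongrightarrow> 1"
      using U(1)
      by (intro tendsto_sandwich [of "\<lambda>i. measure (n i) (good_models E (W i) (s i) U)" "\<lambda>i. measure (n i) (good_models E (W i) (s i) U')" sequentially "\<lambda>_. 1"])
        (auto simp: n.prob_le_1)
  qed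
  have ok: "?ok U" if "generate_topology_on ?B U" "\<nu> \<in> U" for U
    using that
  proof (induction rule: generate_topology_on.induct)
    case Empty
    then show ?case by simp
  next
    case (Int U U')
    then have IH: "?ok U" "?ok U'" by auto
    have "(\<lambda>i. share U i + share U' i - 1) \<longlonglongrightarrow> 1 + 1 - 1" using IH by (intro tendsto_intros) auto
    moreover have "share U i + share U' i - 1 \<le> share (U \<inter> U') i" for i
    proof -
      have "share U i + share U' i - 1 = avg (W i) (\<lambda>v. of_bool (distr (n i) (seq_space E) (pullback_name (s i) v) \<in> U) +
          of_bool (distr (n i) (seq_space E) (pullback_name (s i) v) \<in> U') - 1)"
        by (simp add: share_avg avg_add avg_diff avg_const fin nonempty)
      also have "\<dots> \<le> share (U \<inter> U') i" unfolding share_avg by (rule avg_mono) auto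
      finally show ?thesis .
    qed
    ultimately have 1: "share (U \<inter> U') \<longlonglongrightarrow> 1"
      using share_le_1 by (intro tendsto_sandwich [of "\<lambda>i. share U i + share U' i - 1" "share (U \<inter> U')" sequentially "\<lambda>_. 1"]) auto
    let ?m = "\<lambda>U i. measure (n i) (good_models E (W i) (s i) U)"
    have "(\<lambda>i. ?m U i + ?m U' i - 1) \<longlonglongrightarrow> 1 + 1 - 1" using IH by (intro tendsto_intros) auto
    moreover have "?m U i + ?m U' i - 1 \<le> ?m (U \<inter> U') i" for i
    proof -
      have eq: "good_models E (W i) (s i) (U \<inter> U') = good_models E (W i) (s i) U \<inter> good_models E (W i) (s i) U'"
        by (auto simp: good_models_def)
      have "measure (n i) (good_models E (W i) (s i) U \<union> good_models E (W i) (s i) U') = ?m U i + ?m U' i - ?m (U \<inter> U') i"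
        unfolding eq by (rule measure_Un3) (use gm Int.hyps in \<open>auto simp: n.fmeasurable_eq_sets\<close>)
      then show ?thesis using n.prob_le_1 [of i "good_models E (W i) (s i) U \<union> good_models E (W i) (s i) U'"] by linarith
    qed
    ultimately have 2: "?m (U \<inter> U') \<longlonglongrightarrow> 1"
      by (intro tendsto_sandwich [of "\<lambda>i. ?m U i + ?m U' i - 1" "?m (U \<inter> U')" sequentially "\<lambda>_. 1"]) (auto simp: n.prob_le_1)
    show ?case using 1 2 by blast
  next
    case (UN K)
    then obtain k where k: "k \<in> K" "\<nu> \<in> k" by auto
    then have "?ok k" using UN by blast
    then show ?case by (rule mono) (use k UN in \<open>auto intro: generate_topology_on.UN\<close>)
  next
    case (Basis U)
    then obtain f O' where U: "U = {\<nu> \<in> Prob (seq_space E). integral\<^sup>L \<nu> f \<in> O'}"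
      and f: "continuous_map (seq_topology E) euclideanreal f" and O': "open O'" by blast
    then have "integral\<^sup>L \<nu> f \<in> O'" using Basis by simp
    then obtain \<eta> where \<eta>: "0 < \<eta>" "ball (integral\<^sup>L \<nu> f) \<eta> \<subseteq> O'" using O' open_contains_ball by blast
    have sub: "basic_nhd f \<eta> \<subseteq> U" using \<eta> by (auto simp: basic_nhd_def U)
    have fm: "f \<in> borel_measurable (seq_space E)" by (rule continuous_seq_measurable [OF E f])
    have "?ok (basic_nhd f \<eta>)"
    proof
      let ?a = "\<lambda>i v. \<bar>(\<integral>y. f (pullback_name (s i) v y) \<partial>n i) - (\<integral>x. f x \<partial>\<nu>)\<bar>"
      have "1 - avg (W i) (?a i) / \<eta> \<le> share (basic_nhd f \<eta>) i" for i
      proof -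
        have "1 - avg (W i) (?a i) / \<eta> = avg (W i) (\<lambda>v. 1 - ?a i v * (1 / \<eta>))"
          by (simp only: avg_diff avg_multc avg_const [OF fin nonempty]) simp
        also have "\<dots> \<le> share (basic_nhd f \<eta>) i"
          unfolding share_avg
        proof (rule avg_mono)
          fix v assume v: "v \<in> W i"
          show "1 - ?a i v * (1 / \<eta>) \<le> of_bool (distr (n i) (seq_space E) (pullback_name (s i) v) \<in> basic_nhd f \<eta>)"
          proof (cases "?a i v < \<eta>")
            case True
            have "distr (n i) (seq_space E) (pullback_name (s i) v) \<in> Prob (seq_space E)"
              using n.prob_space_distr [OF pullback_n [OF v]] by (simp add: Prob_def)
            then have "distr (n i) (seq_space E) (pullback_name (s i) v) \<in> basic_nhd f \<eta>"
              using True by (simp add: basic_nhd_def integral_distr [OF pullback_n [OF v] fm] dist_real_def abs_minus_commute)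
            then show ?thesis using \<eta>(1) by simp
          next
            case False
            then have "1 \<le> ?a i v * (1 / \<eta>)" using \<eta>(1) by (simp add: field_simps)
            then have "1 - ?a i v * (1 / \<eta>) \<le> 0" by linarith
            also have "0 \<le> (of_bool (distr (n i) (seq_space E) (pullback_name (s i) v) \<in> basic_nhd f \<eta>) :: real)" by simp
            finally show ?thesis .
          qed
        qed
        finally show ?thesis .
      qed
      moreover have "(\<lambda>i. 1 - avg (W i) (?a i) / \<eta>) \<longlonglongrightarrow> 1 - 0 / \<eta>"
        using \<eta>(1) by (intro tendsto_diff tendsto_divide tendsto_const a [OF f]) auto
      ultimately show "share (basic_nhd f \<eta>) \<longlonglongrightarrow> 1"
        using share_le_1 by (intro tendsto_sandwich [of "\<lambda>i. 1 - avg (W i) (?a i) / \<eta>" "share (basic_nhd f \<eta>)" sequentially "\<lambda>_. 1"]) auto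
      have "1 - (\<integral>y. deviation f i y \<partial>n i) / \<eta> \<le> measure (n i) (good_models E (W i) (s i) (basic_nhd f \<eta>))" for i
      proof -
        note [measurable] = deviation_measurable [OF f]
        have "n.prob i {y \<in> space (n i). \<eta> \<le> deviation f i y} \<le> (\<integral>y. deviation f i y \<partial>n i) / \<eta>"
          by (rule integral_Markov_inequality_measure [OF integrable_deviation [OF f] sets.top])
            (use \<eta> in \<open>auto simp: deviation_def\<close>)
        moreover have "{y \<in> space (n i). deviation f i y < \<eta>} = space (n i) - {y \<in> space (n i). \<eta> \<le> deviation f i y}" by auto
        ultimately show ?thesis unfolding good_basic [OF f] by (simp add: n.prob_compl)
      qed
      moreover have "(\<lambda>i. 1 - (\<integral>y. deviation f i y \<partial>n i) / \<eta>) \<longlonglongrightarrow> 1 - 0 / \<eta>"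
        using \<eta>(1) by (intro tendsto_diff tendsto_divide tendsto_const b [OF f]) auto
      ultimately show "(\<lambda>i. measure (n i) (good_models E (W i) (s i) (basic_nhd f \<eta>))) \<longlonglongrightarrow> 1"
        by (intro tendsto_sandwich [of "\<lambda>i. 1 - (\<integral>y. deviation f i y \<partial>n i) / \<eta>"
              "\<lambda>i. measure (n i) (good_models E (W i) (s i) (basic_nhd f \<eta>))" sequentially "\<lambda>_. 1"]) (auto simp: n.prob_le_1)
    qed
    then show ?case by (rule mono [OF _ sub]) (rule generate_topology_on.Basis, use Basis in blast)
  qed
  show ?thesis
    unfolding quenched_converges_def
  proof (intro allI impI)
    fix U assume "openin (weak_star E) U \<and> \<nu> \<in> U"
    then have "generate_topology_on ?B U" "\<nu> \<in> U" by (simp_all add: weak_star_def openin_topology_generated_by_iff)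
    from ok [OF this]
    show "(\<lambda>i. real (card {v \<in> W i. distr (n i) (seq_space E) (pullback_name (s i) v) \<in> U}) / real (card (W i))) \<longlonglongrightarrow> 1 \<and>
        (\<lambda>i. measure (n i) (good_models E (W i) (s i) U)) \<longlonglongrightarrow> 1"
      by (simp add: share_def [abs_def])
  qed
qed

end

subsection \<open>Pairs of names\<close>

lemma (in prob_space) integrable_pair_bounded:
  fixes f :: "'a \<times> 'a \<Rightarrow> real"
  assumes "f \<in> borel_measurable (M \<Otimes>\<^sub>M M)" "\<And>p. p \<in> space (M \<Otimes>\<^sub>M M) \<Longrightarrow> \<bar>f p\<bar> \<le> C"
  shows "integrable (M \<Otimes>\<^sub>M M) f"
proof -
  interpret P: pair_prob_space M M ..
  show ?thesis by (rule P.integrable_bounded [OF assms])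
qed

lemma (in prob_space) integral_pair_mult:
  fixes g h :: "'a \<Rightarrow> real"
  assumes g: "g \<in> borel_measurable M" "\<And>x. x \<in> space M \<Longrightarrow> \<bar>g x\<bar> \<le> 1"
    and h: "h \<in> borel_measurable M" "\<And>x. x \<in> space M \<Longrightarrow> \<bar>h x\<bar> \<le> 1"
  shows "(\<integral>p. g (fst p) * h (snd p) \<partial>(M \<Otimes>\<^sub>M M)) = (\<integral>x. g x \<partial>M) * (\<integral>x. h x \<partial>M)"
proof -
  interpret P: pair_prob_space M M ..
  note [measurable] = g(1) h(1)
  have "\<bar>g (fst p) * h (snd p)\<bar> \<le> 1" if "p \<in> space (M \<Otimes>\<^sub>M M)" for p
    using g(2) [of "fst p"] h(2) [of "snd p"] that mult_mono [of "\<bar>g (fst p)\<bar>" 1 "\<bar>h (snd p)\<bar>" 1]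
    by (auto simp: space_pair_measure abs_mult)
  then have "integrable (M \<Otimes>\<^sub>M M) (\<lambda>p. g (fst p) * h (snd p))"
    by (intro integrable_pair_bounded [where C = 1]) auto
  from P.integral_fst' [OF this] show ?thesis by simp
qed

text \<open>
  Squaring an integral amounts to integrating over two independent copies, and the double average
  of a product over pairs \<open>(v, w)\<close> factors into two single averages, one of which is at most 1.
\<close>

lemma (in prob_space) square_correlation:
  fixes g h :: "'v \<Rightarrow> 'a \<Rightarrow> real"
  assumes W: "finite W" "W \<noteq> {}"
    and g: "\<And>v. v \<in> W \<Longrightarrow> g v \<in> borel_measurable M" "\<And>v x. v \<in> W \<Longrightarrow> x \<in> space M \<Longrightarrow> \<bar>g v x\<bar> \<le> 1"
    and h: "\<And>v. v \<in> W \<Longrightarrow> h v \<in> borel_measurable M" "\<And>v x. v \<in> W \<Longrightarrow> x \<in> space M \<Longrightarrow> \<bar>h v x\<bar> \<le> 1"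
  shows "avg W (\<lambda>v. avg W (\<lambda>w. (\<integral>x. g v x * h w x \<partial>M)\<^sup>2)) \<le> (\<integral>p. \<bar>avg W (\<lambda>v. g v (fst p) * g v (snd p))\<bar> \<partial>(M \<Otimes>\<^sub>M M))"
proof -
  let ?M = "M \<Otimes>\<^sub>M M"
  let ?f = "\<lambda>v w p. (g v (fst p) * g v (snd p)) * (h w (fst p) * h w (snd p))"
  have le1: "\<bar>a * b\<bar> \<le> 1" if "\<bar>a\<bar> \<le> 1" "\<bar>b\<bar> \<le> 1" for a b :: real
    using mult_mono [OF that] by (simp add: abs_mult)
  have gm [measurable]: "(\<lambda>p. g v (fst p)) \<in> borel_measurable ?M" "(\<lambda>p. g v (snd p)) \<in> borel_measurable ?M" if "v \<in> W" for v
    using measurable_compose [OF measurable_fst g(1) [OF that]] measurable_compose [OF measurable_snd g(1) [OF that]] by auto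
  have hm [measurable]: "(\<lambda>p. h v (fst p)) \<in> borel_measurable ?M" "(\<lambda>p. h v (snd p)) \<in> borel_measurable ?M" if "v \<in> W" for v
    using measurable_compose [OF measurable_fst h(1) [OF that]] measurable_compose [OF measurable_snd h(1) [OF that]] by auto
  have gb: "\<bar>g v (fst p) * g v (snd p)\<bar> \<le> 1" and hb: "\<bar>h v (fst p) * h v (snd p)\<bar> \<le> 1" if "v \<in> W" "p \<in> space ?M" for v p
    using that g(2) h(2) by (auto simp: space_pair_measure intro!: le1)
  have fi: "integrable ?M (?f v w)" if "v \<in> W" "w \<in> W" for v w
  proof (rule integrable_pair_bounded [where C = 1])
    show "?f v w \<in> borel_measurable ?M" using gm hm that by (intro borel_measurable_times) auto
    show "\<bar>?f v w p\<bar> \<le> 1" if "p \<in> space ?M" for p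
      by (rule le1) (use gb hb that \<open>v \<in> W\<close> \<open>w \<in> W\<close> in auto)
  qed
  have sq: "(\<integral>x. g v x * h w x \<partial>M)\<^sup>2 = (\<integral>p. ?f v w p \<partial>?M)" if v: "v \<in> W" and w: "w \<in> W" for v w
  proof -
    have "(\<integral>p. (g v (fst p) * h w (fst p)) * (g v (snd p) * h w (snd p)) \<partial>?M) = (\<integral>x. g v x * h w x \<partial>M) * (\<integral>x. g v x * h w x \<partial>M)"
      by (rule integral_pair_mult) (use g h v w in \<open>auto intro!: le1\<close>)
    then show ?thesis by (simp add: power2_eq_square ac_simps)
  qed
  have "avg W (\<lambda>v. avg W (\<lambda>w. (\<integral>x. g v x * h w x \<partial>M)\<^sup>2)) = avg W (\<lambda>v. avg W (\<lambda>w. \<integral>p. ?f v w p \<partial>?M))"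
    by (intro avg_cong) (rule sq)
  also have "\<dots> = avg W (\<lambda>v. \<integral>p. avg W (\<lambda>w. ?f v w p) \<partial>?M)"
    by (intro avg_cong integral_avg [symmetric] fi)
  also have "\<dots> = (\<integral>p. avg W (\<lambda>v. avg W (\<lambda>w. ?f v w p)) \<partial>?M)"
    by (rule integral_avg [symmetric]) (use fi in \<open>auto simp: avg_def\<close>)
  also have "\<dots> \<le> (\<integral>p. \<bar>avg W (\<lambda>v. g v (fst p) * g v (snd p))\<bar> \<partial>?M)"
  proof (rule integral_mono)
    show "integrable ?M (\<lambda>p. avg W (\<lambda>v. avg W (\<lambda>w. ?f v w p)))"
      unfolding avg_def [of W] using fi by auto
    have 1: "\<bar>avg W (\<lambda>v. g v (fst p) * g v (snd p))\<bar> \<le> 1" if "p \<in> space ?M" for p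
      by (rule order_trans [OF avg_abs]) (rule avg_le_const [OF W gb [OF _ that]])
    show "integrable ?M (\<lambda>p. \<bar>avg W (\<lambda>v. g v (fst p) * g v (snd p))\<bar>)"
    proof (rule integrable_pair_bounded [where C = 1])
      show "(\<lambda>p. \<bar>avg W (\<lambda>v. g v (fst p) * g v (snd p))\<bar>) \<in> borel_measurable ?M" unfolding avg_def using gm by auto
    qed (use 1 in auto)
    fix p assume p: "p \<in> space ?M"
    have 2: "\<bar>avg W (\<lambda>w. h w (fst p) * h w (snd p))\<bar> \<le> 1"
      by (rule order_trans [OF avg_abs]) (rule avg_le_const [OF W hb [OF _ p]])
    have "avg W (\<lambda>v. avg W (\<lambda>w. ?f v w p)) = avg W (\<lambda>v. g v (fst p) * g v (snd p)) * avg W (\<lambda>w. h w (fst p) * h w (snd p))"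
      by (simp only: avg_mult_avg)
    also have "\<dots> \<le> \<bar>avg W (\<lambda>v. g v (fst p) * g v (snd p))\<bar> * 1"
      by (rule order_trans [OF abs_ge_self]) (unfold abs_mult, rule mult_left_mono [OF 2], simp)
    finally show "avg W (\<lambda>v. avg W (\<lambda>w. ?f v w p)) \<le> \<bar>avg W (\<lambda>v. g v (fst p) * g v (snd p))\<bar>" by simp
  qed
  finally show ?thesis .
qed

lemma compact_avg_metric:
  assumes D: "compact_space (mtopology_of D)"
  shows "compact_space (mtopology_of (avg_metric D))"
proof -
  have "Lipschitz_continuous_map (prod_metric D D) (avg_metric D) (\<lambda>p. p)"
    unfolding Lipschitz_continuous_map_def
  proof (intro conjI exI [of _ 1] ballI)
    fix p p' assume "p \<in> mspace (prod_metric D D)" "p' \<in> mspace (prod_metric D D)"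
    let ?a = "mdist D (fst p) (fst p')" and ?b = "mdist D (snd p) (snd p')"
    have mean: "x \<le> z \<Longrightarrow> y \<le> z \<Longrightarrow> (x + y) / 2 \<le> 1 * z" for x y z :: real by simp
    have "(?a + ?b) / 2 \<le> 1 * sqrt (?a\<^sup>2 + ?b\<^sup>2)"
      by (rule mean [OF real_sqrt_sum_squares_ge1 real_sqrt_sum_squares_ge2])
    then show "mdist (avg_metric D) p p' \<le> 1 * mdist (prod_metric D D) p p'"
      by (simp add: avg_dist_def prod_dist_def case_prod_unfold)
  qed auto
  then have c: "continuous_map (prod_topology (mtopology_of D) (mtopology_of D)) (mtopology_of (avg_metric D)) (\<lambda>p. p)"
    using Lipschitz_continuous_imp_continuous_map by (simp add: mtopology_of_prod_metric [symmetric] del: mtopology_of_prod_metric)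
  have "compactin (prod_topology (mtopology_of D) (mtopology_of D)) (mspace D \<times> mspace D)"
    using D compact_space_prod_topology [of "mtopology_of D" "mtopology_of D"] by (simp add: compact_space_def)
  from image_compactin [OF this c] show ?thesis by (simp add: compact_space_def)
qed

lemma avg_metric_coords_continuous:
  assumes q: "metric_coords D q"
  shows "continuous_map (mtopology_of (avg_metric D)) euclideanreal (\<lambda>p. q n (fst p))"
    and "continuous_map (mtopology_of (avg_metric D)) euclideanreal (\<lambda>p. q n (snd p))"
proof -
  have "\<bar>q n (fst p) - q n (fst p')\<bar> \<le> 2 * avg_dist D p p'" "\<bar>q n (snd p) - q n (snd p')\<bar> \<le> 2 * avg_dist D p p'"
    if "p \<in> mspace D \<times> mspace D" "p' \<in> mspace D \<times> mspace D" for p p'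
  proof -
    have "\<bar>q n (fst p) - q n (fst p')\<bar> \<le> mdist D (fst p) (fst p')" "\<bar>q n (snd p) - q n (snd p')\<bar> \<le> mdist D (snd p) (snd p')"
      using metric_coords_lipschitz [OF q] that by (auto simp: mem_Times_iff)
    moreover have "2 * avg_dist D p p' = mdist D (fst p) (fst p') + mdist D (snd p) (snd p')" by (simp add: avg_dist_def)
    ultimately show "\<bar>q n (fst p) - q n (fst p')\<bar> \<le> 2 * avg_dist D p p'" "\<bar>q n (snd p) - q n (snd p')\<bar> \<le> 2 * avg_dist D p p'"
      using mdist_nonneg [of D "fst p" "fst p'"] mdist_nonneg [of D "snd p" "snd p'"] by linarith+
  qed
  then have L: "Lipschitz_continuous_map (avg_metric D) euclidean_metric (\<lambda>p. q n (fst p))"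
    "Lipschitz_continuous_map (avg_metric D) euclidean_metric (\<lambda>p. q n (snd p))"
    unfolding Lipschitz_continuous_map_def by (auto simp: dist_real_def intro!: exI [of _ 2])
  then show "continuous_map (mtopology_of (avg_metric D)) euclideanreal (\<lambda>p. q n (fst p))"
    "continuous_map (mtopology_of (avg_metric D)) euclideanreal (\<lambda>p. q n (snd p))"
    using Lipschitz_continuous_imp_continuous_map [OF L(1)] Lipschitz_continuous_imp_continuous_map [OF L(2)] by simp_all
qed

abbreviation zip_names :: "'i set \<Rightarrow> ('i \<Rightarrow> 'x) \<times> ('i \<Rightarrow> 'x) \<Rightarrow> 'i \<Rightarrow> 'x \<times> 'x" where
  "zip_names I \<equiv> (\<lambda>(x, y). \<lambda>i\<in>I. (x i, y i))"

lemma zip_names_measurable: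
  assumes D: "compact_space (mtopology_of D)" and \<nu>: "sets \<nu> = sets (PiM I (\<lambda>_. metric_borel D))"
  shows "zip_names I \<in> measurable (\<nu> \<Otimes>\<^sub>M \<nu>) (PiM I (\<lambda>_. metric_borel (avg_metric D)))"
proof -
  obtain q where q: "metric_coords D q" using metric_coords_exist [OF D] by blast
  let ?e = "\<lambda>j p. case j of Inl n \<Rightarrow> q n (fst p) | Inr n \<Rightarrow> q n (snd p)"
  note qm = coordinates_measurable [OF coordinates_metric [OF D q]]
  have sp: "space \<nu> = (\<Pi>\<^sub>E i\<in>I. mspace D)" using sets_eq_imp_space_eq [OF \<nu>] by (simp add: space_PiM)
  have c: "(\<lambda>x. x i) \<in> measurable \<nu> (metric_borel D)" if "i \<in> I" for i
    using measurable_component_singleton [OF that] by (simp add: measurable_cong_sets [OF \<nu> refl])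
  have "(\<lambda>p. (fst p i, snd p i)) \<in> measurable (\<nu> \<Otimes>\<^sub>M \<nu>) (metric_borel (avg_metric D))" if i: "i \<in> I" for i
  proof (rule measurable_metric_borel [where e = ?e, OF compact_avg_metric [OF D]])
    show "continuous_map (mtopology_of (avg_metric D)) euclideanreal (?e j)" for j
      using avg_metric_coords_continuous [OF q] by (cases j) auto
    show "x = y" if "x \<in> mspace (avg_metric D)" "y \<in> mspace (avg_metric D)" "\<And>j. ?e j x = ?e j y" for x y
    proof (rule prod_eqI)
      show "fst x = fst y" by (rule metric_coords_separate [OF q]) (use that(1,2) that(3) [of "Inl _"] in auto)
      show "snd x = snd y" by (rule metric_coords_separate [OF q]) (use that(1,2) that(3) [of "Inr _"] in auto)
    qed
    show "(\<lambda>p. (fst p i, snd p i)) \<in> space (\<nu> \<Otimes>\<^sub>M \<nu>) \<rightarrow> mspace (avg_metric D)"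
      using i by (auto simp: space_pair_measure sp)
    show "(\<lambda>p. ?e j (fst p i, snd p i)) \<in> borel_measurable (\<nu> \<Otimes>\<^sub>M \<nu>)" for j
      using measurable_compose [OF measurable_compose [OF measurable_fst c [OF i]] qm]
        measurable_compose [OF measurable_compose [OF measurable_snd c [OF i]] qm] by (cases j) simp_all
  qed
  then have "(\<lambda>p. \<lambda>i\<in>I. (fst p i, snd p i)) \<in> measurable (\<nu> \<Otimes>\<^sub>M \<nu>) (PiM I (\<lambda>_. metric_borel (avg_metric D)))"
    by (rule measurable_restrict)
  then show ?thesis by (simp add: case_prod_unfold)
qed

lemma self_product_Prob:
  fixes h :: "('i \<Rightarrow> 'x \<times> 'x) \<Rightarrow> real"
  assumes D: "compact_space (mtopology_of D)" and \<nu>: "\<nu> \<in> Prob (PiM I (\<lambda>_. metric_borel D))"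
  shows "self_product D I \<nu> \<in> Prob (PiM I (\<lambda>_. metric_borel (avg_metric D)))"
    and "h \<in> borel_measurable (PiM I (\<lambda>_. metric_borel (avg_metric D))) \<Longrightarrow>
      integral\<^sup>L (self_product D I \<nu>) h = (\<integral>p. h (zip_names I p) \<partial>(\<nu> \<Otimes>\<^sub>M \<nu>))"
proof -
  have s: "sets \<nu> = sets (PiM I (\<lambda>_. metric_borel D))" using \<nu> by (simp add: Prob_def)
  interpret prob_space \<nu> using \<nu> by (simp add: Prob_def)
  interpret P: pair_prob_space \<nu> \<nu> ..
  show "self_product D I \<nu> \<in> Prob (PiM I (\<lambda>_. metric_borel (avg_metric D)))"
    unfolding self_product_def Prob_def using P.prob_space_distr [OF zip_names_measurable [OF D s]] by simp
  show "integral\<^sup>L (self_product D I \<nu>) h = (\<integral>p. h (zip_names I p) \<partial>(\<nu> \<Otimes>\<^sub>M \<nu>))"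
    if "h \<in> borel_measurable (PiM I (\<lambda>_. metric_borel (avg_metric D)))"
    unfolding self_product_def by (rule integral_distr [OF zip_names_measurable [OF D s] that])
qed

definition pair_coords :: "('n \<Rightarrow> 'x \<Rightarrow> real) \<Rightarrow> ('g \<Rightarrow> 'x \<times> 'x) \<Rightarrow> ('g \<times> 'n) + ('g \<times> 'n) \<Rightarrow> real" where
  "pair_coords q z = case_sum (sequence_coords q (\<lambda>g. fst (z g))) (sequence_coords q (\<lambda>g. snd (z g)))"

lemma pair_coords_continuous:
  assumes q: "metric_coords D q"
  shows "continuous_map (seq_topology (avg_metric D)) euclideanreal (\<lambda>z. pair_coords q z j)"
proof -
  have p: "continuous_map (seq_topology (avg_metric D)) (mtopology_of (avg_metric D)) (\<lambda>z. z g)" for g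
    unfolding seq_topology_def using continuous_map_product_coordinates [of g UNIV "\<lambda>_. mtopology_of (avg_metric D)"] by simp
  show ?thesis
    using continuous_map_compose [OF p avg_metric_coords_continuous(1) [OF q]]
      continuous_map_compose [OF p avg_metric_coords_continuous(2) [OF q]]
    by (cases j) (auto simp: pair_coords_def sequence_coords_def o_def)
qed

lemma pair_coords_separate:
  assumes q: "metric_coords D q" and z: "z \<in> topspace (seq_topology (avg_metric D))" "z' \<in> topspace (seq_topology (avg_metric D))"
    and eq: "\<And>j. pair_coords q z j = pair_coords q z' j"
  shows "z = z'"
proof
  fix g
  have "fst (z g) \<in> mspace D" "fst (z' g) \<in> mspace D" "snd (z g) \<in> mspace D" "snd (z' g) \<in> mspace D"
    using z by (auto simp: seq_topology_def PiE_iff mem_Times_iff)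
  moreover have "q n (fst (z g)) = q n (fst (z' g))" "q n (snd (z g)) = q n (snd (z' g))" for n
    using eq [of "Inl (g, n)"] eq [of "Inr (g, n)"] by (auto simp: pair_coords_def)
  ultimately show "z g = z' g" using metric_coords_separate [OF q] by (auto simp: prod_eq_iff)
qed

definition lefts :: "('a + 'b) list \<Rightarrow> 'a list" where
  "lefts L = [a. Inl a \<leftarrow> L]"

definition rights :: "('a + 'b) list \<Rightarrow> 'b list" where
  "rights L = [b. Inr b \<leftarrow> L]"

text \<open>
  Monomials of a pair of names split.  This is what turns integrals over two copies into products.
\<close>

lemma monomial_case_sum: "monomial L (case_sum a b) = monomial (lefts L) a * monomial (rights L) b"
proof (induction L)
  case (Cons j L)
  then show ?case by (cases j) (auto simp: lefts_def rights_def)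
qed (simp add: lefts_def rights_def)

lemma continuous_pev:
  assumes "\<And>j. continuous_map T euclideanreal (\<lambda>x. z x j)"
  shows "continuous_map T euclideanreal (\<lambda>x. pev p (z x))"
proof -
  have m: "continuous_map T euclideanreal (\<lambda>x. monomial L (z x))" for L
    by (induction L) (auto intro!: continuous_map_real_mult assms)
  show ?thesis
    by (induction p) (auto intro!: continuous_map_add continuous_map_real_mult_left m)
qed

lemma tendsto_0_of_approximation:
  fixes u :: "nat \<Rightarrow> real"
  assumes u: "\<And>i. 0 \<le> u i"
    and ap: "\<And>\<eta>. 0 < \<eta> \<Longrightarrow> \<exists>w. w \<longlonglongrightarrow> 0 \<and> (\<forall>i. u i \<le> \<eta> + w i)"
  shows "u \<longlonglongrightarrow> 0"
proof (rule LIMSEQ_I)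
  fix e :: real assume e: "0 < e"
  then obtain w where w: "w \<longlonglongrightarrow> 0" "\<And>i. u i \<le> e / 2 + w i" using ap [of "e / 2"] by auto
  have "\<forall>\<^sub>F i in sequentially. w i < e / 2" by (rule order_tendstoD(2) [OF w(1)]) (use e in simp)
  then obtain N where N: "\<And>i. N \<le> i \<Longrightarrow> w i < e / 2" unfolding eventually_sequentially by blast
  have "norm (u i - 0) < e" if "N \<le> i" for i using N [OF that] w(2) [of i] u [of i] by auto
  then show "\<exists>N. \<forall>i\<ge>N. norm (u i - 0) < e" by blast
qed

locale pair_setting =
  fixes D :: "'x metric" and q :: "nat \<Rightarrow> 'x \<Rightarrow> real" and W :: "nat \<Rightarrow> 'v set" and s :: "nat \<Rightarrow> 'g::countable \<Rightarrow> 'v \<Rightarrow> 'v"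
    and m :: "nat \<Rightarrow> ('v \<Rightarrow> 'x) measure" and \<mu> :: "('g \<Rightarrow> 'x) measure"
  assumes D: "compact_space (mtopology_of D)" and q: "metric_coords D q"
    and fin: "finite (W i)" and nonempty: "W i \<noteq> {}" and perm: "s i g permutes W i"
    and m: "m i \<in> Prob (model_space D (W i))" and \<mu>: "\<mu> \<in> Prob (seq_space D)"
begin

sublocale Q: quenched_setting "avg_metric D" W s "\<lambda>i. self_product D (W i) (m i)" "self_product D UNIV \<mu>"
proof
  show "self_product D (W i) (m i) \<in> Prob (model_space (avg_metric D) (W i))" for i
    using self_product_Prob(1) [OF D, of "m i" "W i"] m [of i] by (simp add: model_space_def)
  show "self_product D UNIV \<mu> \<in> Prob (seq_space (avg_metric D))"
    using self_product_Prob(1) [OF D, of \<mu> UNIV] \<mu> by (simp add: seq_space_def)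
qed (use D fin nonempty perm in \<open>simp_all add: compact_avg_metric\<close>)

lemma prob_m: "prob_space (m i)" and sets_m: "sets (m i) = sets (PiM (W i) (\<lambda>_. metric_borel D))"
  and prob_\<mu>: "prob_space \<mu>" and sets_\<mu>: "sets \<mu> = sets (PiM UNIV (\<lambda>_. metric_borel D))"
  using m [of i] \<mu> by (auto simp: Prob_def model_space_def seq_space_def)

abbreviation name :: "nat \<Rightarrow> 'v \<Rightarrow> ('v \<Rightarrow> 'x) \<Rightarrow> 'g \<times> nat \<Rightarrow> real" where
  "name i v x \<equiv> sequence_coords q (pullback_name (s i) v x)"

lemma name_field: "v \<in> W i \<Longrightarrow> cube_field (m i) (name i v)"
proof (rule cube_field_sequence_coords [OF coordinates_metric [OF D q]])
  fix g assume "v \<in> W i"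
  then have "s i g v \<in> W i" using permutes_in_image [OF perm] by blast
  then have "(\<lambda>x. x (s i g v)) \<in> measurable (PiM (W i) (\<lambda>_. metric_borel D)) (metric_borel D)"
    by (rule measurable_component_singleton)
  then show "(\<lambda>x. pullback_name (s i) v x g) \<in> measurable (m i) (metric_borel D)"
    unfolding pullback_name_def measurable_cong_sets [OF sets_m refl] .
qed

lemma limit_field: "cube_field \<mu> (\<lambda>x. sequence_coords q x)"
proof (rule cube_field_sequence_coords [OF coordinates_metric [OF D q]])
  show "(\<lambda>x. x g) \<in> measurable \<mu> (metric_borel D)" for g
    unfolding measurable_cong_sets [OF sets_\<mu> refl] by (rule measurable_component_singleton) simp
qed

sublocale F: field_sequence W m "\<lambda>i v x. sequence_coords q (pullback_name (s i) v x)" \<mu> "\<lambda>x. sequence_coords q x"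
  by (rule field_sequence.intro) (rule fin nonempty prob_m prob_\<mu> limit_field name_field, assumption?)+

lemma pair_coords_zip: "pair_coords q (zip_names UNIV p) = case_sum (sequence_coords q (fst p)) (sequence_coords q (snd p))"
  by (cases p) (simp add: pair_coords_def)

lemma pair_coords_pullback:
  assumes v: "v \<in> W i"
  shows "pair_coords q (pullback_name (s i) v (zip_names (W i) p)) = case_sum (name i v (fst p)) (name i v (snd p))"
proof -
  have "s i g v \<in> W i" for g using permutes_in_image [OF perm] v by blast
  then show ?thesis by (cases p) (simp add: pair_coords_def pullback_name_def)
qed

lemma pair_field: "v \<in> W i \<Longrightarrow> cube_field (self_product D (W i) (m i)) (\<lambda>y. pair_coords q (pullback_name (s i) v y))"
  and pair_limit_field: "cube_field (self_product D UNIV \<mu>) (pair_coords q)"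
proof -
  have m1: "(\<lambda>z. pair_coords q z j) \<in> borel_measurable (seq_space (avg_metric D) :: ('g \<Rightarrow> 'x \<times> 'x) measure)" for j
    by (rule continuous_seq_measurable [OF compact_avg_metric [OF D] pair_coords_continuous [OF q]])
  have r: "0 \<le> pair_coords q z j \<and> pair_coords q z j \<le> 1" if "z \<in> space (seq_space (avg_metric D))" for z :: "'g \<Rightarrow> 'x \<times> 'x" and j
  proof -
    have "fst (z g) \<in> mspace D" "snd (z g) \<in> mspace D" for g
      using that by (auto simp: seq_space_def space_PiM PiE_iff mem_Times_iff)
    then show ?thesis using metric_coords_range [OF q]
      by (cases j) (auto simp: pair_coords_def sequence_coords_def)
  qed
  show "cube_field (self_product D (W i) (m i)) (\<lambda>y. pair_coords q (pullback_name (s i) v y))" if "v \<in> W i"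
    using measurable_compose [OF Q.pullback_n [OF that] m1] r [OF measurable_space [OF Q.pullback_n [OF that]]]
    by (intro cube_fieldI) auto
  have st: "sets (self_product D UNIV \<mu>) = sets (seq_space (avg_metric D))" using Q.\<nu> by (simp add: Prob_def)
  show "cube_field (self_product D UNIV \<mu>) (pair_coords q)"
    using m1 r by (intro cube_fieldI) (auto simp: measurable_cong_sets [OF st refl] sets_eq_imp_space_eq [OF st])
qed

sublocale F2: field_sequence W "\<lambda>i. self_product D (W i) (m i)" "\<lambda>i v y. pair_coords q (pullback_name (s i) v y)"
    "self_product D UNIV \<mu>" "pair_coords q"
proof (rule field_sequence.intro)
  have "self_product D UNIV \<mu> \<in> Prob (seq_space (avg_metric D))" by (rule Q.\<nu>)
  then show "prob_space (self_product D UNIV \<mu>)" by (simp add: Prob_def)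
qed (rule fin nonempty Q.prob_n pair_limit_field pair_field, assumption?)+

lemma integral_limit_pair:
  "(\<integral>z. monomial L (pair_coords q z) \<partial>self_product D UNIV \<mu>) =
    (\<integral>x. monomial (lefts L) (sequence_coords q x) \<partial>\<mu>) * (\<integral>x. monomial (rights L) (sequence_coords q x) \<partial>\<mu>)"
proof -
  interpret prob_space \<mu> by (rule prob_\<mu>)
  have st: "sets (self_product D UNIV \<mu>) = sets (PiM UNIV (\<lambda>_. metric_borel (avg_metric D)))"
    using Q.\<nu> by (simp add: Prob_def seq_space_def)
  have "(\<integral>z. monomial L (pair_coords q z) \<partial>self_product D UNIV \<mu>) = (\<integral>p. monomial L (pair_coords q (zip_names UNIV p)) \<partial>(\<mu> \<Otimes>\<^sub>M \<mu>))"
    by (rule self_product_Prob(2) [OF D])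
      (use \<mu> cube_field_monomial(1) [OF pair_limit_field] in \<open>auto simp: seq_space_def measurable_cong_sets [OF st refl]\<close>)
  also have "\<dots> = (\<integral>p. monomial (lefts L) (sequence_coords q (fst p)) * monomial (rights L) (sequence_coords q (snd p)) \<partial>(\<mu> \<Otimes>\<^sub>M \<mu>))"
    by (simp only: pair_coords_zip monomial_case_sum)
  also have "\<dots> = (\<integral>x. monomial (lefts L) (sequence_coords q x) \<partial>\<mu>) * (\<integral>x. monomial (rights L) (sequence_coords q x) \<partial>\<mu>)"
    by (rule integral_pair_mult [where g = "\<lambda>x. monomial (lefts L) (sequence_coords q x)" and h = "\<lambda>x. monomial (rights L) (sequence_coords q x)"])
      (use cube_field_monomial [OF limit_field] in auto)
  finally show ?thesis .
qed

lemma integral_pair: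
  assumes v: "v \<in> W i" and w: "w \<in> W i"
  shows "(\<integral>y. monomial L (pair_coords q (pullback_name (s i) v y)) * monomial L' (pair_coords q (pullback_name (s i) w y)) \<partial>self_product D (W i) (m i)) =
    (\<integral>x. monomial (lefts L) (name i v x) * monomial (lefts L') (name i w x) \<partial>m i) *
    (\<integral>x. monomial (rights L) (name i v x) * monomial (rights L') (name i w x) \<partial>m i)"
proof -
  interpret prob_space "m i" by (rule prob_m)
  let ?h = "\<lambda>y. monomial L (pair_coords q (pullback_name (s i) v y)) * monomial L' (pair_coords q (pullback_name (s i) w y))"
  have st: "sets (self_product D (W i) (m i)) = sets (PiM (W i) (\<lambda>_. metric_borel (avg_metric D)))"
    using Q.sets_n by (simp add: model_space_def)
  have "?h \<in> borel_measurable (self_product D (W i) (m i))"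
    using cube_field_monomial(1) [OF pair_field [OF v]] cube_field_monomial(1) [OF pair_field [OF w]] by (rule borel_measurable_times)
  then have "integral\<^sup>L (self_product D (W i) (m i)) ?h = (\<integral>p. ?h (zip_names (W i) p) \<partial>(m i \<Otimes>\<^sub>M m i))"
    by (intro self_product_Prob(2) [OF D]) (use m in \<open>auto simp: model_space_def measurable_cong_sets [OF st refl]\<close>)
  also have "\<dots> = (\<integral>p. (monomial (lefts L) (name i v (fst p)) * monomial (lefts L') (name i w (fst p))) *
      (monomial (rights L) (name i v (snd p)) * monomial (rights L') (name i w (snd p))) \<partial>(m i \<Otimes>\<^sub>M m i))"
  proof (rule Bochner_Integration.integral_cong [OF refl])
    fix p
    have ac: "(a * b) * (a' * b') = (a * a') * (b * b')" for a b a' b' :: real by simp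
    show "?h (zip_names (W i) p) = (monomial (lefts L) (name i v (fst p)) * monomial (lefts L') (name i w (fst p))) *
      (monomial (rights L) (name i v (snd p)) * monomial (rights L') (name i w (snd p)))"
      unfolding pair_coords_pullback [OF v] pair_coords_pullback [OF w] monomial_case_sum by (rule ac)
  qed
  also have "\<dots> = (\<integral>x. monomial (lefts L) (name i v x) * monomial (lefts L') (name i w x) \<partial>m i) *
    (\<integral>x. monomial (rights L) (name i v x) * monomial (rights L') (name i w x) \<partial>m i)"
  proof -
    have "(\<lambda>x. monomial a (name i v x) * monomial b (name i w x)) \<in> borel_measurable (m i)" for a b
      using cube_field_monomial(1) [OF name_field [OF v]] cube_field_monomial(1) [OF name_field [OF w]] by (rule borel_measurable_times)
    moreover have "\<bar>monomial a (name i v x) * monomial b (name i w x)\<bar> \<le> 1" if "x \<in> space (m i)" for a b x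
      using cube_field_monomial(2) [OF name_field [OF v] that, of a] cube_field_monomial(2) [OF name_field [OF w] that, of b]
      by (simp add: mult_le_one)
    ultimately show ?thesis
      by (intro integral_pair_mult [where g = "\<lambda>x. monomial (lefts L) (name i v x) * monomial (lefts L') (name i w x)"
            and h = "\<lambda>x. monomial (rights L) (name i v x) * monomial (rights L') (name i w x)"]) auto
  qed
  finally show ?thesis .
qed

end

lemma abs_mult_diff_le:
  fixes a b x y :: real
  assumes "\<bar>b\<bar> \<le> 1" "\<bar>x\<bar> \<le> 1"
  shows "\<bar>a * b - x * y\<bar> \<le> \<bar>a - x\<bar> + \<bar>b - y\<bar>"
proof -
  have "a * b - x * y = (a - x) * b + x * (b - y)" by algebra
  also have "\<bar>\<dots>\<bar> \<le> \<bar>a - x\<bar> * \<bar>b\<bar> + \<bar>x\<bar> * \<bar>b - y\<bar>"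
    using abs_triangle_ineq by (simp add: abs_mult [symmetric])
  also have "\<dots> \<le> \<bar>a - x\<bar> * 1 + 1 * \<bar>b - y\<bar>" using assms by (intro add_mono mult_left_mono mult_right_mono) auto
  finally show ?thesis by simp
qed

lemma (in prob_space) integral_close:
  fixes f g :: "'a \<Rightarrow> real"
  assumes "integrable M f" "integrable M g" "\<And>x. x \<in> space M \<Longrightarrow> \<bar>f x - g x\<bar> \<le> \<eta>"
  shows "\<bar>(\<integral>x. f x \<partial>M) - (\<integral>x. g x \<partial>M)\<bar> \<le> \<eta>"
proof -
  have "\<bar>\<integral>x. f x - g x \<partial>M\<bar> \<le> \<eta>"
    by (rule integral_bounded) (use assms in auto)
  then show ?thesis using assms by simp
qed

context pair_setting
begin

text \<open>
  For two independent copies the joint moments are products of the moments of the copies, which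
  converge in mean over the pairs \<open>(v, w)\<close> and are bounded by 1.
\<close>

lemma pair_converges_pair_coords:
  assumes dq: "dq_coords q W s m \<mu>"
  shows "pair_converges W (\<lambda>i. self_product D (W i) (m i)) (\<lambda>i v y. pair_coords q (pullback_name (s i) v y))
      (self_product D UNIV \<mu>) (pair_coords q)"
  unfolding pair_converges_def
proof (intro allI)
  fix L L' :: "('g \<times> nat + 'g \<times> nat) list"
  define c where "c L = (\<integral>x. monomial L (sequence_coords q x) \<partial>\<mu>)" for L
  define I where "I a a' i v w = (\<integral>x. monomial a (name i v x) * monomial a' (name i w x) \<partial>m i)" for a a' i v w
  define u where "u a a' i = avg (W i) (\<lambda>v. avg (W i) (\<lambda>w. \<bar>I a a' i v w - c a * c a'\<bar>))" for a a' i
  have u: "u a a' \<longlonglongrightarrow> 0" for a a'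
    using dq unfolding dq_coords_def pair_converges_def u_def I_def c_def by blast
  have c1: "\<bar>c a\<bar> \<le> 1" for a unfolding c_def
    by (rule prob_space.integral_bounded [OF prob_\<mu>]) (use cube_field_monomial [OF limit_field] in auto)
  have I1: "\<bar>I a a' i v w\<bar> \<le> 1" if v: "v \<in> W i" and w: "w \<in> W i" for a a' i v w
    unfolding I_def
  proof (rule prob_space.integral_bounded [OF prob_m])
    show "(\<lambda>x. monomial a (name i v x) * monomial a' (name i w x)) \<in> borel_measurable (m i)"
      using cube_field_monomial(1) [OF name_field [OF v]] cube_field_monomial(1) [OF name_field [OF w]] by (rule borel_measurable_times)
    show "\<bar>monomial a (name i v x) * monomial a' (name i w x)\<bar> \<le> 1" if "x \<in> space (m i)" for x
      using cube_field_monomial(2) [OF name_field [OF v] that, of a] cube_field_monomial(2) [OF name_field [OF w] that, of a']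
      by (simp add: mult_le_one)
  qed
  let ?e = "\<lambda>i v w. \<bar>I (lefts L) (lefts L') i v w * I (rights L) (rights L') i v w -
      c (lefts L) * c (rights L) * (c (lefts L') * c (rights L'))\<bar>"
  have "(\<lambda>i. u (lefts L) (lefts L') i + u (rights L) (rights L') i) \<longlonglongrightarrow> 0 + 0" by (intro tendsto_add u)
  then have lim: "(\<lambda>i. u (lefts L) (lefts L') i + u (rights L) (rights L') i) \<longlonglongrightarrow> 0" by simp
  have le: "norm (avg (W i) (\<lambda>v. avg (W i) (?e i v))) \<le> u (lefts L) (lefts L') i + u (rights L) (rights L') i" for i
  proof -
    have "avg (W i) (\<lambda>v. avg (W i) (?e i v)) \<le> avg (W i) (\<lambda>v. avg (W i) (\<lambda>w.
        \<bar>I (lefts L) (lefts L') i v w - c (lefts L) * c (lefts L')\<bar> + \<bar>I (rights L) (rights L') i v w - c (rights L) * c (rights L')\<bar>))"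
    proof (intro avg_mono)
      fix v w assume v: "v \<in> W i" and w: "w \<in> W i"
      have "\<bar>c (lefts L) * c (lefts L')\<bar> \<le> 1" using mult_mono [OF c1 c1, of "lefts L" "lefts L'"] by (simp add: abs_mult mult.commute)
      from abs_mult_diff_le [OF I1 [OF v w, of "rights L" "rights L'"] this, of "I (lefts L) (lefts L') i v w" "c (rights L) * c (rights L')"]
      show "?e i v w \<le> \<bar>I (lefts L) (lefts L') i v w - c (lefts L) * c (lefts L')\<bar> + \<bar>I (rights L) (rights L') i v w - c (rights L) * c (rights L')\<bar>"
        by (simp add: ac_simps)
    qed
    moreover have "0 \<le> avg (W i) (\<lambda>v. avg (W i) (?e i v))" by (intro avg_nonneg) simp
    ultimately show ?thesis by (simp add: u_def avg_add)
  qed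
  have "(\<lambda>i. avg (W i) (\<lambda>v. avg (W i) (?e i v))) \<longlonglongrightarrow> 0"
    by (rule Lim_null_comparison [OF always_eventually lim]) (rule allI, rule le)
  moreover have "avg (W i) (\<lambda>v. avg (W i) (\<lambda>w. \<bar>(\<integral>y. monomial L (pair_coords q (pullback_name (s i) v y)) * monomial L' (pair_coords q (pullback_name (s i) w y)) \<partial>self_product D (W i) (m i))
      - (\<integral>z. monomial L (pair_coords q z) \<partial>self_product D UNIV \<mu>) * (\<integral>z. monomial L' (pair_coords q z) \<partial>self_product D UNIV \<mu>)\<bar>)) =
      avg (W i) (\<lambda>v. avg (W i) (?e i v))" for i
    by (intro avg_cong) (simp only: integral_pair integral_limit_pair I_def c_def)
  ultimately show "(\<lambda>i. avg (W i) (\<lambda>v. avg (W i) (\<lambda>w. \<bar>(\<integral>y. monomial L (pair_coords q (pullback_name (s i) v y)) * monomial L' (pair_coords q (pullback_name (s i) w y)) \<partial>self_product D (W i) (m i))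
      - (\<integral>z. monomial L (pair_coords q z) \<partial>self_product D UNIV \<mu>) * (\<integral>z. monomial L' (pair_coords q z) \<partial>self_product D UNIV \<mu>)\<bar>))) \<longlonglongrightarrow> 0"
    by (simp only:)
qed

text \<open>
  Continuous functions of a pair of names are uniform limits of polynomials.  For these, the first
  clause of quenched convergence is the convergence of single moments and the second is the second
  moment method.
\<close>

lemma dq_converges_of_coords:
  assumes dq: "dq_coords q W s m \<mu>"
  shows "dq_converges D W s m \<mu>"
  unfolding dq_converges_def
proof (rule Q.quenched_if_deviation)
  let ?E = "avg_metric D" and ?n = "\<lambda>i. self_product D (W i) (m i)" and ?\<nu> = "self_product D UNIV \<mu>"
  note conv = pair_converges_pair_coords [OF dq]
  interpret n: prob_space "?n i" for i by (rule Q.prob_n)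
  interpret \<nu>: prob_space ?\<nu> by (rule F2.prob_P)
  fix f :: "('g \<Rightarrow> 'x \<times> 'x) \<Rightarrow> real" assume f: "continuous_map (seq_topology ?E) euclideanreal f"
  have fm: "f \<in> borel_measurable (seq_space ?E)" by (rule continuous_seq_measurable [OF Q.E f])
  obtain C where C: "\<And>z. z \<in> topspace (seq_topology ?E) \<Longrightarrow> \<bar>f z\<bar> \<le> C" using continuous_seq_bounded [OF Q.E f] by blast
  have st: "sets ?\<nu> = sets (seq_space ?E)" using Q.\<nu> by (simp add: Prob_def)
  have sp: "space ?\<nu> = topspace (seq_topology ?E)" using sets_eq_imp_space_eq [OF st] by (simp add: space_seq_space)
  have pb: "pullback_name (s i) v y \<in> topspace (seq_topology ?E)" if "v \<in> W i" "y \<in> space (?n i)" for i v y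
    using measurable_space [OF Q.pullback_n [OF that(1)] that(2)] by (simp add: space_seq_space)
  have int_f: "integrable (?n i) (\<lambda>y. f (pullback_name (s i) v y))" if "v \<in> W i" for i v
    by (rule n.integrable_bounded [OF measurable_compose [OF Q.pullback_n [OF that] fm], where C = C]) (use C pb that in auto)
  have int_\<nu>: "integrable ?\<nu> f"
  proof (rule \<nu>.integrable_bounded [where C = C])
    show "f \<in> borel_measurable ?\<nu>" unfolding measurable_cong_sets [OF st refl] by (rule fm)
  qed (use C sp in auto)
  have ap: "\<exists>p. (\<forall>z\<in>topspace (seq_topology ?E). \<bar>f z - pev p (pair_coords q z)\<bar> \<le> \<eta> / 2) \<and>
      \<bar>(\<integral>z. f z \<partial>?\<nu>) - (\<integral>z. pev p (pair_coords q z) \<partial>?\<nu>)\<bar> \<le> \<eta> / 2" if \<eta>: "0 < \<eta>" for \<eta>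
  proof -
    have \<eta>2: "0 < \<eta> / 2" using \<eta> by simp
    obtain p where p: "\<And>z. z \<in> topspace (seq_topology ?E) \<Longrightarrow> \<bar>f z - pev p (pair_coords q z)\<bar> < \<eta> / 2"
      using compact_embedding_pev [where e = "\<lambda>j z. pair_coords q z j", OF compact_seq_topology [OF Q.E] pair_coords_continuous [OF q]
          pair_coords_separate [OF q] f \<eta>2] by metis
    have "\<bar>(\<integral>z. f z \<partial>?\<nu>) - (\<integral>z. pev p (pair_coords q z) \<partial>?\<nu>)\<bar> \<le> \<eta> / 2"
      by (rule \<nu>.integral_close [OF int_\<nu> F2.integrable_pev_limit]) (use p sp in \<open>auto intro: less_imp_le\<close>)
    then show ?thesis using p less_imp_le by blast
  qed
  show "(\<lambda>i. avg (W i) (\<lambda>v. \<bar>(\<integral>y. f (pullback_name (s i) v y) \<partial>?n i) - (\<integral>z. f z \<partial>?\<nu>)\<bar>)) \<longlonglongrightarrow> 0"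
  proof (rule tendsto_0_of_approximation)
    fix \<eta> :: real assume "0 < \<eta>"
    then obtain p where p: "\<And>z. z \<in> topspace (seq_topology ?E) \<Longrightarrow> \<bar>f z - pev p (pair_coords q z)\<bar> \<le> \<eta> / 2"
      "\<bar>(\<integral>z. f z \<partial>?\<nu>) - (\<integral>z. pev p (pair_coords q z) \<partial>?\<nu>)\<bar> \<le> \<eta> / 2" using ap by blast
    let ?w = "\<lambda>i. avg (W i) (\<lambda>v. \<bar>(\<integral>y. pev p (pair_coords q (pullback_name (s i) v y)) \<partial>?n i) - (\<integral>z. pev p (pair_coords q z) \<partial>?\<nu>)\<bar>)"
    have "avg (W i) (\<lambda>v. \<bar>(\<integral>y. f (pullback_name (s i) v y) \<partial>?n i) - (\<integral>z. f z \<partial>?\<nu>)\<bar>) \<le> avg (W i) (\<lambda>v. \<eta> +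
        \<bar>(\<integral>y. pev p (pair_coords q (pullback_name (s i) v y)) \<partial>?n i) - (\<integral>z. pev p (pair_coords q z) \<partial>?\<nu>)\<bar>)" for i
    proof (rule avg_mono)
      fix v assume v: "v \<in> W i"
      have "\<bar>(\<integral>y. f (pullback_name (s i) v y) \<partial>?n i) - (\<integral>y. pev p (pair_coords q (pullback_name (s i) v y)) \<partial>?n i)\<bar> \<le> \<eta> / 2"
        by (rule n.integral_close [OF int_f [OF v] F2.integrable_pev [OF v]]) (use p(1) pb [OF v] in auto)
      then show "\<bar>(\<integral>y. f (pullback_name (s i) v y) \<partial>?n i) - (\<integral>z. f z \<partial>?\<nu>)\<bar> \<le> \<eta> +
          \<bar>(\<integral>y. pev p (pair_coords q (pullback_name (s i) v y)) \<partial>?n i) - (\<integral>z. pev p (pair_coords q z) \<partial>?\<nu>)\<bar>"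
        using p(2) by linarith
    qed
    then have "\<forall>i. avg (W i) (\<lambda>v. \<bar>(\<integral>y. f (pullback_name (s i) v y) \<partial>?n i) - (\<integral>z. f z \<partial>?\<nu>)\<bar>) \<le> \<eta> + ?w i"
      by (simp add: avg_add avg_const fin nonempty)
    then show "\<exists>w. w \<longlonglongrightarrow> 0 \<and> (\<forall>i. avg (W i) (\<lambda>v. \<bar>(\<integral>y. f (pullback_name (s i) v y) \<partial>?n i) - (\<integral>z. f z \<partial>?\<nu>)\<bar>) \<le> \<eta> + w i)"
      using F2.pair_converges_single [OF conv, of p] by blast
  qed (simp add: avg_nonneg)
  show "(\<lambda>i. \<integral>y. Q.deviation f i y \<partial>?n i) \<longlonglongrightarrow> 0"
  proof (rule tendsto_0_of_approximation)
    fix \<eta> :: real assume "0 < \<eta>"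
    then obtain p where p: "\<And>z. z \<in> topspace (seq_topology ?E) \<Longrightarrow> \<bar>f z - pev p (pair_coords q z)\<bar> \<le> \<eta> / 2"
      "\<bar>(\<integral>z. f z \<partial>?\<nu>) - (\<integral>z. pev p (pair_coords q z) \<partial>?\<nu>)\<bar> \<le> \<eta> / 2" using ap by blast
    let ?h = "\<lambda>i y. \<bar>avg (W i) (\<lambda>v. pev p (pair_coords q (pullback_name (s i) v y))) - (\<integral>z. pev p (pair_coords q z) \<partial>?\<nu>)\<bar>"
    have "(\<integral>y. Q.deviation f i y \<partial>?n i) \<le> \<eta> + (\<integral>y. ?h i y \<partial>?n i)" for i
    proof -
      have i1: "integrable (?n i) (\<lambda>y. avg (W i) (\<lambda>v. pev p (pair_coords q (pullback_name (s i) v y))))"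
        unfolding avg_def using F2.integrable_pev by auto
      have i2: "integrable (?n i) (?h i)"
        by (intro integrable_abs Bochner_Integration.integrable_diff i1) simp
      have "(\<integral>y. Q.deviation f i y \<partial>?n i) \<le> (\<integral>y. \<eta> + ?h i y \<partial>?n i)"
      proof (rule integral_mono [OF Q.integrable_deviation [OF f]])
        show "integrable (?n i) (\<lambda>y. \<eta> + ?h i y)" using i2 by simp
        fix y assume y: "y \<in> space (?n i)"
        have "\<bar>avg (W i) (\<lambda>v. f (pullback_name (s i) v y)) - avg (W i) (\<lambda>v. pev p (pair_coords q (pullback_name (s i) v y)))\<bar> \<le> \<eta> / 2"
          unfolding avg_diff [symmetric]
          by (rule order_trans [OF avg_abs]) (rule avg_le_const [OF fin nonempty], use p(1) pb y in auto)
        then show "Q.deviation f i y \<le> \<eta> + ?h i y" using p(2) unfolding Q.deviation_def by linarith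
      qed
      also have "\<dots> = \<eta> + (\<integral>y. ?h i y \<partial>?n i)" using i2 by (simp add: n.prob_space)
      finally show ?thesis .
    qed
    then show "\<exists>w. w \<longlonglongrightarrow> 0 \<and> (\<forall>i. (\<integral>y. Q.deviation f i y \<partial>?n i) \<le> \<eta> + w i)"
      using F2.pair_converges_in_mean [OF conv, of p] by blast
  qed (simp add: Q.deviation_def)
qed

text \<open>
  Apply the second clause of quenched convergence of the doubled models to the product
  \<open>(f x - c) (f x' - c)\<close>, whose mean under the limit is 0.  That the average over \<open>v\<close> of this
  product, at two independent copies, is small forces the correlations between \<open>v\<close> and \<open>w\<close> to be
  small for most pairs.
\<close>

lemma dq_coords_of_converges:
  assumes dq: "dq_converges D W s m \<mu>"
  shows "dq_coords q W s m \<mu>"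
  unfolding dq_coords_def pair_converges_def
proof (intro allI)
  let ?n = "\<lambda>i. self_product D (W i) (m i)" and ?\<nu> = "self_product D UNIV \<mu>"
  interpret m: prob_space "m i" for i by (rule prob_m)
  interpret \<mu>: prob_space \<mu> by (rule prob_\<mu>)
  fix L L' :: "('g \<times> nat) list"
  define c where "c L = (\<integral>x. monomial L (sequence_coords q x) \<partial>\<mu>)" for L
  have lm: "(\<lambda>x. monomial L (sequence_coords q x)) \<in> borel_measurable \<mu>" and lr: "x \<in> space \<mu> \<Longrightarrow> 0 \<le> monomial L (sequence_coords q x) \<and> monomial L (sequence_coords q x) \<le> 1" for L x
    by (rule cube_field_monomial [OF limit_field])+
  have il: "integrable \<mu> (\<lambda>x. monomial L (sequence_coords q x))" for L
    by (rule \<mu>.integrable_bounded [OF lm, where C = 1]) (use lr in auto)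
  have c: "0 \<le> c L \<and> c L \<le> 1" for L
  proof
    show "0 \<le> c L" unfolding c_def by (rule Bochner_Integration.integral_nonneg) (use lr in auto)
    show "c L \<le> 1" unfolding c_def using \<mu>.integral_bounded [OF lm, where C = 1] lr by fastforce
  qed
  define g where "g L i v x = monomial L (name i v x) - c L" for L i v x
  have gm: "g L i v \<in> borel_measurable (m i)" if "v \<in> W i" for L i v
    unfolding g_def [abs_def] using cube_field_monomial(1) [OF name_field [OF that]] by (rule borel_measurable_diff) simp
  have gb: "\<bar>g L i v x\<bar> \<le> 1" if "v \<in> W i" "x \<in> space (m i)" for L i v x
    using cube_field_monomial(2) [OF name_field [OF that(1)] that(2), of L] c [of L] by (simp add: g_def abs_le_iff)
  have gi: "integrable (m i) (g L i v)" if "v \<in> W i" for L i v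
    by (rule m.integrable_bounded [OF gm [OF that]]) (rule gb [OF that])
  define t where "t L i = (\<integral>p. \<bar>avg (W i) (\<lambda>v. g L i v (fst p) * g L i v (snd p))\<bar> \<partial>(m i \<Otimes>\<^sub>M m i))" for L i
  have t: "t L \<longlonglongrightarrow> 0" for L
  proof -
    \<comment> \<open>The polynomial \<open>(L(x) - c) (L(x') - c)\<close> in the coordinates of a pair \<open>(x, x')\<close>.\<close>
    define P where "P = [(1, map Inl L @ map Inr L), (- c L, map Inl L), (- c L, map Inr L), (c L * c L, [])]"
    define f where "f z = pev P (pair_coords q z)" for z :: "'g \<Rightarrow> 'x \<times> 'x"
    have P: "pev P (case_sum a b) = (monomial L a - c L) * (monomial L b - c L)" for a b
      by (simp add: P_def monomial_map algebra_simps)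
    have f: "continuous_map (seq_topology (avg_metric D)) euclideanreal f"
      unfolding f_def [abs_def] by (rule continuous_pev [OF pair_coords_continuous [OF q]])
    have st: "sets ?\<nu> = sets (PiM UNIV (\<lambda>_. metric_borel (avg_metric D)))" using Q.\<nu> by (simp add: Prob_def seq_space_def)
    have "(\<integral>z. f z \<partial>?\<nu>) = (\<integral>p. f (zip_names UNIV p) \<partial>(\<mu> \<Otimes>\<^sub>M \<mu>))"
      by (rule self_product_Prob(2) [OF D]) (use \<mu> continuous_seq_measurable [OF Q.E f] in \<open>simp_all add: seq_space_def\<close>)
    also have "\<dots> = (\<integral>p. (monomial L (sequence_coords q (fst p)) - c L) * (monomial L (sequence_coords q (snd p)) - c L) \<partial>(\<mu> \<Otimes>\<^sub>M \<mu>))"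
      by (simp only: f_def pair_coords_zip P)
    also have "\<dots> = (\<integral>x. monomial L (sequence_coords q x) - c L \<partial>\<mu>) * (\<integral>x. monomial L (sequence_coords q x) - c L \<partial>\<mu>)"
    proof (rule \<mu>.integral_pair_mult [where g = "\<lambda>x. monomial L (sequence_coords q x) - c L" and h = "\<lambda>x. monomial L (sequence_coords q x) - c L"])
      show "(\<lambda>x. monomial L (sequence_coords q x) - c L) \<in> borel_measurable \<mu>" using lm by (rule borel_measurable_diff) simp
      show "\<bar>monomial L (sequence_coords q x) - c L\<bar> \<le> 1" if "x \<in> space \<mu>" for x using lr [OF that, of L] c [of L] by (simp add: abs_le_iff)
      then show "\<bar>monomial L (sequence_coords q x) - c L\<bar> \<le> 1" if "x \<in> space \<mu>" for x using that .
    qed (use lm in \<open>rule borel_measurable_diff\<close>, simp)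
    also have "\<dots> = 0" using il by (simp add: c_def \<mu>.prob_space)
    finally have 0: "(\<integral>z. f z \<partial>?\<nu>) = 0" .
    have "t L i = (\<integral>y. Q.deviation f i y \<partial>?n i)" for i
    proof -
      have stn: "sets (?n i) = sets (PiM (W i) (\<lambda>_. metric_borel (avg_metric D)))" using Q.sets_n by (simp add: model_space_def)
      have dm: "Q.deviation f i \<in> borel_measurable (PiM (W i) (\<lambda>_. metric_borel (avg_metric D)))"
        using Q.deviation_measurable [OF f, of i] unfolding measurable_cong_sets [OF stn refl] .
      have "(\<integral>y. Q.deviation f i y \<partial>?n i) = (\<integral>p. Q.deviation f i (zip_names (W i) p) \<partial>(m i \<Otimes>\<^sub>M m i))"
        by (rule self_product_Prob(2) [OF D _ dm]) (use m in \<open>simp add: model_space_def\<close>)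
      also have "\<dots> = t L i" unfolding t_def
      proof (rule Bochner_Integration.integral_cong [OF refl])
        fix p
        have "avg (W i) (\<lambda>v. f (pullback_name (s i) v (zip_names (W i) p))) = avg (W i) (\<lambda>v. g L i v (fst p) * g L i v (snd p))"
          by (rule avg_cong) (simp only: f_def pair_coords_pullback P g_def)
        then show "Q.deviation f i (zip_names (W i) p) = \<bar>avg (W i) (\<lambda>v. g L i v (fst p) * g L i v (snd p))\<bar>"
          by (simp only: Q.deviation_def 0 diff_zero)
      qed
      finally show ?thesis by simp
    qed
    then have eq: "t L = (\<lambda>i. \<integral>y. Q.deviation f i y \<partial>?n i)" by (rule ext)
    show ?thesis unfolding eq by (rule Q.quenched_imp_deviation [OF dq [unfolded dq_converges_def] f])
  qed
  have pairs: "avg (W i) (\<lambda>v. avg (W i) (\<lambda>w. (\<integral>x. g L i v x * g L' i w x \<partial>m i)\<^sup>2)) \<le> t L i" for L L' i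
    unfolding t_def by (rule m.square_correlation [OF fin nonempty gm gb gm gb])
  have single: "avg (W i) (\<lambda>v. (\<integral>x. g L i v x \<partial>m i)\<^sup>2) \<le> t L i" for L i
  proof -
    have "avg (W i) (\<lambda>v. avg (W i) (\<lambda>w. (\<integral>x. g L i v x * 1 \<partial>m i)\<^sup>2)) \<le> t L i"
      unfolding t_def by (rule m.square_correlation [where h = "\<lambda>_ _. 1", OF fin nonempty gm gb]) simp_all
    then show ?thesis by (simp add: avg_const fin nonempty)
  qed
  let ?u = "\<lambda>i v w. (\<integral>x. monomial L (name i v x) * monomial L' (name i w x) \<partial>m i) - c L * c L'"
  have "(\<lambda>i. avg (W i) (\<lambda>v. avg (W i) (\<lambda>w. \<bar>?u i v w\<bar>))) \<longlonglongrightarrow> 0"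
  proof (rule tendsto_0_of_square_bound [where K = 3 and v = "\<lambda>i. t L i + t L i + t L' i"])
    have "(\<lambda>i. t L i + t L i + t L' i) \<longlonglongrightarrow> 0 + 0 + 0" by (intro tendsto_add t)
    then show "(\<lambda>i. t L i + t L i + t L' i) \<longlonglongrightarrow> 0" by simp
    show "0 \<le> avg (W i) (\<lambda>v. avg (W i) (\<lambda>w. \<bar>?u i v w\<bar>))" for i by (intro avg_nonneg) simp
    fix i and \<eta> :: real assume \<eta>: "0 < \<eta>"
    let ?K = "\<lambda>v w. \<integral>x. g L i v x * g L' i w x \<partial>m i" and ?a = "\<lambda>v. \<integral>x. g L i v x \<partial>m i" and ?b = "\<lambda>w. \<integral>x. g L' i w x \<partial>m i"
    have "avg (W i) (\<lambda>v. avg (W i) (\<lambda>w. \<bar>?u i v w\<bar>)) \<le>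
        avg (W i) (\<lambda>v. avg (W i) (\<lambda>w. 3 * \<eta> + (1 / \<eta>) * ((?K v w)\<^sup>2 + (?a v)\<^sup>2 + (?b w)\<^sup>2)))"
    proof (intro avg_mono)
      fix v w assume v: "v \<in> W i" and w: "w \<in> W i"
      have gg: "integrable (m i) (\<lambda>x. g L i v x * g L' i w x)"
      proof (rule m.integrable_bounded [where C = 1])
        show "(\<lambda>x. g L i v x * g L' i w x) \<in> borel_measurable (m i)" using gm [OF v] gm [OF w] by (rule borel_measurable_times)
        show "\<bar>g L i v x * g L' i w x\<bar> \<le> 1" if "x \<in> space (m i)" for x
          using mult_mono [OF gb [OF v that, of L] gb [OF w that, of L']] by (simp add: abs_mult)
      qed
      have "(\<integral>x. monomial L (name i v x) * monomial L' (name i w x) \<partial>m i) =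
          (\<integral>x. g L i v x * g L' i w x + c L' * g L i v x + c L * g L' i w x + c L * c L' \<partial>m i)"
        by (rule Bochner_Integration.integral_cong [OF refl]) (simp add: g_def algebra_simps)
      also have "\<dots> = ?K v w + c L' * ?a v + c L * ?b w + c L * c L'"
        using gg gi [OF v, of L] gi [OF w, of L'] by (simp add: m.prob_space)
      finally have "\<bar>?u i v w\<bar> = \<bar>?K v w + c L' * ?a v + c L * ?b w\<bar>" by simp
      also have "\<dots> \<le> \<bar>?K v w\<bar> + \<bar>c L' * ?a v\<bar> + \<bar>c L * ?b w\<bar>" by linarith
      also have "\<dots> \<le> \<bar>?K v w\<bar> + \<bar>?a v\<bar> + \<bar>?b w\<bar>"
        using c [of L] c [of L'] by (intro add_mono) (auto simp: abs_mult mult_left_le_one_le)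
      also have "\<dots> \<le> (\<eta> + (?K v w)\<^sup>2 / \<eta>) + (\<eta> + (?a v)\<^sup>2 / \<eta>) + (\<eta> + (?b w)\<^sup>2 / \<eta>)"
        by (intro add_mono abs_le_square \<eta>)
      also have "\<dots> = 3 * \<eta> + (1 / \<eta>) * ((?K v w)\<^sup>2 + (?a v)\<^sup>2 + (?b w)\<^sup>2)" by (simp add: add_divide_distrib)
      finally show "\<bar>?u i v w\<bar> \<le> 3 * \<eta> + (1 / \<eta>) * ((?K v w)\<^sup>2 + (?a v)\<^sup>2 + (?b w)\<^sup>2)" .
    qed
    also have "\<dots> = 3 * \<eta> + (1 / \<eta>) * (avg (W i) (\<lambda>v. avg (W i) (\<lambda>w. (?K v w)\<^sup>2)) + avg (W i) (\<lambda>v. (?a v)\<^sup>2) + avg (W i) (\<lambda>w. (?b w)\<^sup>2))"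
      by (simp only: avg_add avg_cmult avg_const [OF fin nonempty])
    also have "\<dots> \<le> 3 * \<eta> + (1 / \<eta>) * (t L i + t L i + t L' i)"
      by (intro add_left_mono mult_left_mono add_mono pairs single) (use \<eta> in simp)
    finally show "avg (W i) (\<lambda>v. avg (W i) (\<lambda>w. \<bar>?u i v w\<bar>)) \<le> 3 * \<eta> + (t L i + t L i + t L' i) / \<eta>" by simp
  qed simp
  then show "(\<lambda>i. avg (W i) (\<lambda>v. avg (W i) (\<lambda>w. \<bar>(\<integral>x. monomial L (name i v x) * monomial L' (name i w x) \<partial>m i) -
      (\<integral>y. monomial L (sequence_coords q y) \<partial>\<mu>) * (\<integral>y. monomial L' (sequence_coords q y) \<partial>\<mu>)\<bar>))) \<longlonglongrightarrow> 0"
    by (simp only: c_def)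
qed

end

section \<open>Entropy of a metric process in coordinates\<close>

lemma cov_mono_dist:
  assumes \<nu>: "prob_space \<nu>" and d: "\<And>x. x \<in> space \<nu> \<Longrightarrow> d x \<in> borel_measurable \<nu>"
    and le: "\<And>x y. x \<in> space \<nu> \<Longrightarrow> y \<in> space \<nu> \<Longrightarrow> d' x y < \<delta>' \<Longrightarrow> d x y < \<delta>"
  shows "cov \<epsilon> \<delta> \<nu> d \<le> cov \<epsilon> \<delta>' \<nu> d'"
proof (rule cov_mono_covers)
  interpret prob_space \<nu> by fact
  fix F assume F: "is_cover \<epsilon> \<delta>' \<nu> d' F"
  then have Fs: "finite F" "F \<subseteq> space \<nu>" by (auto simp: is_cover_def)
  have "covered \<nu> d \<delta> F \<in> sets \<nu>" by (rule covered_measurable) (use Fs d in auto)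
  moreover have "covered \<nu> d' \<delta>' F \<subseteq> covered \<nu> d \<delta> F"
    using le Fs(2) unfolding covered_def by blast
  ultimately have "prob (covered \<nu> d' \<delta>' F) \<le> prob (covered \<nu> d \<delta> F)" by (intro finite_measure_mono)
  then have "is_cover \<epsilon> \<delta> \<nu> d F" using F by (simp add: is_cover_def)
  then show "\<exists>F'. is_cover \<epsilon> \<delta> \<nu> d F' \<and> card F' \<le> card F" by blast
qed

lemma hamming_measurable:
  assumes M: "sets M = sets (model_space D W)" and x: "x \<in> (\<Pi>\<^sub>E v\<in>W. mspace D)"
  shows "hamming D W x \<in> borel_measurable M"
proof -
  have "(\<lambda>y. mdist D a y) \<in> borel_measurable (metric_borel D)" if a: "a \<in> mspace D" for a
  proof (rule continuous_metric_borel)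
    have "\<bar>mdist D a y - mdist D a y'\<bar> \<le> mdist D y y'" if "y \<in> mspace D" "y' \<in> mspace D" for y y'
      using mdist_triangle [OF a that] mdist_triangle [OF a that(2,1)] by (simp add: mdist_commute abs_le_iff)
    then have "Lipschitz_continuous_map D euclidean_metric (mdist D a)"
      unfolding Lipschitz_continuous_map_def by (auto simp: dist_real_def intro!: exI [of _ 1])
    then show "continuous_map (mtopology_of D) euclideanreal (mdist D a)"
      using Lipschitz_continuous_imp_continuous_map [of D euclidean_metric "mdist D a"] by simp
  qed
  then have "(\<lambda>y. mdist D (x v) (y v)) \<in> borel_measurable M" if v: "v \<in> W" for v
    using x v measurable_compose [OF measurable_component_singleton [OF v, of "\<lambda>_. metric_borel D"]]
    unfolding measurable_cong_sets [OF M refl] model_space_def by (blast dest: PiE_mem)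
  then show ?thesis unfolding hamming_def [abs_def] by auto
qed

lemma hamming_eq_avg: "hamming D W x y = avg W (\<lambda>v. mdist D (x v) (y v))"
  by (simp add: hamming_def avg_def)

text \<open>
  Each coordinate is Lipschitz for the metric, and conversely the metric is dominated by finitely many
  coordinates up to any given error.
\<close>

lemma rate_eq_rate_coords:
  assumes D: "compact_space (mtopology_of D)" and q: "metric_coords D q"
    and W: "\<And>i. finite (W i)" "\<And>i. W i \<noteq> {}" and m: "\<And>i. m i \<in> Prob (model_space D (W i))"
  shows "(SUP \<delta>\<in>{0<..}. SUP \<epsilon>\<in>{0<..}. growth W (\<lambda>i. cov \<epsilon> \<delta> (m i) (hamming D (W i)))) = rate_coords q W m"
proof (rule antisym)
  have m': "prob_space (m i)" "sets (m i) = sets (model_space D (W i))" for i using m [of i] by (auto simp: Prob_def)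
  have sp: "space (m i) = (\<Pi>\<^sub>E v\<in>W i. mspace D)" for i
    using sets_eq_imp_space_eq [OF m'(2)] by (simp add: model_space_def space_PiM)
  have card: "0 < card (W i)" for i using W by (simp add: card_gt_0_iff)
  show "(SUP \<delta>\<in>{0<..}. SUP \<epsilon>\<in>{0<..}. growth W (\<lambda>i. cov \<epsilon> \<delta> (m i) (hamming D (W i)))) \<le> rate_coords q W m"
  proof (intro SUP_least)
    fix \<delta> \<epsilon> :: real assume \<delta>: "\<delta> \<in> {0<..}" and \<epsilon>: "\<epsilon> \<in> {0<..}"
    then have \<delta>2: "0 < \<delta> / 2" by simp
    obtain N C where C: "0 \<le> C" "\<And>x y. x \<in> mspace D \<Longrightarrow> y \<in> mspace D \<Longrightarrow> mdist D x y \<le> \<delta> / 2 + C * (\<Sum>n<N. \<bar>q n x - q n y\<bar>)"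
      using q \<delta>2 unfolding metric_coords_def by blast
    \<comment> \<open>One half of \<open>\<delta>\<close> is the error of the comparison, the other half is for the coordinates.\<close>
    define \<delta>' where "\<delta>' = \<delta> / (2 * (C + 1))"
    have \<delta>': "0 < \<delta>'" "C * \<delta>' < \<delta> / 2" using \<delta> C(1) by (auto simp: \<delta>'_def field_simps)
    have "cov \<epsilon> \<delta> (m i) (hamming D (W i)) \<le> cov \<epsilon> \<delta>' (m i) (coord_dist q {..<N} (W i))" for i
    proof (rule cov_mono_dist [OF m'(1)])
      show "hamming D (W i) x \<in> borel_measurable (m i)" if "x \<in> space (m i)" for x
        by (rule hamming_measurable [OF m'(2)]) (use that sp in simp)
      fix x y assume x: "x \<in> space (m i)" and y: "y \<in> space (m i)" and lt: "coord_dist q {..<N} (W i) x y < \<delta>'"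
      have "hamming D (W i) x y \<le> avg (W i) (\<lambda>v. \<delta> / 2 + C * (\<Sum>n<N. \<bar>q n (x v) - q n (y v)\<bar>))"
        unfolding hamming_eq_avg by (intro avg_mono C(2)) (use x y sp in auto)
      also have "\<dots> = \<delta> / 2 + C * coord_dist q {..<N} (W i) x y"
        by (simp add: avg_add avg_cmult avg_const W coord_dist_def)
      also have "C * coord_dist q {..<N} (W i) x y \<le> C * \<delta>'" using lt C(1) by (intro mult_left_mono) auto
      finally show "hamming D (W i) x y < \<delta>" using \<delta>'(2) by simp
    qed
    then have "growth W (\<lambda>i. cov \<epsilon> \<delta> (m i) (hamming D (W i))) \<le> growth W (\<lambda>i. cov \<epsilon> \<delta>' (m i) (coord_dist q {..<N} (W i)))"
      by (intro growth_mono card) simp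
    also have "\<dots> \<le> rate_coords q W m"
      unfolding rate_coords_def
      by (rule SUP_upper2 [of "{..<N}"], simp, rule SUP_upper2 [of \<delta>'], use \<delta>' in simp, rule SUP_upper2 [OF \<epsilon>], rule order_refl)
    finally show "growth W (\<lambda>i. cov \<epsilon> \<delta> (m i) (hamming D (W i))) \<le> rate_coords q W m" .
  qed
  show "rate_coords q W m \<le> (SUP \<delta>\<in>{0<..}. SUP \<epsilon>\<in>{0<..}. growth W (\<lambda>i. cov \<epsilon> \<delta> (m i) (hamming D (W i))))"
    unfolding rate_coords_def
  proof (intro SUP_least)
    fix F :: "nat set" and \<delta> \<epsilon> :: real assume F: "F \<in> {F. finite F}" and \<delta>: "\<delta> \<in> {0<..}" and \<epsilon>: "\<epsilon> \<in> {0<..}"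
    define \<delta>' where "\<delta>' = \<delta> / (real (card F) + 1)"
    have \<delta>': "0 < \<delta>'" "real (card F) * \<delta>' < \<delta>" using \<delta> by (auto simp: \<delta>'_def field_simps)
    have "cov \<epsilon> \<delta> (m i) (coord_dist q F (W i)) \<le> cov \<epsilon> \<delta>' (m i) (hamming D (W i))" for i
    proof (rule cov_mono_dist [OF m'(1)])
      show "coord_dist q F (W i) x \<in> borel_measurable (m i)" for x
        by (rule coord_dist_measurable [OF coordinates_metric [OF D q]]) (use m'(2) in \<open>simp add: model_space_def\<close>)
      fix x y assume x: "x \<in> space (m i)" and y: "y \<in> space (m i)" and lt: "hamming D (W i) x y < \<delta>'"
      have "coord_dist q F (W i) x y \<le> avg (W i) (\<lambda>v. real (card F) * mdist D (x v) (y v))"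
        unfolding coord_dist_def
      proof (rule avg_mono)
        fix v assume v: "v \<in> W i"
        have "(\<Sum>n\<in>F. \<bar>q n (x v) - q n (y v)\<bar>) \<le> (\<Sum>n\<in>F. mdist D (x v) (y v))"
          by (intro sum_mono metric_coords_lipschitz [OF q]) (use x y v sp in auto)
        then show "(\<Sum>n\<in>F. \<bar>q n (x v) - q n (y v)\<bar>) \<le> real (card F) * mdist D (x v) (y v)" by simp
      qed
      also have "\<dots> = real (card F) * hamming D (W i) x y" by (simp add: avg_cmult hamming_eq_avg)
      also have "\<dots> \<le> real (card F) * \<delta>'" using lt by (intro mult_left_mono) auto
      finally show "coord_dist q F (W i) x y < \<delta>" using \<delta>'(2) by simp
    qed
    then have "growth W (\<lambda>i. cov \<epsilon> \<delta> (m i) (coord_dist q F (W i))) \<le> growth W (\<lambda>i. cov \<epsilon> \<delta>' (m i) (hamming D (W i)))"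
      by (intro growth_mono card) simp
    also have "\<dots> \<le> (SUP \<delta>\<in>{0<..}. SUP \<epsilon>\<in>{0<..}. growth W (\<lambda>i. cov \<epsilon> \<delta> (m i) (hamming D (W i))))"
      by (rule SUP_upper2 [of \<delta>'], use \<delta>' in simp, rule SUP_upper2 [OF \<epsilon>], rule order_refl)
    finally show "growth W (\<lambda>i. cov \<epsilon> \<delta> (m i) (coord_dist q F (W i))) \<le>
        (SUP \<delta>\<in>{0<..}. SUP \<epsilon>\<in>{0<..}. growth W (\<lambda>i. cov \<epsilon> \<delta> (m i) (hamming D (W i))))" .
  qed
qed

lemma constrained_image_cong:
  assumes "\<And>r m. S r \<Longrightarrow> A r m \<and> B r m \<longleftrightarrow> A' r m \<and> B' r m" "\<And>r m. S r \<Longrightarrow> A r m \<Longrightarrow> f r m = f' r m"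
  shows "{f r m | r m. S r \<and> A r m \<and> B r m} = {f' r m | r m. S r \<and> A' r m \<and> B' r m}"
proof (rule Collect_cong, intro iff_exI)
  fix e r m
  show "(e = f r m \<and> S r \<and> A r m \<and> B r m) = (e = f' r m \<and> S r \<and> A' r m \<and> B' r m)"
    using assms [of r m] by (cases "S r"; cases "A r m") auto
qed

theorem hdq_process_eq_hdq_coords:
  fixes \<sigma> :: "nat \<Rightarrow> 'g::{group_add,countable} \<Rightarrow> 'v \<Rightarrow> 'v"
  assumes sof: "sofic_approximation V \<sigma>" and D: "compact_space (mtopology_of D)" and q: "metric_coords D q"
    and \<mu>: "\<mu> \<in> Prob (seq_space D)"
  shows "hdq_process V \<sigma> D \<mu> = hdq_coords V \<sigma> (metric_borel D) q \<mu>"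
proof -
  have eq: "(\<forall>i. m i \<in> Prob (model_space D (V (r i)))) \<and> dq_converges D (V \<circ> r) (\<sigma> \<circ> r) m \<mu> \<longleftrightarrow>
      (\<forall>i. m i \<in> Prob (PiM (V (r i)) (\<lambda>_. metric_borel D))) \<and> dq_coords q (V \<circ> r) (\<sigma> \<circ> r) m \<mu>"
    and rate: "(\<forall>i. m i \<in> Prob (model_space D (V (r i)))) \<Longrightarrow>
      (SUP \<delta>\<in>{0<..}. SUP \<epsilon>\<in>{0<..}. limsup (\<lambda>i. log_enat (cov \<epsilon> \<delta> (m i) (hamming D (V (r i)))) / ereal (real (card (V (r i)))))) =
      rate_coords q (V \<circ> r) m"
    if r: "strict_mono r" for r m
  proof -
    interpret S: sofic_sequence "V \<circ> r" "\<sigma> \<circ> r" by (rule sofic_approximation_sequence [OF sof r])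
    have "dq_converges D (V \<circ> r) (\<sigma> \<circ> r) m \<mu> \<longleftrightarrow> dq_coords q (V \<circ> r) (\<sigma> \<circ> r) m \<mu>"
      if "\<forall>i. m i \<in> Prob (model_space D (V (r i)))"
    proof -
      interpret pair_setting D q "V \<circ> r" "\<sigma> \<circ> r" m \<mu>
        by (rule pair_setting.intro) (use D q S.fin S.nonempty S.perm \<mu> that in simp_all)
      show ?thesis by (rule iffI) (erule dq_coords_of_converges, erule dq_converges_of_coords)
    qed
    then show "(\<forall>i. m i \<in> Prob (model_space D (V (r i)))) \<and> dq_converges D (V \<circ> r) (\<sigma> \<circ> r) m \<mu> \<longleftrightarrow>
      (\<forall>i. m i \<in> Prob (PiM (V (r i)) (\<lambda>_. metric_borel D))) \<and> dq_coords q (V \<circ> r) (\<sigma> \<circ> r) m \<mu>"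
      unfolding model_space_def by blast
    show "(SUP \<delta>\<in>{0<..}. SUP \<epsilon>\<in>{0<..}. limsup (\<lambda>i. log_enat (cov \<epsilon> \<delta> (m i) (hamming D (V (r i)))) / ereal (real (card (V (r i)))))) =
      rate_coords q (V \<circ> r) m" if "\<forall>i. m i \<in> Prob (model_space D (V (r i)))"
      using rate_eq_rate_coords [where W = "V \<circ> r" and m = m, OF D q S.fin S.nonempty] that by (simp add: growth_def)
  qed
  show ?thesis unfolding hdq_process_def hdq_coords_def
    by (rule arg_cong [where f = Sup], rule constrained_image_cong) (erule eq, erule rate, assumption)
qed

section \<open>Standard spaces inside the Hilbert cube\<close>

text \<open>
  \<open>M\<close> sits in the Hilbert cube by \<open>e\<close>, with a Borel inverse \<open>r\<close> extended to all sequences.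
\<close>

definition cube_retract :: "'a measure \<Rightarrow> ('a \<Rightarrow> nat \<Rightarrow> real) \<Rightarrow> ((nat \<Rightarrow> real) \<Rightarrow> 'a) \<Rightarrow> bool" where
  "cube_retract M e r \<longleftrightarrow> cube_field M e \<and> r \<in> measurable borel M \<and> (\<forall>x\<in>space M. r (e x) = x)"

text \<open>
  The coordinates are truncated distances to the points of a dense sequence.  A limit of points of
  the image comes from a Cauchy sequence, hence lies in the image, as soon as it has arbitrarily
  small coordinates; so by completeness the image is Borel.
\<close>

lemma standard_cube_retract:
  assumes st: "standard_measurable_space M" and ne: "space M \<noteq> {}"
  obtains e r where "cube_retract M e r"
proof -
  obtain \<tau> where \<tau>: "completely_metrizable_space \<tau>" "second_countable \<tau>" "space M = topspace \<tau>" "sets M = sets (topological_borel \<tau>)"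
    using st unfolding standard_measurable_space_def by blast
  obtain S d where S: "Metric_space S d" "Metric_space.mcomplete S d" "\<tau> = Metric_space.mtopology S d"
    using \<tau>(1) unfolding completely_metrizable_space_def by blast
  interpret X: Metric_space S d by (rule S(1))
  have sp: "space M = S" using \<tau>(3) S(3) by simp
  have "openin \<tau> U \<Longrightarrow> U \<subseteq> topspace \<tau>" for U by (rule openin_subset)
  then have sets: "sets M = sigma_sets S {U. openin X.mtopology U}"
    using \<tau>(4) S(3) by (subst \<tau>(4)) (auto simp: topological_borel_def S(3) subset_iff intro!: sets_measure_of)
  have open_sets: "U \<in> sets M" if "openin X.mtopology U" for U
    unfolding sets by (rule sigma_sets.Basic) (use that in simp)
  obtain C where C: "countable C" "C \<subseteq> S" "X.mtopology closure_of C = S"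
    using second_countable_imp_separable_space [OF \<tau>(2)] unfolding separable_space_def S(3) by auto
  have dense: "\<exists>z\<in>C. d x z < \<epsilon>" if "x \<in> S" "0 < \<epsilon>" for x \<epsilon>
  proof -
    have "x \<in> X.mtopology closure_of C" using that C by simp
    then show ?thesis using that by (auto simp: X.metric_closure_of)
  qed
  define c where "c = from_nat_into C"
  have "C \<noteq> {}" using dense [of _ 1] ne sp by fastforce
  then have cS: "c n \<in> S" for n using C(2) from_nat_into [of C n] by (auto simp: c_def)
  have cdense: "\<exists>n. d x (c n) < \<epsilon>" if "x \<in> S" "0 < \<epsilon>" for x \<epsilon>
    using dense [OF that] from_nat_into_surj [OF C(1)] by (metis c_def)
  define e where "e x n = min 1 (d x (c n))" for x n
  define E where "E = e ` S"
  have e_less: "e x n < a \<longleftrightarrow> d x (c n) < a" if "a \<le> 1" for x n a using that by (auto simp: e_def min_def)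
  have near: "d x x' < 2 * \<epsilon>" if "e x n < \<epsilon>" "e x' n < \<epsilon>" "\<epsilon> \<le> 1" "x \<in> S" "x' \<in> S" for x x' n \<epsilon>
  proof -
    have "d x (c n) < \<epsilon>" "d x' (c n) < \<epsilon>" using that e_less by auto
    moreover have "d x x' \<le> d x (c n) + d x' (c n)" using X.triangle [of x "c n" x'] that cS by (simp add: X.commute)
    ultimately show ?thesis by linarith
  qed
  have small: "\<exists>n. e x n < \<epsilon>" if "x \<in> S" "0 < \<epsilon>" for x \<epsilon>
    using cdense [OF that] by (auto simp: e_def min_less_iff_disj)
  have inj: "x = x'" if "x \<in> S" "x' \<in> S" "e x = e x'" for x x'
  proof (rule ccontr)
    assume "x \<noteq> x'"
    then have pos: "0 < d x x'" using that by simp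
    \<comment> \<open>Below 1 the truncation of the distances has no effect.\<close>
    define \<epsilon> where "\<epsilon> = min 1 (d x x' / 2)"
    have \<epsilon>: "0 < \<epsilon>" "\<epsilon> \<le> 1" "2 * \<epsilon> \<le> d x x'" using pos by (auto simp: \<epsilon>_def min_def)
    obtain n where "e x n < \<epsilon>" using small [OF \<open>x \<in> S\<close> \<epsilon>(1)] by blast
    then have "d x x' < 2 * \<epsilon>" using near [of x n \<epsilon> x'] that \<epsilon>(2) by simp
    then show False using \<epsilon>(3) by simp
  qed
  \<comment> \<open>Sequences with arbitrarily small entries: density of the \<open>c n\<close> puts the image inside.\<close>
  define B where "B = {y :: nat \<Rightarrow> real. \<forall>j. \<exists>n. y n < 1 / (real j + 1)}"
  have coord: "(\<lambda>y :: nat \<Rightarrow> real. y n) \<in> borel_measurable borel" for n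
    by (rule borel_measurable_continuous_onI) (rule continuous_on_product_coordinates)
  note [measurable] = coord
  have Bm: "B \<in> sets borel"
  proof -
    have "{y \<in> space borel. \<forall>j. \<exists>n. (y :: nat \<Rightarrow> real) n < 1 / (real j + 1)} \<in> sets borel" by measurable
    then show ?thesis by (simp add: B_def)
  qed
  have EB: "E = closure E \<inter> B"
  proof (intro equalityI subsetI)
    fix y assume y: "y \<in> E"
    then obtain x where x: "x \<in> S" "y = e x" by (auto simp: E_def)
    have "\<exists>n. y n < 1 / (real j + 1)" for j unfolding x(2) by (rule small [OF x(1)]) simp
    then show "y \<in> closure E \<inter> B" using y closure_subset by (auto simp: B_def)
  next
    fix y assume y: "y \<in> closure E \<inter> B"
    then obtain w where w: "\<And>k. w k \<in> E" "w \<longlonglongrightarrow> y" using closure_sequential [of y E] by auto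
    have "\<forall>k. \<exists>x. x \<in> S \<and> w k = e x" using w(1) unfolding E_def by blast
    then obtain z where z: "\<And>k. z k \<in> S" "\<And>k. w k = e (z k)" by metis
    have lim: "(\<lambda>k. e (z k) n) \<longlonglongrightarrow> y n" for n
    proof -
      have "(\<lambda>k. w k n) \<longlonglongrightarrow> y n"
        by (rule continuous_on_tendsto_compose [OF continuous_on_product_coordinates w(2)]) auto
      then show ?thesis by (simp add: z)
    qed
    have "X.MCauchy z"
      unfolding X.MCauchy_def
    proof (intro conjI allI impI)
      show "range z \<subseteq> S" using z(1) by auto
      fix \<epsilon> :: real assume "0 < \<epsilon>"
      define \<epsilon>' where "\<epsilon>' = min 1 (\<epsilon> / 2)"
      have \<epsilon>': "0 < \<epsilon>'" "\<epsilon>' \<le> 1" "2 * \<epsilon>' \<le> \<epsilon>" using \<open>0 < \<epsilon>\<close> by (auto simp: \<epsilon>'_def min_def)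
      obtain j where j: "inverse (real (Suc j)) < \<epsilon>'" using reals_Archimedean [OF \<epsilon>'(1)] by blast
      obtain n where "y n < 1 / (real j + 1)" using y by (auto simp: B_def)
      then have "y n < \<epsilon>'" using j by (simp add: inverse_eq_divide add.commute)
      then have "\<forall>\<^sub>F k in sequentially. e (z k) n < \<epsilon>'" by (rule order_tendstoD(2) [OF lim])
      then obtain N where N: "\<And>k. N \<le> k \<Longrightarrow> e (z k) n < \<epsilon>'" unfolding eventually_sequentially by blast
      have "d (z k) (z k') < \<epsilon>" if "N \<le> k" "N \<le> k'" for k k'
        using near [OF N [OF that(1)] N [OF that(2)] \<epsilon>'(2) z(1) z(1)] \<epsilon>'(3) by linarith
      then show "\<exists>N. \<forall>k k'. N \<le> k \<longrightarrow> N \<le> k' \<longrightarrow> d (z k) (z k') < \<epsilon>" by blast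
    qed
    then obtain x where x: "limitin X.mtopology z x sequentially" using S(2) unfolding X.mcomplete_def by blast
    then have xS: "x \<in> S" and dx: "\<And>\<epsilon>. 0 < \<epsilon> \<Longrightarrow> \<exists>N. \<forall>k\<ge>N. d (z k) x < \<epsilon>"
      unfolding X.limit_metric_sequentially by blast+
    have "e x n = y n" for n
    proof (rule LIMSEQ_unique [OF _ lim])
      show "(\<lambda>k. e (z k) n) \<longlonglongrightarrow> e x n"
      proof (rule LIMSEQ_I)
        fix \<epsilon> :: real assume "0 < \<epsilon>"
        then obtain N where N: "\<And>k. N \<le> k \<Longrightarrow> d (z k) x < \<epsilon>" using dx by blast
        have "norm (e (z k) n - e x n) < \<epsilon>" if "N \<le> k" for k
          using N [OF that] X.triangle [of "z k" x "c n"] X.triangle [of x "z k" "c n"] z(1) [of k] xS cS [of n]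
          by (simp add: e_def X.commute min_def abs_less_iff)
        then show "\<exists>N. \<forall>k\<ge>N. norm (e (z k) n - e x n) < \<epsilon>" by blast
      qed
    qed
    then have "e x = y" by (rule ext)
    then show "y \<in> E" using xS by (auto simp: E_def)
  qed
  have Em: "E \<in> sets borel"
  proof -
    have "closure E \<in> sets borel" by (rule borel_closed) simp
    then show ?thesis using Bm EB by (metis sets.Int)
  qed
  obtain x0 where x0: "x0 \<in> S" using ne sp by blast
  define r where "r y = (if y \<in> E then inv_into S e y else x0)" for y
  have re: "r (e x) = x" if "x \<in> S" for x
    using that inj by (simp add: r_def E_def inv_into_f_f inj_onI)
  have rS: "r y \<in> S" for y using x0 by (auto simp: r_def E_def intro: inv_into_into)
  have er: "e (r y) = y" if "y \<in> E" for y using that by (simp add: r_def E_def f_inv_into_f)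
  have rm: "r \<in> measurable borel M"
  proof -
    have "r \<in> measurable borel (sigma S {U. openin X.mtopology U})"
    proof (rule measurable_measure_of)
      show "{U. openin X.mtopology U} \<subseteq> Pow S" using openin_subset [of X.mtopology] by auto
      show "r \<in> space borel \<rightarrow> S" using rS by simp
      fix U assume "U \<in> {U. openin X.mtopology U}"
      then have U: "openin X.mtopology U" by simp
      define J where "J = {(n, j :: nat). X.mball (c n) (1 / (real j + 1)) \<subseteq> U}"
      have "r -` U \<inter> space borel = (E \<inter> (\<Union>(n, j)\<in>J. {y. y n < 1 / (real j + 1)})) \<union> (if x0 \<in> U then - E else {})"
      proof (intro equalityI subsetI)
        fix y assume "y \<in> r -` U \<inter> space borel"
        then have ry: "r y \<in> U" by simp
        show "y \<in> (E \<inter> (\<Union>(n, j)\<in>J. {y. y n < 1 / (real j + 1)})) \<union> (if x0 \<in> U then - E else {})"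
        proof (cases "y \<in> E")
          case True
          obtain \<rho> where \<rho>: "0 < \<rho>" "X.mball (r y) \<rho> \<subseteq> U" using U ry unfolding X.openin_mtopology by blast
          obtain j where j: "inverse (real (Suc j)) < \<rho> / 2" using reals_Archimedean [of "\<rho> / 2"] \<rho>(1) by auto
          obtain n where n: "d (r y) (c n) < 1 / (real j + 1)" using cdense [OF rS, of "1 / (real j + 1)"] by auto
          have j': "1 / (real j + 1) < \<rho> / 2" using j by (simp add: inverse_eq_divide add.commute)
          have "X.mball (c n) (1 / (real j + 1)) \<subseteq> X.mball (r y) \<rho>"
          proof
            fix x assume x: "x \<in> X.mball (c n) (1 / (real j + 1))"
            have "d (r y) x \<le> d (r y) (c n) + d (c n) x" using X.triangle rS x by auto
            then show "x \<in> X.mball (r y) \<rho>" using x n j' rS by simp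
          qed
          then have "(n, j) \<in> J" using \<rho>(2) by (auto simp: J_def)
          moreover have "y n < 1 / (real j + 1)" using n er [OF True] e_less [of "1 / (real j + 1)" "r y" n] by simp
          ultimately show ?thesis using True by blast
        qed (use ry in \<open>simp add: r_def\<close>)
      next
        fix y assume y: "y \<in> (E \<inter> (\<Union>(n, j)\<in>J. {y. y n < 1 / (real j + 1)})) \<union> (if x0 \<in> U then - E else {})"
        show "y \<in> r -` U \<inter> space borel"
        proof (cases "y \<in> E")
          case True
          then obtain n j where nj: "(n, j) \<in> J" "y n < 1 / (real j + 1)" using y by (auto split: if_splits)
          have "d (r y) (c n) < 1 / (real j + 1)" using nj(2) er [OF True] e_less [of "1 / (real j + 1)" "r y" n] by simp
          then have "r y \<in> X.mball (c n) (1 / (real j + 1))" using rS cS by (simp add: X.commute)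
          then show ?thesis using nj(1) by (auto simp: J_def)
        next
          case False
          then show ?thesis using y by (auto simp: r_def split: if_splits)
        qed
      qed
      moreover have "(\<Union>(n, j)\<in>J. {y :: nat \<Rightarrow> real. y n < 1 / (real j + 1)}) \<in> sets borel"
      proof (rule sets.countable_UN'')
        fix nj assume "nj \<in> J"
        have "{y \<in> space borel. (y :: nat \<Rightarrow> real) (fst nj) < 1 / (real (snd nj) + 1)} \<in> sets borel" by measurable
        then show "(case nj of (n, j) \<Rightarrow> {y :: nat \<Rightarrow> real. y n < 1 / (real j + 1)}) \<in> sets borel" by (simp add: case_prod_unfold)
      qed simp
      ultimately show "r -` U \<inter> space borel \<in> sets borel" using Em by (simp add: borel_comp)
    qed
    moreover have "sets M = sets (sigma S {U. openin X.mtopology U})"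
      unfolding sets using openin_subset [of X.mtopology] by (subst sets_measure_of) auto
    ultimately show ?thesis using measurable_cong_sets [OF refl, of M] by blast
  qed
  have "cube_field M e"
  proof (rule cube_fieldI)
    fix n
    show "(\<lambda>x. e x n) \<in> borel_measurable M"
      unfolding borel_measurable_iff_less
    proof
      fix a
      show "{x \<in> space M. e x n < a} \<in> sets M"
      proof (cases "a \<le> 1")
        case True
        then have "{x \<in> space M. e x n < a} = X.mball (c n) a" using cS e_less by (auto simp: sp X.commute)
        then show ?thesis using open_sets by simp
      next
        case False
        then have "{x \<in> space M. e x n < a} = space M" by (auto simp: e_def)
        then show ?thesis by simp
      qed
    qed
  qed (simp add: e_def)
  then have "cube_retract M e r" using rm re sp by (simp add: cube_retract_def)
  then show ?thesis by (rule that)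
qed

text \<open>
  The coordinates of the components are enumerated by a pairing function.
\<close>

lemma cube_retract_power:
  assumes er: "cube_retract M e r"
  obtains e' r' where "cube_retract (power_measure k M) e' r'"
proof
  have e: "cube_field M e" and r: "r \<in> measurable borel M" and re: "\<And>x. x \<in> space M \<Longrightarrow> r (e x) = x"
    using er by (auto simp: cube_retract_def)
  have em: "(\<lambda>x. e x n) \<in> borel_measurable M" for n using e by (simp add: cube_field_def)
  let ?e = "\<lambda>x i. case prod_decode i of (j, n) \<Rightarrow> if j < k then e (x j) n else 0"
  let ?r = "\<lambda>y. \<lambda>j\<in>{..<k}. r (\<lambda>n. y (prod_encode (j, n)))"
  show "cube_retract (power_measure k M) ?e ?r" unfolding cube_retract_def
  proof (intro conjI ballI)
    show "cube_field (power_measure k M) ?e"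
    proof (rule cube_fieldI)
      fix i
      have "(\<lambda>x. x j) \<in> measurable (power_measure k M) M" if "j < k" for j
        unfolding power_measure_def by (rule measurable_component_singleton) (use that in simp)
      from measurable_compose [OF this em]
      show "(\<lambda>x. ?e x i) \<in> borel_measurable (power_measure k M)"
        by (cases "fst (prod_decode i) < k") (simp_all add: case_prod_unfold)
      fix x assume "x \<in> space (power_measure k M)"
      then show "0 \<le> ?e x i \<and> ?e x i \<le> 1"
        using cube_field_range [OF e] by (auto simp: power_measure_def space_PiM case_prod_unfold)
    qed
    have "(\<lambda>y n. y (prod_encode (j, n))) \<in> measurable borel (borel :: (nat \<Rightarrow> real) measure)" for j
      by (rule measurable_coordinatewise_then_product)
        (rule borel_measurable_continuous_onI, rule continuous_on_product_coordinates)
    from measurable_compose [OF this r]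
    show "?r \<in> measurable borel (power_measure k M)" unfolding power_measure_def by (intro measurable_restrict)
    fix x assume x: "x \<in> space (power_measure k M)"
    then have "?r (?e x) j = x j" for j
      using re by (auto simp: power_measure_def space_PiM PiE_iff extensional_def)
    then show "?r (?e x) = x" by (rule ext)
  qed
qed

definition cube_metric :: "(nat \<Rightarrow> real) metric" where
  "cube_metric = submetric euclidean_metric unit_cube"

lemma mspace_cube_metric [simp]: "mspace cube_metric = unit_cube"
  by (simp add: cube_metric_def)

lemma mtopology_cube_metric: "mtopology_of cube_metric = top_of_set unit_cube"
  by (simp add: cube_metric_def mtopology_of_submetric)

lemma compact_cube_metric: "compact_space (mtopology_of cube_metric)"
  unfolding mtopology_cube_metric by (rule compact_space_subtopology) (simp add: compact_unit_cube)

lemma continuous_cube_coordinate: "continuous_map (mtopology_of cube_metric) euclideanreal (\<lambda>y. y n)"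
  using continuous_on_subset [OF continuous_on_product_coordinates] by (simp add: mtopology_cube_metric)

lemma measurable_cube_metric:
  assumes "cube_field M e"
  shows "e \<in> measurable M (metric_borel cube_metric)"
  by (rule measurable_metric_borel [where e = "\<lambda>n y. y n", OF compact_cube_metric continuous_cube_coordinate])
    (use assms in \<open>auto simp: cube_field_def\<close>)

lemma cube_metric_measurable_borel: "(\<lambda>y. y) \<in> measurable (metric_borel cube_metric) borel"
  by (rule measurable_coordinatewise_then_product) (rule continuous_metric_borel [OF continuous_cube_coordinate])

text \<open>
  The name of \<open>x\<close> is \<open>(e (T\<^sup>h x))\<^sub>h\<close>, and \<open>x\<close> is recovered from the coordinate at the identity.
\<close>

lemma metric_process_exists:
  fixes T :: "'g::{group_add,countable} \<Rightarrow> 'a \<Rightarrow> 'a"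
  assumes M: "prob_space M" and T: "G_action M T" and er: "cube_retract M e r"
  obtains \<mu> where "metric_process cube_metric \<mu>" "system_isomorphic M T \<mu> shift"
proof -
  interpret prob_space M by fact
  let ?S = "seq_space cube_metric :: ('g \<Rightarrow> nat \<Rightarrow> real) measure"
  have e: "cube_field M e" and r: "r \<in> measurable borel M" and re: "\<And>x. x \<in> space M \<Longrightarrow> r (e x) = x"
    using er by (auto simp: cube_retract_def)
  have T1: "T g \<in> measurable M M" "distr M M (T g) = M" for g using T by (auto simp: G_action_def)
  have T2: "x \<in> space M \<Longrightarrow> T 0 x = x" "x \<in> space M \<Longrightarrow> T (g + h) x = T g (T h x)" for g h x using T by (auto simp: G_action_def)
  have em: "e \<in> measurable M (metric_borel cube_metric)" by (rule measurable_cube_metric [OF e])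
  define \<phi> where "\<phi> x = (\<lambda>h. e (T h x))" for x
  define \<psi> where "\<psi> y = r (y 0)" for y :: "'g \<Rightarrow> nat \<Rightarrow> real"
  define \<mu> where "\<mu> = distr M ?S \<phi>"
  have comp: "(\<lambda>y. y g) \<in> measurable ?S (metric_borel cube_metric)" for g
    unfolding seq_space_def by (rule measurable_component_singleton) simp
  have into: "f \<in> measurable N ?S" if "\<And>g. (\<lambda>w. f w g) \<in> measurable N (metric_borel cube_metric)" for f :: "'w \<Rightarrow> 'g \<Rightarrow> nat \<Rightarrow> real" and N
    unfolding seq_space_def by (rule measurable_PiM_single') (use that measurable_space [OF that] in auto)
  have \<phi>: "\<phi> \<in> measurable M ?S"
    by (rule into) (unfold \<phi>_def, rule measurable_compose [OF T1(1) em])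
  have \<psi>: "\<psi> \<in> measurable ?S M"
    unfolding \<psi>_def using measurable_compose [OF measurable_compose [OF comp cube_metric_measurable_borel] r] by simp
  have sh: "shift g \<in> measurable ?S ?S" for g :: 'g
    by (rule into) (unfold shift_def, rule comp)
  have st: "sets \<mu> = sets ?S" by (simp add: \<mu>_def)
  have mM: "measurable M \<mu> = measurable M ?S" "measurable \<mu> M = measurable ?S M"
    by (rule measurable_cong_sets [OF refl st] measurable_cong_sets [OF st refl])+
  have eqv: "\<phi> (T g x) = shift g (\<phi> x)" if "x \<in> space M" for g x
    using T2(2) [OF that] by (simp add: \<phi>_def shift_def)
  have \<psi>\<phi>: "\<psi> (\<phi> x) = x" if "x \<in> space M" for x
    using T2(1) [OF that] re [OF that] by (simp add: \<psi>_def \<phi>_def)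
  have "distr \<mu> \<mu> (shift g) = \<mu>" for g
  proof -
    have "distr \<mu> \<mu> (shift g) = distr \<mu> ?S (shift g)" by (rule distr_cong) (simp_all add: st)
    also have "\<dots> = distr M ?S (shift g \<circ> \<phi>)" unfolding \<mu>_def by (rule distr_distr [OF sh \<phi>])
    also have "\<dots> = distr M ?S (\<phi> \<circ> T g)" by (rule distr_cong) (simp_all add: eqv)
    also have "\<dots> = distr (distr M M (T g)) ?S \<phi>" by (rule distr_distr [OF \<phi> T1(1), symmetric])
    finally show ?thesis by (simp add: T1(2) \<mu>_def)
  qed
  moreover have "\<mu> \<in> Prob ?S" using prob_space_distr [OF \<phi>] by (simp add: Prob_def \<mu>_def)
  ultimately have proc: "metric_process cube_metric \<mu>" by (simp add: metric_process_def compact_cube_metric)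
  have iso: "system_isomorphic M T \<mu> shift" unfolding system_isomorphic_def
  proof (intro exI [of _ \<phi>] exI [of _ \<psi>] conjI allI)
    show "\<phi> \<in> measurable M \<mu>" "\<psi> \<in> measurable \<mu> M" unfolding mM by (rule \<phi> \<psi>)+
    show "distr M \<mu> \<phi> = \<mu>" unfolding \<mu>_def by (rule distr_cong) simp_all
    have "distr \<mu> M \<psi> = distr M M (\<psi> \<circ> \<phi>)" unfolding \<mu>_def by (rule distr_distr [OF \<psi> \<phi>])
    also have "\<dots> = distr M M (\<lambda>x. x)" by (rule distr_cong) (simp_all add: \<psi>\<phi>)
    finally show "distr \<mu> M \<psi> = M" by simp
    show "AE x in M. \<psi> (\<phi> x) = x" by (rule AE_I2) (rule \<psi>\<phi>)
    show "AE x in M. \<phi> (T g x) = shift g (\<phi> x)" for g by (rule AE_I2) (rule eqv)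
    have coord: "(\<lambda>y. y g n) \<in> borel_measurable ?S" for g n
      by (rule measurable_compose [OF comp continuous_metric_borel [OF continuous_cube_coordinate]])
    have eq_pred: "Measurable.pred ?S (\<lambda>y. f y = f' y)" if "f \<in> borel_measurable ?S" "f' \<in> borel_measurable ?S" for f f' :: "('g \<Rightarrow> nat \<Rightarrow> real) \<Rightarrow> real"
      unfolding pred_def by (rule borel_measurable_eq [OF that])
    have "(\<lambda>y. \<phi> (\<psi> y) g n) \<in> borel_measurable ?S" for g n
      by (rule measurable_compose [OF measurable_compose [OF \<psi> \<phi>] coord])
    then have "Measurable.pred ?S (\<lambda>y. \<forall>g n. \<phi> (\<psi> y) g n = y g n)"
      using coord by (intro pred_intros_countable eq_pred)
    then have set: "{y \<in> space ?S. \<phi> (\<psi> y) = y} \<in> sets ?S" by (simp add: pred_def fun_eq_iff)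
    show "AE y in \<mu>. \<phi> (\<psi> y) = y"
      unfolding \<mu>_def AE_distr_iff [OF \<phi> set] by (rule AE_I2) (simp add: \<psi>\<phi>)
  qed
  from proc iso show ?thesis by (rule that)
qed

section \<open>Powers of systems\<close>

lemma system_isomorphic_trans:
  assumes 1: "system_isomorphic M T N S" and 2: "system_isomorphic N S Q R"
    and T: "\<And>g. T g \<in> measurable M M" "\<And>g. distr M M (T g) = M"
  shows "system_isomorphic M T Q R"
proof -
  obtain \<phi> \<psi> where \<phi>: "\<phi> \<in> measurable M N" "\<psi> \<in> measurable N M" "distr M N \<phi> = N" "distr N M \<psi> = M"
    "AE x in M. \<psi> (\<phi> x) = x" "AE y in N. \<phi> (\<psi> y) = y" "\<And>g. AE x in M. \<phi> (T g x) = S g (\<phi> x)"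
    using 1 unfolding system_isomorphic_def by blast
  obtain \<phi>' \<psi>' where \<phi>': "\<phi>' \<in> measurable N Q" "\<psi>' \<in> measurable Q N" "distr N Q \<phi>' = Q" "distr Q N \<psi>' = N"
    "AE x in N. \<psi>' (\<phi>' x) = x" "AE y in Q. \<phi>' (\<psi>' y) = y" "\<And>g. AE x in N. \<phi>' (S g x) = R g (\<phi>' x)"
    using 2 unfolding system_isomorphic_def by blast
  have pull: "AE x in M. P (\<phi> x)" if "AE y in N. P y" for P
    by (rule AE_distrD [OF \<phi>(1)]) (unfold \<phi>(3), rule that)
  have pull': "AE x in Q. P (\<psi>' x)" if "AE y in N. P y" for P
    by (rule AE_distrD [OF \<phi>'(2)]) (unfold \<phi>'(4), rule that)
  show ?thesis unfolding system_isomorphic_def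
  proof (intro exI [of _ "\<phi>' \<circ> \<phi>"] exI [of _ "\<psi> \<circ> \<psi>'"] conjI allI)
    show "\<phi>' \<circ> \<phi> \<in> measurable M Q" "\<psi> \<circ> \<psi>' \<in> measurable Q M"
      by (rule measurable_comp, fact, fact)+
    show "distr M Q (\<phi>' \<circ> \<phi>) = Q" using distr_distr [OF \<phi>'(1) \<phi>(1)] \<phi>(3) \<phi>'(3) by simp
    show "distr Q M (\<psi> \<circ> \<psi>') = M" using distr_distr [OF \<phi>(2) \<phi>'(2)] \<phi>(4) \<phi>'(4) by simp
    show "AE x in M. (\<psi> \<circ> \<psi>') ((\<phi>' \<circ> \<phi>) x) = x" using pull [OF \<phi>'(5)] \<phi>(5) by eventually_elim simp
    show "AE y in Q. (\<phi>' \<circ> \<phi>) ((\<psi> \<circ> \<psi>') y) = y" using pull' [OF \<phi>(6)] \<phi>'(6) by eventually_elim simp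
    show "AE x in M. (\<phi>' \<circ> \<phi>) (T g x) = R g ((\<phi>' \<circ> \<phi>) x)" for g
      using pull [OF \<phi>'(7) [of g]] \<phi>(7) [of g] by eventually_elim simp
  qed
qed

lemma prob_space_power: "prob_space M \<Longrightarrow> prob_space (power_measure k M)"
  unfolding power_measure_def by (rule prob_space_PiM)

lemma distr_power:
  assumes "prob_space M" "prob_space N" and f: "f \<in> measurable M N"
  shows "(\<lambda>x. \<lambda>j\<in>{..<k}. f (x j)) \<in> measurable (power_measure k M) (power_measure k N)"
    and "distr (power_measure k M) (power_measure k N) (\<lambda>x. \<lambda>j\<in>{..<k}. f (x j)) = power_measure k (distr M N f)"
proof -
  show "(\<lambda>x. \<lambda>j\<in>{..<k}. f (x j)) \<in> measurable (power_measure k M) (power_measure k N)"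
    unfolding power_measure_def
  proof (rule measurable_restrict)
    fix j assume "j \<in> {..<k}"
    then have "(\<lambda>x. x j) \<in> measurable (PiM {..<k} (\<lambda>_. M)) M" by (rule measurable_component_singleton)
    from this f show "(\<lambda>x. f (x j)) \<in> measurable (PiM {..<k} (\<lambda>_. M)) N" by (rule measurable_compose)
  qed
  show "distr (power_measure k M) (power_measure k N) (\<lambda>x. \<lambda>j\<in>{..<k}. f (x j)) = power_measure k (distr M N f)"
    using distr_PiM_finite_prob_space' [of "{..<k}" "\<lambda>_. M" "\<lambda>_. N" f] assms by (simp add: power_measure_def compose_def [abs_def])
qed

lemma G_action_power:
  assumes M: "prob_space M" and T: "G_action M T"
  shows "G_action (power_measure k M) (power_action k T)"
proof -
  have T1: "T g \<in> measurable M M" "distr M M (T g) = M" for g using T by (auto simp: G_action_def)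
  have pa: "power_action k T g = (\<lambda>x. \<lambda>j\<in>{..<k}. T g (x j))" for g by (rule ext) (simp add: power_action_def)
  show ?thesis unfolding G_action_def
  proof (intro conjI allI ballI)
    show "power_action k T g \<in> measurable (power_measure k M) (power_measure k M)"
      "distr (power_measure k M) (power_measure k M) (power_action k T g) = power_measure k M" for g
      unfolding pa using distr_power [OF M M T1(1)] by (simp_all add: T1(2))
    fix x assume "x \<in> space (power_measure k M)"
    then have x: "\<And>j. j < k \<Longrightarrow> x j \<in> space M" "x \<in> extensional {..<k}" by (auto simp: power_measure_def space_PiM PiE_iff)
    show "power_action k T 0 x = x"
      using T x by (auto simp: power_action_def G_action_def extensional_def fun_eq_iff)
    show "power_action k T (g + h) x = power_action k T g (power_action k T h x)" for g h
      using T x by (auto simp: power_action_def G_action_def fun_eq_iff)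
  qed
qed

lemma AE_power:
  assumes P: "AE x in M. P x" and M: "prob_space M"
  shows "AE x in power_measure k M. (\<forall>j<k. P (x j)) \<and> x \<in> extensional {..<k}"
proof -
  have "AE x in power_measure k M. P (x j)" if "j < k" for j
    unfolding power_measure_def by (rule AE_PiM_component [OF M _ P]) (use that in simp)
  then have "AE x in power_measure k M. \<forall>j\<in>{..<k}. P (x j)" by (intro AE_finite_allI) auto
  moreover have "AE x in power_measure k M. x \<in> extensional {..<k}"
    by (rule AE_I2) (auto simp: power_measure_def space_PiM PiE_iff)
  ultimately show ?thesis by eventually_elim auto
qed

text \<open>
  The \<open>k\<close>-fold products of the isomorphism and of its inverse.
\<close>

lemma system_isomorphic_power:
  assumes M: "prob_space M" and N: "prob_space N" and iso: "system_isomorphic M T N S"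
  shows "system_isomorphic (power_measure k M) (power_action k T) (power_measure k N) (power_action k S)"
proof -
  obtain \<phi> \<psi> where \<phi>: "\<phi> \<in> measurable M N" "\<psi> \<in> measurable N M" "distr M N \<phi> = N" "distr N M \<psi> = M"
    "AE x in M. \<psi> (\<phi> x) = x" "AE y in N. \<phi> (\<psi> y) = y" "\<And>g. AE x in M. \<phi> (T g x) = S g (\<phi> x)"
    using iso unfolding system_isomorphic_def by blast
  show ?thesis unfolding system_isomorphic_def
  proof (intro exI [of _ "\<lambda>x. \<lambda>j\<in>{..<k}. \<phi> (x j)"] exI [of _ "\<lambda>y. \<lambda>j\<in>{..<k}. \<psi> (y j)"] conjI allI)
    show "(\<lambda>x. \<lambda>j\<in>{..<k}. \<phi> (x j)) \<in> measurable (power_measure k M) (power_measure k N)"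
      "(\<lambda>y. \<lambda>j\<in>{..<k}. \<psi> (y j)) \<in> measurable (power_measure k N) (power_measure k M)"
      by (rule distr_power(1) [OF M N \<phi>(1)], rule distr_power(1) [OF N M \<phi>(2)])
    show "distr (power_measure k M) (power_measure k N) (\<lambda>x. \<lambda>j\<in>{..<k}. \<phi> (x j)) = power_measure k N"
      "distr (power_measure k N) (power_measure k M) (\<lambda>y. \<lambda>j\<in>{..<k}. \<psi> (y j)) = power_measure k M"
      using distr_power(2) [OF M N \<phi>(1)] distr_power(2) [OF N M \<phi>(2)] by (simp_all add: \<phi>(3,4))
    show "AE x in power_measure k M. (\<lambda>j\<in>{..<k}. \<psi> ((\<lambda>j\<in>{..<k}. \<phi> (x j)) j)) = x"
      using AE_power [OF \<phi>(5) M] by eventually_elim (auto simp: fun_eq_iff extensional_def)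
    show "AE y in power_measure k N. (\<lambda>j\<in>{..<k}. \<phi> ((\<lambda>j\<in>{..<k}. \<psi> (y j)) j)) = y"
      using AE_power [OF \<phi>(6) N] by eventually_elim (auto simp: fun_eq_iff extensional_def)
    show "AE x in power_measure k M. (\<lambda>j\<in>{..<k}. \<phi> (power_action k T g x j)) = power_action k S g (\<lambda>j\<in>{..<k}. \<phi> (x j))" for g
      using AE_power [OF \<phi>(7) [of g] M] by eventually_elim (auto simp: fun_eq_iff power_action_def)
  qed
qed

lemma system_isomorphic_transpose:
  fixes \<mu> :: "('g::group_add \<Rightarrow> 'a) measure"
  assumes \<mu>: "sets \<mu> = sets (PiM UNIV (\<lambda>_. A))"
  shows "system_isomorphic (power_measure k \<mu>) (power_action k shift) (power_process k A \<mu>) shift"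
proof -
  let ?Q = "power_measure k \<mu>" and ?R = "PiM (UNIV :: 'g set) (\<lambda>_. PiM {..<k} (\<lambda>_. A))"
  let ?t = "transpose_names k UNIV :: (nat \<Rightarrow> 'g \<Rightarrow> 'a) \<Rightarrow> 'g \<Rightarrow> nat \<Rightarrow> 'a" and ?t' = "\<lambda>y. \<lambda>j\<in>{..<k}. \<lambda>g :: 'g. y g j"
  have pp: "power_process k A \<mu> = distr ?Q ?R ?t" by (simp add: power_process_def power_measure_def)
  have st: "sets (power_process k A \<mu>) = sets ?R" by (simp add: pp)
  have t: "?t \<in> measurable ?Q ?R" unfolding power_measure_def by (rule transpose_names_measurable' [OF \<mu>])
  have t': "?t' \<in> measurable ?R ?Q" unfolding power_measure_def
  proof (rule measurable_restrict)
    fix j assume j: "j \<in> {..<k}"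
    have yg: "(\<lambda>y. y g j) \<in> measurable ?R A" for g
    proof -
      have "(\<lambda>y. y g) \<in> measurable ?R (PiM {..<k} (\<lambda>_. A))" by (rule measurable_component_singleton) simp
      moreover have "(\<lambda>a. a j) \<in> measurable (PiM {..<k} (\<lambda>_. A)) A" using j by (rule measurable_component_singleton)
      ultimately show ?thesis by (rule measurable_compose)
    qed
    have "(\<lambda>y g. y g j) \<in> measurable ?R (PiM UNIV (\<lambda>_. A))"
      by (rule measurable_PiM_single' [where f = "\<lambda>g y. y g j"]) (rule yg, rule funcsetI, rule PiE_I, erule measurable_space [OF yg], simp)
    then show "(\<lambda>y g. y g j) \<in> measurable ?R \<mu>" unfolding measurable_cong_sets [OF refl \<mu>] .
  qed
  have t't: "?t' (?t x) = x" if "x \<in> space ?Q" for x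
    using that by (auto simp: transpose_names_def power_measure_def space_PiM PiE_iff extensional_def fun_eq_iff)
  have tt': "?t (?t' y) = y" if "y \<in> space ?R" for y
  proof -
    have "y g \<in> extensional {..<k}" for g using that by (auto simp: space_PiM PiE_iff)
    then show ?thesis by (auto simp: transpose_names_def fun_eq_iff extensional_def)
  qed
  show ?thesis unfolding system_isomorphic_def
  proof (intro exI [of _ ?t] exI [of _ ?t'] conjI allI)
    show "?t \<in> measurable ?Q (power_process k A \<mu>)" "?t' \<in> measurable (power_process k A \<mu>) ?Q"
      using t t' by (simp_all only: measurable_cong_sets [OF refl st] measurable_cong_sets [OF st refl])
    show "distr ?Q (power_process k A \<mu>) ?t = power_process k A \<mu>" by (subst (2) pp, rule distr_cong) (simp_all add: st)
    have "distr (power_process k A \<mu>) ?Q ?t' = distr ?Q ?Q (?t' \<circ> ?t)" unfolding pp by (rule distr_distr [OF t' t])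
    also have "\<dots> = distr ?Q ?Q (\<lambda>x. x)" by (rule distr_cong) (simp_all add: t't)
    finally show "distr (power_process k A \<mu>) ?Q ?t' = ?Q" by simp
    show "AE x in ?Q. ?t' (?t x) = x" by (rule AE_I2) (rule t't)
    show "AE y in power_process k A \<mu>. ?t (?t' y) = y"
      by (rule AE_I2) (rule tt', simp add: sets_eq_imp_space_eq [OF st])
    show "AE x in ?Q. ?t (power_action k shift g x) = shift g (?t x)" for g
      by (rule AE_I2) (auto simp: transpose_names_def power_action_def shift_def fun_eq_iff)
  qed
qed

section \<open>Entropy of a system\<close>

text \<open>
  The description picks the value of an arbitrary process isomorphic to the system: any two of them
  bound each other.
\<close>

lemma hdq_system_eq:
  fixes \<sigma> :: "nat \<Rightarrow> 'g::{group_add,countable} \<Rightarrow> 'v \<Rightarrow> 'v" and D :: "(nat \<Rightarrow> real) metric"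
  assumes sof: "sofic_approximation V \<sigma>" and M: "prob_space M" and T: "G_action M T"
    and D: "metric_process D \<mu>" "system_isomorphic M T \<mu> shift" and q: "metric_coords D q"
  shows "hdq_system V \<sigma> M T = hdq_coords V \<sigma> (metric_borel D) q \<mu>"
proof -
  have T1: "\<And>g. T g \<in> measurable M M" "\<And>g. distr M M (T g) = M" using T by (auto simp: G_action_def)
  have D1: "compact_space (mtopology_of D)" "\<mu> \<in> Prob (seq_space D)" using D(1) by (auto simp: metric_process_def)
  have eq: "hdq_process V \<sigma> D \<mu> = hdq_coords V \<sigma> (metric_borel D) q \<mu>" by (rule hdq_process_eq_hdq_coords [OF sof D1(1) q D1(2)])
  show ?thesis unfolding hdq_system_def
  proof (rule the_equality)
    show "\<exists>(D' :: (nat \<Rightarrow> real) metric) \<mu>'. metric_process D' \<mu>' \<and> system_isomorphic M T \<mu>' shift \<and>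
        hdq_coords V \<sigma> (metric_borel D) q \<mu> = hdq_process V \<sigma> D' \<mu>'"
      using D eq by metis
    fix h assume "\<exists>(D' :: (nat \<Rightarrow> real) metric) \<mu>'. metric_process D' \<mu>' \<and> system_isomorphic M T \<mu>' shift \<and> h = hdq_process V \<sigma> D' \<mu>'"
    then obtain D' :: "(nat \<Rightarrow> real) metric" and \<mu>' where D': "metric_process D' \<mu>'" "system_isomorphic M T \<mu>' shift" and h: "h = hdq_process V \<sigma> D' \<mu>'" by blast
    have D1': "compact_space (mtopology_of D')" "\<mu>' \<in> Prob (seq_space D')" using D'(1) by (auto simp: metric_process_def)
    obtain q' where q': "metric_coords D' q'" using metric_coords_exist [OF D1'(1)] by blast
    have s: "sets \<mu> = sets (PiM UNIV (\<lambda>_. metric_borel D))" and s': "sets \<mu>' = sets (PiM UNIV (\<lambda>_. metric_borel D'))"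
      using D1(2) D1'(2) by (auto simp: Prob_def seq_space_def)
    note c = coordinates_metric [OF D1(1) q] and c' = coordinates_metric [OF D1'(1) q']
    have "h = hdq_coords V \<sigma> (metric_borel D') q' \<mu>'" unfolding h by (rule hdq_process_eq_hdq_coords [OF sof D1'(1) q' D1'(2)])
    then show "h = hdq_coords V \<sigma> (metric_borel D) q \<mu>"
      using hdq_coords_le_of_isomorphic [OF sof c c' M T1 s D(2) s' D'(2)]
        hdq_coords_le_of_isomorphic [OF sof c' c M T1 s' D'(2) s D(2)] by simp
  qed
qed

theorem corollary7p3:
  fixes V :: "nat \<Rightarrow> 'v set"
    and \<sigma> :: "nat \<Rightarrow> 'g::{group_add,countable} \<Rightarrow> 'v \<Rightarrow> 'v"
    and M :: "'a measure"
    and T :: "'g \<Rightarrow> 'a \<Rightarrow> 'a"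
  assumes "sofic_approximation V \<sigma>"
    and "G_system M T"
  shows "\<forall>k. (1::nat) \<le> k \<longrightarrow> hdq_system V \<sigma> (power_measure k M) (power_action k T)
                 = ereal (real k) * hdq_system V \<sigma> M T"
proof (intro allI impI)
  fix k :: nat assume k: "1 \<le> k"
  note sof = assms(1)
  have M: "prob_space M" and st: "standard_measurable_space M" and T: "G_action M T"
    using assms(2) by (auto simp: G_system_def)
  obtain e r where er: "cube_retract M e r"
    using standard_cube_retract [OF st prob_space.not_empty [OF M]] by blast
  obtain e' r' where er': "cube_retract (power_measure k M) e' r'" by (rule cube_retract_power [OF er])
  note Mk = prob_space_power [OF M, of k] and Tk = G_action_power [OF M T, of k]
  obtain \<mu> where \<mu>: "metric_process cube_metric \<mu>" "system_isomorphic M T \<mu> shift"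
    by (rule metric_process_exists [OF M T er])
  obtain \<nu> where \<nu>: "metric_process cube_metric \<nu>" "system_isomorphic (power_measure k M) (power_action k T) \<nu> shift"
    by (rule metric_process_exists [OF Mk Tk er'])
  obtain q where q: "metric_coords cube_metric q" using metric_coords_exist [OF compact_cube_metric] by blast
  let ?A = "metric_borel cube_metric"
  have \<mu>P: "\<mu> \<in> Prob (PiM UNIV (\<lambda>_. ?A))" and \<nu>P: "\<nu> \<in> Prob (PiM UNIV (\<lambda>_. ?A))"
    using \<mu>(1) \<nu>(1) by (auto simp: metric_process_def seq_space_def)
  then have s: "sets \<mu> = sets (PiM UNIV (\<lambda>_. ?A))" "sets \<nu> = sets (PiM UNIV (\<lambda>_. ?A))" and p: "prob_space \<mu>"
    by (auto simp: Prob_def)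
  have s': "sets (power_process k ?A \<mu>) = sets (PiM UNIV (\<lambda>_. PiM {..<k} (\<lambda>_. ?A)))" by (simp add: power_process_def)
  have Tk1: "\<And>g. power_action k T g \<in> measurable (power_measure k M) (power_measure k M)"
    "\<And>g. distr (power_measure k M) (power_measure k M) (power_action k T g) = power_measure k M"
    using Tk by (auto simp: G_action_def)
  have iso: "system_isomorphic (power_measure k M) (power_action k T) (power_process k ?A \<mu>) shift"
    by (rule system_isomorphic_trans [OF system_isomorphic_power [OF M p \<mu>(2)] system_isomorphic_transpose [OF s(1)] Tk1])
  note c = coordinates_metric [OF compact_cube_metric q]
  note ck = coordinates_power [OF c, of k]
  have "hdq_system V \<sigma> (power_measure k M) (power_action k T) = hdq_coords V \<sigma> ?A q \<nu>"
    by (rule hdq_system_eq [OF sof Mk Tk \<nu> q])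
  also have "\<dots> = hdq_coords V \<sigma> (PiM {..<k} (\<lambda>_. ?A)) (power_coords q k) (power_process k ?A \<mu>)"
    by (rule antisym) (rule hdq_coords_le_of_isomorphic [OF sof c ck Mk Tk1 s(2) \<nu>(2) s' iso],
        rule hdq_coords_le_of_isomorphic [OF sof ck c Mk Tk1 s' iso s(2) \<nu>(2)])
  also have "\<dots> = ereal (real k) * hdq_coords V \<sigma> ?A q \<mu>"
    by (rule hdq_coords_power [OF sof c \<mu>P]) (use k in simp)
  also have "hdq_coords V \<sigma> ?A q \<mu> = hdq_system V \<sigma> M T"
    by (rule hdq_system_eq [OF sof M T \<mu> q, symmetric])
  finally show "hdq_system V \<sigma> (power_measure k M) (power_action k T) = ereal (real k) * hdq_system V \<sigma> M T" .
qed

end
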